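(* For every integer $k\ge 3$, $\#k$-SAT has a randomized approximation scheme running in time $$O^*\left(\epsilon^{-2}\cdot 2^{\,n\left(\frac{k-1}{k-1+\mu_k}\right)}\right),$$ where $n$ is the number of variables of the input formula and $\mu_k=\sum_{j=1}^{\infty}\frac{1}{j\left(j+\frac{1}{k-1}\right)}$.
   Context: For a CNF formula $F$ on $n$ Boolean variables, $\#F$ denotes the number of satisfying assignments of $F$. $\#k$-SAT is the problem of computing $\#F$ for a $k$-CNF formula $F$ (every clause has at most $k$ literals). A randomized $\alpha$-approximation algorithm for $\#k$-SAT is a randomized algorithm that, on input a $k$-CNF formula $F$, outputs a number $\mathbf{A}(F)$ with $\Pr[\alpha^{-1}\#F\le \mathbf{A}(F)\le\alpha\#F]\ge p$, where $p>1/2$ is a constant independent of the input. A randomized approximation scheme for $\#k$-SAT is an algorithm that, on input $F$ and a natural number $\epsilon^{-1}$, behaves as a randomized $e^{\epsilon}$-approximation algorithm. The notation $O^*(\cdot)$ suppresses factors sub-exponential in $n$. *)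

theory Defs
  imports
    "HOL-Probability.SPMF"
    "HOL-Library.Log_Nat"
    "HOL-Library.Landau_Symbols"
    "HOL-Library.FuncSet"
begin

section \<open>CNF formulas and their numbers of satisfying assignments\<close>

text \<open>
  Variables are numbered; the literal \<^term>\<open>(v, True)\<close> is the variable \<^term>\<open>v\<close> and
  \<^term>\<open>(v, False)\<close> is its negation. Clauses and formulas are sets, so that a clause cannot occur
  twice in a formula.
\<close>

type_synonym literal = "nat \<times> bool"
type_synonym clause = "literal set"
type_synonym formula = "clause set"

text \<open>
  \<open>kcnf k n F\<close>: \<open>F\<close> is a \<open>k\<close>-CNF formula on the \<open>n\<close> variables \<open>0, \<dots>, n - 1\<close>, which need not
  all occur in \<open>F\<close>. Clauses may be empty or tautological.
\<close>

definition kcnf :: "nat \<Rightarrow> nat \<Rightarrow> formula \<Rightarrow> bool" where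
  "kcnf k n F \<longleftrightarrow>
     finite F \<and> (\<forall>C\<in>F. finite C \<and> card C \<le> k \<and> (\<forall>(v, b)\<in>C. v < n))"

definition satisfies :: "(nat \<Rightarrow> bool) \<Rightarrow> formula \<Rightarrow> bool" where
  "satisfies \<sigma> F \<longleftrightarrow> (\<forall>C\<in>F. \<exists>(v, b)\<in>C. \<sigma> v = b)"

definition num_sat :: "nat \<Rightarrow> formula \<Rightarrow> nat" where
  "num_sat n F = card {\<sigma> \<in> {..<n} \<rightarrow>\<^sub>E UNIV. satisfies \<sigma> F}"


section \<open>Randomized random access programs with logarithmic cost\<close>

text \<open>
  The machine model is the random access machine with the logarithmic cost criterion, extended by
  fair coin flips and programmed with structured control flow instead of jumps. The store consists
  of arrays of natural numbers; \<open>s x i\<close> is the entry of array \<open>x\<close> at index \<open>i\<close>. The names of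
  arrays are constants of the program, so a program accesses finitely many arrays, and it may use
  \<open>x[0]\<close> as a scalar variable. Under logarithmic cost every operation is charged for
  the binary lengths of the numbers and addresses involved, so the arithmetic on large numbers
  is not free.
\<close>

type_synonym state = "nat \<Rightarrow> nat \<Rightarrow> nat"

datatype aexp =
    Const nat
  | Read nat aexp
  | Add aexp aexp
  | Sub aexp aexp
  | Mul aexp aexp
  | Div aexp aexp

text \<open>Guards of conditionals and loops hold iff they are nonzero.\<close>

datatype com =
    Skip
  | Write nat aexp aexp
  | Flip nat aexp
  | Seq com com
  | Cond aexp com com
  | While aexp com

definition bits :: "nat \<Rightarrow> nat" where
  "bits m = max 1 (floorlog 2 m)"

primrec aval :: "aexp \<Rightarrow> state \<Rightarrow> nat" where
  "aval (Const m) s = m"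
| "aval (Read x e) s = s x (aval e s)"
| "aval (Add e1 e2) s = aval e1 s + aval e2 s"
| "aval (Sub e1 e2) s = aval e1 s - aval e2 s"
| "aval (Mul e1 e2) s = aval e1 s * aval e2 s"
| "aval (Div e1 e2) s = aval e1 s div aval e2 s"

primrec acost :: "aexp \<Rightarrow> state \<Rightarrow> nat" where
  "acost (Const m) s = bits m"
| "acost (Read x e) s = acost e s + bits (aval e s) + bits (s x (aval e s))"
| "acost (Add e1 e2) s = acost e1 s + acost e2 s + bits (aval e1 s) + bits (aval e2 s)"
| "acost (Sub e1 e2) s = acost e1 s + acost e2 s + bits (aval e1 s) + bits (aval e2 s)"
| "acost (Mul e1 e2) s = acost e1 s + acost e2 s + bits (aval e1 s) + bits (aval e2 s)"
| "acost (Div e1 e2) s = acost e1 s + acost e2 s + bits (aval e1 s) + bits (aval e2 s)"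

text \<open>A configuration is a store together with the time spent so far.\<close>

type_synonym config = "state \<times> nat"

definition store :: "nat \<Rightarrow> nat \<Rightarrow> nat \<Rightarrow> state \<Rightarrow> state" where
  "store x i m s = s(x := (s x)(i := m))"

definition eval_guard :: "aexp \<Rightarrow> config \<Rightarrow> config" where
  "eval_guard e = (\<lambda>(s, t). (s, t + acost e s + bits (aval e s)))"

text \<open>Mass that is missing from the resulting subdistribution is the probability of divergence.\<close>

partial_function (spmf) while_loop ::
  "aexp \<Rightarrow> (config \<Rightarrow> config spmf) \<Rightarrow> config \<Rightarrow> config spmf" where
  "while_loop e body \<gamma> =
     (if aval e (fst \<gamma>) \<noteq> 0
      then bind_spmf (body (eval_guard e \<gamma>)) (while_loop e body)
      else return_spmf (eval_guard e \<gamma>))"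

primrec exec :: "com \<Rightarrow> config \<Rightarrow> config spmf" where
  "exec Skip = (\<lambda>(s, t). return_spmf (s, t + 1))"
| "exec (Write x i e) = (\<lambda>(s, t). return_spmf
     (store x (aval i s) (aval e s) s,
      t + acost i s + acost e s + bits (aval i s) + bits (aval e s)))"
| "exec (Flip x i) = (\<lambda>(s, t). map_spmf
     (\<lambda>b. (store x (aval i s) (of_bool b) s, t + acost i s + bits (aval i s) + 1)) coin_spmf)"
| "exec (Seq c d) = (\<lambda>\<gamma>. bind_spmf (exec c \<gamma>) (exec d))"
| "exec (Cond e c d) = (\<lambda>\<gamma>.
     if aval e (fst \<gamma>) \<noteq> 0 then exec c (eval_guard e \<gamma>) else exec d (eval_guard e \<gamma>))"
| "exec (While e c) = while_loop e (exec c)"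


section \<open>Input and output\<close>

text \<open>
  A formula is presented to a program as a list of its clauses, each given as a list of its
  literals, without repetitions and in any order.
\<close>

definition lists_formula :: "literal list list \<Rightarrow> formula \<Rightarrow> bool" where
  "lists_formula Cs F \<longleftrightarrow>
     distinct (map set Cs) \<and> (\<forall>C\<in>set Cs. distinct C) \<and> set (map set Cs) = F"

definition encode_literal :: "literal \<Rightarrow> nat" where
  "encode_literal = (\<lambda>(v, b). 2 * v + of_bool b)"

definition encode_input :: "nat \<Rightarrow> literal list list \<Rightarrow> nat \<Rightarrow> nat list" where
  "encode_input n Cs N =
     [n, N, length Cs] @ concat (map (\<lambda>C. length C # map encode_literal C) Cs)"

text \<open>The input is found in array 0; everything else is initially 0.\<close>

definition init_state :: "nat list \<Rightarrow> state" where
  "init_state xs = (\<lambda>x i. if x = 0 \<and> i < length xs then xs ! i else 0)"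

text \<open>The output is a rational number, with its numerator at index 0 and its denominator at index 1
  of array 1. A zero denominator yields the output 0.\<close>

definition output_value :: "state \<Rightarrow> real" where
  "output_value s = real (s 1 0) / real (s 1 1)"

definition run :: "com \<Rightarrow> nat \<Rightarrow> literal list list \<Rightarrow> nat \<Rightarrow> config spmf" where
  "run P n Cs N = exec P (init_state (encode_input n Cs N), 0)"


section \<open>Approximation schemes and running times\<close>

definition approximates :: "real \<Rightarrow> real \<Rightarrow> real \<Rightarrow> bool" where
  "approximates \<alpha> x a \<longleftrightarrow> inverse \<alpha> * x \<le> a \<and> a \<le> \<alpha> * x"

text \<open>
  The natural number \<open>N > 0\<close> is \<open>\<epsilon>\<^sup>-\<^sup>1\<close>. The success probability \<open>p\<close> depends neither on the
  formula nor on \<open>N\<close>.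
\<close>

definition randomized_approximation_scheme :: "nat \<Rightarrow> com \<Rightarrow> bool" where
  "randomized_approximation_scheme k P \<longleftrightarrow>
     (\<exists>p > 1/2. \<forall>n F Cs N. kcnf k n F \<and> lists_formula Cs F \<and> N > 0 \<longrightarrow>
        measure (measure_spmf (run P n Cs N))
          {(s, t). approximates (exp (1 / real N)) (real (num_sat n F)) (output_value s)} \<ge> p)"

text \<open>
  Worst-case running time over all inputs and all outcomes of the coin flips. As \<open>run\<close>
  is lossless, a diverging or longer computation cannot hide in a missing part of the distribution.
\<close>

definition runs_in_time :: "nat \<Rightarrow> com \<Rightarrow> (nat \<Rightarrow> nat \<Rightarrow> real) \<Rightarrow> bool" where
  "runs_in_time k P T \<longleftrightarrow>
     (\<forall>n F Cs N. kcnf k n F \<and> lists_formula Cs F \<and> N > 0 \<longrightarrow>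
        lossless_spmf (run P n Cs N) \<and>
        (\<forall>(s, t) \<in> set_spmf (run P n Cs N). real t \<le> T n N))"

text \<open>
  Bounds up to a factor \<open>2\<^bsup>o(n)\<^esup>\<close> that does not depend on the second argument, \<open>N = \<epsilon>\<^sup>-\<^sup>1\<close>.
  Constant factors are among those suppressed, since \<open>o(n)\<close> leaves \<open>h n\<close>
  unconstrained for small \<open>n\<close>.
\<close>

definition O_star :: "(nat \<Rightarrow> nat \<Rightarrow> real) \<Rightarrow> (nat \<Rightarrow> nat \<Rightarrow> real) set" where
  "O_star g = {f. \<exists>h \<in> o(\<lambda>n. real n). \<forall>n N. N > 0 \<longrightarrow> \<bar>f n N\<bar> \<le> 2 powr h n * \<bar>g n N\<bar>}"

definition mu :: "nat \<Rightarrow> real" where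
  "mu k = (\<Sum>i. 1 / (real (Suc i) * (real (Suc i) + 1 / (real k - 1))))"

end

theory Submission
  imports Defs "HOL-Probability.Probability" "HOL-Real_Asymp.Real_Asymp"
begin

text \<open>
  The program combines exact counting with sampling. Let \<open>\<gamma> = \<mu>\<^sub>k / (k - 1)\<close>, so that the exponent
  is \<open>1 / (1 + \<gamma>)\<close>, and cut the binary tree of partial assignments at depth \<open>i \<approx> n \<gamma> / (1 + \<gamma>)\<close>.
  By the analysis of PPSZ, in the form valid for formulas with many solutions, one trial on a
  satisfiable formula with \<open>m\<close> unassigned variables succeeds with probability at least
  \<open>2\<close> to the power \<open>- (1 - \<gamma> + o(1)) m\<close>, hence \<open>2\<close> to the power \<open>n - 2i + o(n)\<close> trials decide, with high probability
  simultaneously for all nodes below the cut, which of them contain a solution. A depth-first search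
  from the \<open>2\<^sup>i\<close> nodes of the cut that prunes by this test visits \<open>O(n 2\<^sup>i)\<close> nodes if there are at most
  \<open>2\<^sup>i\<close> solutions, and then counts them exactly in \<open>2\<close> to the power \<open>n - i + o(n)\<close> steps. If the search exceeds this
  budget, there are more than \<open>2\<^sup>i\<close> solutions, so that a fraction of at least \<open>2\<close> to the power \<open>i - n\<close> of all
  assignments is satisfying, and by Chebyshev's inequality \<open>O(N\<^sup>2)\<close> times \<open>2\<close> to the power \<open>n - i\<close> uniform samples
  estimate the fraction up to a factor \<open>exp (1 / N)\<close>. For \<open>N \<ge> 2\<^sup>n\<close> brute force meets the time bound.

  The rate of PPSZ rests on the integral of the survival probability of critical clause trees, with the
  place of a variable in the random order as the integration variable; it is bounded through the depth
  recursion of these trees, up to an error \<open>O(1 / J)\<close> for a slowly growing \<open>J\<close>.\<close>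

section \<open>Random orders and the rate function\<close>

text \<open>The depth \<open>i\<close> is chosen so that \<open>i = \<gamma> * (n - i)\<close>: then
  \<open>2\<close> to the power \<open>i\<close> nodes with \<open>2\<close> to the power
  \<open>(1 - \<gamma>) * (n - i) = n - 2 * i\<close> trials each cost as much as \<open>2\<close>
  to the power \<open>n - i\<close> samples. That the rate for unique solutions carries over to all
  formulas depends on the size of \<open>\<gamma>\<close>: variables that can still take both values
  may be charged the same rate as forced ones if \<open>2 * \<gamma> \<le> 1 / ln 2\<close>. For
  \<open>k = 3\<close> the value \<open>\<gamma> = 2 - 2 * ln 2\<close> is about
  \<open>0.614\<close>, below the limit of about \<open>0.721\<close>, and larger \<open>k\<close>
  have smaller \<open>\<gamma>\<close>.

  All random words are drawn before the search and shared by all nodes and by the samples. From then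
  on the program is deterministic, so that probability enters only where words are filled in, and a
  union bound takes the place of independence.

  The same variable may label several nodes of a critical clause tree. This is why random orders are
  replaced by independent arrival times: for independently chosen sets of variables a correlation
  inequality lets the branches be treated as if they were independent.\<close>

definition bern :: "real \<Rightarrow> 'a set \<Rightarrow> ('a set \<Rightarrow> real) \<Rightarrow> real" where
  "bern r W h = (\<Sum>A\<in>Pow W. r ^ card A * (1 - r) ^ (card W - card A) * h A)"

lemma bern_empty [simp]: "bern r {} h = h {}"
  by (simp add: bern_def)

lemma bern_insert:
  assumes "finite W" "y \<notin> W"
  shows "bern r (insert y W) h = r * bern r W (\<lambda>A. h (insert y A)) + (1 - r) * bern r W h"
proof -
  have disj: "Pow W \<inter> insert y ` Pow W = {}" using assms by auto
  have inj: "inj_on (insert y) (Pow W)"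
    using assms by (auto simp: inj_on_def)
  have "bern r (insert y W) h =
      (\<Sum>A\<in>Pow W. r ^ card A * (1 - r) ^ (card (insert y W) - card A) * h A)
    + (\<Sum>A\<in>insert y ` Pow W. r ^ card A * (1 - r) ^ (card (insert y W) - card A) * h A)"
    unfolding bern_def Pow_insert
    by (rule sum.union_disjoint) (use assms disj in auto)
  also have "(\<Sum>A\<in>Pow W. r ^ card A * (1 - r) ^ (card (insert y W) - card A) * h A)
      = (1 - r) * bern r W h"
    unfolding bern_def sum_distrib_left
  proof (rule sum.cong)
    fix A assume "A \<in> Pow W"
    then have "card A \<le> card W" using assms by (auto intro: card_mono)
    then have "card (insert y W) - card A = Suc (card W - card A)" using assms by auto
    then show "r ^ card A * (1 - r) ^ (card (insert y W) - card A) * h A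
        = (1 - r) * (r ^ card A * (1 - r) ^ (card W - card A) * h A)" by simp
  qed simp
  also have "(\<Sum>A\<in>insert y ` Pow W. r ^ card A * (1 - r) ^ (card (insert y W) - card A) * h A)
      = r * bern r W (\<lambda>A. h (insert y A))"
    unfolding bern_def sum_distrib_left sum.reindex[OF inj] o_def
  proof (rule sum.cong)
    fix A assume "A \<in> Pow W"
    then have "finite A" "y \<notin> A" using assms by (auto intro: finite_subset)
    then show "r ^ card (insert y A) * (1 - r) ^ (card (insert y W) - card (insert y A)) * h (insert y A)
        = r * (r ^ card A * (1 - r) ^ (card W - card A) * h (insert y A))"
      using assms by simp
  qed simp
  finally show ?thesis by simp
qed

lemma bern_const: "finite W \<Longrightarrow> bern r W (\<lambda>A. c) = c"
  by (induction W rule: finite_induct) (auto simp: bern_insert algebra_simps)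

lemma bern_diff: "bern r W (\<lambda>A. f A - g A) = bern r W f - bern r W g"
  by (simp add: bern_def sum_subtractf right_diff_distrib)

lemma bern_mono:
  assumes "0 \<le> r" "r \<le> 1" "\<And>A. A \<subseteq> W \<Longrightarrow> f A \<le> g A"
  shows "bern r W f \<le> bern r W g"
  unfolding bern_def using assms by (intro sum_mono mult_left_mono) auto

lemma bern_cong: "(\<And>A. A \<subseteq> W \<Longrightarrow> f A = g A) \<Longrightarrow> bern r W f = bern r W g"
  unfolding bern_def by (intro sum.cong) auto

text \<open>Harris' inequality. Induction on \<open>W\<close> splits off one point; Chebyshev's sum
  inequality settles that point, because both conditional means grow when it is included.\<close>

lemma harris:
  assumes "finite W" "0 \<le> r" "r \<le> 1"
    and "\<And>A B. A \<subseteq> B \<Longrightarrow> f A \<le> f B" "\<And>A B. A \<subseteq> B \<Longrightarrow> g A \<le> g B"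
  shows "bern r W f * bern r W g \<le> bern r W (\<lambda>A. f A * g A)"
  using assms(1,4,5)
proof (induction W arbitrary: f g rule: finite_induct)
  case empty then show ?case by simp
next
  case (insert y W)
  let ?f1 = "bern r W (\<lambda>A. f (insert y A))" and ?f0 = "bern r W f"
  let ?g1 = "bern r W (\<lambda>A. g (insert y A))" and ?g0 = "bern r W g"
  have 1: "?f1 * ?g1 \<le> bern r W (\<lambda>A. f (insert y A) * g (insert y A))"
    by (rule insert.IH) (auto intro!: insert.prems)
  have 0: "?f0 * ?g0 \<le> bern r W (\<lambda>A. f A * g A)"
    by (rule insert.IH) (auto intro!: insert.prems)
  have "?f0 \<le> ?f1" "?g0 \<le> ?g1" by (auto intro!: bern_mono assms(2,3) insert.prems)
  then have "0 \<le> r * (1 - r) * ((?f1 - ?f0) * (?g1 - ?g0))" using assms(2,3) by auto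
  then have "(r * ?f1 + (1 - r) * ?f0) * (r * ?g1 + (1 - r) * ?g0)
      \<le> r * (?f1 * ?g1) + (1 - r) * (?f0 * ?g0)" by (simp add: algebra_simps)
  also have "\<dots> \<le> r * bern r W (\<lambda>A. f (insert y A) * g (insert y A)) + (1 - r) * bern r W (\<lambda>A. f A * g A)"
    using 1 0 assms(2,3) by (intro add_mono mult_left_mono) auto
  finally show ?case using insert by (simp add: bern_insert)
qed

lemma harris_prod:
  assumes "finite W" "0 \<le> r" "r \<le> 1" "finite I"
    and "\<And>i A B. i \<in> I \<Longrightarrow> A \<subseteq> B \<Longrightarrow> f i A \<le> f i B" "\<And>i A. i \<in> I \<Longrightarrow> 0 \<le> f i A"
  shows "(\<Prod>i\<in>I. bern r W (f i)) \<le> bern r W (\<lambda>A. \<Prod>i\<in>I. f i A)"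
  using assms(4,5,6)
proof (induction I rule: finite_induct)
  case empty then show ?case by (simp add: bern_const assms)
next
  case (insert i I)
  have nn: "0 \<le> bern r W (f i)"
    using bern_mono[of r W "\<lambda>A. 0" "f i"] insert.prems(2) assms by (simp add: bern_const)
  have "(\<Prod>i\<in>insert i I. bern r W (f i)) = bern r W (f i) * (\<Prod>i\<in>I. bern r W (f i))"
    using insert by simp
  also have "\<dots> \<le> bern r W (f i) * bern r W (\<lambda>A. \<Prod>i\<in>I. f i A)"
    using insert nn by (intro mult_left_mono) auto
  also have "\<dots> \<le> bern r W (\<lambda>A. f i A * (\<Prod>i\<in>I. f i A))"
  proof (rule harris[OF assms(1-3)])
    fix A B :: "'a set" assume "A \<subseteq> B"
    then show "f i A \<le> f i B" by (intro insert.prems) auto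
    show "(\<Prod>i\<in>I. f i A) \<le> (\<Prod>i\<in>I. f i B)"
      using \<open>A \<subseteq> B\<close> by (intro prod_mono conjI insert.prems) auto
  qed
  finally show ?case using insert by simp
qed

section \<open>Predecessors of a point in a uniformly random order\<close>

text \<open>The expectation of \<open>h\<close> at the set of elements that precede an extra point
  in a random order of \<open>W\<close> and that point: a given set of size \<open>j\<close> arises
  from \<open>j! (m - j)!\<close> of the \<open>(m + 1)!\<close> orders.\<close>

definition avg :: "'a set \<Rightarrow> ('a set \<Rightarrow> real) \<Rightarrow> real" where
  "avg W h = (\<Sum>A\<in>Pow W. fact (card A) * fact (card W - card A) / fact (Suc (card W)) * h A)"

lemma integral_bernstein:
  "j \<le> m \<Longrightarrow> ((\<lambda>r. r ^ j * (1 - r) ^ (m - j)) has_integral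
     (fact j * fact (m - j) / fact (Suc m) :: real)) {0..1}"
proof -
  assume "j \<le> m"
  have "((\<lambda>t. t powr (real (Suc j) - 1) * (1 - t) powr (real (Suc (m - j)) - 1)) has_integral
      Beta (real (Suc j)) (real (Suc (m - j)))) {0..1}"
    by (rule has_integral_Beta_real) auto
  moreover have "Beta (real (Suc j)) (real (Suc (m - j))) = fact j * fact (m - j) / fact (Suc m)"
  proof -
    have e: "real (Suc j) + real (Suc (m - j)) = 1 + real (Suc m)" using \<open>j \<le> m\<close> by simp
    have "real (Suc j) = 1 + real j" "real (Suc (m - j)) = 1 + real (m - j)" by auto
    then show ?thesis unfolding Beta_def e by (metis Gamma_fact)
  qed
  ultimately have *: "((\<lambda>t. t powr (real (Suc j) - 1) * (1 - t) powr (real (Suc (m - j)) - 1)) has_integral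
      fact j * fact (m - j) / fact (Suc m)) {0..1}" by simp
  show ?thesis
    by (rule has_integral_spike_finite[OF _ _ *, of "{0,1}"]) (auto simp: powr_realpow)
qed

text \<open>Let the points of \<open>W\<close> and the extra point have independent uniform arrival
  times. If the extra point arrives at time \<open>r\<close>, each element of \<open>W\<close>
  precedes it independently with probability \<open>r\<close>. Analytically this is a Beta integral
  in each term.\<close>

lemma avg_has_integral:
  assumes "finite W"
  shows "((\<lambda>r. bern r W h) has_integral avg W h) {0..1}"
  unfolding bern_def avg_def
  by (intro has_integral_sum has_integral_mult_left integral_bernstein)
     (use assms in \<open>auto intro: card_mono\<close>)

text \<open>Conditions on the first element of the order: it is the extra point, which then has no
  predecessors, or some \<open>y\<close>, which then belongs to every set of predecessors.\<close>

lemma avg_rec: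
  assumes "finite W"
  shows "(real (card W) + 1) * avg W h = h {} + (\<Sum>y\<in>W. avg (W - {y}) (\<lambda>A. h (insert y A)))"
proof -
  define m where "m = card W"
  have "(\<Sum>y\<in>W. avg (W - {y}) (\<lambda>A. h (insert y A)))
      = (\<Sum>y\<in>W. \<Sum>A\<in>Pow (W - {y}). fact (card A) * fact (m - Suc (card A)) / fact m * h (insert y A))"
    unfolding avg_def
  proof (rule sum.cong[OF refl], rule sum.cong[OF refl])
    fix y :: 'a and A :: "'a set" assume "y \<in> W"
    then have "card W > 0" using assms by (auto simp: card_gt_0_iff)
    then have "card (W - {y}) - card A = m - Suc (card A)" "Suc (card (W - {y})) = m"
      using \<open>y \<in> W\<close> assms by (auto simp: m_def)
    then show "fact (card A) * fact (card (W - {y}) - card A) / fact (Suc (card (W - {y}))) * h (insert y A)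
      = fact (card A) * fact (m - Suc (card A)) / fact m * h (insert y A)" by simp
  qed
  also have "\<dots> = (\<Sum>(y,A)\<in>Sigma W (\<lambda>y. Pow (W - {y})).
      fact (card A) * fact (m - Suc (card A)) / fact m * h (insert y A))"
    using assms by (intro sum.Sigma) auto
  \<comment> \<open>Double counting: a pair \<open>(y, A)\<close> is the nonempty set
    \<open>insert y A\<close> with a marked element. The \<open>card B\<close> possible marks turn
    \<open>fact (card B - 1)\<close> into \<open>fact (card B)\<close>.\<close>
  also have "\<dots> = (\<Sum>(B,y)\<in>Sigma (Pow W - {{}}) (\<lambda>B. B).
      fact (card B - 1) * fact (m - card B) / fact m * h B)"
  proof (rule sum.reindex_bij_witness[where i = "\<lambda>(B,y). (y, B - {y})" and j = "\<lambda>(y,A). (insert y A, y)"], goal_cases)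
    case (5 a)
    then obtain y A where a: "a = (y, A)" "y \<in> W" "A \<subseteq> W - {y}" by auto
    then have "finite A" "y \<notin> A" using assms by (auto intro: finite_subset)
    then show ?case using a by auto
  qed (auto)
  also have "\<dots> = (\<Sum>B\<in>Pow W - {{}}. \<Sum>y\<in>B. fact (card B - 1) * fact (m - card B) / fact m * h B)"
    using assms by (intro sum.Sigma[symmetric]) (auto intro: finite_subset)
  also have "\<dots> = (\<Sum>B\<in>Pow W - {{}}. fact (card B) * fact (m - card B) / fact m * h B)"
  proof (rule sum.cong[OF refl])
    fix B assume B: "B \<in> Pow W - {{}}"
    then have "card B > 0" using assms by (auto simp: card_gt_0_iff intro: finite_subset)
    then have f: "fact (card B) = (real (card B) * fact (card B - 1) :: real)" by (simp add: fact_reduce)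
    show "(\<Sum>y\<in>B. fact (card B - 1) * fact (m - card B) / fact m * h B)
      = fact (card B) * fact (m - card B) / fact m * h B" unfolding f by simp
  qed
  finally have 1: "(\<Sum>y\<in>W. avg (W - {y}) (\<lambda>A. h (insert y A)))
      = (\<Sum>B\<in>Pow W - {{}}. fact (card B) * fact (m - card B) / fact m * h B)" .
  have f: "fact (Suc m) = ((real m + 1) * fact m :: real)" by simp
  have "(real m + 1) * avg W h = (\<Sum>B\<in>Pow W. fact (card B) * fact (m - card B) / fact m * h B)"
    unfolding avg_def sum_distrib_left m_def[symmetric] f
  proof (rule sum.cong[OF refl])
    fix A :: "'a set"
    have "(real m + 1) * (x / ((real m + 1) * fact m) * y) = x / fact m * y" for x y :: real
    proof -
      have "real m + 1 \<noteq> 0" by linarith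
      then have "x / fact m = ((real m + 1) * x) / ((real m + 1) * fact m)"
        by (rule mult_divide_mult_cancel_left[symmetric])
      then show ?thesis by simp
    qed
    then show "(real m + 1) * (fact (card A) * fact (m - card A) / ((real m + 1) * fact m) * h A)
      = fact (card A) * fact (m - card A) / fact m * h A" .
  qed
  also have "\<dots> = h {} + (\<Sum>B\<in>Pow W - {{}}. fact (card B) * fact (m - card B) / fact m * h B)"
    by (subst sum.remove[of _ "{}"]) (use assms in auto)
  finally show ?thesis using 1 by (simp add: m_def)
qed

text \<open>Placing \<open>y\<close> first can only enlarge the set of predecessors, and
  \<open>h\<close> is antitone. For each \<open>r\<close> the expectation over \<open>W\<close> is a
  mixture of the cases with and without \<open>y\<close>.\<close>

lemma avg_remove_le:
  assumes "finite W" "y \<in> W" and anti: "\<And>A B. A \<subseteq> B \<Longrightarrow> h B \<le> h A"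
  shows "avg (W - {y}) (\<lambda>A. h (insert y A)) \<le> avg W h"
proof (rule has_integral_le[OF avg_has_integral avg_has_integral])
  fix r :: real assume r: "r \<in> {0..1}"
  have W: "W = insert y (W - {y})" using assms by auto
  have "bern r W h = r * bern r (W - {y}) (\<lambda>A. h (insert y A)) + (1 - r) * bern r (W - {y}) h"
    by (subst W, subst bern_insert) (use assms in auto)
  also have "\<dots> \<ge> r * bern r (W - {y}) (\<lambda>A. h (insert y A)) + (1 - r) * bern r (W - {y}) (\<lambda>A. h (insert y A))"
    using r by (intro add_left_mono mult_left_mono bern_mono anti) auto
  finally show "bern r (W - {y}) (\<lambda>A. h (insert y A)) \<le> bern r W h" by (simp add: algebra_simps)
qed (use assms in auto)

section \<open>The cutting recursion of critical clause trees and its inverse\<close>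

text \<open>Bounds from below the probability that a tree of depth \<open>d\<close> with
  \<open>m\<close> children per node is cut by labels that arrive before time \<open>r\<close>: a
  child is settled if its own label is early or, failing that, if its subtree is cut. The value
  \<open>0\<close> at depth \<open>0\<close> is the pessimistic choice where the unfolding
  stops.\<close>

primrec cut :: "nat \<Rightarrow> nat \<Rightarrow> real \<Rightarrow> real" where
  "cut m 0 r = 0"
| "cut m (Suc d) r = (r + (1 - r) * cut m d r) ^ m"

lemma cut_bounds:
  assumes "0 \<le> r" "r \<le> 1" shows "0 \<le> cut m d r \<and> cut m d r \<le> 1"
proof (induction d)
  case (Suc d)
  have "r + (1 - r) * cut m d r \<le> r + (1 - r) * 1" using assms Suc by (intro add_left_mono mult_left_mono) auto
  then show ?case using assms Suc by (auto intro!: power_le_one)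
qed simp

lemma continuous_on_cut: "continuous_on S (cut m d)"
  by (induction d) (auto intro!: continuous_intros)

text \<open>The inverse of the limit of \<open>cut\<close>: \<open>z < 1\<close> is a fixed point of
  \<open>\<lambda>q. (r + (1 - r) * q) ^ m\<close> iff
  \<open>1 - r = (1 - root m z) / (1 - z)\<close>, and this quotient is \<open>psi m z\<close>. The
  geometric sum keeps it defined at \<open>z = 1\<close>.\<close>

definition psi :: "nat \<Rightarrow> real \<Rightarrow> real" where
  "psi m z = 1 / (\<Sum>i<m. root m z ^ i)"

lemma psi_antimono:
  assumes "m > 0" "0 \<le> x" "x \<le> z" shows "psi m z \<le> psi m x"
proof -
  have "(1::real) \<le> (\<Sum>i<m. root m x ^ i)"
    using assms by (intro order_trans[OF _ member_le_sum[of 0]]) auto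
  moreover have "(\<Sum>i<m. root m x ^ i) \<le> (\<Sum>i<m. root m z ^ i)"
    using assms by (intro sum_mono power_mono) auto
  ultimately show ?thesis unfolding psi_def by (intro divide_left_mono mult_pos_pos) auto
qed

lemma psi_le_1: assumes "m > 0" "0 \<le> z" shows "psi m z \<le> 1"
  using psi_antimono[of m 0 z] assms by (simp add: psi_def power_0_left if_distrib cong: if_cong)

lemma psi_times:
  assumes "m > 0" "0 \<le> z" shows "psi m z * (1 - z) = 1 - root m z"
proof -
  have "(1::real) \<le> (\<Sum>i<m. root m z ^ i)"
    using assms by (intro order_trans[OF _ member_le_sum[of 0]]) auto
  moreover have "1 - z = (1 - root m z) * (\<Sum>i<m. root m z ^ i)"
    using one_diff_power_eq[of "root m z" m] assms by simp
  ultimately show ?thesis unfolding psi_def by (simp add: field_simps)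
qed

lemma add_power_le:
  fixes x y :: real
  assumes "l > 0" "0 \<le> x" "0 \<le> y" shows "x ^ l + y ^ l \<le> (x + y) ^ l"
  using assms
proof (induction l rule: nat_induct_non_zero)
  case (Suc l)
  have "x ^ Suc l + y ^ Suc l \<le> (x ^ l + y ^ l) * (x + y)"
    using Suc.prems by (simp add: algebra_simps)
  also have "\<dots> \<le> (x + y) ^ l * (x + y)" using Suc by (intro mult_right_mono) auto
  finally show ?case by (simp add: algebra_simps)
qed simp

text \<open>A quantitative form of convergence to the fixed point. If \<open>r\<close> exceeds the
  threshold \<open>1 - psi m z\<close> by \<open>\<eta>\<close>, every iteration below height
  \<open>z\<close> gains at least \<open>(\<eta> * (1 - z)) ^ m\<close>, by superadditivity of the
  power, so the reciprocal of this gain bounds the number of rounds uniformly in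
  \<open>r\<close>.\<close>

lemma cut_ge:
  assumes m: "m > 0" and z: "0 \<le> z" "z < 1" and e: "0 \<le> \<eta>" and r: "1 - psi m z + \<eta> \<le> r" "r \<le> 1"
    and d: "1 \<le> real d * (\<eta> * (1 - z)) ^ m"
  shows "z \<le> cut m d r"
proof -
  define \<delta> where "\<delta> = (\<eta> * (1 - z)) ^ m"
  have \<delta>: "0 \<le> \<delta>" using z e by (simp add: \<delta>_def)
  have r0: "0 \<le> r" using r e psi_le_1[OF m z(1)] by linarith
  have step: "q + \<delta> \<le> (r + (1 - r) * q) ^ m" if q: "0 \<le> q" "q \<le> z" for q
  proof -
    let ?y = "root m q"
    have "(1 - psi m q + \<eta>) * (1 - q) \<le> r * (1 - q)"
      using r psi_antimono[OF m q] q z by (intro mult_right_mono) auto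
    then have "?y + \<eta> * (1 - q) \<le> r + (1 - r) * q"
      using psi_times[OF m q(1)] by (simp add: algebra_simps)
    moreover have "\<eta> * (1 - z) \<le> \<eta> * (1 - q)" using q e by (intro mult_left_mono) auto
    ultimately have 1: "?y + \<eta> * (1 - z) \<le> r + (1 - r) * q" by linarith
    have "q + \<delta> = ?y ^ m + (\<eta> * (1 - z)) ^ m" using m q by (simp add: \<delta>_def)
    also have "\<dots> \<le> (?y + \<eta> * (1 - z)) ^ m"
      using m q e z
      by (intro add_power_le) auto
    also have "\<dots> \<le> (r + (1 - r) * q) ^ m" using 1 q e z by (intro power_mono) (auto intro!: add_nonneg_nonneg real_root_ge_zero)
    finally show ?thesis .
  qed
  have "min z (real d * \<delta>) \<le> cut m d r" for d
  proof (induction d)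
    case (Suc d)
    define q where "q = min z (cut m d r)"
    have q: "0 \<le> q" "q \<le> z" "q \<le> cut m d r" using cut_bounds[OF r0 r(2)] z by (auto simp: q_def)
    have "min z (real (Suc d) * \<delta>) \<le> q + \<delta>"
      using Suc \<delta> by (auto simp: q_def algebra_simps min_def split: if_splits)
    also have "\<dots> \<le> (r + (1 - r) * q) ^ m" by (rule step) fact+
    also have "\<dots> \<le> cut m (Suc d) r"
      using q r r0 by (auto intro!: power_mono add_mono mult_left_mono)
    finally show ?case .
  qed (use z in auto)
  from this[of d] show ?thesis using d z by (auto simp: \<delta>_def min_def split: if_splits)
qed

section \<open>The integral of the rate function as a series\<close>

text \<open>For \<open>m = k - 1\<close> these are the partial sums of
  \<open>mu k / (real k - 1)\<close>. The division is moved into the terms so that all denominators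
  are integers and the program can approximate the sum by integer division.\<close>

definition gam :: "nat \<Rightarrow> nat \<Rightarrow> real" where
  "gam m t = (\<Sum>j<t. 1 / (real (Suc j) * (real m * real (Suc j) + 1)))"

lemma has_integral_power01: "((\<lambda>z. z ^ j) has_integral 1 / (real j + 1)) {0..1::real}"
proof -
  have "((\<lambda>z. z ^ j) has_integral (1 ^ Suc j / real (Suc j) - 0 ^ Suc j / real (Suc j))) {0..1::real}"
  proof (rule fundamental_theorem_of_calculus)
    fix x :: real
    have "((\<lambda>x. x ^ Suc j / real (Suc j)) has_real_derivative x ^ j) (at x within {0..1})"
      using DERIV_cdivide[OF DERIV_power[OF DERIV_ident], of "Suc j" "real (Suc j)" x "{0..1}"] by simp
    then show "((\<lambda>x. x ^ Suc j / real (Suc j)) has_vector_derivative x ^ j) (at x within {0..1})"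
      by (simp add: has_real_derivative_iff_has_vector_derivative)
  qed simp
  then show ?thesis by (simp add: add.commute)
qed

lemma has_integral_powr01:
  assumes "a > -1"
  shows "((\<lambda>z. z powr a) has_integral 1 / (a + 1)) {0..1::real}"
  using has_integral_powr_from_0[of a 1] assms by simp

text \<open>\<open>psi m z\<close> is \<open>(1 - z powr (1 / real m)) / (1 - z)\<close>. Its
  geometric expansion, cut off after \<open>t\<close> terms so that the integrand stays bounded near
  \<open>1\<close>, integrates term by term to
  \<open>1 / (j + 1) - 1 / (j + 1 + 1 / m)\<close>.\<close>

lemma integral_psi_lower:
  assumes "m > 0"
  shows "((\<lambda>z. (1 - z powr (1 / real m)) * (\<Sum>j<t. z ^ j)) has_integral gam m t) {0..1}"
proof -
  have "((\<lambda>z. \<Sum>j<t. z ^ j - z powr (real j + 1 / real m)) has_integral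
      (\<Sum>j<t. 1 / (real j + 1) - 1 / ((real j + 1 / real m) + 1))) {0..1}"
  proof (intro has_integral_sum has_integral_diff has_integral_power01 has_integral_powr01)
    fix j show "- 1 < real j + 1 / real m"
      by (rule less_le_trans[of _ 0]) auto
  qed auto
  also have "(\<Sum>j<t. 1 / (real j + 1) - 1 / ((real j + 1 / real m) + 1)) = gam m t"
    unfolding gam_def
  proof (rule sum.cong)
    fix j
    have "real j + 1 > 0" "real m > 0" "real j * real m + 1 + real m > 0" using assms by (auto intro: add_nonneg_pos)
    then show "1 / (real j + 1) - 1 / ((real j + 1 / real m) + 1) = 1 / (real (Suc j) * (real m * real (Suc j) + 1))"
      by (simp add: divide_simps) (simp add: algebra_simps)
  qed simp
  finally have *: "((\<lambda>z. \<Sum>j<t. z ^ j - z powr (real j + 1 / real m)) has_integral gam m t) {0..1}" .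
  have eq: "(1 - z powr (1 / real m)) * (\<Sum>j<t. z ^ j) = (\<Sum>j<t. z ^ j - z powr (real j + 1 / real m))"
    if "0 < z" for z :: real
  proof -
    have "(1 - z powr (1 / real m)) * z ^ j = z ^ j - z powr (real j + 1 / real m)" for j
      using that by (simp add: powr_add powr_realpow left_diff_distrib)
    then show ?thesis by (simp add: sum_distrib_left)
  qed
  show ?thesis
    by (rule has_integral_spike_finite[OF _ _ *, of "{0}"]) (use eq in \<open>auto simp: less_le\<close>)
qed

lemma psi_lower:
  assumes "m > 0" "0 \<le> z" "z \<le> 1"
  shows "(1 - z powr (1 / real m)) * (\<Sum>j<t. z ^ j) \<le> psi m z"
proof -
  have root: "z powr (1 / real m) = root m z"
    using assms by (cases "z = 0") (auto simp: root_powr_inverse)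
  have rle: "root m z \<le> 1" using assms by simp
  have "(1 - z) * (\<Sum>j<t. z ^ j) \<le> 1" using one_diff_power_eq[of z t, symmetric] assms by (simp only:) simp
  then have "psi m z * ((1 - z) * (\<Sum>j<t. z ^ j)) \<le> psi m z * 1"
    using assms by (intro mult_left_mono) (auto simp: psi_def intro!: sum_nonneg)
  then show ?thesis unfolding root using psi_times[OF assms(1,2)] by (simp add: mult.assoc[symmetric])
qed

text \<open>\<open>psi\<close> is antitone, so a left Riemann sum dominates the integral. The
  comparison runs interval by interval through the minorant \<open>f\<close>, whose integral is
  known.\<close>

lemma riemann_psi:
  assumes "m > 0" "J > 0"
  shows "gam m t \<le> (\<Sum>i<J. psi m (real i / real J)) / real J"
proof -
  define f where "f = (\<lambda>z. (1 - z powr (1 / real m)) * (\<Sum>j<t. z ^ j))"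
  have f: "(f has_integral gam m t) {0..1}" unfolding f_def by (rule integral_psi_lower) fact
  have "integral {0..real N / real J} f \<le> (\<Sum>i<N. psi m (real i / real J)) / real J" if "N \<le> J" for N
    using that
  proof (induction N)
    case (Suc N)
    have int: "f integrable_on {a..b}" if "0 \<le> a" "b \<le> 1" for a b
      by (rule integrable_subinterval_real[OF has_integral_integrable[OF f]]) (use that in auto)
    have le: "real N / real J \<le> real (Suc N) / real J" "real (Suc N) / real J \<le> 1"
      using Suc.prems assms by (auto simp: field_simps)
    have "integral {real N / real J..real (Suc N) / real J} f
        \<le> integral {real N / real J..real (Suc N) / real J} (\<lambda>_. psi m (real N / real J))"
    proof (rule integral_le)
      fix z assume z: "z \<in> {real N / real J..real (Suc N) / real J}"
      then have "0 \<le> z" "z \<le> 1" using le by (auto intro: order_trans[rotated])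
      then have "f z \<le> psi m z" unfolding f_def by (intro psi_lower assms)
      also have "\<dots> \<le> psi m (real N / real J)" using z by (intro psi_antimono assms) auto
      finally show "f z \<le> psi m (real N / real J)" .
    qed (use le in \<open>auto intro!: int\<close>)
    also have "\<dots> = psi m (real N / real J) / real J"
      using le assms by (simp add: field_simps)
    finally have 1: "integral {real N / real J..real (Suc N) / real J} f \<le> psi m (real N / real J) / real J" .
    have "integral {0..real (Suc N) / real J} f
        = integral {0..real N / real J} f + integral {real N / real J..real (Suc N) / real J} f"
      by (rule Henstock_Kurzweil_Integration.integral_combine[symmetric]) (use le in \<open>auto intro!: int\<close>)
    then show ?case using 1 Suc by (simp add: add_divide_distrib)
  qed auto
  from this[of J] show ?thesis using assms integral_unique[OF f] by simp
qed

text \<open>Layer cake: the integral of \<open>cut\<close> over \<open>r\<close> is the integral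
  over heights \<open>z\<close> of the measure of those \<open>r\<close> where \<open>cut\<close>
  exceeds \<open>z\<close>, which is nearly \<open>psi m z\<close>. Restricting to the heights
  \<open>i / J\<close> costs \<open>1 / J\<close> for the margin above each threshold and at most
  \<open>1 / J\<close> for the omitted height \<open>0\<close>, where \<open>psi\<close> is at most
  \<open>1\<close>.\<close>

lemma integral_cut_ge:
  assumes m: "m > 0" and J: "J > 0" and d: "J ^ (2 * m) \<le> d"
  shows "gam m t - 2 / real J \<le> integral {0..1} (cut m d)"
proof -
  define thr where "thr i = 1 - psi m (real i / real J) + 1 / real J" for i
  have thr0: "0 \<le> thr i" if "i < J" for i
    using psi_le_1[OF m, of "real i / real J"] by (simp add: thr_def add_nonneg_nonneg)
  define g where "g r = (\<Sum>i\<in>{1..<J}. (1 / real J) * indicator {thr i..1} r)" for r :: real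
  have gi: "(g has_integral (\<Sum>i\<in>{1..<J}. (1 / real J) * (if thr i \<le> 1 then 1 - thr i else 0))) {0..1}"
    unfolding g_def
  proof (intro has_integral_sum has_integral_mult_right)
    fix i assume i: "i \<in> {1..<J}"
    have "((\<lambda>r. 1 :: real) has_integral (if thr i \<le> 1 then 1 - thr i else 0)) {thr i..1}"
      using has_integral_const_real[of "1::real" "thr i" 1] by auto
    then have "((\<lambda>r. if r \<in> {thr i..1} then 1 else 0 :: real) has_integral (if thr i \<le> 1 then 1 - thr i else 0)) {0..1}"
      by (subst has_integral_restrict) (use thr0 i in auto)
    also have "(\<lambda>r. if r \<in> {thr i..1} then 1 else 0 :: real) = indicator {thr i..1}"
      by (auto simp: indicator_def)
    finally show "(indicator {thr i..1} has_integral (if thr i \<le> 1 then 1 - thr i else 0)) {0..1}" .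
  qed auto
  have le: "g r \<le> cut m d r" if r: "r \<in> {0..1}" for r
  proof (cases "{i\<in>{1..<J}. thr i \<le> r} = {}")
    case True
    then have "g r = 0" unfolding g_def by (intro sum.neutral) (auto simp: indicator_def)
    then show ?thesis using cut_bounds r by auto
  next
    case False
    let ?I = "{i\<in>{1..<J}. thr i \<le> r}"
    define i where "i = Max ?I"
    have iI: "i \<in> ?I" unfolding i_def by (rule Max_in) (use False in auto)
    have "?I \<subseteq> {1..i}" unfolding i_def by auto
    then have "card ?I \<le> i" using card_mono[of "{1..i}" ?I] by auto
    moreover have "g r = (\<Sum>i\<in>?I. 1 / real J)"
    proof -
      have "(\<Sum>i\<in>?I. 1 / real J) = (\<Sum>i\<in>{1..<J}. if thr i \<le> r then 1 / real J else 0)"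
        by (rule sum.inter_filter) simp
      also have "\<dots> = g r" unfolding g_def by (rule sum.cong) (use r in \<open>auto simp: indicator_def\<close>)
      finally show ?thesis by simp
    qed
    ultimately have "g r \<le> real i / real J" using J by (simp add: divide_right_mono)
    also have "\<dots> \<le> cut m d r"
    proof (rule cut_ge[OF m, of _ "1 / real J"])
      \<comment> \<open>The greatest height is \<open>1 - 1 / J\<close>, so both factors of the gain
        per round are at least \<open>1 / J\<close>; hence the depth
        \<open>J ^ (2 * m)\<close>.\<close>
      have "1 / real J \<le> 1 - real i / real J" using iI J by (simp add: field_simps)
      then have "1 / real J * (1 / real J) \<le> 1 / real J * (1 - real i / real J)"
        by (intro mult_left_mono) auto
      then have 1: "(1 / real J * (1 / real J)) ^ m \<le> (1 / real J * (1 - real i / real J)) ^ m"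
        by (intro power_mono) auto
      have "(1 / real J * (1 / real J)) ^ m * real (J ^ (2 * m)) = 1"
      proof -
        have "(1 / real J * (1 / real J)) ^ m * real (J ^ (2 * m)) = (1 / real J * (1 / real J) * (real J * real J)) ^ m"
          by (simp only: of_nat_power of_nat_mult power_mult power2_eq_square power_mult_distrib)
        also have "1 / real J * (1 / real J) * (real J * real J) = 1" using J by simp
        finally show ?thesis by simp
      qed
      moreover have "(1 / real J * (1 / real J)) ^ m * real (J ^ (2 * m)) \<le> (1 / real J * (1 - real i / real J)) ^ m * real d"
        using 1 d J iI by (intro mult_mono) (auto simp del: of_nat_power)
      ultimately show "1 \<le> real d * (1 / real J * (1 - real i / real J)) ^ m"
        by (simp add: mult.commute)
    qed (use iI J r in \<open>auto simp: thr_def\<close>)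
    finally show ?thesis .
  qed
  have ci: "cut m d integrable_on {0..1}"
    by (intro integrable_continuous_interval continuous_on_cut)
  have "(\<Sum>i\<in>{1..<J}. (1 / real J) * (1 - thr i)) \<le> (\<Sum>i\<in>{1..<J}. (1 / real J) * (if thr i \<le> 1 then 1 - thr i else 0))"
    by (intro sum_mono mult_left_mono) auto
  also have "\<dots> \<le> integral {0..1} (cut m d)"
    by (rule has_integral_le[OF gi integrable_integral[OF ci]]) (use le in auto)
  finally have 1: "(\<Sum>i\<in>{1..<J}. (1 / real J) * (1 - thr i)) \<le> integral {0..1} (cut m d)" .
  have "(\<Sum>i<J. psi m (real i / real J)) = psi m 0 + (\<Sum>i\<in>{1..<J}. psi m (real i / real J))"
    using J by (subst lessThan_atLeast0, subst sum.atLeast_Suc_lessThan) auto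
  also have "psi m 0 \<le> 1" by (rule psi_le_1) (use m in auto)
  finally have "(\<Sum>i<J. psi m (real i / real J)) / real J \<le> (1 + (\<Sum>i\<in>{1..<J}. psi m (real i / real J))) / real J"
    by (auto intro: divide_right_mono)
  with riemann_psi[OF m J, of t]
  have 2: "gam m t \<le> (1 + (\<Sum>i\<in>{1..<J}. psi m (real i / real J))) / real J" by linarith
  have "(\<Sum>i\<in>{1..<J}. (1 / real J) * (1 - thr i))
      = (\<Sum>i\<in>{1..<J}. psi m (real i / real J)) / real J - real (J - 1) / real J * (1 / real J)"
    unfolding thr_def by (simp add: sum_divide_distrib[symmetric] sum_subtractf diff_divide_distrib)
  moreover have "real (J - 1) / real J * (1 / real J) \<le> 1 * (1 / real J)"
    using J by (intro mult_right_mono) auto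
  ultimately have "(\<Sum>i\<in>{1..<J}. psi m (real i / real J)) / real J - 1 / real J \<le> integral {0..1} (cut m d)"
    using 1 by linarith
  then show ?thesis using 2 by (simp add: add_divide_distrib)
qed

lemma avg_le_of_cut:
  assumes "finite W" "m > 0" "J > 0" "J ^ (2 * m) \<le> d"
    and "\<And>r. 0 \<le> r \<Longrightarrow> r \<le> 1 \<Longrightarrow> bern r W h \<le> 1 - cut m d r"
  shows "avg W h \<le> 1 - gam m t + 2 / real J"
proof -
  have ci: "cut m d integrable_on {0..1}"
    by (intro integrable_continuous_interval continuous_on_cut)
  have "((\<lambda>r. 1 - cut m d r) has_integral (1 - integral {0..1} (cut m d))) {0..1}"
    using has_integral_diff[OF has_integral_const_real[of "1::real" 0 1] integrable_integral[OF ci]] by simp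
  then have "avg W h \<le> 1 - integral {0..1} (cut m d)"
    by (rule has_integral_le[OF avg_has_integral[OF assms(1)]]) (use assms(5) in auto)
  with integral_cut_ge[OF assms(2-4), of t] show ?thesis by linarith
qed

section \<open>Success probability of PPSZ\<close>

locale cnf =
  fixes k n w :: nat and F :: formula
  assumes kcnf: "kcnf k n F"
begin

definition sols :: "(nat \<rightharpoonup> bool) \<Rightarrow> (nat \<Rightarrow> bool) set" where
  "sols \<alpha> = {\<sigma> \<in> {..<n} \<rightarrow>\<^sub>E UNIV. satisfies \<sigma> F \<and> (\<forall>v b. \<alpha> v = Some b \<longrightarrow> \<sigma> v = b)}"

definition unset :: "(nat \<rightharpoonup> bool) \<Rightarrow> nat set" where
  "unset \<alpha> = {v. v < n \<and> \<alpha> v = None}"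

definition falsified :: "(nat \<rightharpoonup> bool) \<Rightarrow> bool" where
  "falsified \<alpha> \<longleftrightarrow> (\<exists>C\<in>F. \<forall>(v, b)\<in>C. \<alpha> v = Some (\<not> b))"

text \<open>Falsity is implied by the values of \<open>w\<close> variables. This replaces bounded resolution; padding by
  repeated or assigned variables makes \<open>length vs = w\<close> cover all smaller sets.\<close>

definition refut :: "(nat \<rightharpoonup> bool) \<Rightarrow> bool" where
  "refut \<alpha> \<longleftrightarrow> (\<exists>vs. length vs = w \<and> set vs \<subseteq> {..<n} \<and>
     (\<forall>bs. length bs = w \<longrightarrow> falsified (map_of (zip vs bs) ++ \<alpha>)))"

definition liquid :: "(nat \<rightharpoonup> bool) \<Rightarrow> nat set" where
  "liquid \<alpha> = {x \<in> unset \<alpha>. \<forall>b. sols (\<alpha>(x \<mapsto> b)) \<noteq> {}}"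

definition frozen :: "(nat \<rightharpoonup> bool) \<Rightarrow> nat set" where
  "frozen \<alpha> = unset \<alpha> - liquid \<alpha>"

definition rest :: "(nat \<Rightarrow> bool) \<Rightarrow> nat set \<Rightarrow> (nat \<rightharpoonup> bool)" where
  "rest \<tau> X = (\<lambda>v. if v \<in> X then Some (\<tau> v) else None)"

lemma finite_unset [simp]: "finite (unset \<alpha>)"
  by (rule finite_subset[of _ "{..<n}"]) (auto simp: unset_def)

lemma finite_liquid [simp]: "finite (liquid \<alpha>)" and finite_frozen [simp]: "finite (frozen \<alpha>)"
  by (auto simp: liquid_def frozen_def)

lemma finite_sols [simp]: "finite (sols \<alpha>)"
  by (rule finite_subset[of _ "{..<n} \<rightarrow>\<^sub>E UNIV"]) (auto simp: sols_def intro: finite_PiE)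

lemma unset_upd [simp]: "unset (\<alpha>(y \<mapsto> b)) = unset \<alpha> - {y}"
  by (auto simp: unset_def)

lemma sols_upd: "y \<in> unset \<alpha> \<Longrightarrow> sols (\<alpha>(y \<mapsto> b)) = {\<sigma> \<in> sols \<alpha>. \<sigma> y = b}"
  by (auto simp: sols_def unset_def)

lemma sols_updI: "\<sigma> \<in> sols \<alpha> \<Longrightarrow> y \<in> unset \<alpha> \<Longrightarrow> \<sigma> \<in> sols (\<alpha>(y \<mapsto> \<sigma> y))"
  by (simp add: sols_upd)

lemma falsified_sols: "falsified \<alpha> \<Longrightarrow> sols \<alpha> = {}"
proof (rule ccontr)
  assume "falsified \<alpha>" "sols \<alpha> \<noteq> {}"
  then obtain C \<sigma> where "C \<in> F" "\<forall>(v, b)\<in>C. \<alpha> v = Some (\<not> b)" "\<sigma> \<in> sols \<alpha>"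
    by (auto simp: falsified_def)
  from this(3,1) have "\<exists>(v, b)\<in>C. \<sigma> v = b" by (simp add: sols_def satisfies_def)
  then obtain v b where vb: "(v, b) \<in> C" "\<sigma> v = b" by blast
  then have "\<alpha> v = Some (\<not> b)" using \<open>\<forall>(v, b)\<in>C. \<alpha> v = Some (\<not> b)\<close> by blast
  then show False using \<open>\<sigma> \<in> sols \<alpha>\<close> vb by (simp add: sols_def)
qed

lemma falsified_mono: "\<alpha> \<subseteq>\<^sub>m \<beta> \<Longrightarrow> falsified \<alpha> \<Longrightarrow> falsified \<beta>"
proof -
  assume le: "\<alpha> \<subseteq>\<^sub>m \<beta>" and "falsified \<alpha>"
  then obtain C where C: "C \<in> F" "\<forall>(v, b)\<in>C. \<alpha> v = Some (\<not> b)" by (auto simp: falsified_def)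
  have "\<beta> v = Some (\<not> b)" if "(v, b) \<in> C" for v b
  proof -
    have "\<alpha> v = Some (\<not> b)" using C that by auto
    then have "v \<in> dom \<alpha>" by (rule domI)
    with le have "\<alpha> v = \<beta> v" unfolding map_le_def by (rule bspec)
    then show ?thesis using \<open>\<alpha> v = Some (\<not> b)\<close> by (simp only:)
  qed
  then show "falsified \<beta>" using C by (auto simp: falsified_def)
qed

text \<open>Total assignments that extend \<open>\<alpha>\<close> replace the lists of values, so
  that repetitions in \<open>vs\<close> and variables already set by \<open>\<alpha>\<close> cause
  no case distinctions.\<close>

lemma refut_iff:
  "refut \<alpha> \<longleftrightarrow> (\<exists>vs. length vs = w \<and> set vs \<subseteq> {..<n} \<and>
     (\<forall>\<tau>. (\<forall>v b. \<alpha> v = Some b \<longrightarrow> \<tau> v = b) \<longrightarrow> falsified (rest \<tau> (set vs \<union> dom \<alpha>))))"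
  unfolding refut_def
proof (intro arg_cong[where f = Ex] ext conj_cong refl iffI allI impI)
  fix vs \<tau>
  assume vs: "length vs = w"
    and *: "\<forall>bs. length bs = w \<longrightarrow> falsified (map_of (zip vs bs) ++ \<alpha>)"
    and \<tau>: "\<forall>v b. \<alpha> v = Some b \<longrightarrow> \<tau> v = b"
  have "map_of (zip vs (map \<tau> vs)) ++ \<alpha> = rest \<tau> (set vs \<union> dom \<alpha>)"
    using \<tau> by (auto simp: map_add_def map_of_zip_map rest_def fun_eq_iff split: option.splits)
  then show "falsified (rest \<tau> (set vs \<union> dom \<alpha>))" using *[rule_format, of "map \<tau> vs"] vs by simp
next
  fix vs and bs :: "bool list"
  assume vs: "length vs = w" and bs: "length bs = w"
    and *: "\<forall>\<tau>. (\<forall>v b. \<alpha> v = Some b \<longrightarrow> \<tau> v = b) \<longrightarrow> falsified (rest \<tau> (set vs \<union> dom \<alpha>))"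
  define \<gamma> where "\<gamma> = map_of (zip vs bs) ++ \<alpha>"
  have "dom \<gamma> = set vs \<union> dom \<alpha>" using vs bs by (auto simp: \<gamma>_def)
  then have "rest (\<lambda>v. the (\<gamma> v)) (set vs \<union> dom \<alpha>) = rest (\<lambda>v. the (\<gamma> v)) (dom \<gamma>)" by simp
  also have "\<dots> = \<gamma>" by (auto simp: rest_def fun_eq_iff dom_def)
  finally have "rest (\<lambda>v. the (\<gamma> v)) (set vs \<union> dom \<alpha>) = \<gamma>" .
  moreover have "falsified (rest (\<lambda>v. the (\<gamma> v)) (set vs \<union> dom \<alpha>))"
    by (rule *[rule_format]) (simp add: \<gamma>_def)
  ultimately show "falsified \<gamma>" by simp
qed

lemma refut_sols: "refut \<alpha> \<Longrightarrow> sols \<alpha> = {}"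
proof (rule ccontr)
  assume "refut \<alpha>" "sols \<alpha> \<noteq> {}"
  then obtain vs \<sigma> where vs: "\<forall>\<tau>. (\<forall>v b. \<alpha> v = Some b \<longrightarrow> \<tau> v = b) \<longrightarrow> falsified (rest \<tau> (set vs \<union> dom \<alpha>))"
    and \<sigma>: "\<sigma> \<in> sols \<alpha>" by (auto simp: refut_iff)
  have "falsified (rest \<sigma> (set vs \<union> dom \<alpha>))" using vs \<sigma> by (auto simp: sols_def)
  moreover have "\<sigma> \<in> sols (rest \<sigma> (set vs \<union> dom \<alpha>))" using \<sigma> by (auto simp: sols_def rest_def split: if_splits)
  ultimately show False using falsified_sols by blast
qed

lemma refut_mono:
  assumes "\<alpha> \<subseteq>\<^sub>m \<beta>" "refut \<alpha>" shows "refut \<beta>"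
proof -
  obtain vs where vs: "length vs = w" "set vs \<subseteq> {..<n}"
    "\<And>\<tau>. (\<forall>v b. \<alpha> v = Some b \<longrightarrow> \<tau> v = b) \<Longrightarrow> falsified (rest \<tau> (set vs \<union> dom \<alpha>))"
    using assms(2) unfolding refut_iff by blast
  have "falsified (rest \<tau> (set vs \<union> dom \<beta>))" if "\<forall>v b. \<beta> v = Some b \<longrightarrow> \<tau> v = b" for \<tau>
  proof (rule falsified_mono)
    show "falsified (rest \<tau> (set vs \<union> dom \<alpha>))"
      by (rule vs(3)) (use that assms(1) in \<open>auto simp: map_le_def dom_def\<close>)
    show "rest \<tau> (set vs \<union> dom \<alpha>) \<subseteq>\<^sub>m rest \<tau> (set vs \<union> dom \<beta>)"
      using map_le_implies_dom_le[OF assms(1)] by (auto simp: rest_def map_le_def split: if_splits)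
  qed
  then show ?thesis unfolding refut_iff using vs by blast
qed

text \<open>Counts the choices of a variable and a value that keep a solution: the value taken from
  a fixed solution \<open>\<sigma>\<close> is always admissible, the opposite one exactly for the
  liquid variables.\<close>

lemma card_unset_liquid:
  assumes "sols \<alpha> \<noteq> {}"
  shows "card {(x, b). x \<in> unset \<alpha> \<and> sols (\<alpha>(x \<mapsto> b)) \<noteq> {}} = card (unset \<alpha>) + card (liquid \<alpha>)"
proof -
  obtain \<sigma> where \<sigma>: "\<sigma> \<in> sols \<alpha>" using assms by auto
  have "{(x, b). x \<in> unset \<alpha> \<and> sols (\<alpha>(x \<mapsto> b)) \<noteq> {}}
      = (\<lambda>x. (x, \<sigma> x)) ` unset \<alpha> \<union> (\<lambda>x. (x, \<not> \<sigma> x)) ` liquid \<alpha>" (is "?A = ?B")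
  proof (intro set_eqI iffI)
    fix p assume "p \<in> ?A"
    then obtain x b where p: "p = (x, b)" "x \<in> unset \<alpha>" "sols (\<alpha>(x \<mapsto> b)) \<noteq> {}" by auto
    show "p \<in> ?B"
    proof (cases "b = \<sigma> x")
      case False
      have "sols (\<alpha>(x \<mapsto> b')) \<noteq> {}" for b'
        using p sols_updI[OF \<sigma> p(2)] False by (cases "b' = b") auto
      then have "x \<in> liquid \<alpha>" using p by (simp add: liquid_def)
      then show ?thesis using False p by auto
    qed (use p in auto)
  next
    fix p assume "p \<in> ?B" then show "p \<in> ?A" using sols_updI[OF \<sigma>] by (auto simp: liquid_def)
  qed
  also have "card \<dots> = card ((\<lambda>x. (x, \<sigma> x)) ` unset \<alpha>) + card ((\<lambda>x. (x, \<not> \<sigma> x)) ` liquid \<alpha>)"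
    by (rule card_Un_disjoint) auto
  finally show ?thesis by (simp add: card_image inj_on_def)
qed

lemma frozen_eq:
  assumes "x \<in> frozen \<alpha>" "\<sigma> \<in> sols \<alpha>" "\<tau> \<in> sols \<alpha>" shows "\<sigma> x = \<tau> x"
proof (rule ccontr)
  assume ne: "\<sigma> x \<noteq> \<tau> x"
  have x: "x \<in> unset \<alpha>" using assms by (simp add: frozen_def)
  have "sols (\<alpha>(x \<mapsto> b)) \<noteq> {}" for b
    using sols_updI[OF assms(2) x] sols_updI[OF assms(3) x] ne by (cases "b = \<sigma> x") auto
  then show False using assms x by (simp add: frozen_def liquid_def)
qed

lemma sols_frozen: "x \<in> frozen \<alpha> \<Longrightarrow> \<sigma> \<in> sols \<alpha> \<Longrightarrow> sols (\<alpha>(x \<mapsto> \<sigma> x)) = sols \<alpha>"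
  using frozen_eq by (auto simp: sols_upd frozen_def)

lemma sols_frozen_not: "x \<in> frozen \<alpha> \<Longrightarrow> \<sigma> \<in> sols \<alpha> \<Longrightarrow> sols (\<alpha>(x \<mapsto> (\<not> \<sigma> x))) = {}"
  using frozen_eq by (auto simp: sols_upd frozen_def)

lemma liquid_upd_subset: "y \<in> unset \<alpha> \<Longrightarrow> liquid (\<alpha>(y \<mapsto> b)) \<subseteq> liquid \<alpha> - {y}"
proof
  assume y: "y \<in> unset \<alpha>"
  fix x assume x: "x \<in> liquid (\<alpha>(y \<mapsto> b))"
  then have xu: "x \<in> unset \<alpha>" "x \<noteq> y" by (auto simp: liquid_def)
  have "sols (\<alpha>(y \<mapsto> b, x \<mapsto> c)) \<subseteq> sols (\<alpha>(x \<mapsto> c))" for c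
    using xu y by (simp add: sols_upd) auto
  then have "sols (\<alpha>(x \<mapsto> c)) \<noteq> {}" for c using x unfolding liquid_def by blast
  then show "x \<in> liquid \<alpha> - {y}" using xu by (simp add: liquid_def)
qed

lemma liquid_frozen:
  assumes "y \<in> frozen \<alpha>" "\<sigma> \<in> sols \<alpha>" shows "liquid (\<alpha>(y \<mapsto> \<sigma> y)) = liquid \<alpha>"
proof
  show "liquid (\<alpha>(y \<mapsto> \<sigma> y)) \<subseteq> liquid \<alpha>"
    using liquid_upd_subset[of y \<alpha>] assms by (auto simp: frozen_def)
  show "liquid \<alpha> \<subseteq> liquid (\<alpha>(y \<mapsto> \<sigma> y))"
  proof
    fix x assume x: "x \<in> liquid \<alpha>"
    then have "x \<noteq> y" "x \<in> unset \<alpha>" using assms by (auto simp: frozen_def liquid_def)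
    moreover have "sols (\<alpha>(y \<mapsto> \<sigma> y, x \<mapsto> b)) = sols (\<alpha>(x \<mapsto> b))" for b
      using calculation assms by (simp add: sols_upd sols_frozen)
    ultimately show "x \<in> liquid (\<alpha>(y \<mapsto> \<sigma> y))" using x by (simp add: liquid_def)
  qed
qed

lemma frozen_upd: "y \<in> frozen \<alpha> \<Longrightarrow> z \<in> unset \<alpha> \<Longrightarrow> z \<noteq> y \<Longrightarrow> y \<in> frozen (\<alpha>(z \<mapsto> b))"
  using liquid_upd_subset[of z \<alpha> b] by (auto simp: frozen_def)

text \<open>Lets a sum over solutions be evaluated one assignment further down, since the solutions
  of \<open>\<alpha>\<close> split according to their value at \<open>y\<close>.\<close>

lemma sum_sols_swap:
  fixes f :: "(nat \<rightharpoonup> bool) \<Rightarrow> (nat \<Rightarrow> bool) \<Rightarrow> real"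
  assumes "Y \<subseteq> unset \<alpha>"
  shows "(\<Sum>\<sigma>\<in>sols \<alpha>. \<Sum>y\<in>Y. f (\<alpha>(y \<mapsto> \<sigma> y)) \<sigma>)
    = (\<Sum>y\<in>Y. \<Sum>b\<in>UNIV. \<Sum>\<sigma>\<in>sols (\<alpha>(y \<mapsto> b)). f (\<alpha>(y \<mapsto> b)) \<sigma>)"
proof -
  have "(\<Sum>\<sigma>\<in>sols \<alpha>. f (\<alpha>(y \<mapsto> \<sigma> y)) \<sigma>)
      = (\<Sum>b\<in>UNIV. \<Sum>\<sigma>\<in>sols (\<alpha>(y \<mapsto> b)). f (\<alpha>(y \<mapsto> b)) \<sigma>)" if "y \<in> Y" for y
  proof -
    have "sols \<alpha> = sols (\<alpha>(y \<mapsto> True)) \<union> sols (\<alpha>(y \<mapsto> False))"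
      using that assms by (auto simp: sols_upd)
    then have 1: "(\<Sum>\<sigma>\<in>sols \<alpha>. g \<sigma>)
       = (\<Sum>\<sigma>\<in>sols (\<alpha>(y \<mapsto> True)). g \<sigma>) + (\<Sum>\<sigma>\<in>sols (\<alpha>(y \<mapsto> False)). g \<sigma>)" for g :: "_ \<Rightarrow> real"
      by simp (rule sum.union_disjoint; use that assms in \<open>auto simp: sols_upd\<close>)
    have 2: "(\<Sum>\<sigma>\<in>sols (\<alpha>(y \<mapsto> b)). f (\<alpha>(y \<mapsto> \<sigma> y)) \<sigma>) = (\<Sum>\<sigma>\<in>sols (\<alpha>(y \<mapsto> b)). f (\<alpha>(y \<mapsto> b)) \<sigma>)" for b
      using that assms by (intro sum.cong) (auto simp: sols_upd)
    show ?thesis unfolding UNIV_bool by (subst 1) (simp add: 2)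
  qed
  then show ?thesis by (subst sum.swap) simp
qed

section \<open>Likelihoods of solutions and the cost of guessing\<close>

text \<open>The probability that \<open>\<sigma>\<close> is the outcome if a uniformly random pair of an unset variable and a
  value admitting a solution is assigned repeatedly. Hertli's potential weighs solutions by it.\<close>

primrec lk :: "nat \<Rightarrow> (nat \<rightharpoonup> bool) \<Rightarrow> (nat \<Rightarrow> bool) \<Rightarrow> real" where
  "lk 0 \<alpha> \<sigma> = 1"
| "lk (Suc j) \<alpha> \<sigma> = (\<Sum>y\<in>unset \<alpha>. lk j (\<alpha>(y \<mapsto> \<sigma> y)) \<sigma>) / (real (card (unset \<alpha>)) + real (card (liquid \<alpha>)))"

lemma lk_nonneg: "0 \<le> lk j \<alpha> \<sigma>"
  by (induction j arbitrary: \<alpha>) (auto intro!: divide_nonneg_nonneg sum_nonneg)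

lemma sum_lk:
  "card (unset \<alpha>) = j \<Longrightarrow> sols \<alpha> \<noteq> {} \<Longrightarrow> (\<Sum>\<sigma>\<in>sols \<alpha>. lk j \<alpha> \<sigma>) = 1"
proof (induction j arbitrary: \<alpha>)
  case 0
  obtain \<sigma> where \<sigma>: "\<sigma> \<in> sols \<alpha>" using 0 by auto
  have "unset \<alpha> = {}" using 0 by simp
  then have all: "\<And>v. v < n \<Longrightarrow> \<exists>b. \<alpha> v = Some b" by (auto simp: unset_def)
  have uniq: "\<tau> = \<sigma>" if \<tau>: "\<tau> \<in> sols \<alpha>" for \<tau>
  proof
    fix v show "\<tau> v = \<sigma> v"
    proof (cases "v < n")
      case True
      then obtain b where "\<alpha> v = Some b" using all by auto
      then show ?thesis using \<sigma> \<tau> by (auto simp: sols_def)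
    next
      case False
      then show ?thesis using \<sigma> \<tau> by (auto simp: sols_def PiE_def extensional_def)
    qed
  qed
  have "sols \<alpha> = {\<sigma>}" using \<sigma> uniq by blast
  then show ?case by simp
next
  case (Suc j)
  have "(\<Sum>\<sigma>\<in>sols \<alpha>. \<Sum>y\<in>unset \<alpha>. lk j (\<alpha>(y \<mapsto> \<sigma> y)) \<sigma>)
     = (\<Sum>y\<in>unset \<alpha>. \<Sum>b\<in>UNIV. \<Sum>\<sigma>\<in>sols (\<alpha>(y \<mapsto> b)). lk j (\<alpha>(y \<mapsto> b)) \<sigma>)"
    by (rule sum_sols_swap) simp
  also have "\<dots> = (\<Sum>y\<in>unset \<alpha>. \<Sum>b\<in>UNIV. if sols (\<alpha>(y \<mapsto> b)) \<noteq> {} then 1 else 0)"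
    by (intro sum.cong refl) (use Suc in auto)
  also have "\<dots> = (\<Sum>(y,b)\<in>unset \<alpha> \<times> UNIV. if sols (\<alpha>(y \<mapsto> b)) \<noteq> {} then 1 else 0)"
    by (rule sum.cartesian_product)
  also have "\<dots> = real (card {p\<in>unset \<alpha> \<times> UNIV. sols (\<alpha>(fst p \<mapsto> snd p)) \<noteq> {}})"
    by (simp add: case_prod_beta sum.If_cases Int_def)
  finally have 1: "(\<Sum>\<sigma>\<in>sols \<alpha>. \<Sum>y\<in>unset \<alpha>. lk j (\<alpha>(y \<mapsto> \<sigma> y)) \<sigma>)
      = real (card {p\<in>unset \<alpha> \<times> UNIV. sols (\<alpha>(fst p \<mapsto> snd p)) \<noteq> {}})" .
  have 2: "{p\<in>unset \<alpha> \<times> UNIV. sols (\<alpha>(fst p \<mapsto> snd p)) \<noteq> {}} = {(x, b). x \<in> unset \<alpha> \<and> sols (\<alpha>(x \<mapsto> b)) \<noteq> {}}"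
    by auto
  have 3: "real (card (unset \<alpha>)) + real (card (liquid \<alpha>)) \<noteq> 0" unfolding Suc.prems(1) by linarith
  show ?case unfolding lk.simps(2) sum_divide_distrib[symmetric] 1 2 card_unset_liquid[OF Suc.prems(2)]
    using 3 by simp
qed

text \<open>Setting a variable as in \<open>\<sigma>\<close> can only shrink the liquid set and with
  it the number of choices left, so the likelihood does not drop; a frozen \<open>y\<close> leaves
  the liquid set as it is. After clearing denominators, the induction hypothesis applies to each
  summand in which another variable is set first.\<close>

lemma lk_step:
  assumes "card (unset \<alpha>) = Suc j" "\<sigma> \<in> sols \<alpha>" "y \<in> unset \<alpha>"
  shows "lk (Suc j) \<alpha> \<sigma> \<le> lk j (\<alpha>(y \<mapsto> \<sigma> y)) \<sigma> \<and>
    (y \<in> frozen \<alpha> \<longrightarrow> lk (Suc j) \<alpha> \<sigma> = lk j (\<alpha>(y \<mapsto> \<sigma> y)) \<sigma>)"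
  using assms
proof (induction j arbitrary: \<alpha>)
  case 0
  then have "unset \<alpha> = {y}" by (auto simp: card_Suc_eq)
  moreover have "liquid \<alpha> = {}" if "y \<in> frozen \<alpha>"
    using that \<open>unset \<alpha> = {y}\<close> by (auto simp: frozen_def liquid_def)
  ultimately show ?case by (auto simp: field_simps)
next
  case (Suc j)
  let ?l = "card (liquid \<alpha>)" and ?l' = "card (liquid (\<alpha>(y \<mapsto> \<sigma> y)))"
  have l: "?l' \<le> ?l" using liquid_upd_subset[OF Suc.prems(3)] by (intro card_mono) auto
  have cy: "card (unset \<alpha> - {y}) = Suc j" using Suc.prems by simp
  have comm: "\<alpha>(z \<mapsto> \<sigma> z, y \<mapsto> \<sigma> y) = \<alpha>(y \<mapsto> \<sigma> y, z \<mapsto> \<sigma> z)" for z by (auto simp: fun_eq_iff)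
  have "(\<Sum>z\<in>unset \<alpha> - {y}. lk j (\<alpha>(y \<mapsto> \<sigma> y, z \<mapsto> \<sigma> z)) \<sigma>)
      = (real (Suc j) + ?l') * lk (Suc j) (\<alpha>(y \<mapsto> \<sigma> y)) \<sigma>"
  proof -
    have "real (Suc j) + ?l' \<noteq> 0" by linarith
    then show ?thesis unfolding lk.simps(2)[of j "\<alpha>(y \<mapsto> \<sigma> y)"] unset_upd cy by simp
  qed
  note sum' = this
  have IH: "lk (Suc j) (\<alpha>(z \<mapsto> \<sigma> z)) \<sigma> \<le> lk j (\<alpha>(y \<mapsto> \<sigma> y, z \<mapsto> \<sigma> z)) \<sigma> \<and>
    (y \<in> frozen (\<alpha>(z \<mapsto> \<sigma> z)) \<longrightarrow> lk (Suc j) (\<alpha>(z \<mapsto> \<sigma> z)) \<sigma> = lk j (\<alpha>(y \<mapsto> \<sigma> y, z \<mapsto> \<sigma> z)) \<sigma>)"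
    if "z \<in> unset \<alpha> - {y}" for z
    using Suc.IH[of "\<alpha>(z \<mapsto> \<sigma> z)"] Suc.prems that sols_updI[OF Suc.prems(2), of z] by (simp only: comm) (simp del: fun_upd_apply lk.simps)
  have pos: "real (Suc (Suc j)) + ?l > 0" by linarith
  have lkS: "(real (Suc (Suc j)) + ?l) * lk (Suc (Suc j)) \<alpha> \<sigma>
      = lk (Suc j) (\<alpha>(y \<mapsto> \<sigma> y)) \<sigma> + (\<Sum>z\<in>unset \<alpha> - {y}. lk (Suc j) (\<alpha>(z \<mapsto> \<sigma> z)) \<sigma>)"
    using pos Suc.prems by (subst lk.simps(2)) (simp add: sum.remove[of _ y] del: lk.simps)
  have "(real (Suc (Suc j)) + ?l) * lk (Suc (Suc j)) \<alpha> \<sigma>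
      \<le> lk (Suc j) (\<alpha>(y \<mapsto> \<sigma> y)) \<sigma> + (\<Sum>z\<in>unset \<alpha> - {y}. lk j (\<alpha>(y \<mapsto> \<sigma> y, z \<mapsto> \<sigma> z)) \<sigma>)"
    unfolding lkS by (intro add_left_mono sum_mono) (use IH in auto)
  also have "\<dots> = (real (Suc (Suc j)) + ?l') * lk (Suc j) (\<alpha>(y \<mapsto> \<sigma> y)) \<sigma>"
    unfolding sum' by (simp add: algebra_simps del: lk.simps)
  also have "\<dots> \<le> (real (Suc (Suc j)) + ?l) * lk (Suc j) (\<alpha>(y \<mapsto> \<sigma> y)) \<sigma>"
    using l by (intro mult_right_mono lk_nonneg) auto
  finally have le: "lk (Suc (Suc j)) \<alpha> \<sigma> \<le> lk (Suc j) (\<alpha>(y \<mapsto> \<sigma> y)) \<sigma>"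
    using pos by (simp only: mult_le_cancel_left_pos)
  have "lk (Suc (Suc j)) \<alpha> \<sigma> = lk (Suc j) (\<alpha>(y \<mapsto> \<sigma> y)) \<sigma>" if fr: "y \<in> frozen \<alpha>"
  proof -
    have "(real (Suc (Suc j)) + ?l) * lk (Suc (Suc j)) \<alpha> \<sigma>
      = lk (Suc j) (\<alpha>(y \<mapsto> \<sigma> y)) \<sigma> + (\<Sum>z\<in>unset \<alpha> - {y}. lk j (\<alpha>(y \<mapsto> \<sigma> y, z \<mapsto> \<sigma> z)) \<sigma>)"
      unfolding lkS using IH frozen_upd[OF fr] by (intro arg_cong2[where f = "(+)"] sum.cong) auto
    also have "\<dots> = (real (Suc (Suc j)) + ?l') * lk (Suc j) (\<alpha>(y \<mapsto> \<sigma> y)) \<sigma>"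
      unfolding sum' by (simp add: algebra_simps del: lk.simps)
    also have "?l' = ?l" using liquid_frozen[OF fr Suc.prems(2)] by simp
    finally show ?thesis using pos by (metis mult_cancel_left less_irrefl)
  qed
  with le show ?case by blast
qed

definition hg :: "(nat \<rightharpoonup> bool) \<Rightarrow> (nat \<Rightarrow> bool) \<Rightarrow> nat \<Rightarrow> nat set \<Rightarrow> real" where
  "hg \<alpha> \<sigma> x A = of_bool (\<not> refut ((\<alpha> ++ rest \<sigma> A)(x \<mapsto> \<not> \<sigma> x)))"

text \<open>The probability that \<open>x\<close> has to be guessed when it is processed in a random order and the earlier
  variables are set according to \<open>\<sigma>\<close>.\<close>

definition gw :: "(nat \<rightharpoonup> bool) \<Rightarrow> (nat \<Rightarrow> bool) \<Rightarrow> nat \<Rightarrow> real" where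
  "gw \<alpha> \<sigma> x = avg (unset \<alpha> - {x}) (hg \<alpha> \<sigma> x)"

lemma hg_antimono: "A \<subseteq> B \<Longrightarrow> \<sigma> \<in> sols \<alpha> \<Longrightarrow> hg \<alpha> \<sigma> x B \<le> hg \<alpha> \<sigma> x A"
proof -
  assume "A \<subseteq> B" "\<sigma> \<in> sols \<alpha>"
  then have "(\<alpha> ++ rest \<sigma> A)(x \<mapsto> \<not> \<sigma> x) \<subseteq>\<^sub>m (\<alpha> ++ rest \<sigma> B)(x \<mapsto> \<not> \<sigma> x)"
    by (auto simp: map_le_def rest_def map_add_def sols_def)
  then show ?thesis using refut_mono by (auto simp: hg_def)
qed

lemma gw_upd:
  assumes "y \<in> unset \<alpha>"
  shows "gw (\<alpha>(y \<mapsto> \<sigma> y)) \<sigma> x = avg (unset \<alpha> - {x} - {y}) (\<lambda>A. hg \<alpha> \<sigma> x (insert y A))"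
proof -
  have "\<alpha>(y \<mapsto> \<sigma> y) ++ rest \<sigma> A = \<alpha> ++ rest \<sigma> (insert y A)" for A
    using assms by (auto simp: fun_eq_iff map_add_def rest_def unset_def split: option.splits)
  moreover have "unset \<alpha> - {y} - {x} = unset \<alpha> - {x} - {y}" by auto
  ultimately show ?thesis by (simp add: gw_def hg_def [abs_def])
qed

lemma gw_rec:
  assumes "x \<in> unset \<alpha>"
  shows "real (card (unset \<alpha>)) * gw \<alpha> \<sigma> x
    = hg \<alpha> \<sigma> x {} + (\<Sum>y\<in>unset \<alpha> - {x}. gw (\<alpha>(y \<mapsto> \<sigma> y)) \<sigma> x)"
proof -
  have "card (unset \<alpha>) > 0" using assms by (auto simp: card_gt_0_iff)
  then have "real (card (unset \<alpha>)) = real (card (unset \<alpha> - {x})) + 1"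
    using assms by simp
  then show ?thesis
    using avg_rec[of "unset \<alpha> - {x}" "hg \<alpha> \<sigma> x"]
    by (simp add: gw_upd gw_def[of \<alpha>])
qed

lemma gw_upd_le:
  assumes "y \<in> unset \<alpha>" "y \<noteq> x" "\<sigma> \<in> sols \<alpha>"
  shows "gw (\<alpha>(y \<mapsto> \<sigma> y)) \<sigma> x \<le> gw \<alpha> \<sigma> x"
proof -
  have "avg (unset \<alpha> - {x} - {y}) (\<lambda>A. hg \<alpha> \<sigma> x (insert y A)) \<le> avg (unset \<alpha> - {x}) (hg \<alpha> \<sigma> x)"
    by (rule avg_remove_le) (use assms hg_antimono in auto)
  then show ?thesis using gw_upd[OF assms(1), of \<sigma> x] by (simp only: gw_def[of \<alpha>])
qed

definition cf :: "nat \<Rightarrow> (nat \<rightharpoonup> bool) \<Rightarrow> nat \<Rightarrow> real" where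
  "cf j \<alpha> z = (\<Sum>\<sigma>\<in>sols \<alpha>. lk j \<alpha> \<sigma> * gw \<alpha> \<sigma> z)"

text \<open>The drift of the cost of a frozen \<open>z\<close>: over all admissible choices, setting
  one variable lowers it by at least the chance that \<open>z\<close> itself is set and has to be
  guessed. For a uniform order this would be \<open>gw_rec\<close>, but here the weights
  \<open>L\<close> depend on the variable. They are smallest at \<open>z\<close>, by
  \<open>lk_step\<close>, and they multiply decreases of \<open>gw\<close> that are nonnegative, so
  replacing all of them by the smallest is safe.\<close>

lemma cf_key:
  assumes j: "card (unset \<alpha>) = Suc j" and z: "z \<in> frozen \<alpha>" and \<sigma>0: "\<sigma>0 \<in> sols \<alpha>"
  shows "hg \<alpha> \<sigma>0 z {} + (\<Sum>x\<in>unset \<alpha> - {z}. \<Sum>b\<in>UNIV. cf j (\<alpha>(x \<mapsto> b)) z)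
    \<le> (real (Suc j) + real (card (liquid \<alpha>))) * cf (Suc j) \<alpha> z"
proof -
  have zu: "z \<in> unset \<alpha>" using z by (simp add: frozen_def)
  define L where "L \<sigma> y = lk j (\<alpha>(y \<mapsto> \<sigma> y)) \<sigma>" for \<sigma> y
  have "(\<Sum>x\<in>unset \<alpha> - {z}. \<Sum>b\<in>UNIV. cf j (\<alpha>(x \<mapsto> b)) z)
      = (\<Sum>\<sigma>\<in>sols \<alpha>. \<Sum>x\<in>unset \<alpha> - {z}. L \<sigma> x * gw (\<alpha>(x \<mapsto> \<sigma> x)) \<sigma> z)"
    unfolding cf_def L_def by (rule sum_sols_swap[symmetric]) auto
  moreover have "hg \<alpha> \<sigma>0 z {} = (\<Sum>\<sigma>\<in>sols \<alpha>. L \<sigma> z * hg \<alpha> \<sigma> z {})"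
  proof -
    have "(\<Sum>\<sigma>\<in>sols \<alpha>. L \<sigma> z * hg \<alpha> \<sigma> z {}) = (\<Sum>\<sigma>\<in>sols \<alpha>. lk j (\<alpha>(z \<mapsto> \<sigma>0 z)) \<sigma> * hg \<alpha> \<sigma>0 z {})"
    proof (rule sum.cong[OF refl])
      fix \<sigma> assume "\<sigma> \<in> sols \<alpha>"
      then have "\<sigma> z = \<sigma>0 z" using frozen_eq[OF z] \<sigma>0 by blast
      then show "L \<sigma> z * hg \<alpha> \<sigma> z {} = lk j (\<alpha>(z \<mapsto> \<sigma>0 z)) \<sigma> * hg \<alpha> \<sigma>0 z {}"
        by (simp add: L_def hg_def rest_def)
    qed
    also have "\<dots> = (\<Sum>\<sigma>\<in>sols (\<alpha>(z \<mapsto> \<sigma>0 z)). lk j (\<alpha>(z \<mapsto> \<sigma>0 z)) \<sigma>) * hg \<alpha> \<sigma>0 z {}"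
      using sols_frozen[OF z \<sigma>0] by (simp add: sum_distrib_right)
    also have "(\<Sum>\<sigma>\<in>sols (\<alpha>(z \<mapsto> \<sigma>0 z)). lk j (\<alpha>(z \<mapsto> \<sigma>0 z)) \<sigma>) = 1"
      by (rule sum_lk) (use j zu \<sigma>0 sols_frozen[OF z \<sigma>0] in auto)
    finally show ?thesis by simp
  qed
  moreover have "(real (Suc j) + real (card (liquid \<alpha>))) * cf (Suc j) \<alpha> z
      = (\<Sum>\<sigma>\<in>sols \<alpha>. (\<Sum>x\<in>unset \<alpha>. L \<sigma> x) * gw \<alpha> \<sigma> z)"
  proof -
    have "(real (Suc j) + real (card (liquid \<alpha>))) * lk (Suc j) \<alpha> \<sigma> = (\<Sum>x\<in>unset \<alpha>. L \<sigma> x)" for \<sigma>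
    proof -
      have "real (Suc j) + real (card (liquid \<alpha>)) \<noteq> 0" by linarith
      then show ?thesis unfolding lk.simps(2) j L_def by simp
    qed
    then show ?thesis by (simp only: cf_def sum_distrib_left mult.assoc[symmetric])
  qed
  moreover have "L \<sigma> z * hg \<alpha> \<sigma> z {} + (\<Sum>x\<in>unset \<alpha> - {z}. L \<sigma> x * gw (\<alpha>(x \<mapsto> \<sigma> x)) \<sigma> z)
      \<le> (\<Sum>x\<in>unset \<alpha>. L \<sigma> x) * gw \<alpha> \<sigma> z" if \<sigma>: "\<sigma> \<in> sols \<alpha>" for \<sigma>
  proof -
    have "L \<sigma> z * (gw \<alpha> \<sigma> z - gw (\<alpha>(x \<mapsto> \<sigma> x)) \<sigma> z) \<le> L \<sigma> x * (gw \<alpha> \<sigma> z - gw (\<alpha>(x \<mapsto> \<sigma> x)) \<sigma> z)"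
      if "x \<in> unset \<alpha> - {z}" for x
      using lk_step[OF j \<sigma>, of x] lk_step[OF j \<sigma> zu] that z gw_upd_le[of x \<alpha> z \<sigma>] \<sigma>
      by (intro mult_right_mono) (auto simp: L_def)
    then have "(\<Sum>x\<in>unset \<alpha> - {z}. L \<sigma> z * (gw \<alpha> \<sigma> z - gw (\<alpha>(x \<mapsto> \<sigma> x)) \<sigma> z))
      \<le> (\<Sum>x\<in>unset \<alpha> - {z}. L \<sigma> x * (gw \<alpha> \<sigma> z - gw (\<alpha>(x \<mapsto> \<sigma> x)) \<sigma> z))" by (rule sum_mono)
    moreover have "(\<Sum>x\<in>unset \<alpha> - {z}. L \<sigma> z * (gw \<alpha> \<sigma> z - gw (\<alpha>(x \<mapsto> \<sigma> x)) \<sigma> z))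
       = L \<sigma> z * (real j * gw \<alpha> \<sigma> z - (\<Sum>x\<in>unset \<alpha> - {z}. gw (\<alpha>(x \<mapsto> \<sigma> x)) \<sigma> z))"
      using j zu by (simp add: sum_distrib_left[symmetric] sum_subtractf)
    moreover have "(\<Sum>x\<in>unset \<alpha> - {z}. gw (\<alpha>(x \<mapsto> \<sigma> x)) \<sigma> z) = real (Suc j) * gw \<alpha> \<sigma> z - hg \<alpha> \<sigma> z {}"
      using gw_rec[OF zu, of \<sigma>] j by simp
    moreover have "(\<Sum>x\<in>unset \<alpha>. L \<sigma> x) * gw \<alpha> \<sigma> z
        = L \<sigma> z * gw \<alpha> \<sigma> z + (\<Sum>x\<in>unset \<alpha> - {z}. L \<sigma> x * gw \<alpha> \<sigma> z)"
      using zu by (simp add: sum.remove[of _ z] distrib_right sum_distrib_right)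
    ultimately show ?thesis by (simp add: right_diff_distrib sum_subtractf algebra_simps)
  qed
  ultimately show ?thesis by (simp add: sum.distrib[symmetric] sum_mono)
qed

section \<open>The success probability of PPSZ and Hertli's lower bound\<close>

definition val :: "(nat \<rightharpoonup> bool) \<Rightarrow> nat \<Rightarrow> bool \<Rightarrow> bool" where
  "val \<alpha> x b = (if refut (\<alpha>(x \<mapsto> b)) then \<not> b else b)"

text \<open>The success probability of one run of PPSZ. Drawing the next variable afresh at every
  step yields a uniformly random order and gives the recursion the same shape as that of
  \<open>lk\<close>.\<close>

primrec pp :: "nat \<Rightarrow> (nat \<rightharpoonup> bool) \<Rightarrow> real" where
  "pp 0 \<alpha> = of_bool (\<not> falsified \<alpha>)"
| "pp (Suc j) \<alpha> = (\<Sum>x\<in>unset \<alpha>. \<Sum>b\<in>UNIV. pp j (\<alpha>(x \<mapsto> val \<alpha> x b))) / (2 * real (card (unset \<alpha>)))"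

lemma pp_nonneg: "0 \<le> pp j \<alpha>"
  by (induction j arbitrary: \<alpha>) (auto intro!: divide_nonneg_nonneg sum_nonneg)

text \<open>Jensen's inequality for the convex function \<open>2 powr (- x)\<close>, by its tangent
  at the mean.\<close>

lemma sum_powr_ge:
  fixes f :: "'b \<Rightarrow> real"
  assumes "finite I" "I \<noteq> {}"
  shows "real (card I) * 2 powr (- (\<Sum>i\<in>I. f i) / real (card I)) \<le> (\<Sum>i\<in>I. 2 powr (- f i))"
proof -
  define m where "m = (\<Sum>i\<in>I. f i) / real (card I)"
  have "2 powr (- m) * (1 + ln 2 * (m - f i)) \<le> 2 powr (- f i)" for i
  proof -
    have "1 + ln 2 * (m - f i) \<le> exp (ln 2 * (m - f i))" by (rule exp_ge_add_one_self)
    also have "\<dots> = 2 powr (m - f i)" by (simp add: powr_def mult.commute)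
    finally have "2 powr (- m) * (1 + ln 2 * (m - f i)) \<le> 2 powr (- m) * 2 powr (m - f i)"
      by (intro mult_left_mono) auto
    also have "\<dots> = 2 powr (- f i)" by (simp add: powr_add[symmetric])
    finally show ?thesis .
  qed
  then have "(\<Sum>i\<in>I. 2 powr (- m) * (1 + ln 2 * (m - f i))) \<le> (\<Sum>i\<in>I. 2 powr (- f i))"
    by (rule sum_mono)
  moreover have "(\<Sum>i\<in>I. 2 powr (- m) * (1 + ln 2 * (m - f i)))
     = 2 powr (- m) * (real (card I) + ln 2 * (real (card I) * m - (\<Sum>i\<in>I. f i)))"
    by (simp add: sum_distrib_left[symmetric] sum.distrib sum_subtractf)
  moreover have "real (card I) * m = (\<Sum>i\<in>I. f i)" using assms by (simp add: m_def)
  ultimately show ?thesis by (simp add: m_def mult.commute)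
qed

end

context cnf begin

lemma val_liquid: "x \<in> liquid \<alpha> \<Longrightarrow> val \<alpha> x b = b"
  using refut_sols[of "\<alpha>(x \<mapsto> b)"] by (auto simp: val_def liquid_def)

lemma val_frozen: "x \<in> frozen \<alpha> \<Longrightarrow> \<sigma> \<in> sols \<alpha> \<Longrightarrow> val \<alpha> x (\<sigma> x) = \<sigma> x"
  using refut_sols[of "\<alpha>(x \<mapsto> \<sigma> x)"] sols_frozen[of x \<alpha> \<sigma>] by (auto simp: val_def)

text \<open>Hertli's potential, an upper bound for \<open>- log 2 (pp j \<alpha>)\<close>. A liquid
  variable is charged the full worst-case rate \<open>S\<close>, because it may freeze at the next
  step.\<close>

definition cc :: "real \<Rightarrow> nat \<Rightarrow> (nat \<rightharpoonup> bool) \<Rightarrow> real" where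
  "cc S j \<alpha> = S * real (card (liquid \<alpha>)) + (\<Sum>z\<in>frozen \<alpha>. cf j \<alpha> z)"

lemma cf_le:
  assumes "\<And>\<sigma>. \<sigma> \<in> sols \<alpha> \<Longrightarrow> gw \<alpha> \<sigma> z \<le> S" "card (unset \<alpha>) = j" "sols \<alpha> \<noteq> {}"
  shows "cf j \<alpha> z \<le> S"
proof -
  have "cf j \<alpha> z \<le> (\<Sum>\<sigma>\<in>sols \<alpha>. lk j \<alpha> \<sigma> * S)"
    unfolding cf_def by (intro sum_mono mult_left_mono assms lk_nonneg)
  also have "\<dots> = S" using sum_lk[OF assms(2,3)] by (simp add: sum_distrib_right[symmetric])
  finally show ?thesis .
qed

text \<open>Averaged over the \<open>M\<close> admissible choices, the bit paid for a guess plus the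
  potential afterwards exceeds the present potential by at most \<open>2 * l * (1 - S) / M\<close>,
  where \<open>l\<close> counts the liquid variables: a guess at one of them costs a whole bit where
  only \<open>S\<close> was set aside. In return \<open>M\<close> exceeds the number of unset
  variables by \<open>l\<close>, so that admissible choices are more likely; this is worth at least
  \<open>l / (M * ln 2)\<close> bits. The assumption \<open>S1\<close> balances the two.\<close>

lemma pp_ge:
  assumes S0: "0 \<le> S" and S1: "2 * (1 - S) \<le> 1 / ln 2"
    and Sb: "\<And>\<alpha> \<sigma> x. \<sigma> \<in> sols \<alpha> \<Longrightarrow> x \<in> frozen \<alpha> \<Longrightarrow> gw \<alpha> \<sigma> x \<le> S"
  shows "card (unset \<alpha>) = j \<Longrightarrow> sols \<alpha> \<noteq> {} \<Longrightarrow> 2 powr (- cc S j \<alpha>) \<le> pp j \<alpha>"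
proof (induction j arbitrary: \<alpha>)
  case 0
  then have "\<not> falsified \<alpha>" "unset \<alpha> = {}" using falsified_sols by auto
  then show ?case by (simp add: cc_def liquid_def frozen_def)
next
  case (Suc j)
  obtain \<sigma>0 where \<sigma>0: "\<sigma>0 \<in> sols \<alpha>" using Suc.prems by auto
  define e where "e x = (if x \<in> liquid \<alpha> then 1 else hg \<alpha> \<sigma>0 x {})" for x
  define B where "B x = {b. sols (\<alpha>(x \<mapsto> b)) \<noteq> {}}" for x
  define SL where "SL = {(x, b). x \<in> unset \<alpha> \<and> sols (\<alpha>(x \<mapsto> b)) \<noteq> {}}"
  have SL: "SL = Sigma (unset \<alpha>) B" by (auto simp: SL_def B_def)
  define f where "f = (\<lambda>(x, b). e x + cc S j (\<alpha>(x \<mapsto> b)))"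
  define l where "l = card (liquid \<alpha>)"
  define M where "M = real (Suc j) + real l"
  have M: "real (card SL) = M"
    using card_unset_liquid[OF Suc.prems(2)] Suc.prems(1) by (simp add: SL_def M_def l_def)
  have Mpos: "M > 0" by (simp add: M_def add_pos_nonneg)
  have Bl: "B x = UNIV" if "x \<in> liquid \<alpha>" for x using that by (auto simp: B_def liquid_def)
  have Bf: "B x = {\<sigma>0 x}" if "x \<in> frozen \<alpha>" for x
  proof -
    have "b \<in> B x \<longleftrightarrow> b = \<sigma>0 x" for b
      using sols_frozen[OF that \<sigma>0] sols_frozen_not[OF that \<sigma>0] \<sigma>0
      by (cases "b = \<sigma>0 x") (auto simp: B_def)
    then show ?thesis by auto
  qed
  have split: "unset \<alpha> = liquid \<alpha> \<union> frozen \<alpha>" "liquid \<alpha> \<inter> frozen \<alpha> = {}"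
    by (auto simp: frozen_def liquid_def)
  have finB [simp]: "finite (B x)" for x by simp
  have cardu: "card (unset (\<alpha>(x \<mapsto> b))) = j" if "x \<in> unset \<alpha>" for x b using that Suc.prems by simp
  \<comment> \<open>\<open>e\<close> pays for the factor \<open>1 / 2\<close> of the tentative
    value. If the wrong value of a frozen variable is refuted, both tentative values lead to
    \<open>\<sigma>0 x\<close> and nothing is paid; otherwise one bit is.\<close>
  have step: "(\<Sum>b\<in>B x. 2 powr (- f (x, b))) \<le> (\<Sum>b\<in>UNIV. pp j (\<alpha>(x \<mapsto> val \<alpha> x b))) / 2" if x: "x \<in> unset \<alpha>" for x
  proof -
    have IH: "2 powr (- f (x, b)) \<le> 2 powr (- e x) * pp j (\<alpha>(x \<mapsto> b))" if "b \<in> B x" for b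
    proof -
      have "2 powr (- cc S j (\<alpha>(x \<mapsto> b))) \<le> pp j (\<alpha>(x \<mapsto> b))"
        using Suc.IH[OF cardu[OF x]] that unfolding B_def by blast
      then have "2 powr (- e x) * 2 powr (- cc S j (\<alpha>(x \<mapsto> b))) \<le> 2 powr (- e x) * pp j (\<alpha>(x \<mapsto> b))"
        by (intro mult_left_mono) auto
      then show ?thesis by (simp add: f_def powr_add[symmetric])
    qed
    show ?thesis
    proof (cases "x \<in> liquid \<alpha>")
      case True
      have "(\<Sum>b\<in>B x. 2 powr (- f (x, b))) \<le> (\<Sum>b\<in>B x. 2 powr (- e x) * pp j (\<alpha>(x \<mapsto> b)))"
        by (rule sum_mono) (rule IH)
      also have "\<dots> = (\<Sum>b\<in>UNIV. pp j (\<alpha>(x \<mapsto> b))) / 2"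
        using True by (simp add: Bl e_def powr_minus sum_divide_distrib)
      also have "(\<Sum>b\<in>UNIV. pp j (\<alpha>(x \<mapsto> b))) = (\<Sum>b\<in>UNIV. pp j (\<alpha>(x \<mapsto> val \<alpha> x b)))"
        using val_liquid[OF True] by (simp only:)
      finally show ?thesis .
    next
      case False
      then have fr: "x \<in> frozen \<alpha>" using x by (simp add: frozen_def)
      let ?p = "pp j (\<alpha>(x \<mapsto> \<sigma>0 x))"
      have "(\<Sum>b\<in>B x. 2 powr (- f (x, b))) \<le> 2 powr (- e x) * ?p"
        using IH[of "\<sigma>0 x"] Bf[OF fr] by simp
      also have "\<dots> \<le> (pp j (\<alpha>(x \<mapsto> val \<alpha> x (\<sigma>0 x))) + pp j (\<alpha>(x \<mapsto> val \<alpha> x (\<not> \<sigma>0 x)))) / 2"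
      proof (cases "refut (\<alpha>(x \<mapsto> (\<not> \<sigma>0 x)))")
        case True
        have "e x = 0" using False True by (simp add: e_def hg_def rest_def map_add_def)
        moreover have "val \<alpha> x (\<not> \<sigma>0 x) = \<sigma>0 x" using True by (simp add: val_def)
        ultimately show ?thesis by (simp add: val_frozen[OF fr \<sigma>0])
      next
        case False
        have "e x \<ge> 1" using False \<open>x \<notin> liquid \<alpha>\<close> by (simp add: e_def hg_def rest_def map_add_def)
        then have "2 powr (- e x) \<le> 2 powr (- 1)" by (intro powr_mono) auto
        also have "2 powr (- 1 :: real) = 1 / 2" by (simp add: powr_minus)
        finally have "2 powr (- e x) * ?p \<le> 1 / 2 * ?p" by (intro mult_right_mono pp_nonneg)
        then show ?thesis using pp_nonneg[of j "\<alpha>(x \<mapsto> val \<alpha> x (\<not> \<sigma>0 x))"] by (simp add: val_frozen[OF fr \<sigma>0])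
      qed
      also have "pp j (\<alpha>(x \<mapsto> val \<alpha> x (\<sigma>0 x))) + pp j (\<alpha>(x \<mapsto> val \<alpha> x (\<not> \<sigma>0 x)))
          = (\<Sum>b\<in>UNIV. pp j (\<alpha>(x \<mapsto> val \<alpha> x b)))"
        by (cases "\<sigma>0 x") (simp_all add: UNIV_bool)
      finally show ?thesis .
    qed
  qed
  have "(\<Sum>p\<in>SL. 2 powr (- f p)) = (\<Sum>x\<in>unset \<alpha>. \<Sum>b\<in>B x. 2 powr (- f (x, b)))"
    unfolding SL by (subst sum.Sigma) auto
  also have "\<dots> \<le> (\<Sum>x\<in>unset \<alpha>. (\<Sum>b\<in>UNIV. pp j (\<alpha>(x \<mapsto> val \<alpha> x b))) / 2)"
    by (rule sum_mono) (rule step)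
  also have "\<dots> = real (Suc j) * pp (Suc j) \<alpha>"
    unfolding pp.simps Suc.prems(1) sum_divide_distrib[symmetric] by (simp del: of_nat_Suc)
  finally have pp1: "(\<Sum>p\<in>SL. 2 powr (- f p)) \<le> real (Suc j) * pp (Suc j) \<alpha>" .
  have "finite SL" unfolding SL by auto
  moreover have "SL \<noteq> {}" using M Mpos by auto
  ultimately have pp2: "M * 2 powr (- (\<Sum>p\<in>SL. f p) / M) \<le> (\<Sum>p\<in>SL. 2 powr (- f p))"
    using sum_powr_ge[of SL f] by (simp add: M)
  \<comment> \<open>Setting \<open>x\<close> may freeze the liquid variables in \<open>?D\<close>.
    Their charge then changes from \<open>S\<close> to a cost that is at most
    \<open>S\<close>.\<close>
  have c1: "cc S j (\<alpha>(x \<mapsto> b)) \<le> S * real (card (liquid \<alpha> - {x})) + (\<Sum>z\<in>frozen \<alpha> - {x}. cf j (\<alpha>(x \<mapsto> b)) z)"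
    if x: "x \<in> unset \<alpha>" and b: "b \<in> B x" for x b
  proof -
    let ?\<beta> = "\<alpha>(x \<mapsto> b)"
    let ?D = "liquid \<alpha> - {x} - liquid ?\<beta>"
    have sub: "liquid ?\<beta> \<subseteq> liquid \<alpha> - {x}" by (rule liquid_upd_subset[OF x])
    have fr: "frozen ?\<beta> = (frozen \<alpha> - {x}) \<union> ?D" using sub by (auto simp: frozen_def liquid_def)
    have "(\<Sum>z\<in>?D. cf j ?\<beta> z) \<le> (\<Sum>z\<in>?D. S)"
    proof (rule sum_mono)
      fix z assume "z \<in> ?D"
      then have "z \<in> frozen ?\<beta>" using fr by auto
      then show "cf j ?\<beta> z \<le> S"
        by (intro cf_le Sb) (use b x cardu in \<open>auto simp: B_def\<close>)
    qed
    also have "\<dots> = S * real (card ?D)" by simp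
    finally have 1: "(\<Sum>z\<in>?D. cf j ?\<beta> z) \<le> S * real (card ?D)" .
    have "(\<Sum>z\<in>frozen ?\<beta>. cf j ?\<beta> z) = (\<Sum>z\<in>frozen \<alpha> - {x}. cf j ?\<beta> z) + (\<Sum>z\<in>?D. cf j ?\<beta> z)"
      unfolding fr by (rule sum.union_disjoint) (auto simp: frozen_def)
    moreover have "card (liquid \<alpha> - {x}) = card (liquid ?\<beta>) + card ?D"
      using card_Un_disjoint[of "liquid ?\<beta>" ?D] sub by (simp add: Un_Diff_cancel Un_absorb1)
    ultimately show ?thesis using 1 by (simp add: cc_def algebra_simps)
  qed
  have "(\<Sum>p\<in>SL. f p) = (\<Sum>x\<in>unset \<alpha>. \<Sum>b\<in>B x. f (x, b))"
    unfolding SL by (subst sum.Sigma) auto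
  also have "\<dots> \<le> (\<Sum>x\<in>unset \<alpha>. \<Sum>b\<in>B x. (e x + S * real (card (liquid \<alpha> - {x}))) + (\<Sum>z\<in>frozen \<alpha> - {x}. cf j (\<alpha>(x \<mapsto> b)) z))"
    by (intro sum_mono) (use c1 in \<open>auto simp: f_def\<close>)
  also have "\<dots> = (\<Sum>x\<in>unset \<alpha>. \<Sum>b\<in>B x. e x + S * real (card (liquid \<alpha> - {x})))
      + (\<Sum>x\<in>unset \<alpha>. \<Sum>b\<in>B x. \<Sum>z\<in>frozen \<alpha> - {x}. cf j (\<alpha>(x \<mapsto> b)) z)"
    by (simp only: sum.distrib)
  finally have f1: "(\<Sum>p\<in>SL. f p) \<le> (\<Sum>x\<in>unset \<alpha>. \<Sum>b\<in>B x. e x + S * real (card (liquid \<alpha> - {x})))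
      + (\<Sum>x\<in>unset \<alpha>. \<Sum>b\<in>B x. \<Sum>z\<in>frozen \<alpha> - {x}. cf j (\<alpha>(x \<mapsto> b)) z)" .
  have "(\<Sum>x\<in>unset \<alpha>. \<Sum>b\<in>B x. e x + S * real (card (liquid \<alpha> - {x})))
      = (\<Sum>x\<in>liquid \<alpha>. 2 * (1 + S * (real l - 1))) + (\<Sum>x\<in>frozen \<alpha>. hg \<alpha> \<sigma>0 x {} + S * real l)"
  proof -
    have 1: "(\<Sum>b\<in>B x. e x + S * real (card (liquid \<alpha> - {x}))) = 2 * (1 + S * (real l - 1))" if "x \<in> liquid \<alpha>" for x
    proof -
      have "card (liquid \<alpha>) > 0" using that by (auto simp: card_gt_0_iff)
      then show ?thesis using that by (simp add: Bl e_def l_def of_nat_diff)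
    qed
    have 2: "(\<Sum>b\<in>B x. e x + S * real (card (liquid \<alpha> - {x}))) = hg \<alpha> \<sigma>0 x {} + S * real l" if "x \<in> frozen \<alpha>" for x
      using that split(2) Bf[OF that] by (auto simp: e_def l_def)
    show ?thesis using 1 2 by (subst split(1), subst sum.union_disjoint) (use split in auto)
  qed
  also have "\<dots> = 2 * real l * (1 - S) + S * real l * M + (\<Sum>x\<in>frozen \<alpha>. hg \<alpha> \<sigma>0 x {})"
  proof -
    have "card (unset \<alpha>) = l + card (frozen \<alpha>)"
      unfolding l_def by (subst split(1), rule card_Un_disjoint) (use split in auto)
    then have "real (Suc j) = real l + real (card (frozen \<alpha>))" using Suc.prems(1) by linarith
    then show ?thesis unfolding M_def by (simp add: sum.distrib l_def[symmetric] algebra_simps)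
  qed
  finally have f2: "(\<Sum>x\<in>unset \<alpha>. \<Sum>b\<in>B x. e x + S * real (card (liquid \<alpha> - {x})))
    = 2 * real l * (1 - S) + S * real l * M + (\<Sum>x\<in>frozen \<alpha>. hg \<alpha> \<sigma>0 x {})" .
  have "(\<Sum>x\<in>unset \<alpha>. \<Sum>b\<in>B x. \<Sum>z\<in>frozen \<alpha> - {x}. cf j (\<alpha>(x \<mapsto> b)) z)
      = (\<Sum>x\<in>unset \<alpha>. \<Sum>z\<in>frozen \<alpha> - {x}. \<Sum>b\<in>B x. cf j (\<alpha>(x \<mapsto> b)) z)"
    by (intro sum.cong sum.swap refl)
  also have "\<dots> = (\<Sum>x\<in>unset \<alpha>. \<Sum>z\<in>{z\<in>frozen \<alpha>. x \<noteq> z}. \<Sum>b\<in>B x. cf j (\<alpha>(x \<mapsto> b)) z)"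
    by (intro sum.cong refl) auto
  also have "\<dots> = (\<Sum>z\<in>frozen \<alpha>. \<Sum>x\<in>{x\<in>unset \<alpha>. x \<noteq> z}. \<Sum>b\<in>B x. cf j (\<alpha>(x \<mapsto> b)) z)"
    by (rule sum.swap_restrict) auto
  \<comment> \<open>For an inadmissible value the cost \<open>cf\<close> is an empty sum, so both
    values may be included.\<close>
  also have "\<dots> = (\<Sum>z\<in>frozen \<alpha>. \<Sum>x\<in>unset \<alpha> - {z}. \<Sum>b\<in>UNIV. cf j (\<alpha>(x \<mapsto> b)) z)"
  proof (rule sum.cong[OF refl], rule sum.cong)
    fix z x show "(\<Sum>b\<in>B x. cf j (\<alpha>(x \<mapsto> b)) z) = (\<Sum>b\<in>UNIV. cf j (\<alpha>(x \<mapsto> b)) z)"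
      by (rule sum.mono_neutral_left) (auto simp: B_def cf_def)
  qed auto
  finally have f3: "(\<Sum>x\<in>unset \<alpha>. \<Sum>b\<in>B x. \<Sum>z\<in>frozen \<alpha> - {x}. cf j (\<alpha>(x \<mapsto> b)) z)
    = (\<Sum>z\<in>frozen \<alpha>. \<Sum>x\<in>unset \<alpha> - {z}. \<Sum>b\<in>UNIV. cf j (\<alpha>(x \<mapsto> b)) z)" .
  have "(\<Sum>z\<in>frozen \<alpha>. hg \<alpha> \<sigma>0 z {} + (\<Sum>x\<in>unset \<alpha> - {z}. \<Sum>b\<in>UNIV. cf j (\<alpha>(x \<mapsto> b)) z))
      \<le> (\<Sum>z\<in>frozen \<alpha>. M * cf (Suc j) \<alpha> z)"
    unfolding M_def l_def by (rule sum_mono) (rule cf_key[OF Suc.prems(1) _ \<sigma>0])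
  then have f4: "(\<Sum>z\<in>frozen \<alpha>. hg \<alpha> \<sigma>0 z {}) + (\<Sum>z\<in>frozen \<alpha>. \<Sum>x\<in>unset \<alpha> - {z}. \<Sum>b\<in>UNIV. cf j (\<alpha>(x \<mapsto> b)) z)
      \<le> M * (\<Sum>z\<in>frozen \<alpha>. cf (Suc j) \<alpha> z)"
    by (simp only: sum.distrib sum_distrib_left)
  have "(\<Sum>p\<in>SL. f p) \<le> 2 * real l * (1 - S) + M * cc S (Suc j) \<alpha>"
  proof -
    have "M * cc S (Suc j) \<alpha> = S * real l * M + M * (\<Sum>z\<in>frozen \<alpha>. cf (Suc j) \<alpha> z)"
      by (simp add: cc_def l_def algebra_simps)
    then show ?thesis using f1 f2 f3 f4 by linarith
  qed
  also have "2 * real l * (1 - S) \<le> real l / ln 2"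
    using mult_left_mono[OF S1, of "real l"] by (simp add: algebra_simps)
  finally have "(\<Sum>p\<in>SL. f p) / M \<le> (real l / ln 2 + M * cc S (Suc j) \<alpha>) / M"
    using Mpos by (simp add: divide_right_mono)
  also have "\<dots> = real l / M / ln 2 + cc S (Suc j) \<alpha>" using Mpos by (simp add: add_divide_distrib)
  finally have fM: "(\<Sum>p\<in>SL. f p) / M \<le> real l / M / ln 2 + cc S (Suc j) \<alpha>" .
  \<comment> \<open>The ratio of unset variables to choices is \<open>1 - l / M\<close>. Bounding it
    by \<open>exp (- (l / M))\<close> yields exactly the surplus of \<open>l / (M * ln 2)\<close>
    bits that \<open>fM\<close> allows.\<close>
  have "1 - real l / M \<le> exp (- (real l / M))" using exp_ge_add_one_self[of "- (real l / M)"] by simp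
  also have "1 - real l / M = real (Suc j) / M" using Mpos by (simp add: M_def field_simps)
  finally have ex: "real (Suc j) / M * exp (real l / M) \<le> 1"
    by (simp add: exp_minus field_simps)
  have "real (Suc j) * 2 powr (- cc S (Suc j) \<alpha>)
      = M * ((real (Suc j) / M * exp (real l / M)) * (exp (- (real l / M)) * 2 powr (- cc S (Suc j) \<alpha>)))"
    using Mpos by (simp add: exp_minus)
  also have "\<dots> \<le> M * (1 * (exp (- (real l / M)) * 2 powr (- cc S (Suc j) \<alpha>)))"
    using ex Mpos by (intro mult_left_mono mult_right_mono) auto
  also have "exp (- (real l / M)) = 2 powr (- (real l / M / ln 2))" by (simp add: powr_def)
  also have "M * (1 * (2 powr (- (real l / M / ln 2)) * 2 powr (- cc S (Suc j) \<alpha>)))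
      = M * 2 powr (- (real l / M / ln 2 + cc S (Suc j) \<alpha>))" by (simp add: powr_add[symmetric])
  also have "\<dots> \<le> M * 2 powr (- (\<Sum>p\<in>SL. f p) / M)"
    using fM Mpos by (intro mult_left_mono powr_mono) auto
  also have "\<dots> \<le> real (Suc j) * pp (Suc j) \<alpha>" using pp1 pp2 by linarith
  finally show ?case by (simp del: pp.simps)
qed

lemma pp_ge':
  assumes S0: "0 \<le> S" and S1: "2 * (1 - S) \<le> 1 / ln 2"
    and Sb: "\<And>\<alpha> \<sigma> x. \<sigma> \<in> sols \<alpha> \<Longrightarrow> x \<in> frozen \<alpha> \<Longrightarrow> gw \<alpha> \<sigma> x \<le> S"
    and j: "card (unset \<alpha>) = j" and ne: "sols \<alpha> \<noteq> {}"
  shows "2 powr (- (S * real j)) \<le> pp j \<alpha>"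
proof -
  have "cc S j \<alpha> \<le> S * real (card (liquid \<alpha>)) + (\<Sum>z\<in>frozen \<alpha>. S)"
    unfolding cc_def by (intro add_left_mono sum_mono cf_le Sb j ne)
  also have "\<dots> = S * (real (card (liquid \<alpha>)) + real (card (frozen \<alpha>)))" by (simp add: algebra_simps)
  also have "real (card (liquid \<alpha>)) + real (card (frozen \<alpha>)) = real j"
    using card_Un_disjoint[of "liquid \<alpha>" "frozen \<alpha>"] j
    by (simp add: frozen_def liquid_def Un_Diff_cancel Un_absorb1 subset_eq)
  finally have "2 powr (- (S * real j)) \<le> 2 powr (- cc S j \<alpha>)" by simp
  also have "\<dots> \<le> pp j \<alpha>" by (rule pp_ge[OF S0 S1 Sb j ne])
  finally show ?thesis .
qed

section \<open>Critical clause trees\<close>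

definition flip :: "(nat \<Rightarrow> bool) \<Rightarrow> nat set \<Rightarrow> nat \<Rightarrow> bool" where
  "flip \<sigma> U v \<longleftrightarrow> \<sigma> v \<noteq> (v \<in> U)"

text \<open>Unfolds a critical clause tree: \<open>U\<close> is the set of labels on the path to the current node, where
  the clauses \<open>C\<close> are those violated by \<open>\<sigma>\<close> flipped on \<open>U\<close>.\<close>

primrec Rf :: "(nat \<Rightarrow> bool) \<Rightarrow> nat \<Rightarrow> nat set \<Rightarrow> nat set \<Rightarrow> bool" where
  "Rf \<sigma> 0 U A \<longleftrightarrow> False"
| "Rf \<sigma> (Suc d) U A \<longleftrightarrow> (\<exists>C\<in>F. (\<forall>(v, b)\<in>C. flip \<sigma> U v \<noteq> b) \<and>
     (\<forall>v\<in>fst ` C. v \<in> A \<or> v \<in> U \<or> Rf \<sigma> d (insert v U) A))"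

lemma Rf_mono: "A \<subseteq> B \<Longrightarrow> Rf \<sigma> d U A \<Longrightarrow> Rf \<sigma> d U B"
proof (induction d arbitrary: U)
  case (Suc d)
  then show ?case unfolding Rf.simps by (meson subsetD)
qed simp

text \<open>Labels on the path are never looked up in \<open>A\<close> again. Hence the event that a
  child's label is early is independent of whether the subtree below it is cut.\<close>

lemma Rf_cong: "A - U = B - U \<Longrightarrow> Rf \<sigma> d U A = Rf \<sigma> d U B"
proof (induction d arbitrary: U)
  case (Suc d)
  have "Rf \<sigma> d (insert v U) A = Rf \<sigma> d (insert v U) B" for v by (rule Suc.IH) (use Suc.prems in auto)
  moreover have "v \<in> A \<or> v \<in> U \<longleftrightarrow> v \<in> B \<or> v \<in> U" for v using Suc.prems by auto
  ultimately have "(v \<in> A \<or> v \<in> U \<or> Rf \<sigma> d (insert v U) A) = (v \<in> B \<or> v \<in> U \<or> Rf \<sigma> d (insert v U) B)" for v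
    by metis
  then show ?case unfolding Rf.simps by simp
qed simp

text \<open>By \<open>N\<close>, flipping \<open>\<sigma>\<close> on the path labels
  \<open>U\<close>, which contain \<open>x\<close> and avoid \<open>K\<close>, violates some clause
  \<open>C\<close>. As \<open>\<sigma>\<close> satisfies \<open>C\<close>, one of its literals has
  its variable in \<open>U\<close>, so at most \<open>k - 1\<close> new labels occur; fewer children
  only raise the probability. This is the recursion of \<open>cut\<close>.\<close>

lemma bern_Rf_ge:
  assumes r: "0 \<le> r" "r \<le> 1" and W: "finite W" and sat: "satisfies \<sigma> F"
    and N: "\<And>\<tau>. \<tau> \<in> {..<n} \<rightarrow>\<^sub>E UNIV \<Longrightarrow> (\<And>v. v \<in> K \<Longrightarrow> v < n \<Longrightarrow> \<tau> v = \<sigma> v) \<Longrightarrow> \<tau> x \<noteq> \<sigma> x \<Longrightarrow> \<not> satisfies \<tau> F"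
    and x: "x < n" and U: "x \<in> U" "U \<inter> K = {}" "{..<n} \<subseteq> K \<union> U \<union> W"
  shows "cut (k - 1) d r \<le> bern r W (\<lambda>A. of_bool (Rf \<sigma> d U (K \<union> A)))"
  using U
proof (induction d arbitrary: U)
  case 0 then show ?case using bern_const[OF W, of r 0] by simp
next
  case (Suc d)
  define \<tau> where "\<tau> = restrict (flip \<sigma> U) {..<n}"
  have "\<not> satisfies \<tau> F"
    by (rule N) (use Suc.prems x in \<open>auto simp: \<tau>_def flip_def\<close>)
  then obtain C where C: "C \<in> F" "\<forall>(v, b)\<in>C. \<tau> v \<noteq> b" by (auto simp: satisfies_def)
  have Cn: "finite C" "card C \<le> k" "\<And>v b. (v, b) \<in> C \<Longrightarrow> v < n" using kcnf C by (auto simp: kcnf_def)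
  have Cf: "\<forall>(v, b)\<in>C. flip \<sigma> U v \<noteq> b" using C(2) Cn(3) by (fastforce simp: \<tau>_def)
  define vs where "vs = fst ` C - K - U"
  have vsW: "vs \<subseteq> W"
  proof
    fix v assume v: "v \<in> vs"
    then have "v \<in> {..<n}" using Cn(3) by (auto simp: vs_def)
    then show "v \<in> W" using v Suc.prems(3) by (auto simp: vs_def)
  qed
  have finvs: "finite vs" using Cn by (simp add: vs_def)
  have "card vs \<le> k - 1"
  proof -
    have "\<exists>(v, b)\<in>C. \<sigma> v = b" using sat C(1) by (simp add: satisfies_def)
    then obtain v0 b0 where v0: "(v0, b0) \<in> C" "\<sigma> v0 = b0" by auto
    then have "flip \<sigma> U v0 \<noteq> b0" using Cf by auto
    then have "v0 \<in> U" using v0 by (auto simp: flip_def)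
    then have "vs \<subseteq> fst ` C - {v0}" by (auto simp: vs_def)
    then have "card vs \<le> card (fst ` C - {v0})" using Cn by (intro card_mono) auto
    also have "\<dots> = card (fst ` C) - 1" using v0 Cn by (subst card_Diff_singleton) force+
    also have "\<dots> \<le> k - 1" using card_image_le[OF Cn(1), of fst] Cn(2) by linarith
    finally show ?thesis .
  qed
  define g where "g v A = (of_bool (v \<in> A \<or> Rf \<sigma> d (insert v U) (K \<union> A)) :: real)" for v A
  define q where "q = r + (1 - r) * cut (k - 1) d r"
  have q: "0 \<le> q" "q \<le> 1"
  proof -
    have c: "0 \<le> cut (k - 1) d r" "cut (k - 1) d r \<le> 1" using cut_bounds[OF r] by auto
    have "r + (1 - r) * cut (k - 1) d r \<le> r + (1 - r) * 1" using c r by (intro add_left_mono mult_left_mono) auto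
    then show "0 \<le> q" "q \<le> 1" using c r by (auto simp: q_def)
  qed
  have gv: "q \<le> bern r W (g v)" if v: "v \<in> vs" for v
  proof -
    define W' where "W' = W - {v}"
    have W': "W = insert v W'" "v \<notin> W'" "finite W'" using v vsW W by (auto simp: W'_def)
    let ?h = "\<lambda>A. of_bool (Rf \<sigma> d (insert v U) (K \<union> A)) :: real"
    have ind: "Rf \<sigma> d (insert v U) (K \<union> insert v A) = Rf \<sigma> d (insert v U) (K \<union> A)" for A
      by (rule Rf_cong) auto
    have "bern r W ?h = bern r W' ?h"
      unfolding W'(1) bern_insert[OF W'(3,2)] ind by (simp add: algebra_simps)
    moreover have "bern r W (g v) = r * bern r W' (\<lambda>A. 1) + (1 - r) * bern r W' (g v)"
      unfolding W'(1) bern_insert[OF W'(3,2)] by (simp add: g_def)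
    moreover have "bern r W' (g v) = bern r W' ?h"
      by (rule bern_cong) (use W' in \<open>auto simp: g_def\<close>)
    moreover have "cut (k - 1) d r \<le> bern r W ?h"
      by (rule Suc.IH) (use v Suc.prems in \<open>auto simp: vs_def\<close>)
    ultimately show ?thesis using r bern_const[OF W'(3), of r 1] by (simp add: q_def mult_left_mono)
  qed
  have "cut (k - 1) (Suc d) r = q ^ (k - 1)" by (simp add: q_def)
  also have "\<dots> \<le> q ^ card vs" using q \<open>card vs \<le> k - 1\<close> by (intro power_decreasing) auto
  also have "\<dots> = (\<Prod>v\<in>vs. q)" by simp
  also have "\<dots> \<le> (\<Prod>v\<in>vs. bern r W (g v))" using gv q by (intro prod_mono) auto
  \<comment> \<open>Different subtrees may share labels. All these events increase with
    \<open>A\<close>, so Harris' inequality replaces independence.\<close>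
  also have "\<dots> \<le> bern r W (\<lambda>A. \<Prod>v\<in>vs. g v A)"
  proof (rule harris_prod[OF W r finvs])
    fix v and A B :: "nat set" assume "A \<subseteq> B"
    then show "g v A \<le> g v B"
      using Rf_mono[of "K \<union> A" "K \<union> B" \<sigma> d "insert v U"] by (auto simp: g_def)
  qed (simp add: g_def)
  also have "\<dots> \<le> bern r W (\<lambda>A. of_bool (Rf \<sigma> (Suc d) U (K \<union> A)))"
  proof (rule bern_mono[OF r])
    fix A
    show "(\<Prod>v\<in>vs. g v A) \<le> of_bool (Rf \<sigma> (Suc d) U (K \<union> A))"
    proof (cases "\<forall>v\<in>vs. v \<in> A \<or> Rf \<sigma> d (insert v U) (K \<union> A)")
      case True
      have "v \<in> K \<union> A \<or> v \<in> U \<or> Rf \<sigma> d (insert v U) (K \<union> A)" if "v \<in> fst ` C" for v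
        using True that unfolding vs_def by blast
      then have "Rf \<sigma> (Suc d) U (K \<union> A)" unfolding Rf.simps using C(1) Cf by blast
      then show ?thesis by (auto simp: g_def intro!: prod_le_1 simp del: Rf.simps)
    next
      case False
      then obtain v where "v \<in> vs" "g v A = 0" by (auto simp: g_def)
      then have "(\<Prod>v\<in>vs. g v A) = 0" using finvs by (meson prod_zero)
      then show ?thesis by simp
    qed
  qed
  finally show ?case .
qed

text \<open>\<open>W\<close> collects the labels of the cut tree outside \<open>A\<close> and
  \<open>U\<close>. For any \<open>\<tau>\<close>, descend from the root to children where
  \<open>\<tau>\<close> differs from \<open>\<sigma>\<close> as long as there is one; the clause at
  the last node is violated by \<open>\<tau>\<close>. The bound on \<open>card W\<close> is strict
  to leave room for the label \<open>v\<close> added to each subtree.\<close>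

lemma Rf_witness:
  assumes "Rf \<sigma> d U A"
  shows "\<exists>W. finite W \<and> W \<subseteq> {..<n} \<and> card W < (k + 1) ^ d \<and>
    (\<forall>\<tau>. (\<forall>v\<in>A - U. \<tau> v = \<sigma> v) \<longrightarrow> (\<forall>v\<in>U. \<tau> v \<noteq> \<sigma> v) \<longrightarrow>
      (\<exists>C\<in>F. \<forall>(v, b)\<in>C. \<tau> v \<noteq> b \<and> v \<in> A \<union> U \<union> W))"
  using assms
proof (induction d arbitrary: U)
  case 0 then show ?case by simp
next
  case (Suc d)
  then obtain C where C: "C \<in> F" "\<forall>(v, b)\<in>C. flip \<sigma> U v \<noteq> b"
    "\<forall>v\<in>fst ` C. v \<in> A \<or> v \<in> U \<or> Rf \<sigma> d (insert v U) A" unfolding Rf.simps by blast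
  have Cn: "finite C" "card C \<le> k" "\<And>v b. (v, b) \<in> C \<Longrightarrow> v < n" using kcnf C by (auto simp: kcnf_def)
  define vs where "vs = fst ` C - A - U"
  have vs: "finite vs" "vs \<subseteq> {..<n}" using Cn by (auto simp: vs_def)
  have cvs: "card vs \<le> k"
  proof -
    have "card vs \<le> card (fst ` C)" using Cn(1) by (intro card_mono) (auto simp: vs_def)
    then show ?thesis using card_image_le[OF Cn(1), of fst] Cn(2) by linarith
  qed
  define P where "P v W \<longleftrightarrow> finite W \<and> W \<subseteq> {..<n} \<and> card W < (k + 1) ^ d \<and>
    (\<forall>\<tau>. (\<forall>u\<in>A - insert v U. \<tau> u = \<sigma> u) \<longrightarrow> (\<forall>u\<in>insert v U. \<tau> u \<noteq> \<sigma> u) \<longrightarrow>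
      (\<exists>C\<in>F. \<forall>(u, b)\<in>C. \<tau> u \<noteq> b \<and> u \<in> A \<union> insert v U \<union> W))" for v W
  have "\<forall>v\<in>vs. \<exists>W. P v W"
  proof
    fix v assume "v \<in> vs"
    then have "Rf \<sigma> d (insert v U) A" using C(3) by (auto simp: vs_def)
    from Suc.IH[OF this] show "\<exists>W. P v W" unfolding P_def .
  qed
  from bchoice[OF this] obtain Wf where "\<forall>v\<in>vs. P v (Wf v)" ..
  then have Wf: "finite (Wf v)" "Wf v \<subseteq> {..<n}" "card (Wf v) < (k + 1) ^ d"
    "\<And>\<tau>. (\<forall>u\<in>A - insert v U. \<tau> u = \<sigma> u) \<Longrightarrow> (\<forall>u\<in>insert v U. \<tau> u \<noteq> \<sigma> u) \<Longrightarrow>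
      (\<exists>C\<in>F. \<forall>(u, b)\<in>C. \<tau> u \<noteq> b \<and> u \<in> A \<union> insert v U \<union> Wf v)" if "v \<in> vs" for v
    using that unfolding P_def by blast+
  define W where "W = (\<Union>v\<in>vs. insert v (Wf v))"
  have "card W \<le> (\<Sum>v\<in>vs. card (insert v (Wf v)))" unfolding W_def by (rule card_UN_le[OF vs(1)])
  also have "\<dots> \<le> (\<Sum>v\<in>vs. (k + 1) ^ d)"
  proof (rule sum_mono)
    fix v assume "v \<in> vs"
    then show "card (insert v (Wf v)) \<le> (k + 1) ^ d"
      using Wf(1)[of v] Wf(3)[of v] by (auto simp: card_insert_if)
  qed
  also have "\<dots> = card vs * (k + 1) ^ d" by simp
  also have "\<dots> \<le> k * (k + 1) ^ d" using cvs by (intro mult_right_mono) auto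
  also have "\<dots> < (k + 1) ^ Suc d" by simp
  finally have "card W < (k + 1) ^ Suc d" .
  moreover have "finite W" "W \<subseteq> {..<n}" using vs Wf(1,2) by (auto simp: W_def)
  moreover have "\<exists>C\<in>F. \<forall>(v, b)\<in>C. \<tau> v \<noteq> b \<and> v \<in> A \<union> U \<union> W"
    if \<tau>: "\<forall>v\<in>A - U. \<tau> v = \<sigma> v" "\<forall>v\<in>U. \<tau> v \<noteq> \<sigma> v" for \<tau>
  proof (cases "\<forall>v\<in>vs. \<tau> v = \<sigma> v")
    case True
    have "\<tau> v \<noteq> b \<and> v \<in> A \<union> U \<union> W" if vb: "(v, b) \<in> C" for v b
    proof -
      have "v \<in> A \<or> v \<in> U \<or> v \<in> vs" using vb by (force simp: vs_def)
      moreover have "vs \<subseteq> W" by (auto simp: W_def)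
      moreover have "flip \<sigma> U v \<noteq> b" using C(2) vb by auto
      ultimately show ?thesis using \<tau> True by (auto simp: flip_def)
    qed
    then show ?thesis using C(1) by blast
  next
    case False
    then obtain v where v: "v \<in> vs" "\<tau> v \<noteq> \<sigma> v" by auto
    have "\<exists>C\<in>F. \<forall>(u, b)\<in>C. \<tau> u \<noteq> b \<and> u \<in> A \<union> insert v U \<union> Wf v"
      by (rule Wf(4)[OF v(1)]) (use \<tau> v in auto)
    then obtain C' where C': "C' \<in> F" "\<forall>(u, b)\<in>C'. \<tau> u \<noteq> b \<and> u \<in> A \<union> insert v U \<union> Wf v" ..
    have "v \<in> W" "Wf v \<subseteq> W" using v by (auto simp: W_def)
    then have "\<forall>(u, b)\<in>C'. \<tau> u \<noteq> b \<and> u \<in> A \<union> U \<union> W" using C'(2) by auto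
    then show ?thesis using C'(1) ..
  qed
  ultimately show ?case by blast
qed

text \<open>If the tree of depth \<open>d\<close> is cut, its fewer than \<open>(k + 1) ^ d\<close>
  remaining labels, padded by copies of \<open>x\<close>, are the \<open>w\<close> variables of a
  refutation of the wrong value. So \<open>x\<close> has to be guessed only if the tree is not
  cut.\<close>

lemma gw_le:
  assumes k: "k \<ge> 2" and w: "(k + 1) ^ d \<le> w" and J: "J > 0" "J ^ (2 * (k - 1)) \<le> d"
    and \<sigma>: "\<sigma> \<in> sols \<alpha>" and x: "x \<in> frozen \<alpha>"
  shows "gw \<alpha> \<sigma> x \<le> 1 - gam (k - 1) t + 2 / real J"
  unfolding gw_def
proof (rule avg_le_of_cut[OF _ _ J])
  fix r :: real assume r: "0 \<le> r" "r \<le> 1"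
  have xu: "x < n" "\<alpha> x = None" "x \<in> unset \<alpha>" using x by (auto simp: frozen_def unset_def)
  define W where "W = unset \<alpha> - {x}"
  have "cut (k - 1) d r \<le> bern r W (\<lambda>A. of_bool (Rf \<sigma> d {x} (dom \<alpha> \<union> A)))"
  proof (rule bern_Rf_ge[OF r, where x = x])
    fix \<tau> assume \<tau>: "\<tau> \<in> {..<n} \<rightarrow>\<^sub>E (UNIV :: bool set)" "\<And>v. v \<in> dom \<alpha> \<Longrightarrow> v < n \<Longrightarrow> \<tau> v = \<sigma> v" "\<tau> x \<noteq> \<sigma> x"
    show "\<not> satisfies \<tau> F"
    proof
      assume sat: "satisfies \<tau> F"
      have "\<tau> v = b" if "\<alpha> v = Some b" for v b
      proof (cases "v < n")
        case True
        then have "\<tau> v = \<sigma> v" using \<tau>(2) that by auto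
        then show ?thesis using \<sigma> that by (simp add: sols_def)
      next
        case False
        then have "\<tau> v = undefined" "\<sigma> v = undefined" using \<tau>(1) \<sigma> by (auto simp: sols_def PiE_def extensional_def)
        then show ?thesis using \<sigma> that by (simp add: sols_def)
      qed
      then have "\<tau> \<in> sols \<alpha>" using \<tau>(1) sat by (simp add: sols_def)
      then show False using frozen_eq[OF x \<sigma>] \<tau>(3) by metis
    qed
  next
    show "satisfies \<sigma> F" using \<sigma> by (simp add: sols_def)
  qed (use xu in \<open>auto simp: W_def unset_def\<close>)
  also have "\<dots> \<le> bern r W (\<lambda>A. 1 - hg \<alpha> \<sigma> x A)"
  proof (rule bern_mono[OF r])
    fix A assume A: "A \<subseteq> W"
    define \<beta> where "\<beta> = (\<alpha> ++ rest \<sigma> A)(x \<mapsto> \<not> \<sigma> x)"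
    have dom\<beta>: "dom \<beta> = dom \<alpha> \<union> A \<union> {x}" by (auto simp: \<beta>_def rest_def split: if_splits)
    have "refut \<beta>" if R: "Rf \<sigma> d {x} (dom \<alpha> \<union> A)"
    proof -
      obtain X where X: "finite X" "X \<subseteq> {..<n}" "card X < (k + 1) ^ d"
        "\<And>\<tau>. (\<And>v. v \<in> dom \<alpha> \<union> A - {x} \<Longrightarrow> \<tau> v = \<sigma> v) \<Longrightarrow> \<tau> x \<noteq> \<sigma> x \<Longrightarrow>
          (\<exists>C\<in>F. \<forall>(v, b)\<in>C. \<tau> v \<noteq> b \<and> v \<in> dom \<alpha> \<union> A \<union> {x} \<union> X)"
      proof -
        obtain X where X: "finite X" "X \<subseteq> {..<n}" "card X < (k + 1) ^ d"
          and X4: "\<forall>\<tau>. (\<forall>v\<in>dom \<alpha> \<union> A - {x}. \<tau> v = \<sigma> v) \<longrightarrow> (\<forall>v\<in>{x}. \<tau> v \<noteq> \<sigma> v) \<longrightarrow>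
            (\<exists>C\<in>F. \<forall>(v, b)\<in>C. \<tau> v \<noteq> b \<and> v \<in> dom \<alpha> \<union> A \<union> {x} \<union> X)"
          using Rf_witness[OF R] by (elim exE conjE)
        show ?thesis
        proof (rule that[OF X])
          fix \<tau> :: "nat \<Rightarrow> bool"
          assume "\<And>v. v \<in> dom \<alpha> \<union> A - {x} \<Longrightarrow> \<tau> v = \<sigma> v" "\<tau> x \<noteq> \<sigma> x"
          then show "\<exists>C\<in>F. \<forall>(v, b)\<in>C. \<tau> v \<noteq> b \<and> v \<in> dom \<alpha> \<union> A \<union> {x} \<union> X"
            using X4[rule_format, of \<tau>] by simp
        qed
      qed
      define vs where "vs = sorted_list_of_set X @ replicate (w - card X) x"
      have vs: "length vs = w" "set vs \<subseteq> {..<n}" "X \<subseteq> set vs"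
        using X w xu by (auto simp: vs_def)
      have "falsified (rest \<tau> (set vs \<union> dom \<beta>))" if \<tau>: "\<forall>v b. \<beta> v = Some b \<longrightarrow> \<tau> v = b" for \<tau>
      proof -
        have "\<exists>C\<in>F. \<forall>(v, b)\<in>C. \<tau> v \<noteq> b \<and> v \<in> dom \<alpha> \<union> A \<union> {x} \<union> X"
        proof (rule X(4))
          fix v assume v: "v \<in> dom \<alpha> \<union> A - {x}"
          have "\<beta> v = Some (\<sigma> v)"
          proof (cases "v \<in> A")
            case True then show ?thesis using v by (simp add: \<beta>_def rest_def map_add_def)
          next
            case False
            then obtain b where "\<alpha> v = Some b" using v by auto
            then show ?thesis using v False \<sigma> by (simp add: \<beta>_def rest_def map_add_def sols_def)
          qed
          then show "\<tau> v = \<sigma> v" using \<tau> by auto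
        next
          have "\<beta> x = Some (\<not> \<sigma> x)" by (simp add: \<beta>_def)
          then show "\<tau> x \<noteq> \<sigma> x" using \<tau> by metis
        qed
        then obtain C where C: "C \<in> F" "\<forall>(v, b)\<in>C. \<tau> v \<noteq> b \<and> v \<in> dom \<alpha> \<union> A \<union> {x} \<union> X" by blast
        have "rest \<tau> (set vs \<union> dom \<beta>) v = Some (\<not> b)" if "(v, b) \<in> C" for v b
        proof -
          have "v \<in> set vs \<union> dom \<beta>" "\<tau> v = (\<not> b)" using C(2) that vs(3) dom\<beta> by auto
          then show ?thesis by (simp add: rest_def)
        qed
        then show ?thesis using C(1) by (auto simp: falsified_def)
      qed
      then show ?thesis unfolding refut_iff using vs by blast
    qed
    then show "of_bool (Rf \<sigma> d {x} (dom \<alpha> \<union> A)) \<le> 1 - hg \<alpha> \<sigma> x A"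
      by (auto simp: hg_def \<beta>_def)
  qed
  also have "\<dots> = 1 - bern r W (hg \<alpha> \<sigma> x)"
    using bern_diff[of r W "\<lambda>A. 1" "hg \<alpha> \<sigma> x"] bern_const[of W r 1] by (simp add: W_def)
  finally show "bern r (unset \<alpha> - {x}) (hg \<alpha> \<sigma> x) \<le> 1 - cut (k - 1) d r" by (simp add: W_def)
qed (use k in auto)

end

section \<open>Trials driven by random words, and the binary tree of nodes\<close>

text \<open>A word is read as a number in mixed radix: if \<open>r\<close> is uniform below
  \<open>A * B\<close>, the digit \<open>r mod A\<close> and the rest \<open>r div A\<close> are
  uniform and independent.\<close>

lemma sum_mod_div:
  fixes f :: "nat \<Rightarrow> nat \<Rightarrow> 'a :: comm_monoid_add"
  assumes "0 < A"
  shows "(\<Sum>r<A * B. f (r mod A) (r div A)) = (\<Sum>g<A. \<Sum>q<B. f g q)"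
proof -
  have "(\<Sum>r<A * B. f (r mod A) (r div A)) = (\<Sum>(g, q)\<in>{..<A} \<times> {..<B}. f g q)"
  proof (rule sum.reindex_bij_witness[where i = "\<lambda>(g, q). q * A + g" and j = "\<lambda>r. (r mod A, r div A)"])
    fix p assume "p \<in> {..<A} \<times> {..<B}"
    then obtain g q where p: "p = (g, q)" "g < A" "q < B" by auto
    have "q * A + g < (q + 1) * A" using p by simp
    also have "\<dots> \<le> B * A" using p by (intro mult_right_mono) auto
    finally show "(case p of (g, q) \<Rightarrow> q * A + g) \<in> {..<A * B}" using p by (simp add: mult.commute)
  qed (use assms in \<open>auto simp: less_mult_imp_div_less mult.commute\<close>)
  then show ?thesis by (simp add: sum.cartesian_product)
qed

text \<open>Only the \<open>G div m\<close> complete blocks of residues are counted; the incomplete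
  last block is given away.\<close>

lemma sum_mod_ge:
  fixes h :: "nat \<Rightarrow> real"
  assumes "0 < m" "\<And>i. 0 \<le> h i"
  shows "real (G div m) * (\<Sum>i<m. h i) \<le> (\<Sum>g<G. h (g mod m))"
proof -
  have "real (G div m) * (\<Sum>i<m. h i) = (\<Sum>i<m. \<Sum>q<G div m. h i)"
    by (simp add: sum_distrib_left)
  also have "\<dots> = (\<Sum>g<m * (G div m). h (g mod m))"
    using sum_mod_div[OF assms(1), of "\<lambda>i q. h i" "G div m"] by simp
  also have "\<dots> \<le> (\<Sum>g<G. h (g mod m))"
    using assms by (intro sum_mono2) (auto intro: less_le_trans)
  finally show ?thesis .
qed

context cnf begin

text \<open>The word \<open>r\<close> supplies all random choices, \<open>pv\<close> lists the unset variables. Reduction modulo \<open>G\<close>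
  and then modulo \<open>Suc j\<close> is uniform only up to a bias that \<open>G = 2\<^sup>n\<close> makes harmless.\<close>

primrec trial :: "nat \<Rightarrow> nat \<Rightarrow> (nat \<Rightarrow> nat) \<Rightarrow> (nat \<rightharpoonup> bool) \<Rightarrow> nat \<Rightarrow> bool" where
  "trial G 0 pv \<alpha> r \<longleftrightarrow> \<not> falsified \<alpha>"
| "trial G (Suc j) pv \<alpha> r \<longleftrightarrow>
     trial G j (pv(r mod G mod Suc j := pv j))
       (\<alpha>(pv (r mod G mod Suc j) \<mapsto> val \<alpha> (pv (r mod G mod Suc j)) (odd (r div G)))) (r div G div 2)"

text \<open>Deletion from an unordered list with a single write: the last entry moves to the place
  of the deleted one.\<close>

lemma bij_betw_swap_remove:
  assumes "bij_betw pv {..<Suc j} U" "i < Suc j"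
  shows "bij_betw (pv(i := pv j)) {..<j} (U - {pv i})"
proof -
  have inj: "inj_on pv {..<Suc j}" and im: "pv ` {..<Suc j} = U" using assms by (auto simp: bij_betw_def)
  have inj': "pv a = pv b \<longleftrightarrow> a = b" if "a < Suc j" "b < Suc j" for a b
    using inj_on_eq_iff[OF inj] that by auto
  have "inj_on (pv(i := pv j)) {..<j}"
    by (rule inj_onI) (use inj' in \<open>auto split: if_splits\<close>)
  moreover have "(pv(i := pv j)) ` {..<j} = U - {pv i}"
  proof (intro set_eqI iffI)
    fix u assume "u \<in> (pv(i := pv j)) ` {..<j}"
    then obtain a where a: "a < j" "u = (if a = i then pv j else pv a)" by auto
    then show "u \<in> U - {pv i}" using inj' assms(2) im by (auto split: if_splits)
  next
    fix u assume u: "u \<in> U - {pv i}"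
    then obtain a where a: "a < Suc j" "u = pv a" using im by auto
    then have "a \<noteq> i" using u by auto
    show "u \<in> (pv(i := pv j)) ` {..<j}"
    proof (cases "a = j")
      case True
      then have "i < j" using \<open>a \<noteq> i\<close> assms(2) by auto
      then show ?thesis using a True by (intro image_eqI[of _ _ i]) auto
    next
      case False
      then show ?thesis using a \<open>a \<noteq> i\<close> by (intro image_eqI[of _ _ a]) auto
    qed
  qed
  ultimately show ?thesis by (simp add: bij_betw_def)
qed

text \<open>Behind its first \<open>j\<close> entries the array of the program holds stale values,
  so it agrees with the ideal list of unset variables only on that prefix.\<close>

lemma trial_cong: "(\<And>t. t < j \<Longrightarrow> pv t = pv' t) \<Longrightarrow> trial G j pv \<alpha> r = trial G j pv' \<alpha> r"
proof (induction j arbitrary: pv pv' \<alpha> r)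
  case (Suc j)
  let ?i = "r mod G mod Suc j"
  have i: "?i < Suc j" by simp
  have 1: "pv ?i = pv' ?i" "pv j = pv' j" using Suc.prems[OF i] Suc.prems[of j] by auto
  have "trial G j (pv(?i := pv j)) \<beta> s = trial G j (pv'(?i := pv' j)) \<beta> s" for \<beta> s
    by (rule Suc.IH) (use Suc.prems 1 in auto)
  then show ?case by (simp only: trial.simps 1)
qed simp

text \<open>The final check of the formula makes the error one-sided: a node without solutions never
  passes a test.\<close>

lemma trial_sound:
  assumes "dom \<alpha> \<subseteq> {..<n}" "bij_betw pv {..<j} (unset \<alpha>)" "trial G j pv \<alpha> r"
  shows "sols \<alpha> \<noteq> {}"
  using assms
proof (induction j arbitrary: pv \<alpha> r)
  case 0
  then have u: "unset \<alpha> = {}" by (simp add: bij_betw_def)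
  define \<sigma> where "\<sigma> = restrict (\<lambda>v. the (\<alpha> v)) {..<n}"
  have \<alpha>: "\<alpha> v = Some (\<sigma> v)" if "v < n" for v using u that by (auto simp: \<sigma>_def unset_def)
  have "satisfies \<sigma> F"
    unfolding satisfies_def
  proof
    fix C assume C: "C \<in> F"
    then obtain v b where vb: "(v, b) \<in> C" "\<alpha> v \<noteq> Some (\<not> b)"
      using 0(3) by (auto simp: falsified_def)
    have "v < n" using kcnf C vb by (auto simp: kcnf_def)
    then have "\<sigma> v = b" using \<alpha>[of v] vb(2) by auto
    then show "\<exists>(v, b)\<in>C. \<sigma> v = b" using vb(1) by blast
  qed
  moreover have "\<sigma> v = b" if "\<alpha> v = Some b" for v b
    using \<alpha>[of v] that 0(1) by (auto simp: dom_def)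
  ultimately have "\<sigma> \<in> sols \<alpha>" by (auto simp: sols_def \<sigma>_def)
  then show ?case by auto
next
  case (Suc j)
  let ?i = "r mod G mod Suc j"
  let ?x = "pv ?i"
  let ?b = "val \<alpha> ?x (odd (r div G))"
  have x: "?x \<in> unset \<alpha>" using Suc.prems(2) by (auto simp: bij_betw_def)
  have "sols (\<alpha>(?x \<mapsto> ?b)) \<noteq> {}"
  proof (rule Suc.IH)
    show "dom (\<alpha>(?x \<mapsto> ?b)) \<subseteq> {..<n}" using Suc.prems(1) x by (auto simp: unset_def)
    show "bij_betw (pv(?i := pv j)) {..<j} (unset (\<alpha>(?x \<mapsto> ?b)))"
      unfolding unset_upd by (rule bij_betw_swap_remove[OF Suc.prems(2)]) simp
    show "trial G j (pv(?i := pv j)) (\<alpha>(?x \<mapsto> ?b)) (r div G div 2)"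
      using Suc.prems(3) by (simp only: trial.simps)
  qed
  then show ?case using sols_upd[OF x, of ?b] by auto
qed

text \<open>Counts successful words. Each reduction modulo \<open>Suc j\<close> costs a factor
  \<open>1 - n / G\<close>, because complete blocks cover at least \<open>G - n\<close> of the
  \<open>G\<close> residues. Admitting words longer than a trial consumes, \<open>j \<le> m\<close>,
  lets one word length serve nodes of all depths.\<close>

lemma trial_count:
  assumes G: "0 < G" "n \<le> G"
  shows "j \<le> n \<Longrightarrow> j \<le> m \<Longrightarrow> bij_betw pv {..<j} (unset \<alpha>) \<Longrightarrow>
    real ((2 * G) ^ m) * ((1 - real n / real G) ^ j * pp j \<alpha>)
      \<le> (\<Sum>r<(2 * G) ^ m. of_bool (trial G j pv \<alpha> r))"
proof (induction j arbitrary: m pv \<alpha>)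
  case 0
  then show ?case by simp
next
  case (Suc j)
  define L where "L = 1 - real n / real G"
  have L: "0 \<le> L" using G by (simp add: L_def field_simps)
  obtain m' where m: "m = Suc m'" "j \<le> m'" using Suc.prems by (cases m) auto
  define X where "X = (2 * G) ^ m'"
  define T where "T i b q = trial G j (pv(i := pv j)) (\<alpha>(pv i \<mapsto> val \<alpha> (pv i) b)) q" for i b q
  define h where "h i = (\<Sum>b\<in>UNIV. \<Sum>q<X. of_bool (T i b q) :: real)" for i
  have "(\<Sum>r<(2 * G) ^ m. of_bool (trial G (Suc j) pv \<alpha> r))
      = (\<Sum>r<G * (2 * X). of_bool (T (r mod G mod Suc j) (odd (r div G)) (r div G div 2)) :: real)"
  proof -
    have "(2 * G) ^ m = G * (2 * X)" by (simp add: m X_def)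
    then show ?thesis by (simp only: trial.simps T_def)
  qed
  also have "\<dots> = (\<Sum>g<G. \<Sum>q<2 * X. of_bool (T (g mod Suc j) (odd q) (q div 2)))"
    by (rule sum_mod_div[OF G(1), where f = "\<lambda>g q. of_bool (T (g mod Suc j) (odd q) (q div 2))"])
  also have "\<dots> = (\<Sum>g<G. h (g mod Suc j))"
  proof (rule sum.cong[OF refl])
    fix g
    have "(\<Sum>q<2 * X. of_bool (T (g mod Suc j) (odd q) (q div 2)) :: real)
       = (\<Sum>q<2 * X. of_bool (T (g mod Suc j) (q mod 2 = 1) (q div 2)))"
      by (simp only: odd_iff_mod_2_eq_one)
    also have "\<dots> = (\<Sum>b<(2::nat). \<Sum>q<X. of_bool (T (g mod Suc j) (b = 1) q))"
      by (rule sum_mod_div[where f = "\<lambda>b q. of_bool (T (g mod Suc j) (b = 1) q)"]) simp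
    also have "\<dots> = h (g mod Suc j)"
      by (simp add: h_def UNIV_bool numeral_2_eq_2)
    finally show "(\<Sum>q<2 * X. of_bool (T (g mod Suc j) (odd q) (q div 2)) :: real) = h (g mod Suc j)" .
  qed
  also have "\<dots> \<ge> real (G div Suc j) * (\<Sum>i<Suc j. h i)"
    by (rule sum_mod_ge) (auto simp: h_def intro!: sum_nonneg)
  finally have 1: "real (G div Suc j) * (\<Sum>i<Suc j. h i) \<le> (\<Sum>r<(2 * G) ^ m. of_bool (trial G (Suc j) pv \<alpha> r))" .
  have "G < Suc j * (G div Suc j) + Suc j"
  proof -
    have "G = Suc j * (G div Suc j) + G mod Suc j" by (simp only: mult_div_mod_eq)
    moreover have "G mod Suc j < Suc j" by (rule mod_less_divisor) simp
    ultimately show ?thesis by linarith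
  qed
  then have "real G < real (Suc j * (G div Suc j) + Suc j)" by (simp only: of_nat_less_iff)
  then have "real G - real (Suc j) < real (Suc j) * real (G div Suc j)" by (simp only: of_nat_add of_nat_mult)
  moreover have "real (Suc j) \<le> real n" using Suc.prems(1) by (simp only: of_nat_le_iff)
  moreover have "real G * L = real G - real n" using G by (simp add: L_def field_simps)
  ultimately have "real G * L \<le> real (Suc j) * real (G div Suc j)" by linarith
  then have GL: "real G * L / real (Suc j) \<le> real (G div Suc j)"
    by (simp only: pos_divide_le_eq[OF of_nat_0_less_iff[THEN iffD2, OF zero_less_Suc]] mult.commute)
  have hge: "(\<Sum>b\<in>UNIV. real X * (L ^ j * pp j (\<alpha>(pv i \<mapsto> val \<alpha> (pv i) b)))) \<le> h i" if i: "i < Suc j" for i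
    unfolding h_def
  proof (rule sum_mono)
    fix b
    show "real X * (L ^ j * pp j (\<alpha>(pv i \<mapsto> val \<alpha> (pv i) b))) \<le> (\<Sum>q<X. of_bool (T i b q))"
      unfolding X_def L_def T_def
      by (rule Suc.IH) (use Suc.prems m bij_betw_swap_remove[OF Suc.prems(3) i] in \<open>auto simp del: fun_upd_apply\<close>)
  qed
  have "(\<Sum>i<Suc j. \<Sum>b\<in>UNIV. pp j (\<alpha>(pv i \<mapsto> val \<alpha> (pv i) b)))
      = (\<Sum>x\<in>unset \<alpha>. \<Sum>b\<in>UNIV. pp j (\<alpha>(x \<mapsto> val \<alpha> x b)))"
    by (rule sum.reindex_bij_betw[OF Suc.prems(3), of "\<lambda>x. \<Sum>b\<in>UNIV. pp j (\<alpha>(x \<mapsto> val \<alpha> x b))"])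
  also have "\<dots> = 2 * real (Suc j) * pp (Suc j) \<alpha>"
  proof -
    have "card (unset \<alpha>) = Suc j" using bij_betw_same_card[OF Suc.prems(3)] by simp
    then show ?thesis by (simp del: of_nat_Suc)
  qed
  finally have spp: "(\<Sum>i<Suc j. \<Sum>b\<in>UNIV. pp j (\<alpha>(pv i \<mapsto> val \<alpha> (pv i) b))) = 2 * real (Suc j) * pp (Suc j) \<alpha>" .
  have "real ((2 * G) ^ m) * (L ^ Suc j * pp (Suc j) \<alpha>)
      = real G * L / real (Suc j) * (real X * L ^ j * (2 * real (Suc j) * pp (Suc j) \<alpha>))"
    by (simp add: m X_def del: of_nat_Suc pp.simps)
  also have "\<dots> = real G * L / real (Suc j) * (\<Sum>i<Suc j. \<Sum>b\<in>UNIV. real X * (L ^ j * pp j (\<alpha>(pv i \<mapsto> val \<alpha> (pv i) b))))"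
    unfolding spp[symmetric] by (simp only: sum_distrib_left mult.assoc)
  also have "\<dots> \<le> real (G div Suc j) * (\<Sum>i<Suc j. h i)"
  proof (rule mult_mono[OF GL])
    show "(\<Sum>i<Suc j. \<Sum>b\<in>UNIV. real X * (L ^ j * pp j (\<alpha>(pv i \<mapsto> val \<alpha> (pv i) b)))) \<le> (\<Sum>i<Suc j. h i)"
      by (rule sum_mono) (rule hge, simp)
    show "0 \<le> (\<Sum>i<Suc j. \<Sum>b\<in>UNIV. real X * (L ^ j * pp j (\<alpha>(pv i \<mapsto> val \<alpha> (pv i) b))))"
      using L by (intro sum_nonneg mult_nonneg_nonneg pp_nonneg) auto
  qed simp
  finally show ?case using 1 unfolding L_def by linarith
qed

text \<open>Bit \<open>v\<close> of \<open>q\<close> is the value of variable \<open>v\<close>. As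
  the newest variable is the most significant bit, the children of \<open>q\<close> at depth
  \<open>i\<close> are \<open>q\<close> and \<open>q + 2 ^ i\<close>.\<close>

definition node :: "nat \<Rightarrow> nat \<Rightarrow> (nat \<rightharpoonup> bool)" where
  "node i q = (\<lambda>v. if v < i then Some (odd (q div 2 ^ v)) else None)"

definition nsol :: "nat \<Rightarrow> nat \<Rightarrow> nat" where
  "nsol i q = card (sols (node i q))"

definition node_trial :: "nat \<Rightarrow> nat \<Rightarrow> nat \<Rightarrow> nat \<Rightarrow> bool" where
  "node_trial G i q r = trial G (n - i) (\<lambda>t. i + t) (node i q) r"

lemma unset_node: "unset (node i q) = {i..<n}"
  by (auto simp: unset_def node_def)

lemma bij_node: "bij_betw (\<lambda>t. i + t) {..<n - i} (unset (node i q))"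
  unfolding unset_node
  by (rule bij_betwI[where g = "\<lambda>v. v - i"]) auto

lemma node_trial_sound:
  assumes "i \<le> n" "node_trial G i q r" shows "nsol i q > 0"
proof -
  have "dom (node i q) \<subseteq> {..<n}" using assms(1) by (auto simp: node_def split: if_splits)
  then have "sols (node i q) \<noteq> {}"
    using trial_sound[OF _ bij_node] assms(2) unfolding node_trial_def by blast
  then show ?thesis by (simp add: nsol_def card_gt_0_iff)
qed

lemma node_leaf: "node_trial G n q r \<longleftrightarrow> \<not> falsified (node n q)"
  by (simp add: node_trial_def)

lemma node_Suc:
  assumes "q < 2 ^ i"
  shows "node (Suc i) q = (node i q)(i \<mapsto> False)" "node (Suc i) (q + 2 ^ i) = (node i q)(i \<mapsto> True)"
proof -
  show "node (Suc i) q = (node i q)(i \<mapsto> False)"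
    using assms by (auto simp: node_def fun_eq_iff less_Suc_eq)
  have "odd ((q + 2 ^ i) div 2 ^ v) = odd (q div 2 ^ v)" if "v < i" for v
  proof -
    have "(2::nat) ^ i = 2 ^ v * 2 ^ (i - v)" using that by (simp flip: power_add)
    then have "(q + 2 ^ i) div 2 ^ v = q div 2 ^ v + 2 ^ (i - v)" by simp
    then show ?thesis using that by simp
  qed
  then show "node (Suc i) (q + 2 ^ i) = (node i q)(i \<mapsto> True)"
    using assms by (auto simp: node_def fun_eq_iff less_Suc_eq)
qed

lemma nsol_split:
  assumes "q < 2 ^ i" "i < n"
  shows "nsol i q = nsol (Suc i) q + nsol (Suc i) (q + 2 ^ i)"
proof -
  have i: "i \<in> unset (node i q)" using assms by (simp add: unset_node)
  have "sols (node i q) = sols (node (Suc i) q) \<union> sols (node (Suc i) (q + 2 ^ i))"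
    unfolding node_Suc[OF assms(1)] sols_upd[OF i] by auto
  moreover have "sols (node (Suc i) q) \<inter> sols (node (Suc i) (q + 2 ^ i)) = {}"
    unfolding node_Suc[OF assms(1)] sols_upd[OF i] by auto
  ultimately show ?thesis unfolding nsol_def by (simp add: card_Un_disjoint)
qed

lemma sum_nsol: "i \<le> n \<Longrightarrow> (\<Sum>q<2 ^ i. nsol i q) = num_sat n F"
proof (induction i)
  case 0
  show ?case by (simp add: nsol_def node_def sols_def num_sat_def)
next
  case (Suc i)
  have "(\<Sum>q<2 ^ Suc i. nsol (Suc i) q) = (\<Sum>q<2 ^ i * 2. nsol (Suc i) (q mod 2 ^ i + 2 ^ i * (q div 2 ^ i)))"
    by (simp add: mult.commute)
  also have "\<dots> = (\<Sum>q<2 ^ i. \<Sum>b<(2::nat). nsol (Suc i) (q + 2 ^ i * b))"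
    by (rule sum_mod_div[where f = "\<lambda>q b. nsol (Suc i) (q + 2 ^ i * b)"]) simp
  also have "\<dots> = (\<Sum>q<2 ^ i. nsol i q)"
    by (rule sum.cong) (use Suc.prems nsol_split in \<open>auto simp: numeral_2_eq_2\<close>)
  finally show ?case using Suc by simp
qed

text \<open>With no variable left every solution has weight \<open>lk 0 = 1\<close>, so
  \<open>sum_lk\<close> says that there is exactly one if there is any.\<close>

lemma nsol_leaf: "nsol n q = of_bool (\<not> falsified (node n q))"
proof (cases "falsified (node n q)")
  case True
  then show ?thesis using falsified_sols[OF True] by (simp add: nsol_def)
next
  case False
  then have "sols (node n q) \<noteq> {}"
    using node_trial_sound[of n 1 q 0] by (auto simp: node_leaf nsol_def)
  moreover have "card (unset (node n q)) = 0" by (simp add: unset_node)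
  ultimately have "real (card (sols (node n q))) = 1" using sum_lk[of "node n q" 0] by simp
  then show ?thesis using False by (simp add: nsol_def)
qed

end

section \<open>Tail bounds for independent words\<close>

lemma prob_uniform_nat:
  assumes "0 < X"
  shows "measure_pmf.prob (pmf_of_set {..<X}) {r. P r} = (\<Sum>r<X. of_bool (P r)) / real X"
  using assms by (subst measure_pmf_of_set) (auto simp: sum.If_cases of_bool_def Int_def lessThan_def)

text \<open>Chebyshev's inequality for the number of hits among the first \<open>M\<close> words.
  The variance \<open>M * (p - p^2)\<close> is relaxed to \<open>M * p\<close>, which keeps the
  bound relative to the mean.\<close>

lemma sampling_bound:
  fixes P :: "nat pmf"
  assumes M: "M \<le> m" "0 < M" and c: "0 < c"
    and p: "p = measure_pmf.prob P {r. H r}"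
  shows "measure_pmf.prob (Pi_pmf {..<m} d (\<lambda>_. P)) {\<omega>. c \<le> \<bar>real (card {t\<in>{..<M}. H (\<omega> t)}) - real M * p\<bar>}
    \<le> real M * p / c\<^sup>2"
proof -
  define D where "D = Pi_pmf {..<m} d (\<lambda>_. P)"
  define X where "X t \<omega> = (indicator {\<omega>. H (\<omega> t)} \<omega> :: real)" for t :: nat and \<omega> :: "nat \<Rightarrow> nat"
  have fin: "integrable (measure_pmf D) f" if "\<And>\<omega>. \<bar>f \<omega>\<bar> \<le> B" for f :: "(nat \<Rightarrow> nat) \<Rightarrow> real" and B
    by (rule measure_pmf.integrable_const_bound[of _ B]) (use that in auto)
  have pr: "measure_pmf.expectation D (\<lambda>\<omega>. X s \<omega> * X t \<omega>) = (if s = t then p else p\<^sup>2)"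
    if st: "s < M" "t < M" for s t
  proof -
    have "measure_pmf.expectation D (\<lambda>\<omega>. X s \<omega> * X t \<omega>)
        = measure_pmf.expectation D (indicator {\<omega>. H (\<omega> s) \<and> H (\<omega> t)})"
      by (rule arg_cong2[where f = lebesgue_integral]) (auto simp: X_def indicator_def fun_eq_iff)
    also have "\<dots> = measure_pmf.prob D {\<omega>. H (\<omega> s) \<and> H (\<omega> t)}" by simp
    also have "{\<omega>. H (\<omega> s) \<and> H (\<omega> t)} = Pi {..<m} (\<lambda>u. if u \<in> {s, t} then {r. H r} else UNIV)"
      using st M by (auto simp: Pi_def)
    also have "measure_pmf.prob D \<dots> = (\<Prod>u<m. if u \<in> {s, t} then p else 1)"
      unfolding D_def by (subst measure_Pi_pmf_Pi) (auto simp: p intro!: prod.cong)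
    also have "\<dots> = (\<Prod>u\<in>{s, t}. p)"
      using st M by (subst prod.inter_restrict[symmetric]) (auto intro!: prod.cong)
    finally show ?thesis by (auto simp: power2_eq_square)
  qed
  have ex: "measure_pmf.expectation D (X s) = p" if "s < M" for s
  proof -
    have "(\<lambda>\<omega>. X s \<omega> * X s \<omega>) = X s" by (auto simp: X_def indicator_def fun_eq_iff)
    then show ?thesis using pr[OF that that] by simp
  qed
  have Xb: "\<bar>X s \<omega>\<bar> \<le> 1" "\<bar>X s \<omega> * X t \<omega>\<bar> \<le> 1" for s t \<omega> by (auto simp: X_def indicator_def)
  define Z where "Z \<omega> = (\<Sum>t<M. X t \<omega> - p)" for \<omega>
  have Z: "Z \<omega> = real (card {t\<in>{..<M}. H (\<omega> t)}) - real M * p" for \<omega>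
    unfolding Z_def X_def by (simp add: sum_subtractf indicator_def sum.If_cases Int_def lessThan_def)
  have Z2: "(Z \<omega>)\<^sup>2 = (\<Sum>s<M. \<Sum>t<M. X s \<omega> * X t \<omega> - p * X s \<omega> - p * X t \<omega> + p\<^sup>2)" for \<omega>
    unfolding Z_def power2_eq_square sum_product by (simp add: algebra_simps)
  have "measure_pmf.expectation D (\<lambda>\<omega>. (Z \<omega>)\<^sup>2)
      = (\<Sum>s<M. \<Sum>t<M. measure_pmf.expectation D (\<lambda>\<omega>. X s \<omega> * X t \<omega> - p * X s \<omega> - p * X t \<omega> + p\<^sup>2))"
  proof -
    have i: "integrable (measure_pmf D) (\<lambda>\<omega>. X s \<omega> * X t \<omega> - p * X s \<omega> - p * X t \<omega> + p\<^sup>2)" for s t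
    proof -
      have "integrable (measure_pmf D) (X s)" "integrable (measure_pmf D) (X t)"
        "integrable (measure_pmf D) (\<lambda>\<omega>. X s \<omega> * X t \<omega>)" by (rule fin, rule Xb)+
      then show ?thesis by simp
    qed
    show ?thesis unfolding Z2
      by (subst Bochner_Integration.integral_sum; (intro Bochner_Integration.integrable_sum i)?)
         (intro sum.cong refl Bochner_Integration.integral_sum i)
  qed
  also have "\<dots> = (\<Sum>s<M. \<Sum>t<M. if s = t then p - p\<^sup>2 else 0)"
  proof (intro sum.cong refl)
    fix s t assume "s \<in> {..<M}" "t \<in> {..<M}"
    then have st: "s < M" "t < M" by auto
    have i: "integrable (measure_pmf D) (X s)" "integrable (measure_pmf D) (X t)"
      "integrable (measure_pmf D) (\<lambda>\<omega>. X s \<omega> * X t \<omega>)" by (rule fin, rule Xb)+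
    show "measure_pmf.expectation D (\<lambda>\<omega>. X s \<omega> * X t \<omega> - p * X s \<omega> - p * X t \<omega> + p\<^sup>2) = (if s = t then p - p\<^sup>2 else 0)"
      using i pr[OF st] ex[OF st(1)] ex[OF st(2)] by (simp add: power2_eq_square)
  qed
  also have "\<dots> = real M * (p - p\<^sup>2)" by (simp add: sum.delta)
  also have "\<dots> \<le> real M * p" by (simp add: right_diff_distrib)
  finally have E: "measure_pmf.expectation D (\<lambda>\<omega>. (Z \<omega>)\<^sup>2) \<le> real M * p" .
  have Zb: "\<bar>(Z \<omega>)\<^sup>2\<bar> \<le> (real M * (1 + \<bar>p\<bar>))\<^sup>2" for \<omega>
  proof -
    have "\<bar>Z \<omega>\<bar> \<le> (\<Sum>t<M. 1 + \<bar>p\<bar>)"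
      unfolding Z_def using Xb(1)[of _ \<omega>] by (intro order_trans[OF sum_abs] sum_mono) (smt (verit))
    then have "\<bar>Z \<omega>\<bar> \<le> real M * (1 + \<bar>p\<bar>)" by simp
    from power_mono[OF this abs_ge_zero, of 2] show ?thesis by simp
  qed
  have "measure_pmf.prob D {\<omega>. c\<^sup>2 \<le> (Z \<omega>)\<^sup>2} \<le> measure_pmf.expectation D (\<lambda>\<omega>. (Z \<omega>)\<^sup>2) / c\<^sup>2"
    using integral_Markov_inequality_measure[of "measure_pmf D" "\<lambda>\<omega>. (Z \<omega>)\<^sup>2" UNIV "c\<^sup>2"] fin[OF Zb] c by simp
  also have "\<dots> \<le> real M * p / c\<^sup>2" using E by (rule divide_right_mono) simp
  also have "{\<omega>. c\<^sup>2 \<le> (Z \<omega>)\<^sup>2} = {\<omega>. c \<le> \<bar>Z \<omega>\<bar>}"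
    using abs_le_square_iff[of c] c by auto
  finally show ?thesis by (simp add: Z D_def)
qed

lemma trials_bound:
  fixes P :: "nat pmf"
  assumes "R \<le> m" "p \<le> measure_pmf.prob P {r. H r}" "0 \<le> p"
  shows "measure_pmf.prob (Pi_pmf {..<m} d (\<lambda>_. P)) {\<omega>. \<forall>t<R. \<not> H (\<omega> t)} \<le> exp (- (p * real R))"
proof -
  let ?q = "measure_pmf.prob P {r. H r}"
  have "{\<omega>. \<forall>t<R. \<not> H (\<omega> t)} = Pi {..<m} (\<lambda>u. if u < R then {r. \<not> H r} else UNIV)"
    using assms(1) by (auto simp: Pi_def)
  also have "measure_pmf.prob (Pi_pmf {..<m} d (\<lambda>_. P)) \<dots> = (\<Prod>u<m. if u < R then measure_pmf.prob P {r. \<not> H r} else 1)"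
    by (subst measure_Pi_pmf_Pi) (auto intro!: prod.cong)
  also have "\<dots> = (\<Prod>u<R. measure_pmf.prob P {r. \<not> H r})"
    using assms(1) by (intro prod.mono_neutral_cong_right) auto
  also have "measure_pmf.prob P {r. \<not> H r} = 1 - ?q"
    using measure_pmf.prob_compl[of "{r. H r}" P] by (simp add: Compl_eq_Diff_UNIV[symmetric] Collect_neg_eq)
  also have "(\<Prod>u<R. 1 - ?q) = (1 - ?q) ^ R" by simp
  also have "\<dots> \<le> exp (- p) ^ R"
  proof (rule power_mono)
    have "1 - ?q \<le> 1 - p" using assms by simp
    also have "\<dots> \<le> exp (- p)" using exp_ge_add_one_self[of "- p"] by simp
    finally show "1 - ?q \<le> exp (- p)" .
  qed simp
  also have "\<dots> = exp (- (p * real R))" by (simp add: exp_of_nat_mult[symmetric] mult.commute)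
  finally show ?thesis .
qed

section \<open>Cost calculus for programs\<close>

definition runs :: "com \<Rightarrow> state \<Rightarrow> state \<Rightarrow> nat \<Rightarrow> bool" where
  "runs c s s' u \<longleftrightarrow> (\<forall>t. exec c (s, t) = return_spmf (s', t + u))"

definition bnd :: "nat \<Rightarrow> state \<Rightarrow> bool" where
  "bnd V s \<longleftrightarrow> (\<forall>x i. s x i \<le> V)"

text \<open>Bounds the degree in \<open>V\<close> of every intermediate value if all stored numbers
  and constants are at most \<open>V\<close>, hence its length in units of
  \<open>bits V\<close>.\<close>

primrec esz :: "aexp \<Rightarrow> nat" where
  "esz (Const m) = 1"
| "esz (Read x e) = esz e + 1"
| "esz (Add e1 e2) = esz e1 + esz e2 + 1"
| "esz (Sub e1 e2) = esz e1 + esz e2 + 1"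
| "esz (Mul e1 e2) = esz e1 + esz e2 + 1"
| "esz (Div e1 e2) = esz e1 + esz e2 + 1"

primrec cok :: "nat \<Rightarrow> aexp \<Rightarrow> bool" where
  "cok V (Const m) \<longleftrightarrow> m \<le> V"
| "cok V (Read x e) \<longleftrightarrow> cok V e"
| "cok V (Add e1 e2) \<longleftrightarrow> cok V e1 \<and> cok V e2"
| "cok V (Sub e1 e2) \<longleftrightarrow> cok V e1 \<and> cok V e2"
| "cok V (Mul e1 e2) \<longleftrightarrow> cok V e1 \<and> cok V e2"
| "cok V (Div e1 e2) \<longleftrightarrow> cok V e1 \<and> cok V e2"

text \<open>Bounds, in units of \<open>bits V\<close>, the cost of evaluating \<open>e\<close>
  together with the length of its value; the lengths of all intermediate values add up to at most a
  quadratic expression.\<close>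

definition esq :: "aexp \<Rightarrow> nat" where "esq e = 2 * (esz e * esz e) + esz e"

lemma esz_pos: "1 \<le> esz e" by (cases e) auto

lemma aval_le:
  assumes "2 \<le> V" "bnd V s" "cok V e" shows "aval e s \<le> V ^ esz e"
  using assms(3)
proof (induction e)
  case (Read x e)
  have "s x (aval e s) \<le> V ^ 1" using assms(2) by (simp add: bnd_def)
  also have "\<dots> \<le> V ^ esz (Read x e)" using assms(1) by (intro power_increasing) auto
  finally show ?case by simp
next
  case (Add e1 e2)
  have a: "V ^ esz e1 \<le> V ^ (esz e1 + esz e2)" "V ^ esz e2 \<le> V ^ (esz e1 + esz e2)"
    using assms(1) by (auto intro: power_increasing)
  have "aval (Add e1 e2) s \<le> 2 * V ^ (esz e1 + esz e2)" using Add a by simp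
  also have "\<dots> \<le> V * V ^ (esz e1 + esz e2)" using assms(1) by (intro mult_right_mono) auto
  finally show ?case by simp
next
  case (Sub e1 e2)
  have "aval (Sub e1 e2) s \<le> V ^ esz e1" using Sub by simp
  also have "\<dots> \<le> V ^ esz (Sub e1 e2)" using assms(1) by (intro power_increasing) auto
  finally show ?case .
next
  case (Mul e1 e2)
  have "aval (Mul e1 e2) s \<le> V ^ esz e1 * V ^ esz e2" using Mul by (simp add: mult_mono)
  also have "\<dots> \<le> V ^ esz (Mul e1 e2)" unfolding power_add[symmetric]
    using assms(1) by (intro power_increasing) auto
  finally show ?case .
next
  case (Div e1 e2)
  have "aval (Div e1 e2) s \<le> V ^ esz e1" using Div by simp (meson div_le_dividend le_trans)
  also have "\<dots> \<le> V ^ esz (Div e1 e2)" using assms(1) by (intro power_increasing) auto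
  finally show ?case .
qed simp

lemma bits_ge: "m < 2 ^ bits m"
proof (cases "m = 0")
  case False
  then have "m < 2 ^ floorlog 2 m" using floorlog_bounds[of m 2] by auto
  also have "\<dots> \<le> 2 ^ bits m" by (intro power_increasing) (auto simp: bits_def)
  finally show ?thesis .
qed simp

lemma bits_le: "m < 2 ^ j \<Longrightarrow> 1 \<le> j \<Longrightarrow> bits m \<le> j"
  using floorlog_leD floorlog_le_iff[of 2 m j] by (simp add: bits_def)

lemma bits_mono: "m \<le> m' \<Longrightarrow> bits m \<le> bits m'"
  unfolding bits_def by (intro max.mono floorlog_mono) auto

lemma bits_pos: "1 \<le> bits m" by (simp add: bits_def)

lemma bits_power: assumes "1 \<le> j" shows "bits (V ^ j) \<le> j * bits V"
proof (rule bits_le)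
  have "V ^ j < (2 ^ bits V) ^ j" using bits_ge[of V] assms by (intro power_strict_mono) auto
  then show "V ^ j < 2 ^ (j * bits V)" by (simp add: power_mult[symmetric] mult.commute)
  show "1 \<le> j * bits V" using assms bits_pos[of V] by (metis mult_le_mono nat_mult_1)
qed

lemma bits_aval:
  assumes "2 \<le> V" "bnd V s" "cok V e" shows "bits (aval e s) \<le> esz e * bits V"
  using bits_mono[OF aval_le[OF assms]] bits_power[OF esz_pos] by (meson le_trans)

lemma acost_le:
  assumes "2 \<le> V" "bnd V s" shows "cok V e \<Longrightarrow> acost e s \<le> 2 * (esz e * esz e) * bits V"
proof (induction e)
  case (Const m)
  then show ?case using bits_mono[of m V] by simp
next
  case (Read x e)
  have "bits (s x (aval e s)) \<le> bits V" using assms(2) by (intro bits_mono) (simp add: bnd_def)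
  then have "acost (Read x e) s \<le> 2 * (esz e * esz e) * bits V + esz e * bits V + bits V"
    using Read bits_aval[OF assms, of e] by simp
  also have "\<dots> \<le> 2 * (esz (Read x e) * esz (Read x e)) * bits V" by (simp add: algebra_simps)
  finally show ?case .
next
  case (Add e1 e2)
  have "acost (Add e1 e2) s \<le> 2 * (esz e1 * esz e1) * bits V + 2 * (esz e2 * esz e2) * bits V + esz e1 * bits V + esz e2 * bits V"
    using Add bits_aval[OF assms, of e1] bits_aval[OF assms, of e2] by simp
  also have "\<dots> \<le> 2 * (esz (Add e1 e2) * esz (Add e1 e2)) * bits V" by (simp add: algebra_simps)
  finally show ?case .
next
  case (Sub e1 e2)
  have "acost (Sub e1 e2) s \<le> 2 * (esz e1 * esz e1) * bits V + 2 * (esz e2 * esz e2) * bits V + esz e1 * bits V + esz e2 * bits V"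
    using Sub bits_aval[OF assms, of e1] bits_aval[OF assms, of e2] by simp
  also have "\<dots> \<le> 2 * (esz (Sub e1 e2) * esz (Sub e1 e2)) * bits V" by (simp add: algebra_simps)
  finally show ?case .
next
  case (Mul e1 e2)
  have "acost (Mul e1 e2) s \<le> 2 * (esz e1 * esz e1) * bits V + 2 * (esz e2 * esz e2) * bits V + esz e1 * bits V + esz e2 * bits V"
    using Mul bits_aval[OF assms, of e1] bits_aval[OF assms, of e2] by simp
  also have "\<dots> \<le> 2 * (esz (Mul e1 e2) * esz (Mul e1 e2)) * bits V" by (simp add: algebra_simps)
  finally show ?case .
next
  case (Div e1 e2)
  have "acost (Div e1 e2) s \<le> 2 * (esz e1 * esz e1) * bits V + 2 * (esz e2 * esz e2) * bits V + esz e1 * bits V + esz e2 * bits V"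
    using Div bits_aval[OF assms, of e1] bits_aval[OF assms, of e2] by simp
  also have "\<dots> \<le> 2 * (esz (Div e1 e2) * esz (Div e1 e2)) * bits V" by (simp add: algebra_simps)
  finally show ?case .
qed

lemma cost_le:
  assumes "2 \<le> V" "bnd V s" "cok V e"
  shows "acost e s + bits (aval e s) \<le> esq e * bits V"
  using acost_le[OF assms] bits_aval[OF assms] by (simp add: esq_def algebra_simps)

definition agree :: "nat set \<Rightarrow> state \<Rightarrow> state \<Rightarrow> bool" where
  "agree W s s' \<longleftrightarrow> (\<forall>x. x \<notin> W \<longrightarrow> s' x = s x)"

lemma agree_refl: "agree W s s" by (simp add: agree_def)

lemma agree_trans: "agree W s s' \<Longrightarrow> agree W' s' s'' \<Longrightarrow> W \<subseteq> X \<Longrightarrow> W' \<subseteq> X \<Longrightarrow> agree X s s''"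
  unfolding agree_def by (metis subset_eq)

lemma agree_store: "agree W s s' \<Longrightarrow> x \<in> W \<Longrightarrow> agree W s (store x i m s')"
  by (auto simp: agree_def store_def)

section \<open>A calculus of steps for deterministic programs\<close>

text \<open>\<open>V\<close> bounds every number ever stored and \<open>\<kappa> * bits V\<close>
  the cost of an elementary step. The largest expression independent of \<open>k\<close>, the guard
  in \<open>check_clause_body\<close> of size \<open>41\<close>, has \<open>esq\<close> equal to
  \<open>3403\<close>, which explains \<open>5000\<close>; \<open>\<kappa>\<close> remains a
  parameter because the guard \<open>guardJ\<close> grows with \<open>k\<close>.\<close>

locale machine =
  fixes V \<kappa> :: nat
  assumes V: "1000 \<le> V" and \<kappa>: "5000 \<le> \<kappa>"
begin

text \<open>Total correctness with a time bound. Time is counted in steps of cost at most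
  \<open>\<kappa> * bits V\<close>, so that the counts \<open>T\<close> simply add up under
  composition.\<close>

definition wp :: "com \<Rightarrow> nat \<Rightarrow> (state \<Rightarrow> bool) \<Rightarrow> state \<Rightarrow> bool" where
  "wp c T Q s \<longleftrightarrow> (\<exists>s' u. runs c s s' u \<and> u \<le> T * (\<kappa> * bits V) \<and> bnd V s' \<and> Q s')"

lemma V2: "2 \<le> V" using V by simp

lemma L1: "1 \<le> \<kappa> * bits V" using \<kappa> bits_pos[of V] by (metis One_nat_def Suc_leI mult_le_mono nat_mult_1 le_trans numeral_One one_le_numeral)

lemma num_le_V [simp]: "numeral w \<le> (1000 :: nat) \<Longrightarrow> numeral w \<le> V" using V by linarith

lemma one_le_V [simp]: "Suc 0 \<le> V" using V by linarith

lemma num_le_\<kappa> [simp]: "numeral w \<le> (5000 :: nat) \<Longrightarrow> numeral w \<le> \<kappa>" using \<kappa> by linarith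

lemma bndD [simp]: "bnd V s \<Longrightarrow> s x i \<le> V" by (simp add: bnd_def)

lemma bnd_store: "bnd V s \<Longrightarrow> m \<le> V \<Longrightarrow> bnd V (store x i m s)"
  by (auto simp: bnd_def store_def)

lemma wp_mono: "wp c T Q s \<Longrightarrow> T \<le> T' \<Longrightarrow> (\<And>s'. bnd V s' \<Longrightarrow> Q s' \<Longrightarrow> Q' s') \<Longrightarrow> wp c T' Q' s"
  unfolding wp_def by (meson le_trans mult_le_mono1)

lemma wp_Skip: "bnd V s \<Longrightarrow> Q s \<Longrightarrow> wp Skip 1 Q s"
  unfolding wp_def using L1 by (intro exI[of _ s] exI[of _ 1]) (auto simp: runs_def)

lemma wp_Write:
  assumes "bnd V s" "cok V i" "cok V e" "esq i + esq e \<le> \<kappa>" "aval e s \<le> V"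
    and "bnd V (store x (aval i s) (aval e s) s) \<Longrightarrow> Q (store x (aval i s) (aval e s) s)"
  shows "wp (Write x i e) 1 Q s"
  unfolding wp_def
proof (intro exI conjI)
  show "runs (Write x i e) s (store x (aval i s) (aval e s) s) (acost i s + acost e s + bits (aval i s) + bits (aval e s))"
    by (simp add: runs_def)
  have "acost i s + acost e s + bits (aval i s) + bits (aval e s) \<le> (esq i + esq e) * bits V"
    using cost_le[OF V2 assms(1,2)] cost_le[OF V2 assms(1,3)] by (simp add: algebra_simps)
  also have "\<dots> \<le> \<kappa> * bits V" by (intro mult_right_mono assms(4)) simp
  finally show "acost i s + acost e s + bits (aval i s) + bits (aval e s) \<le> 1 * (\<kappa> * bits V)" by simp
  show "bnd V (store x (aval i s) (aval e s) s)" by (rule bnd_store) fact+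
  then show "Q (store x (aval i s) (aval e s) s)" by fact
qed

lemma wp_Seq:
  assumes "wp c T1 (\<lambda>s'. bnd V s' \<longrightarrow> wp d T2 Q s') s"
  shows "wp (Seq c d) (T1 + T2) Q s"
proof -
  obtain s1 u1 where 1: "runs c s s1 u1" "u1 \<le> T1 * (\<kappa> * bits V)" "bnd V s1" "wp d T2 Q s1"
    using assms unfolding wp_def by blast
  then obtain s2 u2 where 2: "runs d s1 s2 u2" "u2 \<le> T2 * (\<kappa> * bits V)" "bnd V s2" "Q s2"
    unfolding wp_def by blast
  have "runs (Seq c d) s s2 (u1 + u2)" using 1(1) 2(1) by (simp add: runs_def add.assoc)
  moreover have "u1 + u2 \<le> (T1 + T2) * (\<kappa> * bits V)" using 1(2) 2(2) by (simp add: distrib_right)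
  ultimately show ?thesis unfolding wp_def using 2 by blast
qed

lemma wp_SeqWrite:
  assumes "bnd V s" "cok V i" "cok V e" "esq i + esq e \<le> \<kappa>" "aval e s \<le> V"
    and "bnd V (store x (aval i s) (aval e s) s) \<Longrightarrow> wp c T Q (store x (aval i s) (aval e s) s)"
  shows "wp (Seq (Write x i e) c) (1 + T) Q s"
  by (rule wp_Seq, rule wp_Write) (use assms in auto)

lemma wp_Cond:
  assumes "bnd V s" "cok V e" "esq e \<le> \<kappa>"
    and "aval e s \<noteq> 0 \<Longrightarrow> wp c T Q s" "aval e s = 0 \<Longrightarrow> wp d T Q s"
  shows "wp (Cond e c d) (1 + T) Q s"
proof -
  have cost: "acost e s + bits (aval e s) \<le> \<kappa> * bits V"
    using cost_le[OF V2 assms(1,2)] assms(3) by (meson le_trans mult_le_mono1)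
  have *: "wp (Cond e c d) (1 + T) Q s"
    if a1: "wp a T Q s" and a2: "\<And>t. exec (Cond e c d) (s, t) = exec a (s, t + (acost e s + bits (aval e s)))" for a
  proof -
    obtain s1 u1 where 1: "runs a s s1 u1" "u1 \<le> T * (\<kappa> * bits V)" "bnd V s1" "Q s1"
      using a1 unfolding wp_def by blast
    have "runs (Cond e c d) s s1 (acost e s + bits (aval e s) + u1)"
      unfolding runs_def a2 using 1(1) unfolding runs_def by (simp add: add.assoc)
    moreover have "acost e s + bits (aval e s) + u1 \<le> (1 + T) * (\<kappa> * bits V)" using 1(2) cost by simp
    ultimately show ?thesis unfolding wp_def using 1 by blast
  qed
  show ?thesis
  proof (cases "aval e s = 0")
    case True
    show ?thesis by (rule *[OF assms(5)[OF True]]) (simp add: True eval_guard_def add.assoc)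
  next
    case False
    show ?thesis by (rule *[OF assms(4)[OF False]]) (simp add: False eval_guard_def add.assoc)
  qed
qed

text \<open>\<open>m\<close> bounds the iterations still to come and belongs to the invariant;
  termination follows because a true guard forces \<open>0 < m\<close>.\<close>

lemma wp_While:
  assumes inv: "Inv m s" "bnd V s"
    and e: "cok V e" "esq e \<le> \<kappa>"
    and step: "\<And>m s. Inv m s \<Longrightarrow> bnd V s \<Longrightarrow> aval e s \<noteq> 0 \<Longrightarrow> 0 < m \<and> wp c T (Inv (m - 1)) s"
    and fin: "\<And>m s. Inv m s \<Longrightarrow> bnd V s \<Longrightarrow> aval e s = 0 \<Longrightarrow> Q s"
  shows "wp (While e c) (m * (T + 1) + 1) Q s"
  using inv
proof (induction m arbitrary: s)
  case m: 0
  then have 0: "aval e s = 0" using step by blast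
  have "runs (While e c) s s (acost e s + bits (aval e s))"
    unfolding runs_def exec.simps by (subst while_loop.simps) (simp add: 0 eval_guard_def)
  moreover have "acost e s + bits (aval e s) \<le> (0 * (T + 1) + 1) * (\<kappa> * bits V)"
    using le_trans[OF cost_le[OF V2 m(2) e(1)] mult_le_mono1[OF e(2)]] by simp
  ultimately show ?case unfolding wp_def using fin[OF m 0] m by blast
next
  case (Suc m)
  have cost: "acost e s + bits (aval e s) \<le> \<kappa> * bits V"
    by (rule le_trans[OF cost_le[OF V2 Suc.prems(2) e(1)] mult_le_mono1[OF e(2)]])
  show ?case
  proof (cases "aval e s = 0")
    case True
    have "runs (While e c) s s (acost e s + bits (aval e s))"
      unfolding runs_def exec.simps by (subst while_loop.simps) (simp add: True eval_guard_def)
    moreover have "acost e s + bits (aval e s) \<le> (Suc m * (T + 1) + 1) * (\<kappa> * bits V)"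
      using cost by (simp add: algebra_simps)
    ultimately show ?thesis unfolding wp_def using fin[OF Suc.prems True] Suc.prems by blast
  next
    case False
    have "wp c T (Inv m) s" using step[OF Suc.prems False] by simp
    then obtain s1 u1 where 1: "runs c s s1 u1" "u1 \<le> T * (\<kappa> * bits V)" "bnd V s1" "Inv m s1"
      unfolding wp_def by blast
    from Suc.IH[OF 1(4,3)] obtain s2 u2 where 2: "runs (While e c) s1 s2 u2"
      "u2 \<le> (m * (T + 1) + 1) * (\<kappa> * bits V)" "bnd V s2" "Q s2" unfolding wp_def by blast
    have "runs (While e c) s s2 (acost e s + bits (aval e s) + u1 + u2)"
      unfolding runs_def exec.simps
    proof
      fix t
      have "while_loop e (exec c) (s, t) = bind_spmf (exec c (s, t + acost e s + bits (aval e s))) (while_loop e (exec c))"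
        by (subst while_loop.simps) (simp add: False eval_guard_def)
      also have "\<dots> = while_loop e (exec c) (s1, t + acost e s + bits (aval e s) + u1)"
        using 1(1) by (simp add: runs_def)
      also have "\<dots> = return_spmf (s2, t + acost e s + bits (aval e s) + u1 + u2)"
        using 2(1) by (simp add: runs_def)
      finally show "while_loop e (exec c) (s, t) = return_spmf (s2, t + (acost e s + bits (aval e s) + u1 + u2))"
        by (simp add: add.assoc)
    qed
    moreover have "acost e s + bits (aval e s) + u1 + u2 \<le> (Suc m * (T + 1) + 1) * (\<kappa> * bits V)"
      using cost 1(2) 2(2) by (simp add: algebra_simps)
    ultimately show ?thesis unfolding wp_def using 2 by blast
  qed
qed

end

abbreviation (input) Rg :: "nat \<Rightarrow> aexp" where "Rg x \<equiv> Read x (Const 0)"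
abbreviation (input) Set :: "nat \<Rightarrow> aexp \<Rightarrow> com" where "Set x e \<equiv> Write x (Const 0) e"

definition For :: "nat \<Rightarrow> aexp \<Rightarrow> com \<Rightarrow> com" where
  "For x e c = Seq (Set x (Const 0))
     (While (Sub e (Rg x)) (Seq c (Set x (Add (Rg x) (Const 1)))))"

context machine begin

text \<open>The invariant is demanded of the store in which the counter is already advanced, so that
  loop bodies leave the increment to the rule. Each round adds one step for the guard and one for
  the counter.\<close>

lemma wp_For:
  assumes b: "bnd V s" and e: "cok V e" "esz e \<le> 20" and N: "N \<le> V"
    and init: "Inv 0 (store x 0 0 s)"
    and val: "\<And>j s. Inv j s \<Longrightarrow> aval e s = N"
    and step: "\<And>j s. Inv j s \<Longrightarrow> bnd V s \<Longrightarrow> j < N \<Longrightarrow> s x 0 = j \<Longrightarrow>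
      wp c T (\<lambda>s'. s' x 0 = j \<and> Inv (Suc j) (store x 0 (Suc j) s')) s"
    and fin: "\<And>s. Inv N s \<Longrightarrow> bnd V s \<Longrightarrow> s x 0 = N \<Longrightarrow> Q s"
  shows "wp (For x e c) (N * (T + 2) + 2) Q s"
proof -
  have "wp (While (Sub e (Rg x)) (Seq c (Set x (Add (Rg x) (Const 1))))) (N * ((T + 1) + 1) + 1) Q (store x 0 0 s)"
  proof (rule wp_While[where Inv = "\<lambda>m s. m + s x 0 = N \<and> Inv (s x 0) s"])
    show "N + store x 0 0 s x 0 = N \<and> Inv (store x 0 0 s x 0) (store x 0 0 s)"
      using init by (simp add: store_def)
    show "bnd V (store x 0 0 s)" by (rule bnd_store[OF b]) simp
    show "cok V (Sub e (Rg x))" using e by simp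
    have "(esz e + 3) * (esz e + 3) \<le> 23 * 23" using e(2) by (intro mult_mono) auto
    moreover have "esq (Sub e (Rg x)) = 2 * ((esz e + 3) * (esz e + 3)) + (esz e + 3)"
      by (simp add: esq_def algebra_simps)
    ultimately show "esq (Sub e (Rg x)) \<le> \<kappa>" using \<kappa> e(2) by linarith
  next
    fix m s assume I: "m + s x 0 = N \<and> Inv (s x 0) s" and b: "bnd V s" and g: "aval (Sub e (Rg x)) s \<noteq> 0"
    have lt: "s x 0 < N" using g val[of "s x 0" s] I by simp
    have "wp (Seq c (Set x (Add (Rg x) (Const 1)))) (T + 1) (\<lambda>s'. m - 1 + s' x 0 = N \<and> Inv (s' x 0) s') s"
    proof (rule wp_Seq, rule wp_mono[OF step[OF _ b lt refl] order_refl])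
      show "Inv (s x 0) s" using I by simp
      fix s' assume b': "bnd V s'" and s': "s' x 0 = s x 0 \<and> Inv (Suc (s x 0)) (store x 0 (Suc (s x 0)) s')"
      show "bnd V s' \<longrightarrow> wp (Set x (Add (Rg x) (Const 1))) 1 (\<lambda>s'. m - 1 + s' x 0 = N \<and> Inv (s' x 0) s') s'"
        by (intro impI wp_Write) (use s' lt N I b' in \<open>auto simp: esq_def store_def\<close>)
    qed
    then show "0 < m \<and> wp (Seq c (Set x (Add (Rg x) (Const 1)))) (T + 1) (\<lambda>s'. m - 1 + s' x 0 = N \<and> Inv (s' x 0) s') s"
      using lt I by auto
  next
    fix m s assume I: "m + s x 0 = N \<and> Inv (s x 0) s" and b: "bnd V s" and g: "aval (Sub e (Rg x)) s = 0"
    have "s x 0 = N" using g val[of "s x 0" s] I by simp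
    then show "Q s" using fin[of s] I b by simp
  qed
  then have "wp (For x e c) (1 + (N * ((T + 1) + 1) + 1)) Q s"
    unfolding For_def by (intro wp_SeqWrite) (use b in \<open>auto simp: esq_def\<close>)
  then show ?thesis by (simp add: add.commute)
qed

end

lemma store_same [simp]: "store x i m s x i = m" by (simp add: store_def)
lemma store_other [simp]: "y \<noteq> x \<Longrightarrow> store x i m s y = s y" by (simp add: store_def)

section \<open>The counting program\<close>

text \<open>Arrays: 0 input, 1 output, 2 assignment under test (values 0 and 1, with 2 for unset), 10 and 11 partial
  assignment and list of the unset variables of a trial, 30 random words, 40 and 41 stack of nodes, and
  50 to 62 parameters: 50 holds \<open>2\<^sup>n\<close>, 51 \<open>w\<close>, 52 \<open>2\<^sup>w\<close>, 53 \<open>n\<^sup>w\<close>, 58 \<open>2\<^sup>i\<close>, 59 the number of trials, 60 the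
  budget of the search. The node of depth \<open>i\<close> with bits \<open>q\<close> is stored as \<open>2\<^sup>i + q\<close>.\<close>

definition litval :: aexp where
  "litval = (let l = Read 0 (Rg 4) in
     Add (Read 2 (Div l (Const 2))) (Sub l (Mul (Const 2) (Div l (Const 2)))))"

section \<open>Evaluation of the formula under a partial assignment\<close>

definition check_clause_body :: com where
  "check_clause_body = Seq
     (Cond (Add (Sub litval (Const 1)) (Sub (Const 1) litval)) (Set 5 (Const 0)) Skip)
     (Set 4 (Add (Rg 4) (Const 1)))"

definition check :: com where
  "check = Seq (Set 3 (Const 0)) (Seq (Set 4 (Const 3)) (For 6 (Read 0 (Const 2))
     (Seq (Set 5 (Const 1)) (Seq (Set 8 (Rg 4)) (Seq (Set 4 (Add (Rg 4) (Const 1)))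
       (Seq (For 7 (Read 0 (Rg 8)) check_clause_body)
         (Cond (Rg 5) (Set 3 (Const 1)) Skip)))))))"

text \<open>The codes make a single test suffice: the value of the variable plus the sign bit of the
  literal is \<open>1\<close> exactly if the variable is set against the literal, since the code
  \<open>2\<close> of an unset variable exceeds \<open>1\<close> with either sign.\<close>

definition litfalse :: "(nat \<Rightarrow> nat) \<Rightarrow> nat \<Rightarrow> bool" where
  "litfalse a l \<longleftrightarrow> a (l div 2) + l mod 2 = 1"

locale prog = cnf k n w F + machine V \<kappa>
  for k n w F V \<kappa> +
  fixes Cs :: "literal list list" and N :: nat
  assumes Cs: "lists_formula Cs F"
    and XV: "length (encode_input n Cs N) \<le> V"
begin

definition inp :: "nat \<Rightarrow> nat" where
  "inp = init_state (encode_input n Cs N) 0"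

text \<open>The position of the header of clause \<open>i\<close> in the input; \<open>3\<close>
  skips \<open>n\<close>, \<open>N\<close> and the number of clauses.\<close>

definition off :: "nat \<Rightarrow> nat" where
  "off i = 3 + length (concat (map (\<lambda>C. length C # map encode_literal C) (take i Cs)))"

lemma off_Suc: "i < length Cs \<Longrightarrow> off (Suc i) = off i + 1 + length (Cs ! i)"
  by (simp add: off_def take_Suc_conv_app_nth)

lemma inp_off:
  assumes i: "i < length Cs"
  shows "inp (off i) = length (Cs ! i)"
    "j < length (Cs ! i) \<Longrightarrow> inp (off i + 1 + j) = encode_literal (Cs ! i ! j)"
    "off i + 1 + length (Cs ! i) \<le> V"
proof -
  let ?g = "\<lambda>C. length C # map encode_literal C"
  define pre where "pre = [n, N, length Cs] @ concat (map ?g (take i Cs))"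
  define post where "post = concat (map ?g (drop (Suc i) Cs))"
  have "concat (map ?g Cs) = concat (map ?g (take i Cs)) @ ?g (Cs ! i) @ post"
    by (subst id_take_nth_drop[OF i]) (simp add: post_def)
  then have X: "encode_input n Cs N = pre @ ?g (Cs ! i) @ post"
    by (simp add: encode_input_def pre_def)
  have off: "off i = length pre" by (simp add: off_def pre_def)
  show "inp (off i) = length (Cs ! i)"
    unfolding inp_def init_state_def X off by (simp add: nth_append)
  show "inp (off i + 1 + j) = encode_literal (Cs ! i ! j)" if "j < length (Cs ! i)"
    unfolding inp_def init_state_def X off using that by (simp add: nth_append)
  show "off i + 1 + length (Cs ! i) \<le> V"
    using XV unfolding X off by simp
qed

lemma inp_header: "inp 0 = n" "inp 1 = N" "inp (Suc 0) = N" "inp 2 = length Cs"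
  by (simp_all add: inp_def init_state_def encode_input_def numeral_2_eq_2)

lemma Cs_facts:
  assumes "i < length Cs"
  shows "set (Cs ! i) \<in> F" "length (Cs ! i) \<le> k"
proof -
  show *: "set (Cs ! i) \<in> F" using Cs assms by (auto simp: lists_formula_def)
  have "distinct (Cs ! i)" using Cs assms by (auto simp: lists_formula_def)
  then have "length (Cs ! i) = card (set (Cs ! i))" by (simp add: distinct_card)
  then show "length (Cs ! i) \<le> k" using * kcnf by (simp add: kcnf_def)
qed

definition lf :: "(nat \<Rightarrow> nat) \<Rightarrow> nat \<Rightarrow> bool" where
  "lf a i \<longleftrightarrow> (\<forall>j<length (Cs ! i). litfalse a (encode_literal (Cs ! i ! j)))"

definition Tcheck :: nat where
  "Tcheck = length Cs * (k * 6 + 9) + 4"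

lemma litval_aval: "aval litval s \<noteq> 1 \<longleftrightarrow> \<not> litfalse (s 2) (s 0 (s 4 0))"
proof -
  have "aval litval s = s 2 (s 0 (s 4 0) div 2) + s 0 (s 4 0) mod 2"
    by (simp only: litval_def Let_def aval.simps minus_mult_div_eq_mod)
  then show ?thesis by (simp add: litfalse_def)
qed

lemma check_body_wp:
  assumes i: "i < length Cs" and j: "j < length (Cs ! i)" and b: "bnd V s"
    and s: "s 0 = inp" "s 2 = a" "s 4 0 = off i + 1 + j"
  shows "wp check_clause_body 4 (\<lambda>s'. \<exists>g. s' = store 4 0 (off i + 1 + Suc j) (store 5 0 g s) \<and>
     (if litfalse a (encode_literal (Cs ! i ! j)) then g = s 5 0 else g = 0)) s"
proof -
  have lv: "aval (Add (Sub litval (Const 1)) (Sub (Const 1) litval)) s = 0 \<longleftrightarrow> litfalse a (encode_literal (Cs ! i ! j))"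
    using litval_aval[of s] s inp_off(2)[OF i j] by auto
  have V: "off i + 1 + Suc j \<le> V" using inp_off(3)[OF i] j by simp
  have s5: "store 5 0 (s 5 0) s = s" by (simp add: store_def)
  have "wp check_clause_body ((1 + 1) + 1) (\<lambda>s'. \<exists>g. s' = store 4 0 (off i + 1 + Suc j) (store 5 0 g s) \<and>
     (if litfalse a (encode_literal (Cs ! i ! j)) then g = s 5 0 else g = 0)) s"
    unfolding check_clause_body_def
  proof (rule wp_Seq, rule wp_Cond)
    assume "aval (Add (Sub litval (Const 1)) (Sub (Const 1) litval)) s \<noteq> 0"
    then have nl: "\<not> litfalse a (encode_literal (Cs ! i ! j))" by (rule contrapos_nn[OF _ iffD2[OF lv]])
    show "wp (Set 5 (Const 0)) 1 (\<lambda>s'. bnd V s' \<longrightarrow> wp (Set 4 (Add (Rg 4) (Const 1))) 1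
       (\<lambda>s'. \<exists>g. s' = store 4 0 (off i + 1 + Suc j) (store 5 0 g s) \<and>
         (if litfalse a (encode_literal (Cs ! i ! j)) then g = s 5 0 else g = 0)) s') s"
      by (rule wp_Write; (intro impI wp_Write)?) (use b s V nl in \<open>auto simp: esq_def\<close>)
  next
    assume "aval (Add (Sub litval (Const 1)) (Sub (Const 1) litval)) s = 0"
    then have nl: "litfalse a (encode_literal (Cs ! i ! j))" by (rule iffD1[OF lv])
    show "wp Skip 1 (\<lambda>s'. bnd V s' \<longrightarrow> wp (Set 4 (Add (Rg 4) (Const 1))) 1
       (\<lambda>s'. \<exists>g. s' = store 4 0 (off i + 1 + Suc j) (store 5 0 g s) \<and>
         (if litfalse a (encode_literal (Cs ! i ! j)) then g = s 5 0 else g = 0)) s') s"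
      by (rule wp_Skip; (intro impI wp_Write)?) (use b s V nl s5 in \<open>auto simp: esq_def\<close>)
  qed (use b in \<open>auto simp: litval_def Let_def esq_def\<close>)
  then show ?thesis by (rule wp_mono) auto
qed

lemma check_wp:
  assumes b: "bnd V s" and s0: "s 0 = inp"
  shows "wp check Tcheck (\<lambda>s'. agree {3, 4, 5, 6, 7, 8} s s' \<and>
     s' 3 0 = of_bool (\<exists>i<length Cs. lf (s 2) i)) s"
proof -
  define a where "a = s 2"
  let ?W = "{3, 4, 5, 6, 7, 8} :: nat set"
  define I where "I i s' \<longleftrightarrow> agree ?W s s' \<and> s' 4 0 = off i \<and> s' 3 0 = of_bool (\<exists>i'<i. lf a i')" for i s'
  define J where "J i j s' \<longleftrightarrow> agree ?W s s' \<and> s' 4 0 = off i + 1 + j \<and> s' 3 0 = of_bool (\<exists>i'<i. lf a i')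
     \<and> s' 6 0 = i \<and> s' 8 0 = off i \<and> s' 5 0 = of_bool (\<forall>j'<j. litfalse a (encode_literal (Cs ! i ! j')))" for i j s'
  have I0: "\<And>i s'. I i s' \<Longrightarrow> s' 0 = inp" and J0: "\<And>i j s'. J i j s' \<Longrightarrow> s' 0 = inp \<and> s' 2 = a"
    unfolding I_def J_def by (auto simp: agree_def s0 a_def)
  have inner: "wp (For 7 (Read 0 (Rg 8)) check_clause_body) (k * 6 + 2) (J i (length (Cs ! i))) s'"
    if i: "i < length Cs" and J: "J i 0 s'" and b: "bnd V s'" for i s'
  proof (rule wp_mono[OF wp_For[where Inv = "J i" and N = "length (Cs ! i)" and T = 4]])
    show "length (Cs ! i) \<le> V" using inp_off(3)[OF i] by simp
    show "J i 0 (store 7 0 0 s')" using J unfolding J_def by (auto intro: agree_store)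
    show "aval (Read 0 (Rg 8)) s'' = length (Cs ! i)" if "J i j s''" for j s''
      using J0[OF that] that inp_off(1)[OF i] by (simp add: J_def)
    show "wp check_clause_body 4 (\<lambda>s'. s' 7 0 = j \<and> J i (Suc j) (store 7 0 (Suc j) s')) s''"
      if J: "J i j s''" and b: "bnd V s''" and j: "j < length (Cs ! i)" and s7: "s'' 7 0 = j" for j s''
    proof (rule wp_mono[OF check_body_wp[OF i j b] order_refl])
      show "s'' 0 = inp" "s'' 2 = a" "s'' 4 0 = off i + 1 + j" using J0[OF J] J by (auto simp: J_def)
      fix t assume "\<exists>g. t = store 4 0 (off i + 1 + Suc j) (store 5 0 g s'') \<and>
        (if litfalse a (encode_literal (Cs ! i ! j)) then g = s'' 5 0 else g = 0)"
      then obtain g where t: "t = store 4 0 (off i + 1 + Suc j) (store 5 0 g s'')"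
        and g: "if litfalse a (encode_literal (Cs ! i ! j)) then g = s'' 5 0 else g = 0" by blast
      have "g = of_bool (\<forall>j'<Suc j. litfalse a (encode_literal (Cs ! i ! j')))"
        using g J by (auto simp: J_def less_Suc_eq split: if_splits)
      then show "t 7 0 = j \<and> J i (Suc j) (store 7 0 (Suc j) t)"
        using J s7 unfolding J_def t by (auto intro!: agree_store)
    qed
  qed (use b i Cs_facts(2)[OF i] in \<open>auto\<close>)
  have "wp check (1 + (1 + (length Cs * (((1 + (1 + (1 + ((k * 6 + 2) + (1 + 1)))))) + 2) + 2))) (\<lambda>s'. agree ?W s s' \<and>
     s' 3 0 = of_bool (\<exists>i<length Cs. lf a i)) s"
    unfolding check_def
  proof (rule wp_SeqWrite, goal_cases)
    case 6
    then show ?case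
    proof (intro wp_SeqWrite, goal_cases)
      case 6
      show ?case
      proof (rule wp_For[where Inv = "I" and N = "length Cs"])
        show "length Cs \<le> V"
          using bndD[OF b, of 0 2] s0 by (simp add: inp_header)
        show "I 0 (store 6 0 0 (store 4 (aval (Const 0) (store 3 (aval (Const 0) s) (aval (Const 0) s) s))
            (aval (Const 3) (store 3 (aval (Const 0) s) (aval (Const 0) s) s)) (store 3 (aval (Const 0) s) (aval (Const 0) s) s)))"
          by (auto simp: I_def off_def intro!: agree_store agree_refl)
        show "aval (Read 0 (Const 2)) s' = length Cs" if "I i s'" for i s'
          using I0[OF that] by (simp add: inp_header)
        show "wp (Seq (Set 5 (Const 1)) (Seq (Set 8 (Rg 4)) (Seq (Set 4 (Add (Rg 4) (Const 1)))
            (Seq (For 7 (Read 0 (Rg 8)) check_clause_body) (Cond (Rg 5) (Set 3 (Const 1)) Skip)))))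
            (1 + (1 + (1 + ((k * 6 + 2) + (1 + 1)))))
            (\<lambda>s'. s' 6 0 = i \<and> I (Suc i) (store 6 0 (Suc i) s')) s'"
          if I: "I i s'" and b: "bnd V s'" and i: "i < length Cs" and s6: "s' 6 0 = i" for i s'
        proof (intro wp_SeqWrite wp_Seq, goal_cases)
          case 16
          show ?case
          proof (rule wp_mono[OF inner[OF i] order_refl], goal_cases)
            case 1
            show ?case using I s6 unfolding I_def J_def by (auto intro!: agree_store)
          next
            case 2
            show ?case using 16 by simp
          next
            case (3 t)
            show ?case
            proof (intro impI wp_Cond, goal_cases)
              case 4
              then show ?case using 3(2) I i
                by (intro wp_Write)
                   (auto simp: esq_def J_def I_def off_Suc lf_def less_Suc_eq intro!: agree_store split: if_splits)
            next
              case 5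
              then show ?case using 3(2) I i
                by (intro wp_Skip)
                   (auto simp: esq_def J_def I_def off_Suc lf_def less_Suc_eq intro!: agree_store split: if_splits)
            qed (use 3 in \<open>auto simp: esq_def\<close>)
          qed
        qed (use b I inp_off(3)[OF i] in \<open>auto simp: esq_def I_def\<close>)
      qed (use 6 in \<open>auto simp: I_def\<close>)
    qed (auto simp: esq_def)
  qed (use b in \<open>auto simp: esq_def\<close>)
  then show ?thesis by (rule wp_mono) (simp_all add: Tcheck_def a_def add_mult_distrib2)
qed

end

lemma store_fun [simp]: "store x i m s x = (s x)(i := m)" by (simp add: store_def)

section \<open>Refutation by exhaustive extension\<close>

definition md :: "aexp \<Rightarrow> aexp \<Rightarrow> aexp" where
  "md a b = Sub a (Mul b (Div a b))"

lemma aval_md [simp]: "aval (md a b) s = aval a s mod aval b s"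
  by (simp add: md_def minus_mult_div_eq_mod)

lemma cok_md [simp]: "cok V (md a b) \<longleftrightarrow> cok V a \<and> cok V b"
  by (auto simp: md_def)

lemma esz_md [simp]: "esz (md a b) = 2 * esz a + 2 * esz b + 3"
  by (simp add: md_def)

definition code :: "bool option \<Rightarrow> nat" where
  "code x = (case x of None \<Rightarrow> 2 | Some b \<Rightarrow> of_bool b)"

lemma code_simps [simp]: "code None = 2" "code (Some b) = of_bool b" by (auto simp: code_def)

definition copy :: com where
  "copy = For 23 (Rg 0) (Write 2 (Rg 23) (Read 10 (Rg 23)))"

definition refutation_step :: com where
  "refutation_step = Seq (Cond (Sub (Read 2 (md (Rg 21) (Rg 0))) (Const 1))
       (Write 2 (md (Rg 21) (Rg 0)) (md (Rg 22) (Const 2))) Skip)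
     (Seq (Set 21 (Div (Rg 21) (Rg 0))) (Set 22 (Div (Rg 22) (Const 2))))"

definition refutation_ext :: com where
  "refutation_ext = Seq copy (Seq (Set 21 (Rg 18)) (Seq (Set 22 (Rg 19)) (Seq (For 24 (Rg 51) refutation_step) check)))"

definition refutation_vars :: com where
  "refutation_vars = Seq (Set 20 (Const 1)) (Seq
     (For 19 (Rg 52) (Seq refutation_ext (Cond (Rg 3) Skip (Set 20 (Const 0)))))
     (Cond (Rg 20) (Set 17 (Const 1)) Skip))"

definition refutation :: com where
  "refutation = Seq (Set 17 (Const 0)) (For 18 (Rg 53) refutation_vars)"

context cnf begin

definition rep :: "(nat \<rightharpoonup> bool) \<Rightarrow> (nat \<Rightarrow> nat) \<Rightarrow> bool" where
  "rep \<alpha> a \<longleftrightarrow> (\<forall>v<n. a v = code (\<alpha> v))"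

text \<open>The base-\<open>n\<close> digits of \<open>c\<close>, least significant first. Together
  with the binary digits in \<open>blist\<close>, two counters thus enumerate all lists of
  \<open>w\<close> variables and all lists of \<open>w\<close> values.\<close>

definition vlist :: "nat \<Rightarrow> nat \<Rightarrow> nat list" where
  "vlist j c = map (\<lambda>i. c div n ^ i mod n) [0..<j]"

definition blist :: "nat \<Rightarrow> nat \<Rightarrow> bool list" where
  "blist j t = map (\<lambda>i. odd (t div 2 ^ i)) [0..<j]"

lemma length_lists [simp]: "length (vlist j c) = j" "length (blist j t) = j"
  by (simp_all add: vlist_def blist_def)

lemma vlist_surj: "length vs = j \<Longrightarrow> set vs \<subseteq> {..<n} \<Longrightarrow> \<exists>c<n ^ j. vlist j c = vs"
proof (induction j arbitrary: vs)
  case (Suc j)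
  then obtain v vs' where vs: "vs = v # vs'" "length vs' = j" "set vs' \<subseteq> {..<n}" "v < n"
    by (cases vs) auto
  obtain c where c: "c < n ^ j" "vlist j c = vs'" using Suc.IH[OF vs(2,3)] by auto
  have "vlist (Suc j) (v + n * c) = vs"
    unfolding vlist_def map_upt_Suc using c(2) vs by (simp add: vlist_def div_mult2_eq)
  moreover have "v + n * c < n ^ Suc j"
  proof -
    have "v + n * c < n * (c + 1)" using vs by simp
    also have "\<dots> \<le> n * n ^ j" using c(1) by (intro mult_left_mono) auto
    finally show ?thesis by simp
  qed
  ultimately show ?case by blast
qed (auto simp: vlist_def)

lemma blist_surj: "length bs = j \<Longrightarrow> \<exists>t<2 ^ j. blist j t = bs"
proof (induction j arbitrary: bs)
  case (Suc j)
  then obtain b bs' where bs: "bs = b # bs'" "length bs' = j" by (cases bs) auto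
  obtain t where t: "t < 2 ^ j" "blist j t = bs'" using Suc.IH[OF bs(2)] by auto
  have "blist (Suc j) (of_bool b + 2 * t) = bs"
    unfolding blist_def map_upt_Suc using t(2) bs by (simp add: blist_def div_mult2_eq)
  moreover have "of_bool b + 2 * t < 2 ^ Suc j" using t(1) by auto
  ultimately show ?case by blast
qed (auto simp: blist_def)

lemma set_vlist: "c < n ^ j \<Longrightarrow> set (vlist j c) \<subseteq> {..<n}"
proof (cases j)
  case (Suc i)
  assume "c < n ^ j"
  then have "n \<noteq> 0" using Suc by (intro notI) simp
  then show ?thesis by (auto simp: vlist_def)
qed (simp add: vlist_def)

lemma refut_code:
  "refut \<alpha> \<longleftrightarrow> (\<exists>c<n ^ w. \<forall>t<2 ^ w. falsified (map_of (zip (vlist w c) (blist w t)) ++ \<alpha>))"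
proof
  assume "refut \<alpha>"
  then obtain vs where vs: "length vs = w" "set vs \<subseteq> {..<n}"
    "\<And>bs. length bs = w \<Longrightarrow> falsified (map_of (zip vs bs) ++ \<alpha>)" by (auto simp: refut_def)
  obtain c where "c < n ^ w" "vlist w c = vs" using vlist_surj[OF vs(1,2)] by auto
  then show "\<exists>c<n ^ w. \<forall>t<2 ^ w. falsified (map_of (zip (vlist w c) (blist w t)) ++ \<alpha>)"
    using vs(3) by auto
next
  assume "\<exists>c<n ^ w. \<forall>t<2 ^ w. falsified (map_of (zip (vlist w c) (blist w t)) ++ \<alpha>)"
  then obtain c where c: "c < n ^ w"
    "\<And>t. t < 2 ^ w \<Longrightarrow> falsified (map_of (zip (vlist w c) (blist w t)) ++ \<alpha>)" by auto
  have "falsified (map_of (zip (vlist w c) bs) ++ \<alpha>)" if "length bs = w" for bs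
    using blist_surj[OF that] c(2) by blast
  then show "refut \<alpha>" unfolding refut_def using set_vlist[OF c(1)] by (intro exI[of _ "vlist w c"]) simp
qed

end

context prog begin

lemma n_le: "n \<le> V" if "bnd V s" "s 0 = inp" for s
  using bndD[OF that(1), of 0 0] that(2) by (simp add: inp_header)

lemma lf_falsified:
  assumes "rep \<alpha> a" shows "(\<exists>i<length Cs. lf a i) \<longleftrightarrow> falsified \<alpha>"
proof -
  have lit: "litfalse a (encode_literal (v, b)) \<longleftrightarrow> \<alpha> v = Some (\<not> b)" if "v < n" for v b
  proof -
    have "a v = code (\<alpha> v)" using assms that by (simp add: rep_def)
    then show ?thesis by (cases "\<alpha> v") (auto simp: litfalse_def encode_literal_def)
  qed
  have "lf a i \<longleftrightarrow> (\<forall>(v, b)\<in>set (Cs ! i). \<alpha> v = Some (\<not> b))" if i: "i < length Cs" for i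
  proof -
    have vn: "v < n" if "(v, b) \<in> set (Cs ! i)" for v b
      using Cs_facts(1)[OF i] kcnf that by (auto simp: kcnf_def)
    have "lf a i \<longleftrightarrow> (\<forall>l\<in>set (Cs ! i). litfalse a (encode_literal l))"
      by (auto simp: lf_def all_set_conv_all_nth)
    also have "\<dots> \<longleftrightarrow> (\<forall>(v, b)\<in>set (Cs ! i). \<alpha> v = Some (\<not> b))"
      by (rule ball_cong) (use lit vn in auto)
    finally show ?thesis .
  qed
  then have "(\<exists>i<length Cs. lf a i) \<longleftrightarrow> (\<exists>i<length Cs. \<forall>(v, b)\<in>set (Cs ! i). \<alpha> v = Some (\<not> b))"
    by blast
  also have "\<dots> \<longleftrightarrow> (\<exists>C\<in>set (map set Cs). \<forall>(v, b)\<in>C. \<alpha> v = Some (\<not> b))"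
  proof -
    have "(\<exists>i<length Cs. P (Cs ! i)) \<longleftrightarrow> (\<exists>C\<in>set Cs. P C)" for P
      by (metis in_set_conv_nth)
    then show ?thesis by simp
  qed
  also have "set (map set Cs) = F" using Cs by (simp add: lists_formula_def)
  finally show ?thesis by (simp add: falsified_def)
qed

lemma check_rep_wp:
  assumes "bnd V s" "s 0 = inp" "rep \<alpha> (s 2)"
  shows "wp check Tcheck (\<lambda>s'. agree {3, 4, 5, 6, 7, 8} s s' \<and> s' 3 0 = of_bool (falsified \<alpha>)) s"
  using check_wp[OF assms(1,2)] unfolding lf_falsified[OF assms(3)] .

lemma copy_wp:
  assumes b: "bnd V s" and s: "s 0 = inp" "rep \<alpha> (s 10)"
  shows "wp copy (n * 3 + 2) (\<lambda>s'. agree {2, 23} s s' \<and> rep \<alpha> (s' 2)) s"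
proof -
  have "wp copy (n * (1 + 2) + 2) (\<lambda>s'. agree {2, 23} s s' \<and> rep \<alpha> (s' 2)) s"
    unfolding copy_def
  proof (rule wp_For[where Inv = "\<lambda>v s'. agree {2, 23} s s' \<and> (\<forall>v'<v. s' 2 v' = s 10 v')" and N = n])
    fix v s' assume I: "agree {2, 23} s s' \<and> (\<forall>v'<v. s' 2 v' = s 10 v')" and b': "bnd V s'" and v: "v < n" "s' 23 0 = v"
    have "s' 10 = s 10" using I by (auto simp: agree_def)
    then show "wp (Write 2 (Rg 23) (Read 10 (Rg 23))) 1
       (\<lambda>s'. s' 23 0 = v \<and> agree {2, 23} s (store 23 0 (Suc v) s') \<and> (\<forall>v'<Suc v. store 23 0 (Suc v) s' 2 v' = s 10 v')) s'"
      by (intro wp_Write) (use I b' v bndD[OF b, of 10 v] in \<open>auto simp: esq_def less_Suc_eq intro!: agree_store\<close>)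
  next
    fix s' assume "agree {2, 23} s s' \<and> (\<forall>v'<n. s' 2 v' = s 10 v')"
    then show "agree {2, 23} s s' \<and> rep \<alpha> (s' 2)" using s by (simp add: rep_def)
  next
    fix j s' assume "agree {2, 23} s s' \<and> (\<forall>v'<j. s' 2 v' = s 10 v')"
    then have "s' 0 = s 0" by (auto simp: agree_def)
    then show "aval (Rg 0) s' = n" by (simp add: s inp_header)
  qed (use b s n_le[OF b s(1)] in \<open>auto intro: agree_store agree_refl\<close>)
  then show ?thesis by (rule wp_mono) simp_all
qed

definition ext :: "(nat \<rightharpoonup> bool) \<Rightarrow> nat \<Rightarrow> nat \<Rightarrow> nat \<Rightarrow> (nat \<rightharpoonup> bool)" where
  "ext \<alpha> j c t = map_of (zip (vlist j c) (blist j t)) ++ \<alpha>"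

text \<open>The values of \<open>\<alpha>\<close> take precedence over the digits, and among these
  the first occurrence of a variable does. Processing the digits in order therefore amounts to
  writing only to variables that are still unset.\<close>

lemma ext_Suc:
  "ext \<alpha> (Suc j) c t = (let v = c div n ^ j mod n in
     if ext \<alpha> j c t v = None then (ext \<alpha> j c t)(v \<mapsto> odd (t div 2 ^ j)) else ext \<alpha> j c t)"
proof -
  define m where "m = map_of (zip (vlist j c) (blist j t))"
  define v b where "v = c div n ^ j mod n" and "b = odd (t div 2 ^ j)"
  have "zip (vlist (Suc j) c) (blist (Suc j) t) = zip (vlist j c) (blist j t) @ [(v, b)]"
    by (simp add: vlist_def blist_def v_def b_def)
  then have "ext \<alpha> (Suc j) c t = [v \<mapsto> b] ++ (m ++ \<alpha>)" by (simp add: ext_def m_def)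
  moreover have "[v \<mapsto> b] ++ g = (if g v = None then g(v \<mapsto> b) else g)" for g :: "nat \<rightharpoonup> bool"
    by (auto simp: fun_eq_iff map_add_def split: option.splits)
  moreover have "m ++ \<alpha> = ext \<alpha> j c t" by (simp only: ext_def m_def)
  ultimately show ?thesis by (simp only: Let_def v_def b_def)
qed

definition Text :: nat where "Text = n * 3 + w * 6 + Tcheck + 6"

lemma refutation_ext_wp:
  assumes b: "bnd V s" and s: "s 0 = inp" "rep \<alpha> (s 10)" "s 51 0 = w"
  shows "wp refutation_ext Text (\<lambda>s'. agree {2, 3, 4, 5, 6, 7, 8, 21, 22, 23, 24} s s' \<and>
    s' 3 0 = of_bool (falsified (ext \<alpha> w (s 18 0) (s 19 0)))) s"
proof -
  define c t where "c = s 18 0" and "t = s 19 0"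
  let ?W = "{2, 21, 22, 23, 24} :: nat set"
  let ?W' = "{2, 3, 4, 5, 6, 7, 8, 21, 22, 23, 24} :: nat set"
  define I where "I j s' \<longleftrightarrow> agree ?W s s' \<and> rep (ext \<alpha> j c t) (s' 2) \<and> s' 21 0 = c div n ^ j \<and> s' 22 0 = t div 2 ^ j" for j s'
  have loop: "wp (For 24 (Rg 51) refutation_step) (w * (4 + 2) + 2) (I w) s'" if I0: "I 0 s'" and b': "bnd V s'" for s'
  proof (rule wp_For[where Inv = I and N = w])
    fix j s'' assume I: "I j s''" and b'': "bnd V s''" and j: "j < w" "s'' 24 0 = j"
    have s0: "s'' 0 = inp" using I s by (auto simp: I_def agree_def)
    define v where "v = c div n ^ j mod n"
    have vn: "v < n \<or> n = 0" by (auto simp: v_def)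
    define a' where "a' = (if 2 \<le> s'' 2 v then (s'' 2)(v := t div 2 ^ j mod 2) else s'' 2)"
    have rep': "rep (ext \<alpha> (Suc j) c t) a'"
      unfolding rep_def
    proof (intro allI impI)
      fix u assume u: "u < n"
      have eu: "s'' 2 u' = code (ext \<alpha> j c t u')" if "u' < n" for u' using I that by (simp add: I_def rep_def)
      have vn': "v < n" using vn u by auto
      have "2 \<le> s'' 2 v \<longleftrightarrow> ext \<alpha> j c t v = None"
        using eu[OF vn'] by (cases "ext \<alpha> j c t v") auto
      then show "a' u = code (ext \<alpha> (Suc j) c t u)"
        unfolding ext_Suc Let_def v_def[symmetric] a'_def using eu[OF u]
        by (auto simp: mod_2_eq_odd)
    qed
    have s2: "store 2 v (s'' 2 v) s'' = s''" by (simp add: store_def)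
    show "wp refutation_step 4 (\<lambda>s'. s' 24 0 = j \<and> I (Suc j) (store 24 0 (Suc j) s')) s''"
    proof -
      have y: "s'' 21 0 = c div n ^ j" "s'' 22 0 = t div 2 ^ j" "s'' 0 0 = n" using I s0 by (auto simp: I_def inp_header)
      have le: "c div n ^ j div n \<le> V" "t div 2 ^ j div 2 \<le> V" "t div 2 ^ j mod 2 \<le> V"
        using bndD[OF b'', of 21 0] bndD[OF b'', of 22 0] y
        by (auto intro: order_trans[OF div_le_dividend] order_trans[OF mod_less_eq_dividend])
      have fin: "agree ?W s s''" using I by (simp add: I_def)
      have dv: "c div n ^ j div n = c div n ^ Suc j" "t div 2 ^ j div 2 = t div 2 ^ Suc j"
        by (simp_all only: power_Suc2 div_mult2_eq)
      have "wp refutation_step ((1 + 1) + (1 + 1)) (\<lambda>s'. s' 24 0 = j \<and> I (Suc j) (store 24 0 (Suc j) s')) s''"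
        unfolding refutation_step_def
      proof (rule wp_Seq, rule wp_Cond)
        assume "aval (Sub (Read 2 (md (Rg 21) (Rg 0))) (Const 1)) s'' \<noteq> 0"
        then have "2 \<le> s'' 2 v" using y by (simp add: v_def)
        then have a': "a' = (s'' 2)(v := t div 2 ^ j mod 2)" by (simp add: a'_def)
        show "wp (Write 2 (md (Rg 21) (Rg 0)) (md (Rg 22) (Const 2))) 1
          (\<lambda>s'. bnd V s' \<longrightarrow> wp (Seq (Set 21 (Div (Rg 21) (Rg 0))) (Set 22 (Div (Rg 22) (Const 2)))) (1 + 1)
            (\<lambda>s'. s' 24 0 = j \<and> I (Suc j) (store 24 0 (Suc j) s')) s') s''"
          by (rule wp_Write; (intro impI wp_SeqWrite wp_Write)?)
             (use y le b'' j rep' fin a' in \<open>auto simp: esq_def I_def v_def[symmetric] dv fun_upd_def simp del: power_Suc intro!: agree_store\<close>)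
      next
        assume "aval (Sub (Read 2 (md (Rg 21) (Rg 0))) (Const 1)) s'' = 0"
        then have "\<not> 2 \<le> s'' 2 v" using y by (simp add: v_def)
        then have a': "a' = s'' 2" by (simp add: a'_def)
        show "wp Skip 1
          (\<lambda>s'. bnd V s' \<longrightarrow> wp (Seq (Set 21 (Div (Rg 21) (Rg 0))) (Set 22 (Div (Rg 22) (Const 2)))) (1 + 1)
            (\<lambda>s'. s' 24 0 = j \<and> I (Suc j) (store 24 0 (Suc j) s')) s') s''"
          by (rule wp_Skip; (intro impI wp_SeqWrite wp_Write)?)
             (use y le b'' j rep' fin a' in \<open>auto simp: esq_def I_def v_def[symmetric] dv simp del: power_Suc intro!: agree_store\<close>)
      qed (use b'' in \<open>auto simp: esq_def\<close>)
      then show ?thesis by (rule wp_mono) simp_all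
    qed
  next
    show "w \<le> V" using bndD[OF b, of 51 0] s by simp
    show "aval (Rg 51) s'' = w" if "I j s''" for j s'' using that s by (auto simp: I_def agree_def)
    show "I 0 (store 24 0 0 s')" using I0 by (auto simp: I_def intro!: agree_store)
  qed (use b' in auto)
  have "wp refutation_ext ((n * 3 + 2) + (1 + (1 + ((w * (4 + 2) + 2) + Tcheck)))) (\<lambda>s'. agree ?W' s s' \<and>
    s' 3 0 = of_bool (falsified (ext \<alpha> w c t))) s"
    unfolding refutation_ext_def
  proof (rule wp_Seq, rule wp_mono[OF copy_wp[OF b s(1,2)] order_refl], rule impI)
    fix s1 assume b1: "bnd V s1" and s1: "agree {2, 23} s s1 \<and> rep \<alpha> (s1 2)"
    have s1r: "s1 18 0 = c" "s1 19 0 = t" using s1 by (auto simp: agree_def c_def t_def)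
    show "wp (Seq (Set 21 (Rg 18)) (Seq (Set 22 (Rg 19)) (Seq (For 24 (Rg 51) refutation_step) check)))
      (1 + (1 + ((w * (4 + 2) + 2) + Tcheck))) (\<lambda>s'. agree ?W' s s' \<and>
        s' 3 0 = of_bool (falsified (ext \<alpha> w c t))) s1"
    proof (intro wp_SeqWrite wp_Seq, goal_cases)
      case 11
      show ?case
      proof (rule wp_mono[OF loop order_refl], goal_cases)
        case 1
        have "agree ?W s s1" using s1 by (auto simp: agree_def)
        moreover have "ext \<alpha> 0 c t = \<alpha>" by (simp add: ext_def vlist_def)
        ultimately show ?case using s1 s1r by (auto simp: I_def intro!: agree_store)
      next
        case 2
        show ?case by (rule 11)
      next
        case (3 s2)
        show ?case
        proof
          have "s2 0 = inp" "rep (ext \<alpha> w c t) (s2 2)" "agree ?W s s2" using 3(2) s by (auto simp: I_def agree_def)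
          then show "wp check Tcheck (\<lambda>s'. agree ?W' s s' \<and> s' 3 0 = of_bool (falsified (ext \<alpha> w c t))) s2"
            by (intro wp_mono[OF check_rep_wp[OF 3(1)] order_refl]) (auto intro: agree_trans)
        qed
      qed
    qed (use b1 s1 in \<open>auto simp: esq_def\<close>)
  qed
  then show ?thesis by (rule wp_mono) (auto simp: Text_def c_def t_def)
qed

definition Tref :: nat where "Tref = n ^ w * (2 ^ w * (Text + 4) + 7) + 3"

lemma refutation_wp:
  assumes b: "bnd V s" and s: "s 0 = inp" "rep \<alpha> (s 10)" "s 51 0 = w" "s 52 0 = 2 ^ w" "s 53 0 = n ^ w"
  shows "wp refutation Tref (\<lambda>s'. agree {2, 3, 4, 5, 6, 7, 8, 17, 18, 19, 20, 21, 22, 23, 24} s s' \<and>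
    s' 17 0 = of_bool (refut \<alpha>)) s"
proof -
  let ?W = "{2, 3, 4, 5, 6, 7, 8, 17, 18, 19, 20, 21, 22, 23, 24} :: nat set"
  define al where "al c t = falsified (ext \<alpha> w c t)" for c t
  define I where "I c s' \<longleftrightarrow> agree ?W s s' \<and> s' 17 0 = of_bool (\<exists>c'<c. \<forall>t<2 ^ w. al c' t)" for c s'
  define J where "J c t s' \<longleftrightarrow> agree ?W s s' \<and> s' 17 0 = of_bool (\<exists>c'<c. \<forall>t<2 ^ w. al c' t) \<and> s' 18 0 = c \<and>
    s' 20 0 = of_bool (\<forall>t'<t. al c t')" for c t s'
  have inner: "wp (For 19 (Rg 52) (Seq refutation_ext (Cond (Rg 3) Skip (Set 20 (Const 0))))) (2 ^ w * ((Text + (1 + 1)) + 2) + 2) (J c (2 ^ w)) s'"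
    if J0: "J c 0 s'" and b': "bnd V s'" for c s'
  proof (rule wp_For[where Inv = "J c" and N = "2 ^ w"])
    show "2 ^ w \<le> V" using bndD[OF b, of 52 0] s by simp
    show "aval (Rg 52) s'' = 2 ^ w" if "J c t s''" for t s'' using that s by (auto simp: J_def agree_def)
    show "J c 0 (store 19 0 0 s')" using J0 by (auto simp: J_def intro!: agree_store)
    fix t s1 assume J: "J c t s1" and b1: "bnd V s1" and t: "t < 2 ^ w" "s1 19 0 = t"
    have s1: "s1 0 = inp" "rep \<alpha> (s1 10)" "s1 51 0 = w" using J s by (auto simp: J_def agree_def)
    have s1': "s1 18 0 = c" "agree ?W s s1" using J by (auto simp: J_def)
    show "wp (Seq refutation_ext (Cond (Rg 3) Skip (Set 20 (Const 0)))) (Text + (1 + 1))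
      (\<lambda>s'. s' 19 0 = t \<and> J c (Suc t) (store 19 0 (Suc t) s')) s1"
    proof (rule wp_Seq, rule wp_mono[OF refutation_ext_wp[OF b1 s1] order_refl], rule impI)
      fix s2 assume b2: "bnd V s2" and "agree {2, 3, 4, 5, 6, 7, 8, 21, 22, 23, 24} s1 s2 \<and>
        s2 3 0 = of_bool (falsified (ext \<alpha> w (s1 18 0) (s1 19 0)))"
      then have s2: "s2 3 0 = of_bool (al c t)" and a12: "agree {2, 3, 4, 5, 6, 7, 8, 21, 22, 23, 24} s1 s2"
        using s1' t by (auto simp: al_def)
      have "agree ?W s s2" using s1'(2) a12 by (rule agree_trans) auto
      moreover have "s2 17 = s1 17" "s2 18 = s1 18" "s2 19 = s1 19" "s2 20 = s1 20" using a12 by (auto simp: agree_def)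
      ultimately have K: "J c (Suc t) (store 19 0 (Suc t) (if al c t then s2 else store 20 0 0 s2)) \<and> s2 19 0 = t"
        using J t by (auto simp: J_def less_Suc_eq intro!: agree_store)
      show "wp (Cond (Rg 3) Skip (Set 20 (Const 0))) (1 + 1) (\<lambda>s'. s' 19 0 = t \<and> J c (Suc t) (store 19 0 (Suc t) s')) s2"
      proof (rule wp_Cond)
        assume "aval (Rg 3) s2 \<noteq> 0"
        then show "wp Skip 1 (\<lambda>s'. s' 19 0 = t \<and> J c (Suc t) (store 19 0 (Suc t) s')) s2"
          using K s2 by (intro wp_Skip b2) (auto split: if_splits)
      next
        assume "aval (Rg 3) s2 = 0"
        then show "wp (Set 20 (Const 0)) 1 (\<lambda>s'. s' 19 0 = t \<and> J c (Suc t) (store 19 0 (Suc t) s')) s2"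
          using K s2 b2 by (intro wp_Write) (auto simp: esq_def split: if_splits)
      qed (use b2 in \<open>auto simp: esq_def\<close>)
    qed
  qed (use b' in auto)
  have outer: "wp refutation_vars (1 + ((2 ^ w * ((Text + (1 + 1)) + 2) + 2) + (1 + 1))) (\<lambda>s'. s' 18 0 = c \<and> I (Suc c) (store 18 0 (Suc c) s')) s1"
    if I: "I c s1" and b1: "bnd V s1" and c: "s1 18 0 = c" for c s1
    unfolding refutation_vars_def
  proof (rule wp_SeqWrite, goal_cases)
    case 6
    show ?case
    proof (rule wp_Seq, rule wp_mono[OF inner[where c = c] order_refl], goal_cases)
      case 1
      show ?case using I c by (auto simp: I_def J_def intro!: agree_store)
    next
      case 2
      show ?case by (rule 6)
    next
      case (3 s2)
      have K: "s2 18 0 = c" "agree ?W s s2" "s2 17 0 = of_bool (\<exists>c'<c. \<forall>t<2 ^ w. al c' t)"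
         "s2 20 0 = of_bool (\<forall>t<2 ^ w. al c t)" using 3(2) by (auto simp: J_def)
      show ?case
      proof (intro impI wp_Cond)
        assume "aval (Rg 20) s2 \<noteq> 0"
        then show "wp (Set 17 (Const 1)) 1 (\<lambda>s'. s' 18 0 = c \<and> I (Suc c) (store 18 0 (Suc c) s')) s2"
          using K 3(1) by (intro wp_Write) (auto simp: esq_def I_def less_Suc_eq intro!: agree_store split: if_splits)
      next
        assume "aval (Rg 20) s2 = 0"
        then have "\<not> (\<forall>t<2 ^ w. al c t)" using K(4) by simp
        then have "(\<exists>c'<Suc c. \<forall>t<2 ^ w. al c' t) \<longleftrightarrow> (\<exists>c'<c. \<forall>t<2 ^ w. al c' t)" by (metis less_Suc_eq)
        then show "wp Skip 1 (\<lambda>s'. s' 18 0 = c \<and> I (Suc c) (store 18 0 (Suc c) s')) s2"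
          using K 3(1) by (intro wp_Skip) (simp_all add: I_def agree_store)
      qed (use 3(1) in \<open>auto simp: esq_def\<close>)
    qed
  qed (use b1 in \<open>auto simp: esq_def\<close>)
  have "wp refutation (1 + (n ^ w * ((1 + ((2 ^ w * ((Text + (1 + 1)) + 2) + 2) + (1 + 1))) + 2) + 2)) (\<lambda>s'. agree ?W s s' \<and> s' 17 0 = of_bool (refut \<alpha>)) s"
    unfolding refutation_def
  proof (rule wp_SeqWrite, goal_cases)
    case 6
    show ?case
    proof (rule wp_For[where Inv = I and N = "n ^ w"])
      show "n ^ w \<le> V" using bndD[OF b, of 53 0] s by simp
      show "aval (Rg 53) s'' = n ^ w" if "I c s''" for c s'' using that s by (auto simp: I_def agree_def)
      show "agree ?W s s' \<and> s' 17 0 = of_bool (refut \<alpha>)" if "I (n ^ w) s'" for s'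
        using that by (simp add: I_def refut_code al_def ext_def)
    qed (use 6 outer in \<open>auto simp: I_def intro!: agree_store agree_refl\<close>)
  qed (use b in \<open>auto simp: esq_def\<close>)
  then show ?thesis by (rule wp_mono) (simp_all add: Tref_def add_mult_distrib2)
qed

end

section \<open>Trials and node tests as programs\<close>

lemma mod_leI [simp]: "a \<le> V \<Longrightarrow> a mod b \<le> (V :: nat)"
  using mod_less_eq_dividend[of a b] by linarith

lemma div_leI [simp]: "a \<le> V \<Longrightarrow> a div b \<le> (V :: nat)"
  using div_le_dividend[of a b] by linarith

text \<open>The tentative value is written before \<open>refutation\<close> runs, because
  \<open>val\<close> tests exactly this extension; a refuted value is then overwritten by its
  opposite.\<close>

definition trial_step :: com where
  "trial_step = Seq (Set 12 (Sub (Rg 12) (Const 1)))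
     (Seq (Set 14 (md (md (Rg 16) (Rg 50)) (Add (Rg 12) (Const 1))))
     (Seq (Set 13 (Read 11 (Rg 14)))
     (Seq (Write 11 (Rg 14) (Read 11 (Rg 12)))
     (Seq (Set 16 (Div (Rg 16) (Rg 50)))
     (Seq (Set 15 (md (Rg 16) (Const 2)))
     (Seq (Set 16 (Div (Rg 16) (Const 2)))
     (Seq (Write 10 (Rg 13) (Rg 15))
     (Seq refutation (Cond (Rg 17) (Write 10 (Rg 13) (Sub (Const 1) (Rg 15))) Skip)))))))))"

definition run_trial :: com where
  "run_trial = Seq (While (Rg 12) trial_step) (Seq copy check)"

text \<open>The leading bit of the code \<open>2 ^ i + q\<close> marks the depth: while the shifted
  code exceeds \<open>1\<close>, its last bit is the value of a set variable; from then on all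
  variables are unset.\<close>

definition decode_step :: com where
  "decode_step = Seq (Cond (Sub (Rg 21) (Const 1))
       (Write 10 (Rg 23) (md (Rg 21) (Const 2)))
       (Seq (Write 10 (Rg 23) (Const 2)) (Seq (Write 11 (Rg 12) (Rg 23)) (Set 12 (Add (Rg 12) (Const 1))))))
     (Set 21 (Div (Rg 21) (Const 2)))"

definition decode :: com where
  "decode = Seq (Set 21 (Rg 43)) (Seq (Set 12 (Const 0)) (For 23 (Rg 0) decode_step))"

text \<open>Every node is tested with the same random words from array \<open>30\<close>. Nothing is
  claimed about independence between nodes.\<close>

definition test_node :: com where
  "test_node = Seq (Set 46 (Const 0)) (For 47 (Rg 59)
     (Seq decode (Seq (Set 16 (Read 30 (Rg 47))) (Seq run_trial (Cond (Rg 3) Skip (Set 46 (Const 1)))))))"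

abbreviation trial_regs :: "nat set" where
  "trial_regs \<equiv> {2, 3, 4, 5, 6, 7, 8, 10, 11, 12, 13, 14, 15, 16, 17, 18, 19, 20, 21, 22, 23, 24}"

lemma prefix_bits:
  fixes q :: nat
  assumes "q < 2 ^ i"
  shows "v < i \<Longrightarrow> 2 \<le> (2 ^ i + q) div 2 ^ v"
    "v < i \<Longrightarrow> (2 ^ i + q) div 2 ^ v mod 2 = of_bool (odd (q div 2 ^ v))"
    "i \<le> v \<Longrightarrow> (2 ^ i + q) div 2 ^ v \<le> 1"
proof -
  show "(2 ^ i + q) div 2 ^ v \<le> 1" if "i \<le> v"
  proof -
    have "(2::nat) ^ i \<le> 2 ^ v" using that by (intro power_increasing) auto
    then have "2 ^ i + q < 2 ^ v * 2" using assms by linarith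
    then have "(2 ^ i + q) div 2 ^ v < 2" by (simp add: less_mult_imp_div_less mult.commute)
    then show ?thesis by simp
  qed
  assume v: "v < i"
  have e: "(2::nat) ^ i = 2 ^ v * 2 ^ (i - v)" using v by (simp flip: power_add)
  have d: "(2 ^ i + q) div 2 ^ v = 2 ^ (i - v) + q div 2 ^ v" unfolding e by simp
  have "(2::nat) ^ 1 \<le> 2 ^ (i - v)" using v by (intro power_increasing) auto
  then show "2 \<le> (2 ^ i + q) div 2 ^ v" unfolding d by simp
  have "even ((2::nat) ^ (i - v))" using v by simp
  then show "(2 ^ i + q) div 2 ^ v mod 2 = of_bool (odd (q div 2 ^ v))"
    unfolding d by (simp add: mod_2_eq_odd)
qed

lemma (in machine) wp_SeqWriteI:
  assumes "bnd V s" and "wp c T Q (store x a m s)"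
    and "cok V i" "cok V e" "esq i + esq e \<le> \<kappa>" "aval i s = a" "aval e s = m" "m \<le> V"
  shows "wp (Seq (Write x i e) c) (1 + T) Q s"
  by (rule wp_SeqWrite) (use assms in auto)

context prog begin

lemma rep_upd: "rep \<alpha> a \<Longrightarrow> rep (\<alpha>(x \<mapsto> b)) (a(x := of_bool b))"
  by (simp add: rep_def)

definition Tstep :: nat where "Tstep = Tref + 10"

definition consts_ok :: "state \<Rightarrow> bool" where
  "consts_ok s \<longleftrightarrow> s 0 = inp \<and> s 51 0 = w \<and> s 52 0 = 2 ^ w \<and> s 53 0 = n ^ w"

lemma consts_okD:
  assumes "consts_ok s" shows "s 0 = inp" "s 51 0 = w" "s 52 0 = 2 ^ w" "s 53 0 = n ^ w"
  using assms by (auto simp: consts_ok_def)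

text \<open>The step preserves the outcome of the trial: the new store represents some assignment
  from which the remaining \<open>j\<close> rounds, with the rest of the word, decide as the
  \<open>Suc j\<close> rounds would have done before.\<close>

lemma trial_step_wp:
  assumes b: "bnd V s" and s: "consts_ok s" "rep \<alpha> (s 10)" "s 12 0 = Suc j" "s 50 0 = G"
  shows "wp trial_step Tstep (\<lambda>s'. agree trial_regs s s' \<and> s' 12 0 = j \<and>
    (\<exists>\<alpha>'. rep \<alpha>' (s' 10) \<and> trial G j (s' 11) \<alpha>' (s' 16 0) = trial G (Suc j) (s 11) \<alpha> (s 16 0))) s"
    (is "wp _ _ ?Q s")
proof -
  define r where "r = s 16 0"
  define i where "i = r mod G mod Suc j"
  define x where "x = s 11 i"
  define bt where "bt = odd (r div G)"
  let ?W = "{2, 3, 4, 5, 6, 7, 8, 17, 18, 19, 20, 21, 22, 23, 24} :: nat set"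
  have rest: "wp (Seq refutation (Cond (Rg 17) (Write 10 (Rg 13) (Sub (Const 1) (Rg 15))) Skip)) (Tref + (1 + 1)) ?Q s1"
    if b1: "bnd V s1" and a1: "agree trial_regs s s1" and s1: "s1 12 0 = j" "s1 11 = (s 11)(i := s 11 j)"
      "s1 13 0 = x" "s1 15 0 = of_bool bt" "s1 16 0 = r div G div 2" "s1 10 = (s 10)(x := of_bool bt)" for s1
  proof (rule wp_Seq, rule wp_mono[OF refutation_wp[where \<alpha> = "\<alpha>(x \<mapsto> bt)"] order_refl], goal_cases)
    case 1 show ?case by (rule b1)
  next
    case 3 show ?case unfolding s1(6) by (rule rep_upd) (rule s(2))
  next
    case (7 s2)
    have a2: "agree ?W s1 s2" and s17: "s2 17 0 = of_bool (refut (\<alpha>(x \<mapsto> bt)))" using 7(2) by auto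
    have s2: "s2 12 0 = j" "s2 11 = (s 11)(i := s 11 j)" "s2 13 0 = x" "s2 15 0 = of_bool bt"
      "s2 16 0 = r div G div 2" "s2 10 = (s 10)(x := of_bool bt)"
      using a2 s1 by (auto simp: agree_def simp del: fun_upd_apply)
    have ag: "agree trial_regs s s2" using a1 a2 by (rule agree_trans) auto
    have tr: "trial G j ((s 11)(i := s 11 j)) (\<alpha>(x \<mapsto> val \<alpha> x bt)) (r div G div 2) = trial G (Suc j) (s 11) \<alpha> r"
      by (simp only: trial.simps i_def x_def bt_def)
    show ?case
    proof (intro impI wp_Cond)
      assume "aval (Rg 17) s2 \<noteq> 0"
      then have rf: "val \<alpha> x bt = (\<not> bt)" using s17 by (auto simp: val_def)
      have "rep (\<alpha>(x \<mapsto> \<not> bt)) ((s2 10)(x := 1 - of_bool bt))"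
        using s(2) unfolding s2(6) by (auto simp: rep_def)
      then have "?Q (store 10 x (1 - of_bool bt) s2)"
        using s2 ag tr rf unfolding r_def by (auto intro!: agree_store simp del: fun_upd_apply trial.simps)
      then show "wp (Write 10 (Rg 13) (Sub (Const 1) (Rg 15))) 1 ?Q s2"
        by (intro wp_Write 7(1)) (use s2 in \<open>auto simp: esq_def simp del: trial.simps fun_upd_apply\<close>)
    next
      assume "aval (Rg 17) s2 = 0"
      then have rf: "val \<alpha> x bt = bt" using s17 by (auto simp: val_def)
      have "rep (\<alpha>(x \<mapsto> bt)) (s2 10)" unfolding s2(6) by (rule rep_upd) (rule s(2))
      then have "?Q s2"
        using s2 ag tr rf unfolding r_def by (auto simp del: fun_upd_apply trial.simps)
      then show "wp Skip 1 ?Q s2" by (rule wp_Skip[OF 7(1)])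
    qed (use 7(1) in \<open>auto simp: esq_def\<close>)
  qed (use a1 consts_okD[OF s(1)] in \<open>auto simp: agree_def\<close>)
  have i_le: "s 11 i \<le> V" "s 11 j \<le> V" "r \<le> V" "Suc j \<le> V" using bndD[OF b] bndD[OF b, of 12 0] s(3) by (auto simp: r_def)
  let ?S1 = "store 12 0 j s" let ?S2 = "store 14 0 i ?S1" let ?S3 = "store 13 0 x ?S2"
  let ?S4 = "store 11 i (s 11 j) ?S3" let ?S5 = "store 16 0 (r div G) ?S4"
  let ?S6 = "store 15 0 (of_bool bt) ?S5" let ?S7 = "store 16 0 (r div G div 2) ?S6"
  let ?S8 = "store 10 x (of_bool bt) ?S7"
  have le: "i \<le> V" "x \<le> V" "r div G \<le> V" "r div G div 2 \<le> V" "of_bool bt \<le> V"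
    using i_le by (auto simp: i_def x_def)
  have b1: "bnd V ?S1" by (rule bnd_store[OF b]) (use i_le in simp)
  have b2: "bnd V ?S2" by (rule bnd_store[OF b1 le(1)])
  have b3: "bnd V ?S3" by (rule bnd_store[OF b2 le(2)])
  have b4: "bnd V ?S4" by (rule bnd_store[OF b3 i_le(2)])
  have b5: "bnd V ?S5" by (rule bnd_store[OF b4 le(3)])
  have b6: "bnd V ?S6" by (rule bnd_store[OF b5 le(5)])
  have b7: "bnd V ?S7" by (rule bnd_store[OF b6 le(4)])
  have b8: "bnd V ?S8" by (rule bnd_store[OF b7 le(5)])
  let ?c0 = "Seq refutation (Cond (Rg 17) (Write 10 (Rg 13) (Sub (Const 1) (Rg 15))) Skip)"
  have w8: "wp ?c0 (Tref + (1 + 1)) ?Q ?S8"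
    by (rule rest[OF b8]) (auto intro!: agree_store agree_refl)
  have w7: "wp (Seq (Write 10 (Rg 13) (Rg 15)) ?c0) (1 + (Tref + (1 + 1))) ?Q ?S7" (is "wp ?c1 ?t1 _ _")
    by (rule wp_SeqWriteI[OF b7 w8]) (use le in \<open>simp_all add: esq_def\<close>)
  have w6: "wp (Seq (Set 16 (Div (Rg 16) (Const 2))) ?c1) (1 + ?t1) ?Q ?S6" (is "wp ?c2 ?t2 _ _")
    by (rule wp_SeqWriteI[OF b6 w7]) (use le in \<open>simp_all add: esq_def\<close>)
  have w5: "wp (Seq (Set 15 (md (Rg 16) (Const 2))) ?c2) (1 + ?t2) ?Q ?S5" (is "wp ?c3 ?t3 _ _")
    by (rule wp_SeqWriteI[OF b5 w6]) (use le in \<open>simp_all add: esq_def bt_def mod_2_eq_odd\<close>)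
  have w4: "wp (Seq (Set 16 (Div (Rg 16) (Rg 50))) ?c3) (1 + ?t3) ?Q ?S4" (is "wp ?c4 ?t4 _ _")
    by (rule wp_SeqWriteI[OF b4 w5]) (use le s in \<open>simp_all add: esq_def r_def\<close>)
  have w3: "wp (Seq (Write 11 (Rg 14) (Read 11 (Rg 12))) ?c4) (1 + ?t4) ?Q ?S3" (is "wp ?c5 ?t5 _ _")
    by (rule wp_SeqWriteI[OF b3 w4]) (use b in \<open>simp_all add: esq_def\<close>)
  have w2: "wp (Seq (Set 13 (Read 11 (Rg 14))) ?c5) (1 + ?t5) ?Q ?S2" (is "wp ?c6 ?t6 _ _")
    by (rule wp_SeqWriteI[OF b2 w3]) (use b in \<open>simp_all add: esq_def x_def\<close>)
  have w1: "wp (Seq (Set 14 (md (md (Rg 16) (Rg 50)) (Add (Rg 12) (Const 1)))) ?c6) (1 + ?t6) ?Q ?S1" (is "wp ?c7 ?t7 _ _")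
    by (rule wp_SeqWriteI[OF b1 w2]) (use le s in \<open>simp_all add: esq_def i_def r_def\<close>)
  have "wp trial_step (1 + ?t7) ?Q s"
    unfolding trial_step_def by (rule wp_SeqWriteI[OF b w1]) (use i_le s in \<open>simp_all add: esq_def\<close>)
  then show ?thesis by (rule wp_mono) (simp_all add: Tstep_def)
qed

definition Ttrial :: nat where "Ttrial = n * (Tstep + 1) + n * 3 + Tcheck + 3"

lemma run_trial_wp:
  assumes b: "bnd V s" and s: "consts_ok s" "rep \<alpha> (s 10)" "s 12 0 = j" "s 50 0 = G" "j \<le> n"
  shows "wp run_trial Ttrial (\<lambda>s'. agree trial_regs s s' \<and>
     s' 3 0 = of_bool (\<not> trial G j (s 11) \<alpha> (s 16 0))) s"
proof -
  define Inv where "Inv m s' \<longleftrightarrow> agree trial_regs s s' \<and> s' 12 0 = m \<and>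
    (\<exists>\<alpha>'. rep \<alpha>' (s' 10) \<and> trial G m (s' 11) \<alpha>' (s' 16 0) = trial G j (s 11) \<alpha> (s 16 0))" for m s'
  have loop: "wp (While (Rg 12) trial_step) (j * (Tstep + 1) + 1) (Inv 0) s"
  proof (rule wp_While[where Inv = Inv])
    show "Inv j s" using s by (auto simp: Inv_def intro: agree_refl)
    fix m s' assume I: "Inv m s'" and b': "bnd V s'" and g: "aval (Rg 12) s' \<noteq> 0"
    then obtain m' where m: "m = Suc m'" by (cases m) (auto simp: Inv_def)
    obtain \<alpha>' where \<alpha>': "rep \<alpha>' (s' 10)" "trial G m (s' 11) \<alpha>' (s' 16 0) = trial G j (s 11) \<alpha> (s 16 0)"
      using I by (auto simp: Inv_def)
    have ag: "agree trial_regs s s'" using I by (simp add: Inv_def)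
    have "wp trial_step Tstep (Inv m') s'"
    proof (rule wp_mono[OF trial_step_wp[OF b' _ \<alpha>'(1)] order_refl])
      show "consts_ok s'" "s' 50 0 = G" using ag s by (auto simp: consts_ok_def agree_def)
      show "s' 12 0 = Suc m'" using I m by (simp add: Inv_def)
      fix t assume t: "agree trial_regs s' t \<and> t 12 0 = m' \<and>
        (\<exists>\<beta>. rep \<beta> (t 10) \<and> trial G m' (t 11) \<beta> (t 16 0) = trial G (Suc m') (s' 11) \<alpha>' (s' 16 0))"
      moreover have "agree trial_regs s t" by (rule agree_trans[OF ag]) (use t in auto)
      ultimately show "Inv m' t" using \<alpha>'(2) m unfolding Inv_def by (simp del: trial.simps)
    qed
    then show "0 < m \<and> wp trial_step Tstep (Inv (m - 1)) s'" using m by simp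
  next
    fix m s' assume "Inv m s'" "aval (Rg 12) s' = 0"
    then show "Inv 0 s'" by (auto simp: Inv_def)
  qed (use b in \<open>auto simp: esq_def\<close>)
  have "wp run_trial ((j * (Tstep + 1) + 1) + ((n * 3 + 2) + Tcheck)) (\<lambda>s'. agree trial_regs s s' \<and>
     s' 3 0 = of_bool (\<not> trial G j (s 11) \<alpha> (s 16 0))) s"
    unfolding run_trial_def
  proof (rule wp_Seq, rule wp_mono[OF loop order_refl], rule impI)
    fix s1 assume b1: "bnd V s1" and I: "Inv 0 s1"
    then obtain \<beta> where \<beta>: "rep \<beta> (s1 10)" "(\<not> falsified \<beta>) = trial G j (s 11) \<alpha> (s 16 0)"
      by (auto simp: Inv_def)
    have ag: "agree trial_regs s s1" using I by (simp add: Inv_def)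
    have X: "s1 0 = inp" using ag consts_okD(1)[OF s(1)] by (simp add: agree_def)
    show "wp (Seq copy check) ((n * 3 + 2) + Tcheck) (\<lambda>s'. agree trial_regs s s' \<and>
     s' 3 0 = of_bool (\<not> trial G j (s 11) \<alpha> (s 16 0))) s1"
    proof (rule wp_Seq, rule wp_mono[OF copy_wp[OF b1 X \<beta>(1)] order_refl], rule impI)
      fix s2 assume b2: "bnd V s2" and s2: "agree {2, 23} s1 s2 \<and> rep \<beta> (s2 2)"
      have ag2: "agree trial_regs s s2" by (rule agree_trans[OF ag]) (use s2 in auto)
      have X2: "s2 0 = inp" using ag2 consts_okD(1)[OF s(1)] by (simp add: agree_def)
      show "wp check Tcheck (\<lambda>s'. agree trial_regs s s' \<and>
         s' 3 0 = of_bool (\<not> trial G j (s 11) \<alpha> (s 16 0))) s2"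
        by (rule wp_mono[OF check_rep_wp[where \<alpha> = \<beta>, OF b2 X2] order_refl])
           (use s2 \<beta>(2) agree_trans[OF ag2] in auto)
    qed
  qed
  note L = this
  have le: "j * (Tstep + 1) \<le> n * (Tstep + 1)" using s(5) by (rule mult_right_mono) simp
  have "j * (Tstep + 1) + 1 + (n * 3 + 2 + Tcheck) \<le> Ttrial" using le unfolding Ttrial_def by linarith
  then show ?thesis by (rule wp_mono[OF L])
qed

definition Tdecode :: nat where "Tdecode = n * 7 + 4"

lemma decode_wp:
  assumes b: "bnd V s" and s: "s 0 = inp" "s 43 0 = 2 ^ i + q" and q: "q < 2 ^ i" "i \<le> n"
  shows "wp decode Tdecode (\<lambda>s'. agree {10, 11, 12, 21, 23} s s' \<and> rep (node i q) (s' 10) \<and>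
     s' 12 0 = n - i \<and> (\<forall>t<n - i. s' 11 t = i + t)) s"
proof -
  let ?W = "{10, 11, 12, 21, 23} :: nat set"
  let ?u = "2 ^ i + q"
  define I where "I v s' \<longleftrightarrow> agree ?W s s' \<and> s' 21 0 = ?u div 2 ^ v \<and> s' 12 0 = v - i \<and>
    (\<forall>v'<v. s' 10 v' = code (node i q v')) \<and> (\<forall>t<v - i. s' 11 t = i + t)" for v s'
  have step: "wp decode_step ((1 + (1 + (1 + 1))) + 1) (\<lambda>s'. s' 23 0 = v \<and> I (Suc v) (store 23 0 (Suc v) s')) s'"
    if I: "I v s'" and b': "bnd V s'" and v: "v < n" "s' 23 0 = v" for v s'
    unfolding decode_step_def
  proof (rule wp_Seq, rule wp_Cond)
    have dv: "?u div 2 ^ v div 2 = ?u div 2 ^ Suc v" by (simp only: power_Suc2 div_mult2_eq)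
    have y: "s' 21 0 = ?u div 2 ^ v" "s' 12 0 = v - i" using I by (auto simp: I_def)
    have nV: "n \<le> V" by (rule n_le[OF b s(1)])
    {
      assume g: "aval (Sub (Rg 21) (Const 1)) s' \<noteq> 0"
      have vi: "v < i" using g y prefix_bits(3)[OF q(1), of v] by (cases "v < i") auto
      have "wp (Write 10 (Rg 23) (md (Rg 21) (Const 2))) 1 (\<lambda>s'. bnd V s' \<longrightarrow>
        wp (Set 21 (Div (Rg 21) (Const 2))) 1 (\<lambda>s'. s' 23 0 = v \<and> I (Suc v) (store 23 0 (Suc v) s')) s') s'"
      proof (rule wp_Write, goal_cases)
        case 6
        show ?case
          by (intro impI wp_Write)
            (use 6 y I v vi dv prefix_bits(2)[OF q(1) vi] b' bndD[OF b', of 21 0] in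
              \<open>auto simp: esq_def I_def less_Suc_eq node_def simp del: power_Suc intro!: agree_store\<close>)
      qed (use b' y bndD[OF b', of 21 0] in \<open>auto simp: esq_def\<close>)
      then show "wp (Write 10 (Rg 23) (md (Rg 21) (Const 2))) (1 + (1 + 1)) (\<lambda>s'. bnd V s' \<longrightarrow>
        wp (Set 21 (Div (Rg 21) (Const 2))) 1 (\<lambda>s'. s' 23 0 = v \<and> I (Suc v) (store 23 0 (Suc v) s')) s') s'"
        by (rule wp_mono) auto
    next
      assume g: "aval (Sub (Rg 21) (Const 1)) s' = 0"
      have vi: "i \<le> v" using g y prefix_bits(1)[OF q(1), of v] by (cases "v < i") auto
      then have sd: "Suc v - i = Suc (v - i)" by simp
      show "wp (Seq (Write 10 (Rg 23) (Const 2)) (Seq (Write 11 (Rg 12) (Rg 23)) (Set 12 (Add (Rg 12) (Const 1)))))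
        (1 + (1 + 1)) (\<lambda>s'. bnd V s' \<longrightarrow>
        wp (Set 21 (Div (Rg 21) (Const 2))) 1 (\<lambda>s'. s' 23 0 = v \<and> I (Suc v) (store 23 0 (Suc v) s')) s') s'"
      proof (intro wp_SeqWrite wp_Write, goal_cases)
        case 16
        show ?case
          by (intro impI wp_Write)
            (use 16 y I v vi dv sd b' bndD[OF b', of 21 0] in
              \<open>auto simp: esq_def I_def less_Suc_eq node_def simp del: power_Suc intro!: agree_store\<close>)
      qed (use b' y v nV in \<open>auto simp: esq_def\<close>)
    }
  qed (use b' in \<open>auto simp: esq_def\<close>)
  have "wp decode (1 + (1 + (n * (((1 + (1 + (1 + 1))) + 1) + 2) + 2))) (I n) s"
    unfolding decode_def
  proof (intro wp_SeqWrite, goal_cases)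
    case 11
    show ?case
    proof (rule wp_For[where Inv = I and N = n])
      show "n \<le> V" by (rule n_le[OF b s(1)])
      show "aval (Rg 0) s' = n" if "I v s'" for v s' using that s by (auto simp: I_def agree_def inp_header)
    qed (use step 11 s in \<open>auto simp: I_def intro!: agree_store agree_refl\<close>)
  qed (use b s bndD[OF b, of 43 0] in \<open>auto simp: esq_def\<close>)
  then show ?thesis by (rule wp_mono) (auto simp: Tdecode_def I_def rep_def)
qed

definition Ttest :: "nat \<Rightarrow> nat" where "Ttest R = R * (Tdecode + Ttrial + 5) + 3"

lemma test_node_wp:
  assumes b: "bnd V s" and s: "consts_ok s" "s 50 0 = G" "s 59 0 = R" "s 43 0 = 2 ^ i + q"
    and q: "q < 2 ^ i" "i \<le> n"
  shows "wp test_node (Ttest R) (\<lambda>s'. agree (trial_regs \<union> {46, 47}) s s' \<and>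
     s' 46 0 = of_bool (\<exists>j<R. node_trial G i q (s 30 j))) s"
proof -
  let ?W = "trial_regs \<union> {46, 47}"
  define I where "I j s' \<longleftrightarrow> agree ?W s s' \<and> s' 46 0 = of_bool (\<exists>j'<j. node_trial G i q (s 30 j'))" for j s'
  let ?body = "Seq decode (Seq (Set 16 (Read 30 (Rg 47))) (Seq run_trial (Cond (Rg 3) Skip (Set 46 (Const 1)))))"
  have step: "wp ?body (Tdecode + (1 + (Ttrial + (1 + 1)))) (\<lambda>s'. s' 47 0 = j \<and> I (Suc j) (store 47 0 (Suc j) s')) s1"
    if I: "I j s1" and b1: "bnd V s1" and j: "j < R" "s1 47 0 = j" for j s1
  proof -
    have s1: "s1 0 = inp" "s1 43 0 = 2 ^ i + q" "s1 30 = s 30" "s1 50 0 = G" "consts_ok s1"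
      using I s by (auto simp: I_def agree_def consts_ok_def)
    show ?thesis
    proof (rule wp_Seq, rule wp_mono[OF decode_wp[OF b1 s1(1,2) q] order_refl], rule impI)
      fix s2 assume b2: "bnd V s2" and s2: "agree {10, 11, 12, 21, 23} s1 s2 \<and> rep (node i q) (s2 10) \<and>
        s2 12 0 = n - i \<and> (\<forall>t<n - i. s2 11 t = i + t)"
      show "wp (Seq (Set 16 (Read 30 (Rg 47))) (Seq run_trial (Cond (Rg 3) Skip (Set 46 (Const 1)))))
        (1 + (Ttrial + (1 + 1))) (\<lambda>s'. s' 47 0 = j \<and> I (Suc j) (store 47 0 (Suc j) s')) s2"
      proof (rule wp_SeqWrite, goal_cases)
        case 6
        define s3 where "s3 = store 16 0 (s 30 j) s2"
        have s3: "agree {10, 11, 12, 16, 21, 23} s1 s3" "rep (node i q) (s3 10)" "s3 12 0 = n - i"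
          "\<forall>t<n - i. s3 11 t = i + t" "s3 16 0 = s 30 j"
          using s2 by (auto simp: s3_def agree_def store_def)
        have s3': "consts_ok s3" "s3 50 0 = G" "s3 47 0 = j" using s3(1) s1 j by (auto simp: agree_def consts_ok_def)
        have e3: "store 16 (aval (Const 0) s2) (aval (Read 30 (Rg 47)) s2) s2 = s3"
          using s2 s1 j by (auto simp: s3_def agree_def)
        have b3: "bnd V s3" using 6 unfolding e3 .
        have tr: "trial G (n - i) (s3 11) (node i q) (s3 16 0) = node_trial G i q (s 30 j)"
          unfolding node_trial_def s3(5) by (rule trial_cong) (use s3(4) in auto)
        show ?case unfolding e3
        proof (rule wp_Seq, rule wp_mono[OF run_trial_wp[OF b3 s3'(1) s3(2,3) s3'(2)] order_refl])
          show "n - i \<le> n" by simp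
          fix s4 assume b4: "bnd V s4" and "agree trial_regs s3 s4 \<and>
            s4 3 0 = of_bool (\<not> trial G (n - i) (s3 11) (node i q) (s3 16 0))"
          then have s4: "agree trial_regs s3 s4" "s4 3 0 = of_bool (\<not> node_trial G i q (s 30 j))"
            using tr by auto
          have "agree trial_regs s1 s3" using s3(1) by (auto simp: agree_def)
          then have ag: "agree ?W s s4" using I s4(1) unfolding I_def agree_def by auto
          have "s4 46 0 = s1 46 0" "s4 47 0 = j" using s4(1) s3(1) s3'(3) by (auto simp: agree_def)
          then have s46: "s4 46 0 = of_bool (\<exists>j'<j. node_trial G i q (s 30 j'))" "s4 47 0 = j"
            using I by (auto simp: I_def)
          show "bnd V s4 \<longrightarrow> wp (Cond (Rg 3) Skip (Set 46 (Const 1))) (1 + 1)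
            (\<lambda>s'. s' 47 0 = j \<and> I (Suc j) (store 47 0 (Suc j) s')) s4"
          proof (intro impI wp_Cond)
            assume "aval (Rg 3) s4 \<noteq> 0"
            then show "wp Skip 1 (\<lambda>s'. s' 47 0 = j \<and> I (Suc j) (store 47 0 (Suc j) s')) s4"
              using ag s46 s4(2) by (intro wp_Skip b4) (auto simp: I_def less_Suc_eq intro!: agree_store split: if_splits)
          next
            assume "aval (Rg 3) s4 = 0"
            then show "wp (Set 46 (Const 1)) 1 (\<lambda>s'. s' 47 0 = j \<and> I (Suc j) (store 47 0 (Suc j) s')) s4"
              using ag s46 s4(2) b4 by (intro wp_Write) (auto simp: esq_def I_def less_Suc_eq intro!: agree_store split: if_splits)
          qed (use b4 in \<open>auto simp: esq_def\<close>)
        qed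
      qed (use b2 in \<open>auto simp: esq_def\<close>)
    qed
  qed
  have "wp test_node (1 + (R * ((Tdecode + (1 + (Ttrial + (1 + 1)))) + 2) + 2)) (I R) s"
    unfolding test_node_def
  proof (rule wp_SeqWrite, goal_cases)
    case 6
    show ?case
    proof (rule wp_For[where Inv = I and N = R])
      show "R \<le> V" using bndD[OF b, of 59 0] s by simp
      show "aval (Rg 59) s' = R" if "I j s'" for j s' using that s by (auto simp: I_def agree_def)
    qed (use step 6 in \<open>auto simp: I_def intro!: agree_store agree_refl\<close>)
  qed (use b in \<open>auto simp: esq_def\<close>)
  then show ?thesis by (rule wp_mono) (simp_all add: Ttest_def I_def algebra_simps)
qed

end

section \<open>Depth-first search, sampling, and their combination\<close>

definition push :: com where
  "push = Seq (Write 40 (Rg 42) (Add (Rg 43) (Rg 44)))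
     (Seq (Write 41 (Rg 42) (Mul (Const 2) (Rg 44)))
     (Seq (Set 42 (Add (Rg 42) (Const 1)))
     (Seq (Write 40 (Rg 42) (Add (Rg 43) (Mul (Const 2) (Rg 44))))
     (Seq (Write 41 (Rg 42) (Mul (Const 2) (Rg 44)))
     (Set 42 (Add (Rg 42) (Const 1)))))))"

definition search_step :: com where
  "search_step = Seq (Set 42 (Sub (Rg 42) (Const 1)))
     (Seq (Set 43 (Read 40 (Rg 42)))
     (Seq (Set 44 (Read 41 (Rg 42)))
     (Seq test_node
     (Seq (Cond (Rg 46) (Cond (Sub (Rg 50) (Rg 44)) push (Set 48 (Add (Rg 48) (Const 1)))) Skip)
     (Set 45 (Add (Rg 45) (Const 1)))))))"

text \<open>The product in the guard vanishes if the stack is empty or the budget is used up. The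
  stack height left in array \<open>42\<close> afterwards tells whether the search was
  complete.\<close>

definition search :: com where
  "search = Seq (For 42 (Rg 58) (Seq (Write 40 (Rg 42) (Add (Rg 58) (Rg 42))) (Write 41 (Rg 42) (Rg 58))))
     (Seq (Set 45 (Const 0)) (Seq (Set 48 (Const 0))
     (While (Mul (Rg 42) (Sub (Rg 60) (Rg 45))) search_step)))"

definition load_step :: com where
  "load_step = Seq (Write 2 (Rg 23) (md (Rg 21) (Const 2))) (Set 21 (Div (Rg 21) (Const 2)))"

definition sample :: com where
  "sample = Seq (Set 32 (Const 0)) (Seq
     (For 33 (Rg 31) (Seq (Set 21 (Read 30 (Rg 33))) (Seq (For 23 (Rg 0) load_step)
        (Seq check (Cond (Rg 3) Skip (Set 32 (Add (Rg 32) (Const 1))))))))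
     (Seq (Write 1 (Const 0) (Mul (Rg 32) (Rg 50))) (Write 1 (Const 1) (Rg 31))))"

definition count :: com where
  "count = Seq search (Cond (Rg 42) sample (Seq (Write 1 (Const 0) (Rg 48)) (Write 1 (Const 1) (Const 1))))"

context prog begin

text \<open>The event on which the search counts correctly. The converse implication, that a passed
  test implies a solution, holds for all words by \<open>node_trial_sound\<close>.\<close>

definition good :: "nat \<Rightarrow> nat \<Rightarrow> nat \<Rightarrow> (nat \<Rightarrow> nat) \<Rightarrow> bool" where
  "good G i0 R \<omega> \<longleftrightarrow> (\<forall>i q. i0 \<le> i \<longrightarrow> i \<le> n \<longrightarrow> q < 2 ^ i \<longrightarrow> nsol i q > 0 \<longrightarrow> (\<exists>j<R. node_trial G i q (\<omega> j)))"

text \<open>\<open>1\<close> for the visit to the node itself and, for each solution below it,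
  \<open>2\<close> per level, since a live node causes two visits on the next level.\<close>

definition pot :: "nat \<Rightarrow> nat \<Rightarrow> nat" where
  "pot i q = 1 + 2 * (n - i + 1) * nsol i q"

lemma pot_split:
  assumes "q < 2 ^ i" "i < n" "0 < nsol i q"
  shows "1 + (pot (Suc i) q + pot (Suc i) (q + 2 ^ i)) \<le> pot i q"
proof -
  let ?a = "nsol (Suc i) q" and ?b = "nsol (Suc i) (q + 2 ^ i)"
  obtain d where d: "n - i = Suc d" "n - Suc i = d" using assms(2) by (metis Suc_diff_Suc)
  have ab: "nsol i q = ?a + ?b" by (rule nsol_split[OF assms(1,2)])
  then have "1 \<le> ?a + ?b" using assms(3) by linarith
  then show ?thesis unfolding pot_def ab d by (simp add: algebra_simps)
qed

text \<open>The potential in the invariant bounds the iterations: a live inner node costs more than its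
  two children, since it contains a solution.\<close>

definition search_inv :: "nat \<Rightarrow> nat \<Rightarrow> nat \<Rightarrow> nat \<Rightarrow> state \<Rightarrow> nat \<Rightarrow> state \<Rightarrow> bool" where
  "search_inv G i0 R cap s0 m s \<longleftrightarrow>
     agree (trial_regs \<union> {40, 41, 42, 43, 44, 45, 46, 47, 48}) s0 s \<and> s 45 0 + m = cap \<and> s 42 0 \<le> 2 ^ i0 + s 45 0 \<and> s 48 0 \<le> s 45 0 \<and>
     (\<exists>fi fq. (\<forall>j<s 42 0. s 40 j = 2 ^ fi j + fq j \<and> s 41 j = 2 ^ fi j \<and> fq j < 2 ^ fi j \<and> i0 \<le> fi j \<and> fi j \<le> n) \<and>
       (good G i0 R (s0 30) \<longrightarrow> s 48 0 + (\<Sum>j<s 42 0. nsol (fi j) (fq j)) = num_sat n F \<and>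
         s 45 0 + (\<Sum>j<s 42 0. pot (fi j) (fq j)) \<le> 2 ^ i0 + 2 * (n + 1) * num_sat n F))"

lemma search_invI:
  assumes "agree (trial_regs \<union> {40, 41, 42, 43, 44, 45, 46, 47, 48}) s0 s" "s 45 0 + m = cap"
    "s 42 0 \<le> 2 ^ i0 + s 45 0" "s 48 0 \<le> s 45 0"
    "\<forall>j<s 42 0. s 40 j = 2 ^ fi j + fq j \<and> s 41 j = 2 ^ fi j \<and> fq j < 2 ^ fi j \<and> i0 \<le> fi j \<and> fi j \<le> n"
    "good G i0 R (s0 30) \<longrightarrow> s 48 0 + (\<Sum>j<s 42 0. nsol (fi j) (fq j)) = num_sat n F \<and>
         s 45 0 + (\<Sum>j<s 42 0. pot (fi j) (fq j)) \<le> 2 ^ i0 + 2 * (n + 1) * num_sat n F"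
  shows "search_inv G i0 R cap s0 m s"
  unfolding search_inv_def using assms by blast

text \<open>For \<open>u = 2 ^ i + q\<close> and \<open>pw = 2 ^ i\<close> the two codes written are
  \<open>2 ^ Suc i + q\<close> and \<open>2 ^ Suc i + (q + 2 ^ i)\<close>, which are the children of
  the node.\<close>

lemma push_wp:
  assumes b: "bnd V s" and s: "s 43 0 = u" "s 44 0 = pw" "s 42 0 = t" and le: "u + 2 * pw \<le> V" "t + 2 \<le> V"
  shows "wp push 6 (\<lambda>s'. s' = store 42 0 (t + 2) (store 41 (t + 1) (2 * pw) (store 40 (t + 1) (u + 2 * pw)
    (store 42 0 (t + 1) (store 41 t (2 * pw) (store 40 t (u + pw) s)))))) s"
    (is "wp _ _ ?Q _")
proof -
  let ?S1 = "store 40 t (u + pw) s" let ?S2 = "store 41 t (2 * pw) ?S1" let ?S3 = "store 42 0 (t + 1) ?S2"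
  let ?S4 = "store 40 (t + 1) (u + 2 * pw) ?S3" let ?S5 = "store 41 (t + 1) (2 * pw) ?S4"
  have l: "u + pw \<le> V" "2 * pw \<le> V" "t + 1 \<le> V" using le by auto
  have b1: "bnd V ?S1" by (rule bnd_store[OF b l(1)])
  have b2: "bnd V ?S2" by (rule bnd_store[OF b1 l(2)])
  have b3: "bnd V ?S3" by (rule bnd_store[OF b2 l(3)])
  have b4: "bnd V ?S4" by (rule bnd_store[OF b3 le(1)])
  have b5: "bnd V ?S5" by (rule bnd_store[OF b4 l(2)])
  have w5: "wp (Set 42 (Add (Rg 42) (Const 1))) 1 ?Q ?S5"
    by (rule wp_Write[OF b5]) (use le in \<open>simp_all add: esq_def\<close>)
  have w4: "wp (Seq (Write 41 (Rg 42) (Mul (Const 2) (Rg 44))) (Set 42 (Add (Rg 42) (Const 1)))) (1 + 1) ?Q ?S4" (is "wp ?c4 ?t4 _ _")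
    by (rule wp_SeqWriteI[OF b4 w5]) (use le s in \<open>simp_all add: esq_def\<close>)
  have w3: "wp (Seq (Write 40 (Rg 42) (Add (Rg 43) (Mul (Const 2) (Rg 44)))) ?c4) (1 + ?t4) ?Q ?S3" (is "wp ?c3 ?t3 _ _")
    by (rule wp_SeqWriteI[OF b3 w4]) (use le s in \<open>simp_all add: esq_def\<close>)
  have w2: "wp (Seq (Set 42 (Add (Rg 42) (Const 1))) ?c3) (1 + ?t3) ?Q ?S2" (is "wp ?c2 ?t2 _ _")
    by (rule wp_SeqWriteI[OF b2 w3]) (use le s in \<open>simp_all add: esq_def\<close>)
  have w1: "wp (Seq (Write 41 (Rg 42) (Mul (Const 2) (Rg 44))) ?c2) (1 + ?t2) ?Q ?S1" (is "wp ?c1 ?t1 _ _")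
    by (rule wp_SeqWriteI[OF b1 w2]) (use le s in \<open>simp_all add: esq_def\<close>)
  have "wp push (1 + ?t1) ?Q s"
    unfolding push_def by (rule wp_SeqWriteI[OF b w1]) (use le s in \<open>simp_all add: esq_def\<close>)
  then show ?thesis by (rule wp_mono) simp_all
qed

text \<open>A node that fails the test is dropped, a live leaf raises the count, and a live inner
  node is replaced by its children. Dropping loses no solutions only under \<open>good\<close>, so
  the counting part of the invariant is conditional; the part on the shape and height of the stack
  is not, because the bounds on time and stored numbers must hold for all coin flips.\<close>

lemma search_step_wp:
  assumes I: "search_inv G i0 R cap s0 (Suc m) s" and b: "bnd V s" and t: "s 42 0 = Suc t"
    and c: "consts_ok s0" "s0 50 0 = 2 ^ n" "G = 2 ^ n" "s0 59 0 = R"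
    and V4: "2 ^ n * 4 \<le> V" and Vc: "2 ^ i0 + cap + 2 \<le> V"
  shows "wp search_step (Ttest R + 14) (search_inv G i0 R cap s0 m) s"
proof -
  let ?W = "trial_regs \<union> {40, 41, 42, 43, 44, 45, 46, 47, 48}"
  obtain fi fq where f: "\<And>j. j < s 42 0 \<Longrightarrow> s 40 j = 2 ^ fi j + fq j \<and> s 41 j = 2 ^ fi j \<and> fq j < 2 ^ fi j \<and> i0 \<le> fi j \<and> fi j \<le> n"
    and gd: "good G i0 R (s0 30) \<Longrightarrow> s 48 0 + (\<Sum>j<s 42 0. nsol (fi j) (fq j)) = num_sat n F \<and>
         s 45 0 + (\<Sum>j<s 42 0. pot (fi j) (fq j)) \<le> 2 ^ i0 + 2 * (n + 1) * num_sat n F"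
    and ag: "agree ?W s0 s" "s 45 0 + Suc m = cap" "s 42 0 \<le> 2 ^ i0 + s 45 0" "s 48 0 \<le> s 45 0"
    using I unfolding search_inv_def by blast
  define i q where "i = fi t" and "q = fq t"
  have iq: "s 40 t = 2 ^ i + q" "s 41 t = 2 ^ i" "q < 2 ^ i" "i0 \<le> i" "i \<le> n"
    using f[of t] t by (auto simp: i_def q_def)
  define live where "live \<longleftrightarrow> (\<exists>j<R. node_trial G i q (s0 30 j))"
  have live1: "live \<Longrightarrow> 0 < nsol i q" using node_trial_sound[OF iq(5)] by (auto simp: live_def)
  have live2: "good G i0 R (s0 30) \<Longrightarrow> \<not> live \<Longrightarrow> nsol i q = 0"
    using iq unfolding good_def live_def by blast
  have gd': "good G i0 R (s0 30) \<Longrightarrow> s 48 0 + nsol i q + (\<Sum>j<t. nsol (fi j) (fq j)) = num_sat n F \<and>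
         s 45 0 + pot i q + (\<Sum>j<t. pot (fi j) (fq j)) \<le> 2 ^ i0 + 2 * (n + 1) * num_sat n F"
    using gd by (simp add: t i_def q_def)
  have p2: "(2::nat) ^ i \<le> 2 ^ n" using iq(5) by (intro power_increasing) auto
  let ?S1 = "store 42 0 t s" let ?S2 = "store 43 0 (2 ^ i + q) ?S1" let ?S3 = "store 44 0 (2 ^ i) ?S2"
  have le: "t \<le> V" "2 ^ i + q \<le> V" "2 ^ i \<le> V" using bndD[OF b, of 42 0] bndD[OF b, of 40 t] bndD[OF b, of 41 t] t iq by auto
  have b1: "bnd V ?S1" by (rule bnd_store[OF b le(1)])
  have b2: "bnd V ?S2" by (rule bnd_store[OF b1 le(2)])
  have b3: "bnd V ?S3" by (rule bnd_store[OF b2 le(3)])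
  let ?inc = "Set 45 (Add (Rg 45) (Const 1))"
  let ?cond = "Cond (Rg 46) (Cond (Sub (Rg 50) (Rg 44)) push (Set 48 (Add (Rg 48) (Const 1)))) Skip"
  have it: "s 45 0 < cap" using ag(2) by simp
  have main: "wp (Seq ?cond ?inc) ((1 + (1 + 6)) + 1) (search_inv G i0 R cap s0 m) s2"
    if b': "bnd V s2" and a2: "agree (trial_regs \<union> {46, 47}) ?S3 s2" and ok: "s2 46 0 = of_bool live" for s2
  proof -
    have s2: "s2 42 0 = t" "s2 43 0 = 2 ^ i + q" "s2 44 0 = 2 ^ i" "s2 45 0 = s 45 0" "s2 48 0 = s 48 0"
      "s2 40 = s 40" "s2 41 = s 41" "s2 50 0 = 2 ^ n"
      using a2 ag(1) c by (auto simp: agree_def)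
    have ag2: "agree ?W s0 s2" using a2 ag(1) by (auto simp: agree_def)
    have f2: "\<forall>j<t. s 40 j = 2 ^ fi j + fq j \<and> s 41 j = 2 ^ fi j \<and> fq j < 2 ^ fi j \<and> i0 \<le> fi j \<and> fi j \<le> n"
      using f t by auto
    show ?thesis
    proof (rule wp_Seq, rule wp_Cond)
      assume "aval (Rg 46) s2 \<noteq> 0"
      then have live: live using ok by (auto split: if_splits)
      show "wp (Cond (Sub (Rg 50) (Rg 44)) push (Set 48 (Add (Rg 48) (Const 1)))) (1 + 6)
         (\<lambda>s'. bnd V s' \<longrightarrow> wp ?inc 1 (search_inv G i0 R cap s0 m) s') s2"
      proof (rule wp_Cond)
        assume "aval (Sub (Rg 50) (Rg 44)) s2 \<noteq> 0"
        then have "(2::nat) ^ i < 2 ^ n" using s2 by simp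
        then have i_n: "i < n" by (simp add: power_strict_increasing_iff)
        let ?s3 = "store 42 0 (t + 2) (store 41 (t + 1) (2 * 2 ^ i) (store 40 (t + 1) (2 ^ i + q + 2 * 2 ^ i)
            (store 42 0 (t + 1) (store 41 t (2 * 2 ^ i) (store 40 t (2 ^ i + q + 2 ^ i) s2)))))"
        show "wp push 6 (\<lambda>s'. bnd V s' \<longrightarrow> wp ?inc 1 (search_inv G i0 R cap s0 m) s') s2"
        proof (rule wp_mono[OF push_wp[OF b' s2(2,3,1)] order_refl], goal_cases)
          case 1
          have "2 ^ i + q + 2 * 2 ^ i \<le> 4 * 2 ^ i" using iq(3) by linarith
          then show ?case using p2 V4 by linarith
        next
          case 2
          show ?case using ag(2,3) t Vc by linarith
        next
          case (3 s')
          define fi' where "fi' = fi(t := Suc i, t + 1 := Suc i)"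
          define fq' where "fq' = fq(t := q, t + 1 := q + 2 ^ i)"
          have sums: "(\<Sum>j<t + 2. nsol (fi' j) (fq' j)) = (\<Sum>j<t. nsol (fi j) (fq j)) + (nsol (Suc i) q + nsol (Suc i) (q + 2 ^ i))"
            "(\<Sum>j<t + 2. pot (fi' j) (fq' j)) = (\<Sum>j<t. pot (fi j) (fq j)) + (pot (Suc i) q + pot (Suc i) (q + 2 ^ i))"
            by (simp_all add: fi'_def fq'_def)
          have nodes: "\<forall>j<t + 2. ?s3 40 j = 2 ^ fi' j + fq' j \<and> ?s3 41 j = 2 ^ fi' j \<and> fq' j < 2 ^ fi' j \<and> i0 \<le> fi' j \<and> fi' j \<le> n"
          proof (intro allI impI)
            fix j assume "j < t + 2"
            then consider "j < t" | "j = t" | "j = t + 1" by linarith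
            then show "?s3 40 j = 2 ^ fi' j + fq' j \<and> ?s3 41 j = 2 ^ fi' j \<and> fq' j < 2 ^ fi' j \<and> i0 \<le> fi' j \<and> fi' j \<le> n"
            proof cases
              case 1 then show ?thesis using f2 s2(6,7) by (simp add: fi'_def fq'_def)
            next
              case 2 then show ?thesis using iq i_n by (simp add: fi'_def fq'_def)
            next
              case 3 then show ?thesis using iq i_n by (simp add: fi'_def fq'_def)
            qed
          qed
          have "search_inv G i0 R cap s0 m (store 45 0 (Suc (s 45 0)) ?s3)"
            
          proof (rule search_invI[where fi = fi' and fq = fq'], goal_cases)
            case 1 show ?case using ag2 by (auto intro!: agree_store)
          next
            case 5 show ?case using nodes by simp
          next
            case 6
            show ?case
            proof
              assume g: "good G i0 R (s0 30)"
              show "store 45 0 (Suc (s 45 0)) ?s3 48 0 + (\<Sum>j<store 45 0 (Suc (s 45 0)) ?s3 42 0. nsol (fi' j) (fq' j)) = num_sat n F \<and>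
                store 45 0 (Suc (s 45 0)) ?s3 45 0 + (\<Sum>j<store 45 0 (Suc (s 45 0)) ?s3 42 0. pot (fi' j) (fq' j)) \<le> 2 ^ i0 + 2 * (n + 1) * num_sat n F"
                using gd'[OF g] sums nsol_split[OF iq(3) i_n] pot_split[OF iq(3) i_n live1[OF live]] s2(5) by simp
            qed
          qed (use ag(2,3,4) t s2(5) in auto)
          then show ?case using 3 it Vc s2(4)
            by (intro impI wp_Write) (simp_all add: esq_def)
        qed
      next
        assume "aval (Sub (Rg 50) (Rg 44)) s2 = 0"
        then have "(2::nat) ^ n \<le> 2 ^ i" using s2 by simp
        then have i_n: "i = n" using iq(5) by (simp add: power_increasing_iff)
        have n1: "nsol i q = 1" using live1[OF live] nsol_leaf[of q] i_n by (simp split: if_splits)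
        have inv: "search_inv G i0 R cap s0 m (store 45 0 (Suc (s 45 0)) (store 48 0 (Suc (s 48 0)) s2))"
          
        proof (rule search_invI[where fi = fi and fq = fq], goal_cases)
          case 1 show ?case using ag2 by (auto intro!: agree_store)
        next
          case 5 show ?case using f2 s2 by simp
        next
          case 6
          show ?case using gd' s2 n1 by (auto simp: pot_def)
        qed (use ag(2,3,4) t s2 in auto)
        have "wp (Set 48 (Add (Rg 48) (Const 1))) 1 (\<lambda>s'. bnd V s' \<longrightarrow> wp ?inc 1 (search_inv G i0 R cap s0 m) s') s2"
        proof (rule wp_Write[OF b'], goal_cases)
          case 5
          show ?case using inv it Vc s2 5
            by (intro impI wp_Write) (simp_all add: esq_def)
        qed (use s2 it ag(4) Vc in \<open>simp_all add: esq_def\<close>)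
        then show "wp (Set 48 (Add (Rg 48) (Const 1))) 6 (\<lambda>s'. bnd V s' \<longrightarrow> wp ?inc 1 (search_inv G i0 R cap s0 m) s') s2"
          by (rule wp_mono) auto
      qed (use b' in \<open>auto simp: esq_def\<close>)
    next
      assume "aval (Rg 46) s2 = 0"
      then have nl: "\<not> live" using ok by (auto split: if_splits)
      have inv: "search_inv G i0 R cap s0 m (store 45 0 (Suc (s 45 0)) s2)"
        
      proof (rule search_invI[where fi = fi and fq = fq], goal_cases)
        case 1 show ?case using ag2 by (auto intro!: agree_store)
      next
        case 5 show ?case using f2 s2 by simp
      next
        case 6
        show ?case using gd' s2 live2 nl by (auto simp: pot_def)
      qed (use ag(2,3,4) t s2 in auto)
      have "wp Skip 1 (\<lambda>s'. bnd V s' \<longrightarrow> wp ?inc 1 (search_inv G i0 R cap s0 m) s') s2"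
      proof (rule wp_Skip[OF b'], rule impI)
        show "wp ?inc 1 (search_inv G i0 R cap s0 m) s2"
          by (rule wp_Write[OF b']) (use inv it Vc s2 in \<open>simp_all add: esq_def\<close>)
      qed
      then show "wp Skip (1 + 6) (\<lambda>s'. bnd V s' \<longrightarrow> wp ?inc 1 (search_inv G i0 R cap s0 m) s') s2"
        by (rule wp_mono) auto
    qed (use b' in \<open>auto simp: esq_def\<close>)
  qed
  have c3: "consts_ok ?S3" "?S3 50 0 = G" "?S3 59 0 = R" "?S3 43 0 = 2 ^ i + q"
    using ag(1) c by (auto simp: agree_def consts_ok_def)
  have S30: "?S3 30 = s0 30" using ag(1) by (simp add: agree_def)
  have w3: "wp (Seq test_node (Seq ?cond ?inc)) (Ttest R + ((1 + (1 + 6)) + 1)) (search_inv G i0 R cap s0 m) ?S3"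
  proof (rule wp_Seq, rule wp_mono[OF test_node_wp[OF b3 c3 iq(3,5)] order_refl], rule impI)
    fix s2 assume b': "bnd V s2" and "agree (trial_regs \<union> {46, 47}) ?S3 s2 \<and> s2 46 0 = of_bool (\<exists>j<R. node_trial G i q (?S3 30 j))"
    then have "agree (trial_regs \<union> {46, 47}) ?S3 s2" "s2 46 0 = of_bool live" unfolding S30 live_def by auto
    then show "wp (Seq ?cond ?inc) ((1 + (1 + 6)) + 1) (search_inv G i0 R cap s0 m) s2" by (rule main[OF b'])
  qed
  have w2: "wp (Seq (Set 44 (Read 41 (Rg 42))) (Seq test_node (Seq ?cond ?inc))) (1 + (Ttest R + ((1 + (1 + 6)) + 1))) (search_inv G i0 R cap s0 m) ?S2"
    by (rule wp_SeqWriteI[OF b2 w3]) (use iq le in \<open>simp_all add: esq_def\<close>)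
  have w1: "wp (Seq (Set 43 (Read 40 (Rg 42))) (Seq (Set 44 (Read 41 (Rg 42))) (Seq test_node (Seq ?cond ?inc)))) (1 + (1 + (Ttest R + ((1 + (1 + 6)) + 1)))) (search_inv G i0 R cap s0 m) ?S1"
    by (rule wp_SeqWriteI[OF b1 w2]) (use iq le in \<open>simp_all add: esq_def\<close>)
  have "wp search_step (1 + (1 + (1 + (Ttest R + ((1 + (1 + 6)) + 1))))) (search_inv G i0 R cap s0 m) s"
    unfolding search_step_def by (rule wp_SeqWriteI[OF b w1]) (use t le in \<open>simp_all add: esq_def\<close>)
  then show ?thesis by (rule wp_mono) simp_all
qed

text \<open>The initial potential is at most \<open>2 ^ i0 + 2 * (n + 1) * num_sat n F\<close>, and
  the budget is this value with \<open>2 ^ i0\<close> in place of \<open>num_sat n F\<close>. If the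
  budget runs out, a node left on the stack still has positive potential, so there must be more than
  \<open>2 ^ i0\<close> solutions.\<close>

lemma search_wp:
  assumes b: "bnd V s" and c: "consts_ok s" "s 50 0 = 2 ^ n" "s 59 0 = R" "s 58 0 = 2 ^ i0" "s 60 0 = cap"
    and i0: "i0 \<le> n" and cap: "cap = (2 * n + 3) * 2 ^ i0"
    and V4: "2 ^ n * 4 \<le> V" and Vc: "2 ^ i0 + cap + 2 \<le> V"
  shows "wp search (2 ^ i0 * 4 + cap * (Ttest R + 15) + 5)
    (\<lambda>s'. agree (trial_regs \<union> {40, 41, 42, 43, 44, 45, 46, 47, 48}) s s' \<and>
      (good (2 ^ n) i0 R (s 30) \<longrightarrow> (if s' 42 0 = 0 then s' 48 0 = num_sat n F else 2 ^ i0 < num_sat n F))) s"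
    (is "wp _ _ ?Q _")
proof -
  let ?W = "trial_regs \<union> {40, 41, 42, 43, 44, 45, 46, 47, 48}"
  define J where "J j s' \<longleftrightarrow> agree {40, 41, 42} s s' \<and> (\<forall>j'<j. s' 40 j' = 2 ^ i0 + j' \<and> s' 41 j' = 2 ^ i0)" for j s'
  have V0: "2 ^ i0 \<le> V" using Vc by simp
  have init: "wp (For 42 (Rg 58) (Seq (Write 40 (Rg 42) (Add (Rg 58) (Rg 42))) (Write 41 (Rg 42) (Rg 58)))) (2 ^ i0 * ((1 + 1) + 2) + 2)
    (\<lambda>s'. J (2 ^ i0) s' \<and> s' 42 0 = 2 ^ i0) s"
  proof (rule wp_For[where Inv = J and N = "2 ^ i0"])
    show "aval (Rg 58) s' = 2 ^ i0" if "J j s'" for j s' using that c by (auto simp: J_def agree_def)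
    fix j s' assume J: "J j s'" and b': "bnd V s'" and j: "j < 2 ^ i0" "s' 42 0 = j"
    have s': "s' 58 0 = 2 ^ i0" using J c by (auto simp: J_def agree_def)
    have le: "2 ^ i0 + j \<le> V"
    proof -
      have "2 ^ i0 \<le> (2::nat) ^ n" using i0 by (intro power_increasing) auto
      then show ?thesis using j V4 by linarith
    qed
    show "wp (Seq (Write 40 (Rg 42) (Add (Rg 58) (Rg 42))) (Write 41 (Rg 42) (Rg 58))) (1 + 1)
      (\<lambda>s'. s' 42 0 = j \<and> J (Suc j) (store 42 0 (Suc j) s')) s'"
    proof (rule wp_SeqWriteI[OF b'])
      show "wp (Write 41 (Rg 42) (Rg 58)) 1 (\<lambda>s'. s' 42 0 = j \<and> J (Suc j) (store 42 0 (Suc j) s')) (store 40 j (2 ^ i0 + j) s')"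
        by (rule wp_Write[OF bnd_store[OF b' le]])
           (use J s' j V0 in \<open>auto simp: esq_def J_def less_Suc_eq intro!: agree_store\<close>)
    qed (use j s' le in \<open>simp_all add: esq_def\<close>)
  qed (use b c V0 in \<open>auto simp: J_def intro!: agree_store agree_refl\<close>)
  have loop: "wp (While (Mul (Rg 42) (Sub (Rg 60) (Rg 45))) search_step) (cap * ((Ttest R + 14) + 1) + 1) ?Q s1"
    if b1: "bnd V s1" and J: "\<forall>j'<2 ^ i0. s1 40 j' = 2 ^ i0 + j' \<and> s1 41 j' = 2 ^ i0" "s1 42 0 = 2 ^ i0" "s1 45 0 = 0" "s1 48 0 = 0" "agree {40, 41, 42, 45, 48} s s1" for s1
  proof (rule wp_While[where Inv = "search_inv (2 ^ n) i0 R cap s"])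
    show "search_inv (2 ^ n) i0 R cap s cap s1"
      
    proof (rule search_invI[where fi = "\<lambda>_. i0" and fq = "\<lambda>j. j"], goal_cases)
      case 1 show ?case using J(5) by (auto simp: agree_def)
    next
      case 5 show ?case using J i0 by (auto simp: J_def)
    next
      case 6
      have "(\<Sum>j<2 ^ i0. pot i0 j) = 2 ^ i0 + 2 * (n - i0 + 1) * num_sat n F"
        unfolding pot_def sum_nsol[OF i0, symmetric] by (simp only: sum.distrib sum_distrib_left) simp
      also have "\<dots> \<le> 2 ^ i0 + 2 * (n + 1) * num_sat n F" by (intro add_left_mono mult_right_mono mult_left_mono) auto
      finally show ?case using sum_nsol[OF i0] J by simp
    qed (use J in auto)
  next
    fix m s' assume I: "search_inv (2 ^ n) i0 R cap s m s'" and b': "bnd V s'" and g: "aval (Mul (Rg 42) (Sub (Rg 60) (Rg 45))) s' \<noteq> 0"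
    have s60: "s' 60 0 = cap" "s' 45 0 + m = cap" using I c by (auto simp: search_inv_def agree_def)
    then obtain m' where m: "m = Suc m'" using g by (cases m) auto
    obtain t where t: "s' 42 0 = Suc t" using g by (cases "s' 42 0") auto
    show "0 < m \<and> wp search_step (Ttest R + 14) (search_inv (2 ^ n) i0 R cap s (m - 1)) s'"
      using search_step_wp[OF I[unfolded m] b' t c(1,2) refl c(3) V4 Vc] m by simp
  next
    fix m s' assume I: "search_inv (2 ^ n) i0 R cap s m s'" and b': "bnd V s'" and g: "aval (Mul (Rg 42) (Sub (Rg 60) (Rg 45))) s' = 0"
    have s60: "s' 60 0 = cap" using I c by (auto simp: search_inv_def agree_def)
    show "?Q s'"
    proof (intro conjI impI)
      show "agree ?W s s'" using I by (simp add: search_inv_def)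
      assume gd: "good (2 ^ n) i0 R (s 30)"
      obtain fi fq where A: "s' 48 0 + (\<Sum>j<s' 42 0. nsol (fi j) (fq j)) = num_sat n F"
         "s' 45 0 + (\<Sum>j<s' 42 0. pot (fi j) (fq j)) \<le> 2 ^ i0 + 2 * (n + 1) * num_sat n F"
        using I gd unfolding search_inv_def by blast
      show "if s' 42 0 = 0 then s' 48 0 = num_sat n F else 2 ^ i0 < num_sat n F"
      proof (cases "s' 42 0 = 0")
        case True then show ?thesis using A(1) by simp
      next
        case False
        then have "cap \<le> s' 45 0" using g s60 by simp
        moreover have "(\<Sum>j<s' 42 0. 1) \<le> (\<Sum>j<s' 42 0. pot (fi j) (fq j))" by (rule sum_mono) (simp add: pot_def)
        ultimately have "cap + 1 \<le> 2 ^ i0 + 2 * (n + 1) * num_sat n F" using A(2) False by simp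
        then have "2 * (n + 1) * 2 ^ i0 < 2 * (n + 1) * num_sat n F" unfolding cap by (simp add: algebra_simps)
        then have "2 ^ i0 < num_sat n F" by (simp only: mult_less_cancel1)
        then show ?thesis using False by simp
      qed
    qed
  qed (use b1 in \<open>auto simp: esq_def\<close>)
  have "wp search ((2 ^ i0 * ((1 + 1) + 2) + 2) + (1 + (1 + (cap * ((Ttest R + 14) + 1) + 1)))) ?Q s"
    unfolding search_def
  proof (rule wp_Seq, rule wp_mono[OF init order_refl], rule impI)
    fix s1 assume b1: "bnd V s1" and s1: "J (2 ^ i0) s1 \<and> s1 42 0 = 2 ^ i0"
    have b2: "bnd V (store 45 0 0 s1)" by (rule bnd_store[OF b1]) simp
    have b3: "bnd V (store 48 0 0 (store 45 0 0 s1))" by (rule bnd_store[OF b2]) simp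
    have w2: "wp (While (Mul (Rg 42) (Sub (Rg 60) (Rg 45))) search_step) (cap * ((Ttest R + 14) + 1) + 1) ?Q (store 48 0 0 (store 45 0 0 s1))"
      by (rule loop[OF b3]) (use s1 in \<open>auto simp: J_def agree_def store_def\<close>)
    have w1: "wp (Seq (Set 48 (Const 0)) (While (Mul (Rg 42) (Sub (Rg 60) (Rg 45))) search_step)) (1 + (cap * ((Ttest R + 14) + 1) + 1)) ?Q (store 45 0 0 s1)"
      by (rule wp_SeqWriteI[OF b2 w2]) (simp_all add: esq_def)
    show "wp (Seq (Set 45 (Const 0)) (Seq (Set 48 (Const 0)) (While (Mul (Rg 42) (Sub (Rg 60) (Rg 45))) search_step)))
       (1 + (1 + (cap * ((Ttest R + 14) + 1) + 1))) ?Q s1"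
      by (rule wp_SeqWriteI[OF b1 w1]) (simp_all add: esq_def)
  qed
  then show ?thesis by (rule wp_mono) (simp_all add: add_mult_distrib2)
qed

definition Tsample :: "nat \<Rightarrow> nat" where "Tsample M = M * (n * 4 + Tcheck + 8) + 6"

lemma load_wp:
  assumes b: "bnd V s" and s: "s 0 = inp" "s 21 0 = r"
  shows "wp (For 23 (Rg 0) load_step) (n * 4 + 2) (\<lambda>s'. agree {2, 21, 23} s s' \<and> rep (node n r) (s' 2)) s"
proof -
  define I where "I v s' \<longleftrightarrow> agree {2, 21, 23} s s' \<and> s' 21 0 = r div 2 ^ v \<and> (\<forall>v'<v. s' 2 v' = of_bool (odd (r div 2 ^ v')))" for v s'
  have "wp (For 23 (Rg 0) load_step) (n * ((1 + 1) + 2) + 2) (I n) s"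
  proof (rule wp_For[where Inv = I and N = n])
    show "n \<le> V" by (rule n_le[OF b s(1)])
    show "aval (Rg 0) s' = n" if "I v s'" for v s' using that s by (auto simp: I_def agree_def inp_header)
    fix v s' assume I: "I v s'" and b': "bnd V s'" and v: "v < n" "s' 23 0 = v"
    have y: "s' 21 0 = r div 2 ^ v" using I by (simp add: I_def)
    have dv: "r div 2 ^ v div 2 = r div 2 ^ Suc v" by (simp only: power_Suc2 div_mult2_eq)
    have le: "r div 2 ^ v mod 2 \<le> V" "r div 2 ^ v div 2 \<le> V" using bndD[OF b', of 21 0] y by simp_all
    show "wp load_step (1 + 1) (\<lambda>s'. s' 23 0 = v \<and> I (Suc v) (store 23 0 (Suc v) s')) s'"
      unfolding load_step_def
    proof (rule wp_SeqWriteI[OF b'])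
      show "wp (Set 21 (Div (Rg 21) (Const 2))) 1 (\<lambda>s'. s' 23 0 = v \<and> I (Suc v) (store 23 0 (Suc v) s')) (store 2 v (r div 2 ^ v mod 2) s')"
        by (rule wp_Write[OF bnd_store[OF b' le(1)]])
           (use I y v le dv in \<open>auto simp: esq_def I_def less_Suc_eq mod_2_eq_odd simp del: power_Suc intro!: agree_store\<close>)
    qed (use y v le in \<open>simp_all add: esq_def\<close>)
  qed (use b s in \<open>auto simp: I_def intro!: agree_store agree_refl\<close>)
  then show ?thesis by (rule wp_mono) (auto simp: I_def rep_def node_def)
qed

lemma sample_wp:
  assumes b: "bnd V s" and s: "s 0 = inp" "s 31 0 = M" "s 50 0 = 2 ^ n" and MV: "M * 2 ^ n \<le> V"
  shows "wp sample (Tsample M) (\<lambda>s'. s' 1 0 = card {t \<in> {..<M}. \<not> falsified (node n (s 30 t))} * 2 ^ n \<and> s' 1 1 = M) s"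
    (is "wp _ _ ?Q _")
proof -
  let ?W = "{2, 3, 4, 5, 6, 7, 8, 21, 23, 32, 33} :: nat set"
  define hits where "hits j = card {t \<in> {..<j}. \<not> falsified (node n (s 30 t))}" for j
  have hits: "hits (Suc j) = hits j + of_bool (\<not> falsified (node n (s 30 j)))" for j
  proof -
    have "{t \<in> {..<Suc j}. \<not> falsified (node n (s 30 t))} = (if falsified (node n (s 30 j)) then {} else {j}) \<union> {t \<in> {..<j}. \<not> falsified (node n (s 30 t))}"
      by (auto simp: less_Suc_eq)
    then show ?thesis by (auto simp: hits_def)
  qed
  have hle: "hits j \<le> j" for j
    using card_mono[of "{..<j}" "{t \<in> {..<j}. \<not> falsified (node n (s 30 t))}"] by (auto simp: hits_def)
  have M: "M \<le> V" using bndD[OF b, of 31 0] s by simp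
  define I where "I j s' \<longleftrightarrow> agree ?W s s' \<and> s' 32 0 = hits j" for j s'
  let ?body = "Seq (Set 21 (Read 30 (Rg 33))) (Seq (For 23 (Rg 0) load_step)
        (Seq check (Cond (Rg 3) Skip (Set 32 (Add (Rg 32) (Const 1))))))"
  have step: "wp ?body (1 + ((n * 4 + 2) + (Tcheck + (1 + 1)))) (\<lambda>s'. s' 33 0 = j \<and> I (Suc j) (store 33 0 (Suc j) s')) s1"
    if I: "I j s1" and b1: "bnd V s1" and j: "j < M" "s1 33 0 = j" for j s1
  proof -
    let ?Q' = "\<lambda>s'. s' 33 0 = j \<and> I (Suc j) (store 33 0 (Suc j) s')"
    have s1: "s1 0 = inp" "s1 30 = s 30" using I s by (auto simp: I_def agree_def)
    let ?s2 = "store 21 0 (s 30 j) s1"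
    have b2: "bnd V ?s2" by (rule bnd_store[OF b1]) (use b in simp)
    have "wp (Seq (For 23 (Rg 0) load_step) (Seq check (Cond (Rg 3) Skip (Set 32 (Add (Rg 32) (Const 1))))))
      ((n * 4 + 2) + (Tcheck + (1 + 1))) ?Q' ?s2"
    proof (rule wp_Seq, rule wp_mono[OF load_wp[OF b2, where r = "s 30 j"] order_refl])
      show "?s2 0 = inp" "?s2 21 0 = s 30 j" using s1 by auto
      fix s3 assume b3: "bnd V s3" and s3: "agree {2, 21, 23} ?s2 s3 \<and> rep (node n (s 30 j)) (s3 2)"
      have ag3: "agree {2, 21, 23} s1 s3" using s3 by (auto simp: agree_def)
      have i3: "s3 0 = inp" using ag3 s1 by (auto simp: agree_def)
      have "wp (Seq check (Cond (Rg 3) Skip (Set 32 (Add (Rg 32) (Const 1))))) (Tcheck + (1 + 1)) ?Q' s3"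
      proof (rule wp_Seq, rule wp_mono[OF check_rep_wp[OF b3 i3 conjunct2[OF s3]] order_refl])
        fix s4 assume b4: "bnd V s4" and s4: "agree {3, 4, 5, 6, 7, 8} s3 s4 \<and> s4 3 0 = of_bool (falsified (node n (s 30 j)))"
        have ag4: "agree ?W s s4" using I ag3 s4 by (auto simp: I_def agree_def)
        have s4': "s4 33 0 = j" "s4 32 0 = hits j" using I ag3 s4 j by (auto simp: I_def agree_def)
        show "bnd V s4 \<longrightarrow> wp (Cond (Rg 3) Skip (Set 32 (Add (Rg 32) (Const 1)))) (1 + 1) ?Q' s4"
        proof (intro impI wp_Cond)
          assume "aval (Rg 3) s4 \<noteq> 0"
          then show "wp Skip 1 ?Q' s4"
            using ag4 s4 s4' by (intro wp_Skip b4) (auto simp: I_def hits intro!: agree_store split: if_splits)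
        next
          assume "aval (Rg 3) s4 = 0"
          then show "wp (Set 32 (Add (Rg 32) (Const 1))) 1 ?Q' s4"
            using ag4 s4 s4' b4 hle[of j] j M by (intro wp_Write) (auto simp: esq_def I_def hits intro!: agree_store split: if_splits)
        qed (use b4 in \<open>auto simp: esq_def\<close>)
      qed
      then show "bnd V s3 \<longrightarrow> wp (Seq check (Cond (Rg 3) Skip (Set 32 (Add (Rg 32) (Const 1))))) (Tcheck + (1 + 1)) ?Q' s3" by simp
    qed
    note w = this
    show ?thesis
      by (rule wp_SeqWriteI[OF b1 w]) (use s1 j b in \<open>simp_all add: esq_def\<close>)
  qed
  have loop: "wp (For 33 (Rg 31) ?body) (M * ((1 + ((n * 4 + 2) + (Tcheck + (1 + 1)))) + 2) + 2) (I M) s1"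
    if b1: "bnd V s1" and I: "I 0 s1" for s1
  proof (rule wp_For[where Inv = I and N = M])
    show "aval (Rg 31) s' = M" if "I j s'" for j s' using that s by (auto simp: I_def agree_def)
    show "I 0 (store 33 0 0 s1)" using I by (auto simp: I_def intro!: agree_store)
  qed (use b1 M step in auto)
  let ?out = "Seq (Write 1 (Const 0) (Mul (Rg 32) (Rg 50))) (Write 1 (Const 1) (Rg 31))"
  have b1: "bnd V (store 32 0 0 s)" by (rule bnd_store[OF b]) simp
  have w1: "wp (Seq (For 33 (Rg 31) ?body) ?out) ((M * ((1 + ((n * 4 + 2) + (Tcheck + (1 + 1)))) + 2) + 2) + (1 + 1)) ?Q (store 32 0 0 s)"
  proof (rule wp_Seq, rule wp_mono[OF loop[OF b1] order_refl])
    show "I 0 (store 32 0 0 s)" by (auto simp: I_def hits_def intro!: agree_store agree_refl)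
    fix s1 assume b1: "bnd V s1" and I: "I M s1"
    have s1: "s1 32 0 = hits M" "s1 31 0 = M" "s1 50 0 = 2 ^ n" using I s by (auto simp: I_def agree_def)
    have le: "hits M * 2 ^ n \<le> V" by (rule le_trans[OF mult_le_mono1[OF hle] MV])
    have w: "wp (Write 1 (Const 1) (Rg 31)) 1 ?Q (store 1 0 (hits M * 2 ^ n) s1)"
      by (rule wp_Write[OF bnd_store[OF b1 le]]) (use s1 M in \<open>simp_all add: esq_def hits_def\<close>)
    have "wp ?out (1 + 1) ?Q s1"
      by (rule wp_SeqWriteI[OF b1 w]) (use s1 le in \<open>simp_all add: esq_def\<close>)
    then show "bnd V s1 \<longrightarrow> wp ?out (1 + 1) ?Q s1" by simp
  qed
  have "wp sample (1 + ((M * ((1 + ((n * 4 + 2) + (Tcheck + (1 + 1)))) + 2) + 2) + (1 + 1))) ?Q s"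
    unfolding sample_def by (rule wp_SeqWriteI[OF b w1]) (simp_all add: esq_def)
  then show ?thesis by (rule wp_mono) (simp_all add: Tsample_def algebra_simps)
qed

text \<open>Array \<open>30\<close> serves twice: its words drive the trials and are also the
  sampled assignments. The two uses are dependent, so their failure probabilities are added
  later.\<close>

lemma count_wp:
  assumes b: "bnd V s" and c: "consts_ok s" "s 50 0 = 2 ^ n" "s 59 0 = R" "s 58 0 = 2 ^ i0" "s 60 0 = cap" "s 31 0 = M"
    and i0: "i0 \<le> n" and cap: "cap = (2 * n + 3) * 2 ^ i0"
    and V4: "2 ^ n * 4 \<le> V" and Vc: "2 ^ i0 + cap + 2 \<le> V" and MV: "M * 2 ^ n \<le> V"
  shows "wp count (2 ^ i0 * 4 + cap * (Ttest R + 15) + 6 + Tsample M)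
    (\<lambda>s'. good (2 ^ n) i0 R (s 30) \<longrightarrow>
      (s' 1 0 = num_sat n F \<and> s' 1 1 = 1) \<or>
      (2 ^ i0 < num_sat n F \<and> s' 1 0 = card {t \<in> {..<M}. \<not> falsified (node n (s 30 t))} * 2 ^ n \<and> s' 1 1 = M)) s"
    (is "wp _ _ ?Q _")
proof -
  have "wp count ((2 ^ i0 * 4 + cap * (Ttest R + 15) + 5) + (1 + Tsample M)) ?Q s"
    unfolding count_def
  proof (rule wp_Seq, rule wp_mono[OF search_wp[OF b c(1-5) i0 cap V4 Vc] order_refl], rule impI)
    fix s1 assume b1: "bnd V s1" and A: "agree (trial_regs \<union> {40, 41, 42, 43, 44, 45, 46, 47, 48}) s s1 \<and>
      (good (2 ^ n) i0 R (s 30) \<longrightarrow> (if s1 42 0 = 0 then s1 48 0 = num_sat n F else 2 ^ i0 < num_sat n F))"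
    have s1: "s1 0 = inp" "s1 31 0 = M" "s1 50 0 = 2 ^ n" "s1 30 = s 30"
      using A c consts_okD[OF c(1)] by (auto simp: agree_def)
    show "wp (Cond (Rg 42) sample (Seq (Write 1 (Const 0) (Rg 48)) (Write 1 (Const 1) (Const 1)))) (1 + Tsample M) ?Q s1"
    proof (rule wp_Cond)
      assume "aval (Rg 42) s1 \<noteq> 0"
      then show "wp sample (Tsample M) ?Q s1"
        using A s1 by (intro wp_mono[OF sample_wp[OF b1 s1(1-3) MV] order_refl]) auto
    next
      assume g: "aval (Rg 42) s1 = 0"
      have w: "wp (Write 1 (Const 1) (Const 1)) 1 ?Q (store 1 0 (s1 48 0) s1)"
        by (rule wp_Write[OF bnd_store[OF b1]]) (use A g b1 in \<open>simp_all add: esq_def\<close>)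
      have "wp (Seq (Write 1 (Const 0) (Rg 48)) (Write 1 (Const 1) (Const 1))) (1 + 1) ?Q s1"
        by (rule wp_SeqWriteI[OF b1 w]) (use b1 in \<open>simp_all add: esq_def\<close>)
      then show "wp (Seq (Write 1 (Const 0) (Rg 48)) (Write 1 (Const 1) (Const 1))) (Tsample M) ?Q s1"
        by (rule wp_mono) (auto simp: Tsample_def)
    qed (use b1 in \<open>auto simp: esq_def\<close>)
  qed
  then show ?thesis by (rule wp_mono) simp_all
qed

end

section \<open>Coin flips\<close>

definition fill_bit :: com where
  "fill_bit = Seq (Flip 66 (Const 0)) (Set 69 (Add (Mul (Const 2) (Rg 69)) (Rg 66)))"

definition fill_word :: com where
  "fill_word = Seq (Set 69 (Const 0)) (Seq (For 68 (Rg 62) fill_bit) (Write 30 (Rg 67) (Rg 69)))"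

definition fill :: com where
  "fill = For 67 (Rg 61) fill_word"

definition word_pmf :: "nat \<Rightarrow> nat pmf" where
  "word_pmf K = pmf_of_set {..<2 ^ K}"

definition words_pmf :: "nat \<Rightarrow> nat \<Rightarrow> (nat \<Rightarrow> nat) pmf" where
  "words_pmf K m = Pi_pmf {..<m} 0 (\<lambda>_. word_pmf K)"

lemma set_word_pmf: "set_pmf (word_pmf K) = {..<2 ^ K}"
  unfolding word_pmf_def by (rule set_pmf_of_set) (auto simp: lessThan_empty_iff)

lemma word_pmf_0: "word_pmf 0 = return_pmf 0"
  by (simp add: word_pmf_def pmf_of_set_singleton lessThan_Suc)

lemma double_of_bool_eq: "2 * x + of_bool b = 2 * y + of_bool c \<Longrightarrow> x = y \<and> b = c" for x y :: nat
proof -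
  assume e: "2 * x + of_bool b = 2 * y + of_bool c"
  have "odd (2 * x + of_bool b) = b" "odd (2 * y + of_bool c) = c" by simp_all
  then have "b = c" using e by simp
  then show ?thesis using e by simp
qed

text \<open>Appending a fair bit by Horner's rule turns a uniform word into a uniform word one bit
  longer. This is the form in which the loop rule for coin flips takes a distribution.\<close>

lemma word_pmf_Suc:
  "word_pmf (Suc K) = map_pmf (\<lambda>(x, b). 2 * x + of_bool b) (pair_pmf (word_pmf K) (pmf_of_set (UNIV :: bool set)))"
proof -
  have "pair_pmf (word_pmf K) (pmf_of_set (UNIV :: bool set)) = pmf_of_set ({..<2 ^ K} \<times> UNIV)"
    unfolding word_pmf_def
  proof (rule pmf_eqI)
    fix p :: "nat \<times> bool"
    show "pmf (pair_pmf (pmf_of_set {..<2 ^ K}) (pmf_of_set UNIV)) p = pmf (pmf_of_set ({..<2 ^ K} \<times> UNIV)) p"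
      by (cases p) (simp add: pmf_pair lessThan_empty_iff card_cartesian_product indicator_def)
  qed
  also have "map_pmf (\<lambda>(x, b). 2 * x + of_bool b) \<dots>
      = pmf_of_set ((\<lambda>(x, b). 2 * x + of_bool b) ` ({..<2 ^ K} \<times> (UNIV :: bool set)))"
  proof (rule map_pmf_of_set_inj)
    show "inj_on (\<lambda>(x, b). 2 * x + of_bool b) ({..<2 ^ K} \<times> (UNIV :: bool set) :: (nat \<times> bool) set)"
      by (rule inj_onI, clarify) (drule double_of_bool_eq, simp)
  qed (auto simp: lessThan_empty_iff)
  also have "(\<lambda>(x, b). 2 * x + of_bool b) ` ({..<2 ^ K} \<times> (UNIV :: bool set)) = {..<(2::nat) ^ Suc K}"
  proof (intro set_eqI iffI)
    fix r :: nat assume "r \<in> {..<2 ^ Suc K}"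
    then have "r div 2 < 2 ^ K" by auto
    moreover have "r = 2 * (r div 2) + of_bool (odd r)" by simp
    ultimately show "r \<in> (\<lambda>(x, b). 2 * x + of_bool b) ` ({..<2 ^ K} \<times> (UNIV :: bool set))"
      by (intro image_eqI[of _ _ "(r div 2, odd r)"]) auto
  qed auto
  finally show ?thesis by (simp add: word_pmf_def)
qed

lemma words_pmf_0: "words_pmf K 0 = return_pmf (\<lambda>_. 0)"
  by (simp add: words_pmf_def)

lemma words_pmf_Suc:
  "words_pmf K (Suc m) = map_pmf (\<lambda>(f, y). f(m := y)) (pair_pmf (words_pmf K m) (word_pmf K))"
proof -
  have "words_pmf K (Suc m) = map_pmf (\<lambda>(y, f). f(m := y)) (pair_pmf (word_pmf K) (words_pmf K m))"
    unfolding words_pmf_def lessThan_Suc by (rule Pi_pmf_insert) auto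
  also have "\<dots> = map_pmf (\<lambda>(f, y). f(m := y)) (pair_pmf (words_pmf K m) (word_pmf K))"
    by (subst pair_commute_pmf) (simp add: map_pmf_comp case_prod_unfold)
  finally show ?thesis .
qed

text \<open>Positions not yet filled hold the default \<open>0\<close>. Thus
  \<open>f(m := y)\<close> determines both \<open>f\<close> and \<open>y\<close>, as the loop rule
  demands.\<close>

lemma set_words_pmf: "f \<in> set_pmf (words_pmf K m) \<Longrightarrow> j < m \<Longrightarrow> f j < 2 ^ K"
  "f \<in> set_pmf (words_pmf K m) \<Longrightarrow> m \<le> j \<Longrightarrow> f j = 0"
  unfolding words_pmf_def using set_Pi_pmf[of "{..<m}" 0 "\<lambda>_. word_pmf K"] set_word_pmf[of K]
  by (auto simp: PiE_dflt_def)

section \<open>Rules for programs with coin flips\<close>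

context machine begin

text \<open>One draw from \<open>D\<close> summarises all coin flips: store and time are functions
  of the outcome. Probabilities can then be computed in \<open>D\<close> alone, while the time bound
  holds for every outcome.\<close>

definition wpp :: "com \<Rightarrow> nat \<Rightarrow> 'a pmf \<Rightarrow> ('a \<Rightarrow> state \<Rightarrow> bool) \<Rightarrow> state \<Rightarrow> bool" where
  "wpp c T D Q s \<longleftrightarrow> (\<exists>g u. (\<forall>t. exec c (s, t) = map_spmf (\<lambda>x. (g x, t + u x)) (spmf_of_pmf D)) \<and>
     (\<forall>x\<in>set_pmf D. u x \<le> T * (\<kappa> * bits V) \<and> bnd V (g x) \<and> Q x (g x)))"

lemma wpp_mono: "wpp c T D Q s \<Longrightarrow> T \<le> T' \<Longrightarrow> (\<And>x s'. x \<in> set_pmf D \<Longrightarrow> bnd V s' \<Longrightarrow> Q x s' \<Longrightarrow> Q' x s') \<Longrightarrow> wpp c T' D Q' s"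
  unfolding wpp_def by (elim exE conjE, intro exI conjI, assumption) (meson le_trans mult_le_mono1)

lemma wp_wpp: "wp c T Q s \<Longrightarrow> wpp c T (return_pmf a) (\<lambda>_. Q) s"
  unfolding wp_def wpp_def runs_def
proof (elim exE conjE)
  fix s' u assume "\<forall>t. exec c (s, t) = return_spmf (s', t + u)" "u \<le> T * (\<kappa> * bits V)" "bnd V s'" "Q s'"
  then show "\<exists>g u. (\<forall>t. exec c (s, t) = map_spmf (\<lambda>x. (g x, t + u x)) (spmf_of_pmf (return_pmf a))) \<and>
     (\<forall>x\<in>set_pmf (return_pmf a). u x \<le> T * (\<kappa> * bits V) \<and> bnd V (g x) \<and> Q (g x))"
    by (intro exI[of _ "\<lambda>_. s'"] exI[of _ "\<lambda>_. u"]) simp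
qed

lemma wp_wpp_Seq:
  assumes "wp c T1 (\<lambda>s'. bnd V s' \<longrightarrow> wpp d T2 D Q s') s"
  shows "wpp (Seq c d) (T1 + T2) D Q s"
proof -
  obtain s1 u1 where 1: "\<And>t. exec c (s, t) = return_spmf (s1, t + u1)" "u1 \<le> T1 * (\<kappa> * bits V)" "wpp d T2 D Q s1"
    using assms unfolding wp_def runs_def by blast
  then obtain g u where 2: "\<And>t. exec d (s1, t) = map_spmf (\<lambda>x. (g x, t + u x)) (spmf_of_pmf D)"
     "\<And>x. x \<in> set_pmf D \<Longrightarrow> u x \<le> T2 * (\<kappa> * bits V) \<and> bnd V (g x) \<and> Q x (g x)" unfolding wpp_def by blast
  show ?thesis unfolding wpp_def
  proof (intro exI[of _ g] exI[of _ "\<lambda>x. u1 + u x"] conjI allI ballI)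
    show "exec (Seq c d) (s, t) = map_spmf (\<lambda>x. (g x, t + (u1 + u x))) (spmf_of_pmf D)" for t
      by (simp add: 1(1) 2(1) add.assoc)
    fix x assume x: "x \<in> set_pmf D"
    show "u1 + u x \<le> (T1 + T2) * (\<kappa> * bits V)" using 1(2) 2(2)[OF x] by (simp add: distrib_right)
  qed (use 2(2) in auto)
qed

lemma wpp_wp_Seq:
  assumes "wpp c T1 D (\<lambda>x s'. bnd V s' \<longrightarrow> wp d T2 (Q x) s') s"
  shows "wpp (Seq c d) (T1 + T2) D Q s"
proof -
  obtain g u where 1: "\<And>t. exec c (s, t) = map_spmf (\<lambda>x. (g x, t + u x)) (spmf_of_pmf D)"
     "\<And>x. x \<in> set_pmf D \<Longrightarrow> u x \<le> T1 * (\<kappa> * bits V) \<and> wp d T2 (Q x) (g x)"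
    using assms unfolding wpp_def by blast
  have "\<forall>x\<in>set_pmf D. \<exists>p. runs d (g x) (fst p) (snd p) \<and> snd p \<le> T2 * (\<kappa> * bits V) \<and> bnd V (fst p) \<and> Q x (fst p)"
    using 1(2) unfolding wp_def by force
  from bchoice[OF this] obtain p where p: "\<And>x. x \<in> set_pmf D \<Longrightarrow> runs d (g x) (fst (p x)) (snd (p x)) \<and>
      snd (p x) \<le> T2 * (\<kappa> * bits V) \<and> bnd V (fst (p x)) \<and> Q x (fst (p x))" by blast
  show ?thesis unfolding wpp_def
  proof (intro exI[of _ "\<lambda>x. fst (p x)"] exI[of _ "\<lambda>x. u x + snd (p x)"] conjI allI ballI)
    fix t
    have "exec (Seq c d) (s, t) = bind_spmf (spmf_of_pmf D) (\<lambda>x. exec d (g x, t + u x))"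
      by (simp add: 1(1) bind_map_pmf)
    also have "\<dots> = bind_spmf (spmf_of_pmf D) (\<lambda>x. return_spmf (fst (p x), t + (u x + snd (p x))))"
      by (rule bind_spmf_cong) (use p in \<open>auto simp: runs_def add.assoc\<close>)
    also have "\<dots> = map_spmf (\<lambda>x. (fst (p x), t + (u x + snd (p x)))) (spmf_of_pmf D)"
      by (simp add: map_spmf_conv_bind_spmf)
    finally show "exec (Seq c d) (s, t) = map_spmf (\<lambda>x. (fst (p x), t + (u x + snd (p x)))) (spmf_of_pmf D)" .
    fix x assume x: "x \<in> set_pmf D"
    show "u x + snd (p x) \<le> (T1 + T2) * (\<kappa> * bits V)" using 1(2)[OF x] p[OF x] by (simp add: distrib_right)
  qed (use p in auto)
qed

lemma wpp_Flip:
  assumes "bnd V s" "\<And>b. Q b (store x 0 (of_bool b) s)"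
  shows "wpp (Flip x (Const 0)) 1 (pmf_of_set UNIV) Q s"
  unfolding wpp_def
proof (intro exI[of _ "\<lambda>b. store x 0 (of_bool b) s"] exI[of _ "\<lambda>_. acost (Const 0) s + bits 0 + 1"] conjI allI ballI)
  show "exec (Flip x (Const 0)) (s, t) = map_spmf (\<lambda>b. (store x 0 (of_bool b) s, t + (acost (Const 0) s + bits 0 + 1))) (spmf_of_pmf (pmf_of_set UNIV))" for t
  proof -
    have "coin_spmf = spmf_of_pmf (pmf_of_set (UNIV :: bool set))" unfolding spmf_of_set_def by (simp only: finite UNIV_not_empty simp_thms if_True not_False_eq_True)
    then show ?thesis by (simp only: exec.simps case_prod_conv aval.simps add.assoc)
  qed
  have "bits 0 = 1" using bits_le[of 0 1] bits_pos[of 0] by simp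
  moreover have "5000 * 1 \<le> \<kappa> * bits V" by (intro mult_mono \<kappa> bits_pos) auto
  ultimately show "acost (Const 0) s + bits 0 + 1 \<le> 1 * (\<kappa> * bits V)" by simp
qed (use assms in \<open>auto intro!: bnd_store\<close>)

text \<open>\<open>D j\<close> is the joint distribution of the outcomes of the first
  \<open>j\<close> rounds. As \<open>h\<close> is injective, the combined outcome determines the
  earlier outcome and the latest draw, so that store and time remain functions of it, via the
  inverse \<open>iv\<close>.\<close>

lemma wpp_While:
  assumes b: "bnd V s" and I0: "I 0 a0 s" and D0: "D 0 = return_pmf a0"
    and D: "\<And>j. D (Suc j) = map_pmf (\<lambda>(x, y). h j x y) (pair_pmf (D j) E)"
    and inj: "\<And>j. inj_on (\<lambda>(x, y). h j x y) (set_pmf (D j) \<times> set_pmf E)"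
    and e: "cok V e" "esq e \<le> \<kappa>"
    and step: "\<And>j x s. j < N \<Longrightarrow> x \<in> set_pmf (D j) \<Longrightarrow> I j x s \<Longrightarrow> bnd V s \<Longrightarrow>
      aval e s \<noteq> 0 \<and> wpp c T E (\<lambda>y. I (Suc j) (h j x y)) s"
    and fin: "\<And>x s. x \<in> set_pmf (D N) \<Longrightarrow> I N x s \<Longrightarrow> bnd V s \<Longrightarrow> aval e s = 0"
  shows "wpp (While e c) (N * (T + 1) + 1) (D N) (I N) s"
proof -
  let ?L = "\<kappa> * bits V"
  have cost: "acost e s + bits (aval e s) \<le> ?L" if "bnd V s" for s
    by (rule le_trans[OF cost_le[OF V2 that e(1)] mult_le_mono1[OF e(2)]])
  have "\<exists>g u. (\<forall>t. while_loop e (exec c) (s, t) =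
      bind_spmf (spmf_of_pmf (D j)) (\<lambda>x. while_loop e (exec c) (g x, t + u x))) \<and>
     (\<forall>x\<in>set_pmf (D j). u x \<le> j * (T + 1) * ?L \<and> bnd V (g x) \<and> I j x (g x))" if "j \<le> N" for j
    using that
  proof (induction j)
    case 0
    show ?case
      by (intro exI[of _ "\<lambda>_. s"] exI[of _ "\<lambda>_. 0"]) (use b I0 in \<open>simp add: D0\<close>)
  next
    case (Suc j)
    then obtain g u where 1: "\<And>t. while_loop e (exec c) (s, t) =
        bind_spmf (spmf_of_pmf (D j)) (\<lambda>x. while_loop e (exec c) (g x, t + u x))"
      "\<And>x. x \<in> set_pmf (D j) \<Longrightarrow> u x \<le> j * (T + 1) * ?L \<and> bnd V (g x) \<and> I j x (g x)" by auto
    have st: "aval e (g x) \<noteq> 0 \<and> wpp c T E (\<lambda>y. I (Suc j) (h j x y)) (g x)" if "x \<in> set_pmf (D j)" for x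
      using step[OF _ that] 1(2)[OF that] Suc.prems by auto
    have "\<forall>x\<in>set_pmf (D j). \<exists>p. (\<forall>t. exec c (g x, t) = map_spmf (\<lambda>y. (fst p y, t + snd p y)) (spmf_of_pmf E)) \<and>
       (\<forall>y\<in>set_pmf E. snd p y \<le> T * ?L \<and> bnd V (fst p y) \<and> I (Suc j) (h j x y) (fst p y))"
      using st unfolding wpp_def by force
    from bchoice[OF this] obtain p where p: "\<And>x t. x \<in> set_pmf (D j) \<Longrightarrow>
        exec c (g x, t) = map_spmf (\<lambda>y. (fst (p x) y, t + snd (p x) y)) (spmf_of_pmf E)"
       "\<And>x y. x \<in> set_pmf (D j) \<Longrightarrow> y \<in> set_pmf E \<Longrightarrow>
        snd (p x) y \<le> T * ?L \<and> bnd V (fst (p x) y) \<and> I (Suc j) (h j x y) (fst (p x) y)" by blast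
    define H where "H = (\<lambda>(x, y). h j x y)"
    define iv where "iv = inv_into (set_pmf (D j) \<times> set_pmf E) H"
    have iv: "iv (h j x y) = (x, y)" if "x \<in> set_pmf (D j)" "y \<in> set_pmf E" for x y
      using inv_into_f_f[of H "set_pmf (D j) \<times> set_pmf E" "(x, y)"] inj[of j] that by (simp add: iv_def H_def)
    define g' where "g' z = (case iv z of (x, y) \<Rightarrow> fst (p x) y)" for z
    define u' where "u' z = (case iv z of (x, y) \<Rightarrow> u x + (acost e (g x) + bits (aval e (g x))) + snd (p x) y)" for z
    show ?case
    proof (intro exI[of _ g'] exI[of _ u'] conjI allI ballI)
      fix t
      have "while_loop e (exec c) (s, t) =
          bind_spmf (spmf_of_pmf (D j)) (\<lambda>x. while_loop e (exec c) (g x, t + u x))" by (rule 1(1))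
      also have "\<dots> = bind_spmf (spmf_of_pmf (D j)) (\<lambda>x. bind_spmf (spmf_of_pmf E)
          (\<lambda>y. while_loop e (exec c) (g' (h j x y), t + u' (h j x y))))"
      proof (rule bind_spmf_cong[OF refl])
        fix x assume "x \<in> set_spmf (spmf_of_pmf (D j))"
        then have x: "x \<in> set_pmf (D j)" by simp
        have "while_loop e (exec c) (g x, t + u x)
            = bind_spmf (exec c (g x, t + u x + acost e (g x) + bits (aval e (g x)))) (while_loop e (exec c))"
          by (subst while_loop.simps) (use st[OF x] in \<open>simp add: eval_guard_def\<close>)
        also have "\<dots> = bind_spmf (spmf_of_pmf E)
          (\<lambda>y. while_loop e (exec c) (fst (p x) y, t + u x + acost e (g x) + bits (aval e (g x)) + snd (p x) y))"
          by (simp add: p(1)[OF x] bind_map_pmf)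
        also have "\<dots> = bind_spmf (spmf_of_pmf E)
          (\<lambda>y. while_loop e (exec c) (g' (h j x y), t + u' (h j x y)))"
          by (rule bind_spmf_cong[OF refl]) (use iv[OF x] in \<open>simp add: g'_def u'_def add.assoc\<close>)
        finally show "while_loop e (exec c) (g x, t + u x) = bind_spmf (spmf_of_pmf E)
          (\<lambda>y. while_loop e (exec c) (g' (h j x y), t + u' (h j x y)))" .
      qed
      also have "\<dots> = bind_spmf (spmf_of_pmf (D (Suc j))) (\<lambda>z. while_loop e (exec c) (g' z, t + u' z))"
        unfolding D by (simp add: bind_spmf_of_pmf bind_map_pmf pair_pmf_def bind_assoc_pmf bind_return_pmf)
      finally show "while_loop e (exec c) (s, t) =
         bind_spmf (spmf_of_pmf (D (Suc j))) (\<lambda>z. while_loop e (exec c) (g' z, t + u' z))" .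
    next
      fix z assume "z \<in> set_pmf (D (Suc j))"
      then obtain x y where xy: "x \<in> set_pmf (D j)" "y \<in> set_pmf E" "z = h j x y" by (auto simp: D)
      show "u' z \<le> Suc j * (T + 1) * ?L"
        using 1(2)[OF xy(1)] p(2)[OF xy(1,2)] cost[of "g x"] by (simp add: u'_def xy(3) iv[OF xy(1,2)] algebra_simps)
      show "bnd V (g' z)" "I (Suc j) z (g' z)" using p(2)[OF xy(1,2)] by (simp_all add: g'_def xy(3) iv[OF xy(1,2)])
    qed
  qed
  from this[of N] obtain g u where 1: "\<And>t. while_loop e (exec c) (s, t) =
      bind_spmf (spmf_of_pmf (D N)) (\<lambda>x. while_loop e (exec c) (g x, t + u x))"
     "\<And>x. x \<in> set_pmf (D N) \<Longrightarrow> u x \<le> N * (T + 1) * ?L \<and> bnd V (g x) \<and> I N x (g x)" by auto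
  show ?thesis unfolding wpp_def
  proof (intro exI[of _ g] exI[of _ "\<lambda>x. u x + (acost e (g x) + bits (aval e (g x)))"] conjI allI ballI)
    fix t
    have "exec (While e c) (s, t) = bind_spmf (spmf_of_pmf (D N)) (\<lambda>x. while_loop e (exec c) (g x, t + u x))"
      by (simp add: 1(1))
    also have "\<dots> = bind_spmf (spmf_of_pmf (D N)) (\<lambda>x. return_spmf (g x, t + (u x + (acost e (g x) + bits (aval e (g x))))))"
      by (rule bind_spmf_cong[OF refl], subst while_loop.simps)
         (use fin 1(2) in \<open>auto simp: eval_guard_def add.assoc\<close>)
    also have "\<dots> = map_spmf (\<lambda>x. (g x, t + (u x + (acost e (g x) + bits (aval e (g x)))))) (spmf_of_pmf (D N))"
      by (simp add: map_spmf_conv_bind_spmf)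
    finally show "exec (While e c) (s, t) = map_spmf (\<lambda>x. (g x, t + (u x + (acost e (g x) + bits (aval e (g x)))))) (spmf_of_pmf (D N))" .
    fix x assume x: "x \<in> set_pmf (D N)"
    show "u x + (acost e (g x) + bits (aval e (g x))) \<le> (N * (T + 1) + 1) * ?L"
      using 1(2)[OF x] cost[of "g x"] by (simp add: algebra_simps)
  qed (use 1(2) in auto)
qed

lemma wpp_For:
  assumes b: "bnd V s" and I0: "I 0 a0 (store x 0 0 s)" and D0: "D 0 = return_pmf a0"
    and D: "\<And>j. D (Suc j) = map_pmf (\<lambda>(x, y). h j x y) (pair_pmf (D j) E)"
    and inj: "\<And>j. inj_on (\<lambda>(x, y). h j x y) (set_pmf (D j) \<times> set_pmf E)"
    and e: "cok V e" "esz e \<le> 20" and N: "N \<le> V"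
    and val: "\<And>j a s. I j a s \<Longrightarrow> aval e s = N \<and> s x 0 = j"
    and step: "\<And>j a s. j < N \<Longrightarrow> a \<in> set_pmf (D j) \<Longrightarrow> I j a s \<Longrightarrow> bnd V s \<Longrightarrow>
      wpp c T E (\<lambda>y s'. s' x 0 = j \<and> I (Suc j) (h j a y) (store x 0 (Suc j) s')) s"
  shows "wpp (For x e c) (N * (T + 2) + 2) (D N) (I N) s"
proof -
  have w: "wpp (While (Sub e (Rg x)) (Seq c (Set x (Add (Rg x) (Const 1))))) (N * ((T + 1) + 1) + 1) (D N) (I N) (store x 0 0 s)"
  proof (rule wpp_While[where I = I and D = D and h = h and E = E, OF _ I0 D0 D inj])
    show "bnd V (store x 0 0 s)" by (rule bnd_store[OF b]) simp
    show "cok V (Sub e (Rg x))" using e by simp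
    have "(esz e + 3) * (esz e + 3) \<le> 23 * 23" using e(2) by (intro mult_mono) auto
    moreover have "esq (Sub e (Rg x)) = 2 * ((esz e + 3) * (esz e + 3)) + (esz e + 3)"
      by (simp add: esq_def algebra_simps)
    ultimately show "esq (Sub e (Rg x)) \<le> \<kappa>" using \<kappa> e(2) by linarith
  next
    fix j a s assume j: "j < N" and a: "a \<in> set_pmf (D j)" and I: "I j a s" and b: "bnd V s"
    have "wpp (Seq c (Set x (Add (Rg x) (Const 1)))) (T + 1) E (\<lambda>y. I (Suc j) (h j a y)) s"
    proof (rule wpp_wp_Seq, rule wpp_mono[OF step[OF j a I b] order_refl], rule impI)
      fix y s' assume b': "bnd V s'" and s': "s' x 0 = j \<and> I (Suc j) (h j a y) (store x 0 (Suc j) s')"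
      show "wp (Set x (Add (Rg x) (Const 1))) 1 (I (Suc j) (h j a y)) s'"
        by (rule wp_Write[OF b']) (use s' j N in \<open>auto simp: esq_def\<close>)
    qed
    then show "aval (Sub e (Rg x)) s \<noteq> 0 \<and> wpp (Seq c (Set x (Add (Rg x) (Const 1)))) (T + 1) E (\<lambda>y. I (Suc j) (h j a y)) s"
      using val[OF I] j by simp
  next
    fix a s assume "I N a s"
    from val[OF this] show "aval (Sub e (Rg x)) s = 0" by simp
  qed
  have "wpp (For x e c) (1 + (N * ((T + 1) + 1) + 1)) (D N) (I N) s"
    unfolding For_def by (rule wp_wpp_Seq, rule wp_Write[OF b]) (use w in \<open>auto simp: esq_def\<close>)
  then show ?thesis by (rule wpp_mono) simp_all
qed

lemma fill_wp:
  assumes b: "bnd V s" and s: "s 61 0 = m" "s 62 0 = K" and KV: "2 ^ K \<le> V"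
  shows "wpp fill (m * (K * 4 + 6) + 2) (words_pmf K m)
    (\<lambda>f s'. agree {30, 66, 67, 68, 69} s s' \<and> (\<forall>j<m. s' 30 j = f j)) s"
proof -
  let ?W = "{30, 66, 67, 68, 69} :: nat set"
  define I where "I j f s' \<longleftrightarrow> agree ?W s s' \<and> (\<forall>j'<j. s' 30 j' = f j') \<and> s' 67 0 = j" for j f s'
  have mV: "m \<le> V" "K \<le> V" using bndD[OF b, of 61 0] bndD[OF b, of 62 0] s by auto
  have word: "wpp fill_word (K * 4 + 4) (word_pmf K)
      (\<lambda>y s'. s' 67 0 = j \<and> I (Suc j) (fun_upd f j y) (store 67 0 (Suc j) s')) s1"
    if j: "j < m" and I: "I j f s1" and b1: "bnd V s1" for j f s1
  proof -
    define J where "J i x s' \<longleftrightarrow> agree {66, 68, 69} s1 s' \<and> s' 69 0 = x \<and> s' 68 0 = i \<and> x < 2 ^ i" for i x s'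
    have s1: "s1 62 0 = K" "s1 67 0 = j" using I s by (auto simp: I_def agree_def)
    have b2: "bnd V (store 69 0 0 s1)" by (rule bnd_store[OF b1]) simp
    have loop: "wpp (For 68 (Rg 62) fill_bit) (K * (2 + 2) + 2) (word_pmf K) (J K) (store 69 0 0 s1)"
    proof (rule wpp_For[where I = J and D = word_pmf and E = "pmf_of_set UNIV" and h = "\<lambda>_ x b. 2 * x + of_bool b", OF b2 _ word_pmf_0 word_pmf_Suc])
      show "J 0 0 (store 68 0 0 (store 69 0 0 s1))" by (auto simp: J_def intro!: agree_store agree_refl)
      show "inj_on (\<lambda>(x, b). 2 * x + of_bool b) (set_pmf (word_pmf i) \<times> set_pmf (pmf_of_set (UNIV :: bool set)))" for i
        by (rule inj_onI, clarify) (drule double_of_bool_eq, simp)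
      show "aval (Rg 62) s' = K \<and> s' 68 0 = i" if "J i x s'" for i x s'
        using that s1 by (auto simp: J_def agree_def)
      fix i x s' assume i: "i < K" and J: "J i x s'" and b': "bnd V s'"
      have x2: "2 * x + of_bool c < 2 ^ Suc i" for c using J by (auto simp: J_def)
      have "(2::nat) ^ Suc i \<le> 2 ^ K" using i by (intro power_increasing) auto
      then have xV: "2 * x + of_bool c \<le> V" for c using x2[of c] KV by linarith
      have "wpp fill_bit (1 + 1) (pmf_of_set UNIV) (\<lambda>y s'. s' 68 0 = i \<and> J (Suc i) (2 * x + of_bool y) (store 68 0 (Suc i) s')) s'"
        unfolding fill_bit_def
      proof (rule wpp_wp_Seq, rule wpp_Flip[OF b'], rule impI)
        fix c assume b2: "bnd V (store 66 0 (of_bool c) s')"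
        show "wp (Set 69 (Add (Mul (Const 2) (Rg 69)) (Rg 66))) 1
          (\<lambda>s'. s' 68 0 = i \<and> J (Suc i) (2 * x + of_bool c) (store 68 0 (Suc i) s')) (store 66 0 (of_bool c) s')"
          by (rule wp_Write[OF b2]) (use J x2[of c] xV[of c] in \<open>auto simp: esq_def J_def intro!: agree_store\<close>)
      qed
      then show "wpp fill_bit 2 (pmf_of_set UNIV) (\<lambda>y s'. s' 68 0 = i \<and> J (Suc i) (2 * x + of_bool y) (store 68 0 (Suc i) s')) s'"
        by (rule wpp_mono) simp_all
    qed (use mV in auto)
    have "wpp (Seq (For 68 (Rg 62) fill_bit) (Write 30 (Rg 67) (Rg 69))) ((K * (2 + 2) + 2) + 1) (word_pmf K)
      (\<lambda>y s'. s' 67 0 = j \<and> I (Suc j) (fun_upd f j y) (store 67 0 (Suc j) s')) (store 69 0 0 s1)"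
    proof (rule wpp_wp_Seq, rule wpp_mono[OF loop order_refl], rule impI)
      fix y s' assume b': "bnd V s'" and J: "J K y s'"
      show "wp (Write 30 (Rg 67) (Rg 69)) 1 (\<lambda>s'. s' 67 0 = j \<and> I (Suc j) (fun_upd f j y) (store 67 0 (Suc j) s')) s'"
        by (rule wp_Write[OF b'])
           (use b' J I s1 in \<open>auto simp: esq_def J_def I_def agree_def store_def less_Suc_eq\<close>)
    qed
    then have "wpp fill_word (1 + ((K * (2 + 2) + 2) + 1)) (word_pmf K)
      (\<lambda>y s'. s' 67 0 = j \<and> I (Suc j) (fun_upd f j y) (store 67 0 (Suc j) s')) s1"
      unfolding fill_word_def by (intro wp_wpp_Seq wp_Write b1) (auto simp: esq_def)
    then show ?thesis by (rule wpp_mono) simp_all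
  qed
  have "wpp fill (m * ((K * 4 + 4) + 2) + 2) (words_pmf K m) (I m) s"
    unfolding fill_def
  proof (rule wpp_For[where I = I and D = "words_pmf K" and E = "word_pmf K" and h = "\<lambda>j f y. f(j := y)", OF b _ words_pmf_0 words_pmf_Suc])
    show "inj_on (\<lambda>(f, y). f(j := y)) (set_pmf (words_pmf K j) \<times> set_pmf (word_pmf K))" for j
    proof (rule inj_onI, clarify)
      fix f f' :: "nat \<Rightarrow> nat" and y y'
      assume f: "f \<in> set_pmf (words_pmf K j)" "f' \<in> set_pmf (words_pmf K j)" and e: "f(j := y) = f'(j := y')"
      have "y = y'" using fun_cong[OF e, of j] by simp
      moreover have "f i = f' i" for i
        using fun_cong[OF e, of i] set_words_pmf(2)[OF f(1), of j] set_words_pmf(2)[OF f(2), of j] by (cases "i = j") auto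
      ultimately show "f = f' \<and> y = y'" by auto
    qed
    show "aval (Rg 61) s' = m \<and> s' 67 0 = j" if "I j f s'" for j f s'
      using that s by (auto simp: I_def agree_def)
    show "I 0 (\<lambda>_. 0) (store 67 0 0 s)" by (auto simp: I_def intro!: agree_store agree_refl)
  qed (use mV word in auto)
  then show ?thesis by (rule wpp_mono) (simp_all add: I_def)
qed

text \<open>Returns from the calculus to the semantics: losslessness, worst-case time, and the
  probability of \<open>P\<close>, bounded below by that of the outcomes whose postcondition implies
  \<open>P\<close>.\<close>

lemma wpp_run:
  assumes "wpp c T D Q s"
  shows "lossless_spmf (exec c (s, 0))"
    "(s', t) \<in> set_spmf (exec c (s, 0)) \<Longrightarrow> t \<le> T * (\<kappa> * bits V)"
    "measure_pmf.prob D {x. \<forall>s'. Q x s' \<longrightarrow> P s'} \<le> measure (measure_spmf (exec c (s, 0))) {(s', t). P s'}"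
proof -
  obtain g u where 1: "exec c (s, 0) = map_spmf (\<lambda>x. (g x, u x)) (spmf_of_pmf D)"
    and 2: "\<And>x. x \<in> set_pmf D \<Longrightarrow> u x \<le> T * (\<kappa> * bits V) \<and> Q x (g x)"
  proof -
    obtain g u where "\<And>t. exec c (s, t) = map_spmf (\<lambda>x. (g x, t + u x)) (spmf_of_pmf D)"
      "\<And>x. x \<in> set_pmf D \<Longrightarrow> u x \<le> T * (\<kappa> * bits V) \<and> bnd V (g x) \<and> Q x (g x)"
      using assms unfolding wpp_def by blast
    from this(1)[of 0] this(2) show ?thesis by (intro that[of g u]) simp_all
  qed
  show "lossless_spmf (exec c (s, 0))" by (simp add: 1)
  show "(s', t) \<in> set_spmf (exec c (s, 0)) \<Longrightarrow> t \<le> T * (\<kappa> * bits V)" using 2 by (auto simp: 1)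
  have "measure (measure_spmf (exec c (s, 0))) {(s', t). P s'} = measure_pmf.prob D {x. P (g x)}"
    unfolding 1 by (simp add: measure_map_spmf vimage_def measure_spmf_spmf_of_pmf)
  moreover have "measure_pmf.prob D {x. \<forall>s'. Q x s' \<longrightarrow> P s'} \<le> measure_pmf.prob D {x. P (g x)}"
    by (rule measure_pmf.finite_measure_mono_AE) (use 2 in \<open>auto simp: AE_measure_pmf_iff\<close>)
  ultimately show "measure_pmf.prob D {x. \<forall>s'. Q x s' \<longrightarrow> P s'} \<le> measure (measure_spmf (exec c (s, 0))) {(s', t). P s'}" by simp
qed

end

section \<open>Parameters\<close>

text \<open>The program must compute all parameters, so \<open>w = (k + 1)\<^sup>d \<le> \<surd>n\<close>, \<open>J\<close> and the rational approximation
  \<open>qpar / n\<^sup>2\<close> of \<open>\<gamma>\<close> use only integer arithmetic.\<close>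

definition dpar :: "nat \<Rightarrow> nat \<Rightarrow> nat" where
  "dpar k n = (LEAST d. n < (k + 1) ^ Suc d * (k + 1) ^ Suc d)"

definition wpar :: "nat \<Rightarrow> nat \<Rightarrow> nat" where
  "wpar k n = (k + 1) ^ dpar k n"

text \<open>The largest \<open>J\<close> for which depth \<open>dpar k n\<close> suffices to
  approximate the rate up to \<open>2 / J\<close>; the exponent is that of
  \<open>gw_le\<close>.\<close>

definition Jpar :: "nat \<Rightarrow> nat \<Rightarrow> nat" where
  "Jpar k n = (LEAST J. dpar k n < Suc J ^ (2 * (k - 1)))"

definition qpar :: "nat \<Rightarrow> nat \<Rightarrow> nat" where
  "qpar k n = (\<Sum>j<Jpar k n. n * n div (Suc j * ((k - 1) * Suc j + 1)))"

text \<open>The solution of \<open>i = \<gamma> * (n - i)\<close> with \<open>\<gamma>\<close>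
  replaced by \<open>qpar k n / n^2\<close>, rounded down.\<close>

definition ipar :: "nat \<Rightarrow> nat \<Rightarrow> nat" where
  "ipar k n = n * qpar k n div (n * n + qpar k n)"

text \<open>The exponent of the number of trials. The success probability of a trial is at least
  about \<open>2\<close> to the power \<open>- (n - 2 * i + 2 * n / J)\<close>. What the constant
  \<open>16\<close> exceeds \<open>2\<close> by pays for rounding, for the factor
  \<open>1 / 2\<close> lost to biased words, and for the factor \<open>n + 4\<close> of the union
  bound.\<close>

definition epar :: "nat \<Rightarrow> nat \<Rightarrow> nat" where
  "epar k n = n - 2 * ipar k n + 16 * (n div Jpar k n)"

text \<open>If a fraction of more than \<open>2 ^ i / 2 ^ n\<close> of all assignments is
  satisfying, a relative error above \<open>1 / (2 * N)\<close> has probability at most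
  \<open>4 * N^2 * 2 ^ (n - i) / M\<close> by Chebyshev's inequality; the factor \<open>16\<close>
  makes this \<open>1 / 4\<close>.\<close>

definition Mpar :: "nat \<Rightarrow> nat \<Rightarrow> nat \<Rightarrow> nat" where
  "Mpar k n N = 16 * (N * N * 2 ^ (n - ipar k n))"

section \<open>Programs for the parameters and the main program\<close>

primrec powe :: "aexp \<Rightarrow> nat \<Rightarrow> aexp" where
  "powe b 0 = Const 1"
| "powe b (Suc m) = Mul b (powe b m)"

definition kw :: "nat \<Rightarrow> aexp" where
  "kw k = Mul (Const (k + 1)) (Rg 51)"

definition set_w :: "nat \<Rightarrow> com" where
  "set_w k = Seq (Set 51 (Const 1)) (Seq (Set 54 (Const 0))
     (While (Sub (Add (Rg 0) (Const 1)) (Mul (kw k) (kw k)))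
       (Seq (Set 51 (kw k)) (Set 54 (Add (Rg 54) (Const 1))))))"

definition guardJ :: "nat \<Rightarrow> aexp" where
  "guardJ k = Sub (Add (Rg 54) (Const 1)) (powe (Add (Rg 55) (Const 1)) (2 * (k - 1)))"

definition set_J :: "nat \<Rightarrow> com" where
  "set_J k = Seq (Set 55 (Const 0)) (While (guardJ k) (Set 55 (Add (Rg 55) (Const 1))))"

definition pow2 :: "nat \<Rightarrow> aexp \<Rightarrow> com" where
  "pow2 x e = Seq (Set x (Const 1)) (For 64 e (Set x (Mul (Const 2) (Rg x))))"

definition set_NW :: com where
  "set_NW = Seq (Set 53 (Const 1)) (For 64 (Rg 51) (Set 53 (Mul (Rg 0) (Rg 53))))"

definition set_q :: "nat \<Rightarrow> com" where
  "set_q k = Seq (Set 56 (Const 0)) (For 64 (Rg 55) (Set 56 (Add (Rg 56)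
     (Div (Mul (Rg 0) (Rg 0)) (Mul (Add (Rg 64) (Const 1)) (Add (Mul (Const (k - 1)) (Add (Rg 64) (Const 1))) (Const 1)))))))"

definition exponent :: aexp where
  "exponent = Add (Sub (Rg 0) (Mul (Const 2) (Rg 57))) (Mul (Const 16) (Div (Rg 0) (Rg 55)))"

definition parameters :: "nat \<Rightarrow> com" where
  "parameters k = Seq (set_w k) (Seq (set_J k) (Seq (pow2 52 (Rg 51)) (Seq set_NW (Seq (set_q k)
     (Seq (Set 57 (Div (Mul (Rg 0) (Rg 56)) (Add (Mul (Rg 0) (Rg 0)) (Rg 56))))
     (Seq (pow2 58 (Rg 57))
     (Seq (Set 31 (Mul (Const 16) (Mul (Mul (Read 0 (Const 1)) (Read 0 (Const 1))) (Div (Rg 50) (Rg 58)))))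
     (Seq (pow2 59 exponent)
     (Seq (Set 60 (Mul (Add (Mul (Const 2) (Rg 0)) (Const 3)) (Rg 58)))
     (Seq (Set 61 (Add (Rg 31) (Rg 59)))
     (Set 62 (Mul (Rg 0) (Add (Rg 0) (Const 1))))))))))))))"

text \<open>Exact counting by way of \<open>sample\<close>: the words \<open>0\<close> to
  \<open>2 ^ n - 1\<close> are all assignments, each occurring once.\<close>

definition brute :: com where
  "brute = Seq (For 31 (Rg 50) (Write 30 (Rg 31) (Rg 31))) sample"

text \<open>Subtraction is truncated, so the guard holds iff \<open>2 ^ n \<le> N\<close> or
  \<open>n < n0\<close>. The constant \<open>n0\<close> is chosen from \<open>k\<close> alone and
  covers the small \<open>n\<close> for which the parameters are not yet adequate.\<close>

definition main :: "nat \<Rightarrow> nat \<Rightarrow> com" where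
  "main k n0 = Seq (pow2 50 (Rg 0))
     (Cond (Add (Sub (Add (Read 0 (Const 1)) (Const 1)) (Rg 50)) (Sub (Const n0) (Rg 0)))
       brute (Seq (parameters k) (Seq fill count)))"

lemma aval_powe [simp]: "aval (powe b m) s = aval b s ^ m"
  by (induction m) auto

lemma cok_powe: "cok V b \<Longrightarrow> 1 \<le> V \<Longrightarrow> cok V (powe b m)"
  by (induction m) auto

section \<open>Size and computation of the parameters\<close>

lemma dpar_ex:
  assumes "0 < k" shows "n < (k + 1) ^ Suc n * (k + 1) ^ Suc n"
proof -
  have "n < 2 ^ n" by (rule less_exp)
  also have "(2::nat) ^ n \<le> (k + 1) ^ n" using assms by (intro power_mono) auto
  also have "\<dots> \<le> (k + 1) ^ Suc n * (k + 1) ^ Suc n"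
    unfolding power_add[symmetric] by (intro power_increasing) auto
  finally show ?thesis .
qed

lemma dpar_props:
  assumes "0 < k"
  shows "n < (k + 1) ^ Suc (dpar k n) * (k + 1) ^ Suc (dpar k n)" "dpar k n \<le> n"
    "d < dpar k n \<Longrightarrow> (k + 1) ^ Suc d * (k + 1) ^ Suc d \<le> n"
  unfolding dpar_def
proof -
  let ?P = "\<lambda>d. n < (k + 1) ^ Suc d * (k + 1) ^ Suc d"
  show "?P (LEAST d. ?P d)" by (rule LeastI[of ?P n]) (rule dpar_ex[OF assms])
  show "(LEAST d. ?P d) \<le> n" by (rule Least_le) (rule dpar_ex[OF assms])
  show "(k + 1) ^ Suc d * (k + 1) ^ Suc d \<le> n" if "d < (LEAST d. ?P d)"
    using not_less_Least[OF that] by simp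
qed

lemma wpar_square: assumes "0 < k" "0 < n" shows "wpar k n * wpar k n \<le> n"
  using dpar_props(3)[OF assms(1), of "dpar k n - 1" n] assms(2)
  by (cases "dpar k n") (auto simp: wpar_def)

lemma wpar_le: assumes "0 < k" "0 < n" shows "wpar k n \<le> n"
proof -
  have "1 \<le> wpar k n" by (simp add: wpar_def)
  then have "wpar k n * 1 \<le> wpar k n * wpar k n" by (intro mult_left_mono) auto
  then show ?thesis using wpar_square[OF assms] by linarith
qed

lemma Jpar_props:
  assumes "2 \<le> k"
  shows "dpar k n < Suc (Jpar k n) ^ (2 * (k - 1))" "Jpar k n \<le> dpar k n"
    "J < Jpar k n \<Longrightarrow> Suc J ^ (2 * (k - 1)) \<le> dpar k n"
  unfolding Jpar_def
proof -
  let ?P = "\<lambda>J. dpar k n < Suc J ^ (2 * (k - 1))"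
  have "dpar k n < Suc (dpar k n) ^ 1" by simp
  also have "\<dots> \<le> Suc (dpar k n) ^ (2 * (k - 1))" using assms by (intro power_increasing) auto
  finally have ex: "?P (dpar k n)" .
  show "?P (LEAST J. ?P J)" by (rule LeastI[of ?P, OF ex])
  show "(LEAST J. ?P J) \<le> dpar k n" by (rule Least_le[of ?P, OF ex])
  show "Suc J ^ (2 * (k - 1)) \<le> dpar k n" if "J < (LEAST J. ?P J)"
    using not_less_Least[OF that] by simp
qed

lemma ipar_le: "ipar k n \<le> n"
proof (cases "n * n + qpar k n = 0")
  case False
  have "n * qpar k n \<le> n * (n * n + qpar k n)" by (intro mult_left_mono) auto
  then have "ipar k n \<le> n * (n * n + qpar k n) div (n * n + qpar k n)"
    unfolding ipar_def by (rule div_le_mono)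
  then show ?thesis using False by (auto simp: ipar_def split: if_splits)
qed (simp add: ipar_def)

lemma qpar_le:
  assumes "2 \<le> k" shows "(\<Sum>j<J. n * n div (Suc j * ((k - 1) * Suc j + 1))) \<le> J * (n * n)"
proof -
  have "(\<Sum>j<J. n * n div (Suc j * ((k - 1) * Suc j + 1))) \<le> (\<Sum>j<J. n * n)"
    by (rule sum_mono) (rule div_le_dividend)
  then show ?thesis by simp
qed

context machine begin

lemma pow2_wp:
  assumes b: "bnd V s" and x: "x \<noteq> 64" and e: "cok V e" "esz e \<le> 20" and m: "2 ^ m \<le> V" "m \<le> V"
    and val: "\<And>s'. agree {64, x} s s' \<Longrightarrow> aval e s' = m"
  shows "wp (pow2 x e) (m * 3 + 3) (\<lambda>s'. agree {64, x} s s' \<and> s' x 0 = 2 ^ m) s"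
proof -
  define I where "I j s' \<longleftrightarrow> agree {64, x} s s' \<and> s' x 0 = 2 ^ j" for j s'
  have b1: "bnd V (store x 0 1 s)" by (rule bnd_store[OF b]) simp
  have w: "wp (For 64 e (Set x (Mul (Const 2) (Rg x)))) (m * (1 + 2) + 2) (I m) (store x 0 1 s)"
  proof (rule wp_For[where Inv = I and N = m])
    fix j s' assume I: "I j s'" and b': "bnd V s'" and j: "j < m" "s' 64 0 = j"
    have "(2::nat) ^ Suc j \<le> 2 ^ m" using j by (intro power_increasing) auto
    then have "2 * 2 ^ j \<le> V" using m by simp
    then show "wp (Set x (Mul (Const 2) (Rg x))) 1 (\<lambda>s'. s' 64 0 = j \<and> I (Suc j) (store 64 0 (Suc j) s')) s'"
      by (intro wp_Write b') (use I j x in \<open>auto simp: esq_def I_def intro!: agree_store\<close>)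
  qed (use b1 e m val x in \<open>auto simp: I_def intro!: agree_store agree_refl\<close>)
  have "wp (pow2 x e) (1 + (m * (1 + 2) + 2)) (I m) s"
    unfolding pow2_def by (rule wp_SeqWriteI[OF b w]) (simp_all add: esq_def)
  then show ?thesis by (rule wp_mono) (auto simp: I_def)
qed

end

lemma n_lt: "n < (2::nat) ^ n" by (rule less_exp)

context prog begin

lemma set_w_wp:
  assumes b: "bnd V s" and s: "s 0 = inp" and n: "0 < n" and k: "0 < k" and kV: "k + 1 \<le> V"
  shows "wp (set_w k) (n * 3 + 3) (\<lambda>s'. agree {51, 54} s s' \<and> s' 51 0 = wpar k n \<and> s' 54 0 = dpar k n) s"
proof -
  have nV: "n \<le> V" by (rule n_le[OF b s])
  define I where "I m s' \<longleftrightarrow> agree {51, 54} s s' \<and> s' 51 0 = (k + 1) ^ s' 54 0 \<and> s' 54 0 + m = dpar k n" for m s'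
  let ?g = "Sub (Add (Rg 0) (Const 1)) (Mul (kw k) (kw k))"
  have g: "aval ?g s' = 0 \<longleftrightarrow> n < (k + 1) ^ Suc (s' 54 0) * (k + 1) ^ Suc (s' 54 0)" if "I m s'" for m s'
  proof -
    have "s' 0 0 = n" "s' 51 0 = (k + 1) ^ s' 54 0" using that s by (auto simp: I_def agree_def inp_header)
    then show ?thesis by (auto simp: kw_def)
  qed
  have loop: "wp (While ?g (Seq (Set 51 (kw k)) (Set 54 (Add (Rg 54) (Const 1))))) (dpar k n * ((1 + 1) + 1) + 1)
    (\<lambda>s'. agree {51, 54} s s' \<and> s' 51 0 = wpar k n \<and> s' 54 0 = dpar k n) s1"
    if b1: "bnd V s1" and I: "I (dpar k n) s1" for s1
  proof (rule wp_While[where Inv = I, OF I b1])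
    fix m s' assume I: "I m s'" and b': "bnd V s'" and g': "aval ?g s' \<noteq> 0"
    have le: "(k + 1) ^ Suc (s' 54 0) * (k + 1) ^ Suc (s' 54 0) \<le> n" using g[OF I] g' by simp
    have m: "0 < m"
    proof (rule ccontr)
      assume "\<not> 0 < m"
      then have "s' 54 0 = dpar k n" using I by (simp add: I_def)
      then show False using le dpar_props(1)[OF k, of n] by simp
    qed
    have "(k + 1) ^ Suc (s' 54 0) * 1 \<le> (k + 1) ^ Suc (s' 54 0) * (k + 1) ^ Suc (s' 54 0)"
      by (rule mult_left_mono, rule one_le_power) simp_all
    from le_trans[OF this le] have "(k + 1) ^ Suc (s' 54 0) \<le> n" by (simp only: mult_1_right)
    then have kwV: "(k + 1) * (k + 1) ^ s' 54 0 \<le> V" using nV unfolding power_Suc by linarith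
    have dV: "Suc (s' 54 0) \<le> V" using I m dpar_props(2)[OF k, of n] nV by (simp add: I_def)
    have s51: "s' 51 0 = (k + 1) ^ s' 54 0" using I by (simp add: I_def)
    have b2: "bnd V (store 51 0 ((k + 1) * (k + 1) ^ s' 54 0) s')" by (rule bnd_store[OF b' kwV])
    have "wp (Seq (Set 51 (kw k)) (Set 54 (Add (Rg 54) (Const 1)))) (1 + 1) (I (m - 1)) s'"
    proof (rule wp_SeqWriteI[OF b'])
      show "wp (Set 54 (Add (Rg 54) (Const 1))) 1 (I (m - 1)) (store 51 0 ((k + 1) * (k + 1) ^ s' 54 0) s')"
        by (rule wp_Write[OF b2]) (use I m dV in \<open>auto simp: esq_def I_def intro!: agree_store\<close>)
    qed (use s51 kV kwV in \<open>simp_all add: kw_def esq_def\<close>)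
    then show "0 < m \<and> wp (Seq (Set 51 (kw k)) (Set 54 (Add (Rg 54) (Const 1)))) (1 + 1) (I (m - 1)) s'" using m by simp
  next
    fix m s' assume I: "I m s'" and b': "bnd V s'" and g': "aval ?g s' = 0"
    have lt: "n < (k + 1) ^ Suc (s' 54 0) * (k + 1) ^ Suc (s' 54 0)" using g[OF I] g' by simp
    have "\<not> s' 54 0 < dpar k n" using dpar_props(3)[OF k, of "s' 54 0" n] lt by linarith
    then have "s' 54 0 = dpar k n" using I by (simp add: I_def)
    then show "agree {51, 54} s s' \<and> s' 51 0 = wpar k n \<and> s' 54 0 = dpar k n" using I by (simp add: I_def wpar_def)
  qed (use kV in \<open>auto simp: kw_def esq_def\<close>)
  have b1: "bnd V (store 51 0 1 s)" by (rule bnd_store[OF b]) simp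
  have b2: "bnd V (store 54 0 0 (store 51 0 1 s))" by (rule bnd_store[OF b1]) simp
  have w2: "wp (While ?g (Seq (Set 51 (kw k)) (Set 54 (Add (Rg 54) (Const 1))))) (dpar k n * ((1 + 1) + 1) + 1)
    (\<lambda>s'. agree {51, 54} s s' \<and> s' 51 0 = wpar k n \<and> s' 54 0 = dpar k n) (store 54 0 0 (store 51 0 1 s))"
    by (rule loop[OF b2]) (auto simp: I_def intro!: agree_store agree_refl)
  have w1: "wp (Seq (Set 54 (Const 0)) (While ?g (Seq (Set 51 (kw k)) (Set 54 (Add (Rg 54) (Const 1)))))) (1 + (dpar k n * ((1 + 1) + 1) + 1))
    (\<lambda>s'. agree {51, 54} s s' \<and> s' 51 0 = wpar k n \<and> s' 54 0 = dpar k n) (store 51 0 1 s)"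
    by (rule wp_SeqWriteI[OF b1 w2]) (simp_all add: esq_def)
  have "wp (set_w k) (1 + (1 + (dpar k n * ((1 + 1) + 1) + 1)))
    (\<lambda>s'. agree {51, 54} s s' \<and> s' 51 0 = wpar k n \<and> s' 54 0 = dpar k n) s"
    unfolding set_w_def by (rule wp_SeqWriteI[OF b w1]) (simp_all add: esq_def)
  then show ?thesis by (rule wp_mono) (use dpar_props(2)[OF k, of n] in auto)
qed

lemma set_J_wp:
  assumes b: "bnd V s" and s: "s 54 0 = dpar k n" and k: "2 \<le> k" and g\<kappa>: "esq (guardJ k) \<le> \<kappa>" and nV: "n \<le> V"
  shows "wp (set_J k) (n * 2 + 2) (\<lambda>s'. agree {55} s s' \<and> s' 55 0 = Jpar k n) s"
proof -
  have k0: "0 < k" using k by simp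
  define I where "I m s' \<longleftrightarrow> agree {55} s s' \<and> s' 55 0 + m = Jpar k n" for m s'
  have g: "aval (guardJ k) s' = 0 \<longleftrightarrow> dpar k n < Suc (s' 55 0) ^ (2 * (k - 1))" if "I m s'" for m s'
  proof -
    have "s' 54 0 = dpar k n" using that s by (auto simp: I_def agree_def)
    then show ?thesis by (auto simp: guardJ_def)
  qed
  have Jn: "Jpar k n \<le> n" using Jpar_props(2)[OF k, of n] dpar_props(2)[OF k0, of n] by linarith
  have b1: "bnd V (store 55 0 0 s)" by (rule bnd_store[OF b]) simp
  have I0: "I (Jpar k n) (store 55 0 0 s)" by (auto simp: I_def intro!: agree_store agree_refl)
  have w: "wp (While (guardJ k) (Set 55 (Add (Rg 55) (Const 1)))) (Jpar k n * (1 + 1) + 1)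
    (\<lambda>s'. agree {55} s s' \<and> s' 55 0 = Jpar k n) (store 55 0 0 s)"
  proof (rule wp_While[where Inv = I, OF I0 b1])
    show "cok V (guardJ k)" unfolding guardJ_def by (auto intro!: cok_powe)
  next
    fix m s' assume I: "I m s'" and b': "bnd V s'" and g': "aval (guardJ k) s' \<noteq> 0"
    have le: "Suc (s' 55 0) ^ (2 * (k - 1)) \<le> dpar k n" using g[OF I] g' by simp
    have m: "0 < m"
    proof (rule ccontr)
      assume "\<not> 0 < m"
      then have "s' 55 0 = Jpar k n" using I by (simp add: I_def)
      then show False using le Jpar_props(1)[OF k, of n] by simp
    qed
    have "Suc (s' 55 0) \<le> V" using I m Jn nV by (simp add: I_def)
    then have "wp (Set 55 (Add (Rg 55) (Const 1))) 1 (I (m - 1)) s'"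
      by (intro wp_Write b') (use I m in \<open>auto simp: esq_def I_def intro!: agree_store\<close>)
    then show "0 < m \<and> wp (Set 55 (Add (Rg 55) (Const 1))) 1 (I (m - 1)) s'" using m by simp
  next
    fix m s' assume I: "I m s'" and b': "bnd V s'" and g': "aval (guardJ k) s' = 0"
    have "\<not> s' 55 0 < Jpar k n" using Jpar_props(3)[OF k, of "s' 55 0" n] g[OF I] g' by linarith
    then show "agree {55} s s' \<and> s' 55 0 = Jpar k n" using I by (simp add: I_def)
  qed (use g\<kappa> in auto)
  have "wp (set_J k) (1 + (Jpar k n * (1 + 1) + 1)) (\<lambda>s'. agree {55} s s' \<and> s' 55 0 = Jpar k n) s"
    unfolding set_J_def by (rule wp_SeqWriteI[OF b w]) (simp_all add: esq_def)
  then show ?thesis by (rule wp_mono) (use Jn in auto)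
qed

lemma set_NW_wp:
  assumes b: "bnd V s" and s: "s 0 = inp" "s 51 0 = m" and n: "0 < n" and mV: "n ^ m \<le> V" "m \<le> V"
  shows "wp set_NW (m * 3 + 3) (\<lambda>s'. agree {53, 64} s s' \<and> s' 53 0 = n ^ m) s"
proof -
  define I where "I j s' \<longleftrightarrow> agree {53, 64} s s' \<and> s' 53 0 = n ^ j" for j s'
  have b1: "bnd V (store 53 0 1 s)" by (rule bnd_store[OF b]) simp
  have w: "wp (For 64 (Rg 51) (Set 53 (Mul (Rg 0) (Rg 53)))) (m * (1 + 2) + 2) (I m) (store 53 0 1 s)"
  proof (rule wp_For[where Inv = I and N = m])
    show "aval (Rg 51) s' = m" if "I j s'" for j s' using that s by (auto simp: I_def agree_def)
    fix j s' assume I: "I j s'" and b': "bnd V s'" and j: "j < m" "s' 64 0 = j"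
    have "n ^ Suc j \<le> n ^ m" using j n by (intro power_increasing) auto
    then have "n * n ^ j \<le> V" using mV by simp
    moreover have "s' 0 0 = n" using I s by (auto simp: I_def agree_def inp_header)
    ultimately show "wp (Set 53 (Mul (Rg 0) (Rg 53))) 1 (\<lambda>s'. s' 64 0 = j \<and> I (Suc j) (store 64 0 (Suc j) s')) s'"
      by (intro wp_Write b') (use I j in \<open>auto simp: esq_def I_def intro!: agree_store\<close>)
  qed (use b1 mV in \<open>auto simp: I_def intro!: agree_store agree_refl\<close>)
  have "wp set_NW (1 + (m * (1 + 2) + 2)) (I m) s"
    unfolding set_NW_def by (rule wp_SeqWriteI[OF b w]) (simp_all add: esq_def)
  then show ?thesis by (rule wp_mono) (auto simp: I_def)
qed

lemma set_q_wp:
  assumes b: "bnd V s" and s: "s 0 = inp" "s 55 0 = Jpar k n" and k: "2 \<le> k" and kV: "k \<le> V"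
    and V3: "n * (n * n) \<le> V" and Jn: "Jpar k n \<le> n" and nV: "n \<le> V"
  shows "wp (set_q k) (n * 3 + 3) (\<lambda>s'. agree {56, 64} s s' \<and> s' 56 0 = qpar k n) s"
proof -
  define f where "f J = (\<Sum>j<J. n * n div (Suc j * ((k - 1) * Suc j + 1)))" for J
  define I where "I j s' \<longleftrightarrow> agree {56, 64} s s' \<and> s' 56 0 = f j \<and> s' 64 0 = j" for j s'
  let ?c = "Set 56 (Add (Rg 56)
     (Div (Mul (Rg 0) (Rg 0)) (Mul (Add (Rg 64) (Const 1)) (Add (Mul (Const (k - 1)) (Add (Rg 64) (Const 1))) (Const 1)))))"
  have b1: "bnd V (store 56 0 0 s)" by (rule bnd_store[OF b]) simp
  have w: "wp (For 64 (Rg 55) ?c) (Jpar k n * (1 + 2) + 2) (I (Jpar k n)) (store 56 0 0 s)"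
  proof (rule wp_For[where Inv = I and N = "Jpar k n"])
    show "aval (Rg 55) s' = Jpar k n" if "I j s'" for j s' using that s by (auto simp: I_def agree_def)
    fix j s' assume I: "I j s'" and b': "bnd V s'" and j: "j < Jpar k n" "s' 64 0 = j"
    have s0: "s' 0 0 = n" using I s by (auto simp: I_def agree_def inp_header)
    have "f (Suc j) \<le> Suc j * (n * n)" unfolding f_def by (rule qpar_le[OF k])
    also have "\<dots> \<le> n * (n * n)" using j Jn by (intro mult_right_mono) auto
    finally have "f (Suc j) \<le> V" using V3 by simp
    moreover have "f (Suc j) = f j + n * n div (Suc j * ((k - 1) * Suc j + 1))" by (simp add: f_def)
    ultimately show "wp ?c 1 (\<lambda>s'. s' 64 0 = j \<and> I (Suc j) (store 64 0 (Suc j) s')) s'"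
      by (intro wp_Write b') (use I j kV s0 in \<open>auto simp: esq_def I_def intro!: agree_store\<close>)
  qed (use b1 Jn nV in \<open>auto simp: I_def f_def intro!: agree_store agree_refl\<close>)
  have "wp (set_q k) (1 + (Jpar k n * (1 + 2) + 2)) (I (Jpar k n)) s"
    unfolding set_q_def by (rule wp_SeqWriteI[OF b w]) (simp_all add: esq_def)
  then show ?thesis by (rule wp_mono) (use Jn in \<open>auto simp: I_def f_def qpar_def\<close>)
qed

abbreviation par_regs :: "nat set" where
  "par_regs \<equiv> {31, 51, 52, 53, 54, 55, 56, 57, 58, 59, 60, 61, 62, 64}"

text \<open>The exponent \<open>n * n + 20 * n + 20\<close> leaves room for
  \<open>n ^ wpar k n \<le> 2 ^ (n * n)\<close>, for \<open>2 ^ epar k n\<close> with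
  \<open>epar k n \<le> 17 * n\<close>, and for the words of \<open>n * (n + 1)\<close> bits used
  later.\<close>

lemma parameters_wp:
  assumes b: "bnd V s" and s: "s 0 = inp" "s 50 0 = 2 ^ n" and n: "0 < n" and k: "2 \<le> k" and g\<kappa>: "esq (guardJ k) \<le> \<kappa>"
    and kV: "k + 1 \<le> V" and N: "N < 2 ^ n" and J: "0 < Jpar k n" and big: "2 ^ (n * n + 20 * n + 20) \<le> V"
  shows "wp (parameters k) (n * 80 + 30) (\<lambda>s'. agree par_regs s s' \<and> s' 51 0 = wpar k n \<and> s' 52 0 = 2 ^ wpar k n \<and>
     s' 53 0 = n ^ wpar k n \<and> s' 58 0 = 2 ^ ipar k n \<and> s' 31 0 = Mpar k n N \<and> s' 59 0 = 2 ^ epar k n \<and>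
     s' 60 0 = (2 * n + 3) * 2 ^ ipar k n \<and> s' 61 0 = Mpar k n N + 2 ^ epar k n \<and> s' 62 0 = n * (n + 1)) s"
    (is "wp _ _ ?Q s")
proof -
  have k0: "0 < k" using k by simp
  have V2: "x \<le> V" if "x \<le> 2 ^ a" "a \<le> n * n + 20 * n + 20" for x a
  proof -
    have "(2::nat) ^ a \<le> 2 ^ (n * n + 20 * n + 20)" using that(2) by (intro power_increasing) auto
    then show ?thesis using that(1) big by linarith
  qed
  have nV: "n \<le> V" by (rule n_le[OF b s(1)])
  have nn: "n * n \<le> 2 ^ (2 * n)" using mult_mono[OF less_imp_le[OF n_lt] less_imp_le[OF n_lt], of n n] by (simp add: mult_2 power_add)
  have nnn: "n * (n * n) \<le> 2 ^ (3 * n)"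
    using mult_mono[OF less_imp_le[OF n_lt] nn, of n] by (simp add: power_add[symmetric])
  have wn: "wpar k n \<le> n" by (rule wpar_le[OF k0 n])
  have Jn: "Jpar k n \<le> n" using Jpar_props(2)[OF k, of n] dpar_props(2)[OF k0, of n] by linarith
  have TW: "2 ^ wpar k n \<le> V" by (rule V2[OF order_refl]) (use wn in simp)
  have NW: "n ^ wpar k n \<le> V"
  proof (rule V2)
    show "n ^ wpar k n \<le> 2 ^ (n * n)"
    proof -
      have "n ^ wpar k n \<le> (2 ^ n) ^ wpar k n" using n_lt[of n] by (intro power_mono) auto
      also have "\<dots> \<le> (2 ^ n) ^ n" using wn by (intro power_increasing) auto
      finally show ?thesis by (simp add: power_mult)
    qed
  qed simp
  have iV: "2 ^ ipar k n \<le> V" by (rule V2[OF order_refl]) (use ipar_le[of k n] in simp)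
  have Mle: "Mpar k n N \<le> 2 ^ (3 * n + 4)"
  proof -
    have "N * N \<le> 2 ^ n * 2 ^ n" using N by (intro mult_mono) auto
    moreover have "(2::nat) ^ (n - ipar k n) \<le> 2 ^ n" by (intro power_increasing) auto
    ultimately have "N * N * 2 ^ (n - ipar k n) \<le> 2 ^ n * 2 ^ n * 2 ^ n" by (rule mult_mono) auto
    then have "Mpar k n N \<le> 2 ^ 4 * (2 ^ n * 2 ^ n * 2 ^ n)" unfolding Mpar_def by simp
    also have "\<dots> = 2 ^ (4 + (n + n + n))" by (simp only: power_add mult.assoc)
    also have "4 + (n + n + n) = 3 * n + 4" by simp
    finally show ?thesis .
  qed
  have ele: "epar k n \<le> 17 * n" using div_le_dividend[of n "Jpar k n"] unfolding epar_def by linarith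
  have R: "2 ^ epar k n \<le> V" by (rule V2[OF order_refl]) (use ele in simp)
  have MRle: "Mpar k n N + 2 ^ epar k n \<le> V"
  proof (rule V2)
    have "(2::nat) ^ (3 * n + 4) \<le> 2 ^ (17 * n + 4)" "(2::nat) ^ epar k n \<le> 2 ^ (17 * n + 4)"
      using ele by (auto intro!: power_increasing)
    moreover have "(2::nat) ^ (17 * n + 5) = 2 * 2 ^ (17 * n + 4)" by (simp flip: power_Suc)
    ultimately show "Mpar k n N + 2 ^ epar k n \<le> 2 ^ (17 * n + 5)" using Mle by linarith
  qed simp
  have capV: "(2 * n + 3) * 2 ^ ipar k n \<le> V"
  proof (rule V2)
    have "2 * n + 3 \<le> 8 * 2 ^ n" using n_lt[of n] one_le_power[of "2::nat" n] by linarith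
    then have "2 * n + 3 \<le> 2 ^ (n + 3)" by (simp add: power_add)
    moreover have "(2::nat) ^ ipar k n \<le> 2 ^ n" using ipar_le by (intro power_increasing) auto
    ultimately have "(2 * n + 3) * 2 ^ ipar k n \<le> 2 ^ (n + 3) * 2 ^ n" by (rule mult_le_mono)
    also have "\<dots> = 2 ^ (2 * n + 3)" unfolding power_add[symmetric] by (rule arg_cong[where f = "power 2"]) simp
    finally show "(2 * n + 3) * 2 ^ ipar k n \<le> 2 ^ (2 * n + 3)" .
  qed simp
  have KV: "n * (n + 1) \<le> V"
  proof (rule V2)
    show "n * (n + 1) \<le> 2 ^ (n * (n + 1))" using n_lt[of "n * (n + 1)"] by simp
  qed simp
  have ep: "aval exponent s' = epar k n" if "s' 0 0 = n" "s' 57 0 = ipar k n" "s' 55 0 = Jpar k n" for s'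
    using that by (simp add: exponent_def epar_def)
  have dv: "(2::nat) ^ n div 2 ^ ipar k n = 2 ^ (n - ipar k n)" using ipar_le[of k n] by (simp add: power_diff)
  let ?c12 = "Set 62 (Mul (Rg 0) (Add (Rg 0) (Const 1)))"
  let ?c11 = "Seq (Set 61 (Add (Rg 31) (Rg 59))) ?c12"
  let ?c10 = "Seq (Set 60 (Mul (Add (Mul (Const 2) (Rg 0)) (Const 3)) (Rg 58))) ?c11"
  let ?c9 = "Seq (pow2 59 exponent) ?c10"
  let ?c8 = "Seq (Set 31 (Mul (Const 16) (Mul (Mul (Read 0 (Const 1)) (Read 0 (Const 1))) (Div (Rg 50) (Rg 58))))) ?c9"
  let ?c7 = "Seq (pow2 58 (Rg 57)) ?c8"
  let ?c6 = "Seq (Set 57 (Div (Mul (Rg 0) (Rg 56)) (Add (Mul (Rg 0) (Rg 0)) (Rg 56)))) ?c7"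
  let ?c5 = "Seq (set_q k) ?c6"
  let ?c4 = "Seq set_NW ?c5"
  let ?c3 = "Seq (pow2 52 (Rg 51)) ?c4"
  let ?c2 = "Seq (set_J k) ?c3"
  define P where "P s1 \<longleftrightarrow> agree par_regs s s1 \<and> s1 51 0 = wpar k n" for s1
  define P5 where "P5 s1 \<longleftrightarrow> P s1 \<and> s1 52 0 = 2 ^ wpar k n \<and> s1 53 0 = n ^ wpar k n \<and> s1 55 0 = Jpar k n" for s1
  define P7 where "P7 s1 \<longleftrightarrow> P5 s1 \<and> s1 57 0 = ipar k n" for s1
  define P9 where "P9 s1 \<longleftrightarrow> P7 s1 \<and> s1 58 0 = 2 ^ ipar k n \<and> s1 31 0 = Mpar k n N" for s1
  have PX: "s1 0 = inp \<and> s1 0 0 = n \<and> s1 0 1 = N \<and> s1 0 (Suc 0) = N \<and> s1 50 0 = 2 ^ n" if "P s1" for s1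
    using that s by (auto simp: P_def agree_def inp_header)
  have w10: "wp ?c10 (1 + (1 + 1)) ?Q s1" if b1: "bnd V s1" and P1: "P9 s1" "s1 59 0 = 2 ^ epar k n" for s1
  proof -
    have X: "s1 0 0 = n" using PX[of s1] P1 by (simp add: inp_header P9_def P7_def P5_def)
    have b2: "bnd V (store 60 0 ((2 * n + 3) * 2 ^ ipar k n) s1)" by (rule bnd_store[OF b1 capV])
    let ?s3 = "store 61 0 (Mpar k n N + 2 ^ epar k n) (store 60 0 ((2 * n + 3) * 2 ^ ipar k n) s1)"
    have b3: "bnd V ?s3" by (rule bnd_store[OF b2 MRle])
    have w: "wp ?c12 1 ?Q ?s3"
      by (rule wp_Write[OF b3]) (use P1 X KV in \<open>auto simp: esq_def P9_def P7_def P5_def P_def intro!: agree_store\<close>)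
    have w': "wp ?c11 (1 + 1) ?Q (store 60 0 ((2 * n + 3) * 2 ^ ipar k n) s1)"
      by (rule wp_SeqWriteI[OF b2 w]) (use P1 MRle in \<open>simp_all add: esq_def P9_def\<close>)
    show ?thesis
      by (rule wp_SeqWriteI[OF b1 w']) (use P1 X capV in \<open>simp_all add: esq_def P9_def\<close>)
  qed
  have w9: "wp ?c9 ((epar k n * 3 + 3) + (1 + (1 + 1))) ?Q s1" if b1: "bnd V s1" and P1: "P9 s1" for s1
  proof (rule wp_Seq, rule wp_mono[OF pow2_wp[OF b1, of 59 exponent "epar k n"] order_refl], goal_cases)
    case (6 s')
    show ?case by (rule ep) (use 6 P1 PX[of s1] in \<open>auto simp: inp_header P9_def P7_def P5_def agree_def\<close>)
  next
    case (7 s2)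
    show ?case
    proof
      have "P9 s2" using 7(2) P1 by (auto simp: P9_def P7_def P5_def P_def agree_def)
      then show "wp ?c10 (1 + (1 + 1)) ?Q s2" using w10[OF 7(1)] 7(2) by simp
    qed
  qed (use R ele V2[of "17 * n" "17 * n"] n_lt[of "17 * n"] in \<open>auto simp: exponent_def\<close>)
  have w8: "wp ?c8 (1 + ((epar k n * 3 + 3) + (1 + (1 + 1)))) ?Q s1" if b1: "bnd V s1" and P1: "P7 s1" "s1 58 0 = 2 ^ ipar k n" for s1
  proof -
    have X: "s1 0 0 = n" "s1 0 (Suc 0) = N" "s1 50 0 = 2 ^ n" using PX[of s1] P1 by (auto simp: inp_header P7_def P5_def)
    have MV: "Mpar k n N \<le> V" using MRle by simp
    have b2: "bnd V (store 31 0 (Mpar k n N) s1)" by (rule bnd_store[OF b1 MV])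
    have P2: "P9 (store 31 0 (Mpar k n N) s1)" using P1 by (auto simp: P9_def P7_def P5_def P_def intro!: agree_store)
    show ?thesis
      by (rule wp_SeqWriteI[OF b1 w9[OF b2 P2]]) (use X P1 MV dv in \<open>simp_all add: esq_def Mpar_def\<close>)
  qed
  have w7: "wp ?c7 ((ipar k n * 3 + 3) + (1 + ((epar k n * 3 + 3) + (1 + (1 + 1))))) ?Q s1" if b1: "bnd V s1" and P1: "P7 s1" for s1
  proof (rule wp_Seq, rule wp_mono[OF pow2_wp[OF b1, of 58 "Rg 57" "ipar k n"] order_refl], goal_cases)
    case (6 s')
    show ?case using 6 P1 by (auto simp: P7_def agree_def)
  next
    case (7 s2)
    show ?case
    proof
      have "P7 s2" using 7(2) P1 by (auto simp: P7_def P5_def P_def agree_def)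
      then show "wp ?c8 (1 + ((epar k n * 3 + 3) + (1 + (1 + 1)))) ?Q s2" using w8[OF 7(1)] 7(2) by simp
    qed
  qed (use iV ipar_le[of k n] nV in auto)
  let ?T7 = "(ipar k n * 3 + 3) + (1 + ((epar k n * 3 + 3) + (1 + (1 + 1))))"
  have w6: "wp ?c6 (1 + ?T7) ?Q s1" if b1: "bnd V s1" and P1: "P5 s1" "s1 56 0 = qpar k n" for s1
  proof -
    have X: "s1 0 0 = n" using PX[of s1] P1 by (simp add: inp_header P5_def)
    have iV': "ipar k n \<le> V" using ipar_le[of k n] nV by simp
    have b2: "bnd V (store 57 0 (ipar k n) s1)" by (rule bnd_store[OF b1 iV'])
    have P2: "P7 (store 57 0 (ipar k n) s1)" using P1 by (auto simp: P7_def P5_def P_def intro!: agree_store)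
    show ?thesis
      by (rule wp_SeqWriteI[OF b1 w7[OF b2 P2]]) (use X P1 iV' in \<open>simp_all add: esq_def ipar_def\<close>)
  qed
  have w5: "wp ?c5 ((n * 3 + 3) + (1 + ?T7)) ?Q s1" if b1: "bnd V s1" and P1: "P5 s1" for s1
  proof (rule wp_Seq, rule wp_mono[OF set_q_wp[OF b1] order_refl], goal_cases)
    case (8 s2)
    show ?case
    proof
      have "P5 s2" using 8(2) P1 by (auto simp: P5_def P_def agree_def)
      then show "wp ?c6 (1 + ?T7) ?Q s2" using w6[OF 8(1)] 8(2) by simp
    qed
  qed (use P1 PX[of s1] k kV nnn V2[of "n * (n * n)" "3 * n"] Jn nV in \<open>auto simp: inp_header P5_def\<close>)
  have w4: "wp ?c4 ((wpar k n * 3 + 3) + ((n * 3 + 3) + (1 + ?T7))) ?Q s1" if b1: "bnd V s1" and P1: "P s1" "s1 52 0 = 2 ^ wpar k n" "s1 55 0 = Jpar k n" for s1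
  proof (rule wp_Seq, rule wp_mono[OF set_NW_wp[OF b1, of "wpar k n"] order_refl], goal_cases)
    case (6 s2)
    show ?case
    proof
      have "P5 s2" using 6(2) P1 by (auto simp: P5_def P_def agree_def)
      then show "wp ?c5 ((n * 3 + 3) + (1 + ?T7)) ?Q s2" by (rule w5[OF 6(1)])
    qed
  qed (use P1 PX[of s1] n NW wn nV in \<open>auto simp: inp_header P_def\<close>)
  have w3: "wp ?c3 ((wpar k n * 3 + 3) + ((wpar k n * 3 + 3) + ((n * 3 + 3) + (1 + ?T7)))) ?Q s1" if b1: "bnd V s1" and P1: "P s1" "s1 55 0 = Jpar k n" for s1
  proof (rule wp_Seq, rule wp_mono[OF pow2_wp[OF b1, of 52 "Rg 51" "wpar k n"] order_refl], goal_cases)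
    case (6 s')
    show ?case using 6 P1 by (auto simp: P_def agree_def)
  next
    case (7 s2)
    show ?case
    proof
      have "P s2" "s2 55 0 = Jpar k n" using 7(2) P1 by (auto simp: P_def agree_def)
      then show "wp ?c4 ((wpar k n * 3 + 3) + ((n * 3 + 3) + (1 + ?T7))) ?Q s2" using w4[OF 7(1)] 7(2) by simp
    qed
  qed (use TW wn nV in auto)
  let ?T3 = "(wpar k n * 3 + 3) + ((wpar k n * 3 + 3) + ((n * 3 + 3) + (1 + ?T7)))"
  have w2: "wp ?c2 ((n * 2 + 2) + ?T3) ?Q s1" if b1: "bnd V s1" and P1: "P s1" "s1 54 0 = dpar k n" for s1
  proof (rule wp_Seq, rule wp_mono[OF set_J_wp[OF b1 P1(2) k g\<kappa> nV] order_refl], rule impI)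
    fix s2 assume b2: "bnd V s2" and A: "agree {55} s1 s2 \<and> s2 55 0 = Jpar k n"
    have "P s2" using A P1 by (auto simp: P_def agree_def)
    then show "wp ?c3 ?T3 ?Q s2" using w3[OF b2] A by simp
  qed
  have "wp (parameters k) ((n * 3 + 3) + ((n * 2 + 2) + ?T3)) ?Q s"
    unfolding parameters_def
  proof (rule wp_Seq, rule wp_mono[OF set_w_wp[OF b s(1) n k0 kV] order_refl], rule impI)
    fix s2 assume b2: "bnd V s2" and A: "agree {51, 54} s s2 \<and> s2 51 0 = wpar k n \<and> s2 54 0 = dpar k n"
    have "P s2" using A by (auto simp: P_def agree_def)
    then show "wp ?c2 ((n * 2 + 2) + ?T3) ?Q s2" using w2[OF b2] A by simp
  qed
  moreover have "(n * 3 + 3) + ((n * 2 + 2) + ?T3) \<le> n * 80 + 30" using wn ele ipar_le[of k n] by linarith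
  ultimately show ?thesis by (rule wp_mono)
qed

lemma brute_wp:
  assumes b: "bnd V s" and s: "s 0 = inp" "s 50 0 = 2 ^ n" and V: "2 ^ n * 2 ^ n \<le> V"
  shows "wp brute (2 ^ n * 3 + 2 + Tsample (2 ^ n)) (\<lambda>s'. s' 1 0 = num_sat n F * 2 ^ n \<and> s' 1 1 = 2 ^ n) s"
    (is "wp _ _ ?Q s")
proof -
  have nV: "2 ^ n \<le> V" using bndD[OF b, of 50 0] s by simp
  define I where "I j s' \<longleftrightarrow> agree {30, 31} s s' \<and> (\<forall>t<j. s' 30 t = t)" for j s'
  have w: "wp (For 31 (Rg 50) (Write 30 (Rg 31) (Rg 31))) (2 ^ n * (1 + 2) + 2) (\<lambda>s'. I (2 ^ n) s' \<and> s' 31 0 = 2 ^ n) s"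
  proof (rule wp_For[where Inv = I and N = "2 ^ n"])
    show "aval (Rg 50) s' = 2 ^ n" if "I j s'" for j s' using that s by (auto simp: I_def agree_def)
    fix j s' assume I: "I j s'" and b': "bnd V s'" and j: "j < 2 ^ n" "s' 31 0 = j"
    show "wp (Write 30 (Rg 31) (Rg 31)) 1 (\<lambda>s'. s' 31 0 = j \<and> I (Suc j) (store 31 0 (Suc j) s')) s'"
      by (rule wp_Write[OF b']) (use I j b' in \<open>auto simp: esq_def I_def less_Suc_eq intro!: agree_store\<close>)
  qed (use b nV in \<open>auto simp: I_def intro!: agree_store agree_refl\<close>)
  have "wp brute ((2 ^ n * (1 + 2) + 2) + Tsample (2 ^ n)) ?Q s"
    unfolding brute_def
  proof (rule wp_Seq, rule wp_mono[OF w order_refl], rule impI)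
    fix s1 assume b1: "bnd V s1" and A: "I (2 ^ n) s1 \<and> s1 31 0 = 2 ^ n"
    have s1: "s1 0 = inp" "s1 31 0 = 2 ^ n" "s1 50 0 = 2 ^ n" using A s by (auto simp: I_def agree_def)
    have "card {t \<in> {..<2 ^ n}. \<not> falsified (node n (s1 30 t))} = card {t \<in> {..<2 ^ n}. \<not> falsified (node n t)}"
      using A by (intro arg_cong[where f = card]) (auto simp: I_def)
    also have "\<dots> = (\<Sum>t<2 ^ n. nsol n t)"
      unfolding nsol_leaf by (simp add: of_bool_def sum.If_cases Int_def)
    also have "\<dots> = num_sat n F" by (rule sum_nsol) simp
    finally have c: "card {t \<in> {..<2 ^ n}. \<not> falsified (node n (s1 30 t))} = num_sat n F" .
    show "wp sample (Tsample (2 ^ n)) ?Q s1"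
      by (rule wp_mono[OF sample_wp[OF b1 s1 V] order_refl]) (simp only: c)
  qed
  then show ?thesis by (rule wp_mono) simp_all
qed

end

section \<open>Correctness\<close>

text \<open>For \<open>y = 1 / N \<le> 1\<close> a relative error of \<open>y / 2\<close> stays
  within the factor \<open>exp y\<close>: upwards since \<open>1 + y / 2 \<le> exp y\<close>,
  downwards since \<open>(1 - y / 2) * (1 + y) \<ge> 1\<close>.\<close>

lemma approximates_exp:
  assumes "0 < N" "0 \<le> x" "\<bar>a - x\<bar> \<le> x / (2 * real N)"
  shows "approximates (exp (1 / real N)) x a"
proof -
  define y where "y = 1 / real N"
  have y: "0 < y" "y \<le> 1" using assms(1) by (auto simp: y_def)
  have a: "x * (1 - y / 2) \<le> a" "a \<le> x * (1 + y / 2)"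
    using assms(3) by (auto simp: y_def field_simps abs_le_iff)
  have "1 + y / 2 \<le> exp y" using exp_ge_add_one_self[of y] y by linarith
  from mult_left_mono[OF this assms(2)] have 1: "x * (1 + y / 2) \<le> exp y * x" by (simp only: mult.commute)
  have "y * y \<le> 1 * y" using y by (intro mult_right_mono) auto
  then have "1 \<le> (1 - y / 2) * (1 + y)" by (simp add: algebra_simps)
  also have "\<dots> \<le> (1 - y / 2) * exp y" using y exp_ge_add_one_self[of y] by (intro mult_left_mono) auto
  finally have "inverse (exp y) \<le> 1 - y / 2" by (simp add: field_simps)
  from mult_left_mono[OF this assms(2)] have "inverse (exp y) * x \<le> x * (1 - y / 2)" by (simp only: mult.commute)
  then show ?thesis using a 1 unfolding approximates_def y_def by linarith
qed

lemma (in machine) wpp_Cond_else: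
  assumes b: "bnd V s" and e: "cok V e" "esq e \<le> \<kappa>" "aval e s = 0" and d: "wpp d T D Q s"
  shows "wpp (Cond e c d) (1 + T) D Q s"
proof -
  obtain g u where 1: "\<And>t. exec d (s, t) = map_spmf (\<lambda>x. (g x, t + u x)) (spmf_of_pmf D)"
     "\<And>x. x \<in> set_pmf D \<Longrightarrow> u x \<le> T * (\<kappa> * bits V) \<and> bnd V (g x) \<and> Q x (g x)" using d unfolding wpp_def by blast
  have cost: "acost e s + bits (aval e s) \<le> \<kappa> * bits V"
    by (rule le_trans[OF cost_le[OF V2 b e(1)] mult_le_mono1[OF e(2)]])
  show ?thesis unfolding wpp_def
  proof (intro exI[of _ g] exI[of _ "\<lambda>x. (acost e s + bits (aval e s)) + u x"] conjI allI ballI)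
    show "exec (Cond e c d) (s, t) = map_spmf (\<lambda>x. (g x, t + ((acost e s + bits (aval e s)) + u x))) (spmf_of_pmf D)" for t
      using 1(1) by (simp add: e(3) eval_guard_def add.assoc)
    fix x assume x: "x \<in> set_pmf D"
    show "(acost e s + bits (aval e s)) + u x \<le> (1 + T) * (\<kappa> * bits V)" using 1(2)[OF x] cost by simp
  qed (use 1(2) in auto)
qed

context prog begin

lemma node_mod: "node i (q mod 2 ^ i) = node i q"
proof -
  have "odd (q mod 2 ^ i div 2 ^ v) = odd (q div 2 ^ v)" if "v < i" for v
    using that by (simp add: bit_iff_odd[symmetric] bit_take_bit_iff take_bit_eq_mod[symmetric])
  then show ?thesis by (auto simp: node_def fun_eq_iff)
qed

text \<open>A word has \<open>n\<close> blocks of \<open>n + 1\<close> bits, \<open>n\<close> for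
  the position and one for the value in each step. The bias costs at most a factor
  \<open>1 / 2\<close>, by Bernoulli's inequality and \<open>2 * n^2 \<le> 2 ^ n\<close>. Deeper
  nodes have fewer unset variables, so the bound at depth \<open>i0\<close> holds for all of
  them.\<close>

lemma node_trial_prob:
  assumes S: "0 \<le> S" "2 * (1 - S) \<le> 1 / ln 2"
    and Sb: "\<And>\<alpha> \<sigma> x. \<sigma> \<in> sols \<alpha> \<Longrightarrow> x \<in> frozen \<alpha> \<Longrightarrow> gw \<alpha> \<sigma> x \<le> S"
    and i: "i0 \<le> i" "i \<le> n" and ne: "nsol i q > 0" and n2: "2 * (n * n) \<le> 2 ^ n"
  shows "2 powr (- (S * real (n - i0))) / 2 \<le> measure_pmf.prob (word_pmf (n * (n + 1))) {r. node_trial (2 ^ n) i q r}"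
proof -
  define L where "L = 1 - real n / real (2 ^ n)"
  have nG: "n \<le> 2 ^ n" by (rule less_imp_le[OF n_lt])
  have K: "(2::nat) ^ (n * (n + 1)) = (2 * 2 ^ n) ^ n"
    by (simp add: power_mult[symmetric] power_add[symmetric] power_mult_distrib algebra_simps)
  have fr: "real n / real (2 ^ n) \<le> 1" using of_nat_mono[OF nG, where 'a = real] by (simp add: divide_le_eq)
  then have L: "0 \<le> L" "L \<le> 1" by (auto simp: L_def)
  have "1 / 2 \<le> 1 + real n * (- (real n / real (2 ^ n)))"
  proof -
    have "real (2 * (n * n)) \<le> real (2 ^ n)" by (rule of_nat_mono[OF n2])
    then show ?thesis by (simp add: field_simps)
  qed
  also have "\<dots> \<le> (1 + (- (real n / real (2 ^ n)))) ^ n" by (rule Bernoulli_inequality) (use fr in simp)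
  also have "\<dots> = L ^ n" by (simp add: L_def)
  also have "\<dots> \<le> L ^ (n - i)" by (rule power_decreasing) (use L in auto)
  finally have L2: "1 / 2 \<le> L ^ (n - i)" .
  have ne': "sols (node i q) \<noteq> {}" using ne by (auto simp: nsol_def)
  have ci: "card (unset (node i q)) = n - i" by (simp add: unset_node)
  have "2 powr (- (S * real (n - i0))) \<le> 2 powr (- (S * real (n - i)))"
    using S i by (intro powr_mono) (auto intro!: mult_left_mono)
  also have "\<dots> \<le> pp (n - i) (node i q)" by (rule pp_ge'[OF S Sb ci ne'])
  finally have "2 powr (- (S * real (n - i0))) / 2 \<le> L ^ (n - i) * pp (n - i) (node i q)"
    using mult_mono[OF L2, of "2 powr (- (S * real (n - i0)))" "pp (n - i) (node i q)"] L by simp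
  also have "\<dots> \<le> (\<Sum>r<2 ^ (n * (n + 1)). of_bool (node_trial (2 ^ n) i q r)) / real (2 ^ (n * (n + 1)))"
    using trial_count[of "2 ^ n" "n - i" n "\<lambda>t. i + t" "node i q"] bij_node nG
    unfolding K node_trial_def L_def by (simp add: pos_le_divide_eq mult.commute)
  also have "\<dots> = measure_pmf.prob (word_pmf (n * (n + 1))) {r. node_trial (2 ^ n) i q r}"
    unfolding word_pmf_def by (subst prob_uniform_nat) auto
  finally show ?thesis .
qed

text \<open>A union bound over at most \<open>2 ^ (n + 1)\<close> live nodes, each missed with
  probability at most \<open>exp (- (n + 4))\<close>; the \<open>4\<close> leaves
  \<open>2 ^ (- 3)\<close>. It applies although the nodes share their words.\<close>

lemma good_prob:
  assumes S: "0 \<le> S" "2 * (1 - S) \<le> 1 / ln 2"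
    and Sb: "\<And>\<alpha> \<sigma> x. \<sigma> \<in> sols \<alpha> \<Longrightarrow> x \<in> frozen \<alpha> \<Longrightarrow> gw \<alpha> \<sigma> x \<le> S"
    and n2: "2 * (n * n) \<le> 2 ^ n" and R: "R \<le> m" "real n + 4 \<le> 2 powr (- (S * real (n - i0))) / 2 * real R"
  shows "measure_pmf.prob (words_pmf (n * (n + 1)) m) {\<omega>. \<not> good (2 ^ n) i0 R \<omega>} \<le> 1 / 8"
proof -
  let ?D = "words_pmf (n * (n + 1)) m"
  let ?p = "2 powr (- (S * real (n - i0))) / 2"
  define bad where "bad = (\<lambda>(i, q). {\<omega> :: nat \<Rightarrow> nat. \<forall>j<R. \<not> node_trial (2 ^ n) i q (\<omega> j)})"
  define X where "X = {(i, q). i0 \<le> i \<and> i \<le> n \<and> q < 2 ^ i \<and> nsol i q > 0}"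
  have Xsub: "X \<subseteq> Sigma {..n} (\<lambda>i. {..<2 ^ i})" by (auto simp: X_def)
  have fin: "finite (Sigma {..n} (\<lambda>i. {..<2 ^ i :: nat}))" by auto
  have finX: "finite X" by (rule finite_subset[OF Xsub fin])
  have "card X \<le> (\<Sum>i\<le>n. 2 ^ i)" using card_mono[OF fin Xsub] by simp
  also have "\<dots> \<le> 2 ^ (n + 1)"
  proof -
    have "(\<Sum>i\<le>n. (2::nat) ^ i) = 2 ^ Suc n - 1"
      by (induction n) auto
    then show ?thesis by simp
  qed
  finally have cX: "real (card X) \<le> 2 ^ (n + 1)" by (metis of_nat_le_iff of_nat_numeral of_nat_power)
  have "{\<omega>. \<not> good (2 ^ n) i0 R \<omega>} \<subseteq> (\<Union>x\<in>X. bad x)" by (auto simp: good_def X_def bad_def)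
  then have "measure_pmf.prob ?D {\<omega>. \<not> good (2 ^ n) i0 R \<omega>} \<le> measure_pmf.prob ?D (\<Union>x\<in>X. bad x)"
    by (intro measure_pmf.finite_measure_mono) auto
  also have "\<dots> \<le> (\<Sum>x\<in>X. measure_pmf.prob ?D (bad x))"
    by (rule measure_pmf.finite_measure_subadditive_finite[OF finX]) auto
  also have "\<dots> \<le> (\<Sum>x\<in>X. exp (- (?p * real R)))"
  proof (rule sum_mono)
    fix x assume "x \<in> X"
    then obtain i q where x: "x = (i, q)" "i0 \<le> i" "i \<le> n" "nsol i q > 0" by (auto simp: X_def)
    show "measure_pmf.prob ?D (bad x) \<le> exp (- (?p * real R))"
      unfolding x(1) bad_def words_pmf_def prod.case
      by (rule trials_bound[OF R(1) node_trial_prob[OF S Sb x(2-4) n2]]) simp_all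
  qed
  also have "\<dots> = real (card X) * exp (- (?p * real R))" by simp
  also have "\<dots> \<le> 2 ^ (n + 1) * exp (- (real n + 4))"
    using R(2) cX by (intro mult_mono) auto
  also have "\<dots> \<le> 2 ^ (n + 1) * inverse (2 ^ (n + 4))"
  proof -
    have "(2::real) ^ (n + 4) \<le> exp 1 ^ (n + 4)" using exp_ge_add_one_self[of 1] by (intro power_mono) auto
    also have "\<dots> = exp (real n + 4)" by (simp add: exp_of_nat_mult[symmetric])
    finally have "inverse (exp (real n + 4)) \<le> inverse (2 ^ (n + 4))" by (intro le_imp_inverse_le) auto
    then show ?thesis unfolding exp_minus by (rule mult_left_mono) simp
  qed
  also have "\<dots> = 1 / 8" by (simp add: power_add divide_simps)
  finally show ?thesis .
qed

text \<open>Only the lowest \<open>n\<close> bits of a word are read as an assignment, and these are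
  uniform.\<close>

lemma leaf_prob:
  assumes "n \<le> K"
  shows "measure_pmf.prob (word_pmf K) {r. \<not> falsified (node n r)} = real (num_sat n F) / 2 ^ n"
proof -
  have K: "(2::nat) ^ K = 2 ^ n * 2 ^ (K - n)" using assms by (simp flip: power_add)
  have "(\<Sum>r<2 ^ K. of_bool (\<not> falsified (node n r)) :: real)
      = (\<Sum>r<2 ^ n * 2 ^ (K - n). of_bool (\<not> falsified (node n (r mod 2 ^ n))))"
    unfolding K node_mod ..
  also have "\<dots> = (\<Sum>q<2 ^ n. \<Sum>b<(2::nat) ^ (K - n). of_bool (\<not> falsified (node n q)))"
    by (rule sum_mod_div[where f = "\<lambda>q b. of_bool (\<not> falsified (node n q))"]) simp
  also have "\<dots> = 2 ^ (K - n) * (\<Sum>q<2 ^ n. real (nsol n q))"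
    by (simp add: nsol_leaf sum_distrib_left)
  also have "(\<Sum>q<2 ^ n. real (nsol n q)) = real (num_sat n F)"
    using sum_nsol[of n] by (simp flip: of_nat_sum)
  finally have s: "(\<Sum>r<2 ^ K. of_bool (\<not> falsified (node n r)) :: real) = 2 ^ (K - n) * real (num_sat n F)" .
  show ?thesis
    unfolding word_pmf_def by (subst prob_uniform_nat, simp, subst s) (simp add: K)
qed

definition hits :: "nat \<Rightarrow> (nat \<Rightarrow> nat) \<Rightarrow> nat" where
  "hits M \<omega> = card {t \<in> {..<M}. \<not> falsified (node n (\<omega> t))}"

text \<open>Chebyshev's inequality with a deviation \<open>c\<close> of \<open>1 / (2 * N)\<close>
  times the mean \<open>M * p\<close>. More than \<open>2 ^ i0\<close> solutions give
  \<open>p > 2 ^ i0 / 2 ^ n\<close>, and the factor \<open>2 ^ (n - i0)\<close> in \<open>M\<close>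
  cancels this density.\<close>

lemma hits_prob:
  assumes i0: "i0 \<le> n" "2 ^ i0 < num_sat n F" and N: "0 < N" and M: "M = 16 * (N * N * 2 ^ (n - i0))" "M \<le> m" and nK: "n \<le> K"
  shows "measure_pmf.prob (words_pmf K m) {\<omega>. \<not> approximates (exp (1 / real N)) (real (num_sat n F)) (real (hits M \<omega> * 2 ^ n) / real M)} \<le> 1 / 4"
proof -
  define s where "s = real (num_sat n F)"
  define p where "p = s / 2 ^ n"
  have s: "2 ^ i0 < s" using i0(2) unfolding s_def by (metis of_nat_less_iff of_nat_numeral of_nat_power)
  have s0: "0 < s" by (rule le_less_trans[OF _ s]) simp
  have M0: "0 < M" using N M by simp
  have p0: "0 < p" using s0 by (simp add: p_def)
  define c where "c = real M * p / (2 * real N)"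
  have c: "0 < c" using M0 p0 N by (simp add: c_def)
  have sub: "{\<omega>. \<not> approximates (exp (1 / real N)) s (real (hits M \<omega> * 2 ^ n) / real M)}
      \<subseteq> {\<omega>. c \<le> \<bar>real (hits M \<omega>) - real M * p\<bar>}"
  proof (rule subsetI, rule ccontr)
    fix \<omega> assume na: "\<omega> \<in> {\<omega>. \<not> approximates (exp (1 / real N)) s (real (hits M \<omega> * 2 ^ n) / real M)}"
      and "\<omega> \<notin> {\<omega>. c \<le> \<bar>real (hits M \<omega>) - real M * p\<bar>}"
    then have lt: "\<bar>real (hits M \<omega>) - real M * p\<bar> \<le> c" by simp
    have "real (hits M \<omega> * 2 ^ n) / real M - s = (real (hits M \<omega>) - real M * p) * (2 ^ n / real M)"
      using M0 by (simp add: p_def field_simps)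
    then have "\<bar>real (hits M \<omega> * 2 ^ n) / real M - s\<bar> = \<bar>real (hits M \<omega>) - real M * p\<bar> * (2 ^ n / real M)"
      by (simp add: abs_mult)
    also have "\<dots> \<le> c * (2 ^ n / real M)" using lt by (rule mult_right_mono) simp
    also have "\<dots> = s / (2 * real N)" using M0 by (simp add: c_def p_def)
    finally have "approximates (exp (1 / real N)) s (real (hits M \<omega> * 2 ^ n) / real M)"
      using s0 by (intro approximates_exp[OF N]) auto
    then show False using na by simp
  qed
  have "measure_pmf.prob (words_pmf K m) {\<omega>. \<not> approximates (exp (1 / real N)) s (real (hits M \<omega> * 2 ^ n) / real M)}
      \<le> measure_pmf.prob (words_pmf K m) {\<omega>. c \<le> \<bar>real (hits M \<omega>) - real M * p\<bar>}"
    by (rule measure_pmf.finite_measure_mono[OF sub]) simp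
  also have "\<dots> \<le> real M * p / c\<^sup>2"
    unfolding words_pmf_def hits_def
    by (rule sampling_bound[OF M(2) M0 c]) (simp add: leaf_prob[OF nK] p_def s_def)
  also have "\<dots> = 4 * (real N)\<^sup>2 / (real M * p)"
    using M0 p0 N by (simp add: c_def power2_eq_square field_simps)
  also have "real M * p = 16 * (real N)\<^sup>2 * (s * 2 ^ (n - i0) / 2 ^ n)"
    by (simp add: M(1) p_def power2_eq_square)
  also have "(2::real) ^ (n - i0) / 2 ^ n = 1 / 2 ^ i0"
    using i0(1) by (simp add: power_diff)
  then have "s * 2 ^ (n - i0) / 2 ^ n = s / 2 ^ i0" by (metis times_divide_eq_right mult.right_neutral)
  also have "4 * (real N)\<^sup>2 / (16 * (real N)\<^sup>2 * (s / 2 ^ i0)) = 1 / 4 * (2 ^ i0 / s)"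
    using N s0 by (simp add: field_simps)
  also have "\<dots> \<le> 1 / 4 * 1" using s s0 by (intro mult_left_mono) auto
  finally show ?thesis by (simp add: s_def)
qed

lemma good_cong: "(\<And>j. j < R \<Longrightarrow> \<omega> j = \<omega>' j) \<Longrightarrow> good G i0 R \<omega> = good G i0 R \<omega>'"
  unfolding good_def by (metis (no_types, lifting))

lemma hits_cong: "(\<And>j. j < M \<Longrightarrow> \<omega> j = \<omega>' j) \<Longrightarrow> hits M \<omega> = hits M \<omega>'"
  unfolding hits_def by (rule arg_cong[where f = card]) auto

lemma set_P2_wp:
  assumes b: "bnd V s" and s: "s 0 = inp" and V: "2 ^ n \<le> V"
  shows "wp (pow2 50 (Rg 0)) (n * 3 + 3) (\<lambda>s'. agree {50, 64} s s' \<and> s' 50 0 = 2 ^ n) s"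
  by (rule wp_mono[OF pow2_wp[OF b, of 50 "Rg 0" n] order_refl])
     (use V s le_trans[OF less_imp_le[OF n_lt[of n]] V] in \<open>auto simp: agree_def inp_header\<close>)

definition Tmain :: "nat \<Rightarrow> nat" where
  "Tmain R = n * 83 + 50 + (Mpar k n N + R) * (n * (n + 1) * 4 + 6) +
     2 ^ ipar k n * 4 + (2 * n + 3) * 2 ^ ipar k n * (Ttest R + 15) + Tsample (Mpar k n N)"

lemma main_search_wpp:
  assumes b: "bnd V s" and s: "s 0 = inp" and n: "0 < n" "n0 \<le> n" and k: "2 \<le> k" and g\<kappa>: "esq (guardJ k) \<le> \<kappa>"
    and kV: "k + 1 \<le> V" "n0 \<le> V" and N: "N < 2 ^ n" and J: "0 < Jpar k n" and big: "2 ^ (n * n + 20 * n + 20) \<le> V"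
    and w: "w = wpar k n"
  shows "wpp (main k n0) (Tmain (2 ^ epar k n)) (words_pmf (n * (n + 1)) (Mpar k n N + 2 ^ epar k n))
    (\<lambda>\<omega> s'. good (2 ^ n) (ipar k n) (2 ^ epar k n) \<omega> \<longrightarrow>
      (s' 1 0 = num_sat n F \<and> s' 1 1 = 1) \<or>
      (2 ^ ipar k n < num_sat n F \<and> s' 1 0 = hits (Mpar k n N) \<omega> * 2 ^ n \<and> s' 1 1 = Mpar k n N)) s"
    (is "wpp _ _ ?D ?Q s")
proof -
  let ?R = "2 ^ epar k n" and ?M = "Mpar k n N" and ?i = "ipar k n"
  let ?cap = "(2 * n + 3) * 2 ^ ?i"
  have V2: "x \<le> V" if "x \<le> 2 ^ a" "a \<le> n * n + 20 * n + 20" for x a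
  proof -
    have "(2::nat) ^ a \<le> 2 ^ (n * n + 20 * n + 20)" using that(2) by (intro power_increasing) auto
    then show ?thesis using that(1) big by linarith
  qed
  have nV: "2 ^ n \<le> V" by (rule V2[OF order_refl]) simp
  have V4: "2 ^ n * 4 \<le> V" by (rule V2[of _ "n + 2"]) (simp_all add: power_add)
  have ile: "(2::nat) ^ ?i \<le> 2 ^ n" using ipar_le[of k n] by (intro power_increasing) auto
  have n8: "2 * n + 3 \<le> 8 * 2 ^ n" using n_lt[of n] one_le_power[of "2::nat" n] by linarith
  have Vc: "2 ^ ?i + ?cap + 2 \<le> V"
  proof (rule V2)
    have "?cap \<le> 8 * 2 ^ n * 2 ^ n" by (rule mult_le_mono[OF n8 ile])
    moreover have "(2::nat) ^ n * 1 \<le> 2 ^ n * 2 ^ n" by (rule mult_left_mono, rule one_le_power) simp_all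
    moreover have "(1::nat) \<le> 2 ^ n" by simp
    ultimately have "2 ^ ?i + ?cap + 2 \<le> 16 * (2 ^ n * 2 ^ n)" using ile by linarith
    also have "\<dots> = 2 ^ (4 + (n + n))" by (simp only: power_add) simp
    finally show "2 ^ ?i + ?cap + 2 \<le> 2 ^ (4 + (n + n))" .
  qed simp
  have MV: "?M * 2 ^ n \<le> V"
  proof (rule V2)
    have "N * N \<le> 2 ^ n * 2 ^ n" by (rule mult_le_mono) (use N in simp_all)
    moreover have "(2::nat) ^ (n - ?i) \<le> 2 ^ n" by (intro power_increasing) auto
    ultimately have "N * N * 2 ^ (n - ?i) \<le> 2 ^ n * 2 ^ n * 2 ^ n" by (rule mult_le_mono)
    from mult_le_mono1[OF mult_le_mono2[OF this]] have "?M * 2 ^ n \<le> 16 * (2 ^ n * 2 ^ n * 2 ^ n) * 2 ^ n" unfolding Mpar_def .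
    also have "\<dots> = 2 ^ (4 + (n + n + n) + n)" by (simp only: power_add) simp
    finally show "?M * 2 ^ n \<le> 2 ^ (4 + (n + n + n) + n)" .
  qed simp
  have KV: "2 ^ (n * (n + 1)) \<le> V" by (rule V2[OF order_refl]) simp
  have count: "wp count (2 ^ ?i * 4 + ?cap * (Ttest ?R + 15) + 6 + Tsample ?M) (?Q \<omega>) s3"
    if b3: "bnd V s3" and c: "consts_ok s3" "s3 50 0 = 2 ^ n" "s3 59 0 = ?R" "s3 58 0 = 2 ^ ?i" "s3 60 0 = ?cap" "s3 31 0 = ?M"
      and \<omega>: "\<forall>j<?M + ?R. s3 30 j = \<omega> j" for s3 \<omega>
  proof (rule wp_mono[OF count_wp[OF b3 c ipar_le refl V4 Vc MV] order_refl])
    fix s' :: state assume A: "good (2 ^ n) ?i ?R (s3 30) \<longrightarrow> s' 1 0 = num_sat n F \<and> s' 1 1 = 1 \<or>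
      2 ^ ?i < num_sat n F \<and> s' 1 0 = card {t \<in> {..<?M}. \<not> falsified (node n (s3 30 t))} * 2 ^ n \<and> s' 1 1 = ?M"
    have "good (2 ^ n) ?i ?R (s3 30) = good (2 ^ n) ?i ?R \<omega>" by (rule good_cong) (use \<omega> in auto)
    moreover have "hits ?M (s3 30) = hits ?M \<omega>" by (rule hits_cong) (use \<omega> in auto)
    ultimately show "?Q \<omega> s'" using A by (simp add: hits_def)
  qed
  let ?Tc = "2 ^ ?i * 4 + ?cap * (Ttest ?R + 15) + 6 + Tsample ?M"
  let ?Tf = "(?M + ?R) * (n * (n + 1) * 4 + 6) + 2"
  have rest: "wpp (Seq (parameters k) (Seq fill count)) ((n * 80 + 30) + (?Tf + ?Tc)) ?D ?Q s1"
    if b1: "bnd V s1" and s1: "s1 0 = inp" "s1 50 0 = 2 ^ n" for s1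
  proof (rule wp_wpp_Seq, rule wp_mono[OF parameters_wp[OF b1 s1 n(1) k g\<kappa> kV(1) N J big] order_refl], rule impI)
    fix s2 assume b2: "bnd V s2" and A: "agree par_regs s1 s2 \<and> s2 51 0 = wpar k n \<and> s2 52 0 = 2 ^ wpar k n \<and>
     s2 53 0 = n ^ wpar k n \<and> s2 58 0 = 2 ^ ?i \<and> s2 31 0 = ?M \<and> s2 59 0 = ?R \<and>
     s2 60 0 = ?cap \<and> s2 61 0 = ?M + ?R \<and> s2 62 0 = n * (n + 1)"
    have s20: "s2 0 = inp" "s2 50 0 = 2 ^ n" using A s1 by (auto simp: agree_def)
    have "s2 51 0 = w" "s2 52 0 = 2 ^ w" "s2 53 0 = n ^ w" using A unfolding w by blast+
    then have s2: "consts_ok s2" "s2 50 0 = 2 ^ n" using s20 unfolding consts_ok_def by simp_all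
    show "wpp (Seq fill count) (?Tf + ?Tc) ?D ?Q s2"
    proof (rule wpp_wp_Seq, rule wpp_mono[OF fill_wp[OF b2 _ _ KV] order_refl], goal_cases)
      case (3 \<omega> s3)
      show ?case
      proof
        have ag: "agree {30, 66, 67, 68, 69} s2 s3" and \<omega>: "\<forall>j<?M + ?R. s3 30 j = \<omega> j" using 3(3) by auto
        show "wp count ?Tc (?Q \<omega>) s3"
        proof (rule count[OF 3(2) _ _ _ _ _ _ \<omega>])
          have e: "s3 x = s2 x" if "x \<notin> {30, 66, 67, 68, 69}" for x using ag that by (auto simp: agree_def)
          show "consts_ok s3" using s2(1) unfolding consts_ok_def by (simp add: e)
          show "s3 50 0 = 2 ^ n" "s3 59 0 = ?R" "s3 58 0 = 2 ^ ?i" "s3 60 0 = ?cap" "s3 31 0 = ?M"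
            using A s2(2) by (simp_all add: e)
        qed
      qed
    qed (use A in auto)
  qed
  have "wpp (main k n0) ((n * 3 + 3) + (1 + ((n * 80 + 30) + (?Tf + ?Tc)))) ?D ?Q s"
    unfolding main_def
  proof (rule wp_wpp_Seq, rule wp_mono[OF set_P2_wp[OF b s nV] order_refl], rule impI)
    fix s1 assume b1: "bnd V s1" and A: "agree {50, 64} s s1 \<and> s1 50 0 = 2 ^ n"
    have s1: "s1 0 = inp" "s1 50 0 = 2 ^ n" using A s by (auto simp: agree_def)
    show "wpp (Cond (Add (Sub (Add (Read 0 (Const 1)) (Const 1)) (Rg 50)) (Sub (Const n0) (Rg 0)))
       brute (Seq (parameters k) (Seq fill count))) (1 + ((n * 80 + 30) + (?Tf + ?Tc))) ?D ?Q s1"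
    proof (rule wpp_Cond_else[OF b1 _ _ _ rest[OF b1 s1]])
      show "aval (Add (Sub (Add (Read 0 (Const 1)) (Const 1)) (Rg 50)) (Sub (Const n0) (Rg 0))) s1 = 0"
        using s1 N n by (simp add: inp_header)
    next
      show "cok V (Add (Sub (Add (Read 0 (Const 1)) (Const 1)) (Rg 50)) (Sub (Const n0) (Rg 0)))"
        using kV by simp
    next
      show "esq (Add (Sub (Add (Read 0 (Const 1)) (Const 1)) (Rg 50)) (Sub (Const n0) (Rg 0))) \<le> \<kappa>"
        by (simp add: esq_def)
    qed
  qed
  then show ?thesis by (rule wpp_mono) (simp_all add: Tmain_def)
qed

lemma main_brute_wp:
  assumes b: "bnd V s" and s: "s 0 = inp" and br: "2 ^ n \<le> N \<or> n < n0" and kV: "n0 \<le> V" and V: "2 ^ n * 2 ^ n \<le> V"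
  shows "wp (main k n0) (n * 3 + 6 + (2 ^ n * 3 + Tsample (2 ^ n))) (\<lambda>s'. s' 1 0 = num_sat n F * 2 ^ n \<and> s' 1 1 = 2 ^ n) s"
    (is "wp _ _ ?Q s")
proof -
  have "(2::nat) ^ n * 1 \<le> 2 ^ n * 2 ^ n" by (rule mult_left_mono, rule one_le_power) simp_all
  then have nV: "2 ^ n \<le> V" using V by linarith
  have "wp (main k n0) ((n * 3 + 3) + (1 + (2 ^ n * 3 + 2 + Tsample (2 ^ n)))) ?Q s"
    unfolding main_def
  proof (rule wp_Seq, rule wp_mono[OF set_P2_wp[OF b s nV] order_refl], rule impI)
    fix s1 assume b1: "bnd V s1" and A: "agree {50, 64} s s1 \<and> s1 50 0 = 2 ^ n"
    have s1: "s1 0 = inp" "s1 50 0 = 2 ^ n" using A s by (auto simp: agree_def)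
    show "wp (Cond (Add (Sub (Add (Read 0 (Const 1)) (Const 1)) (Rg 50)) (Sub (Const n0) (Rg 0)))
       brute (Seq (parameters k) (Seq fill count))) (1 + (2 ^ n * 3 + 2 + Tsample (2 ^ n))) ?Q s1"
    proof (rule wp_Cond[OF b1])
      show "wp brute (2 ^ n * 3 + 2 + Tsample (2 ^ n)) ?Q s1" by (rule brute_wp[OF b1 s1 V])
    qed (use s1 br kV in \<open>auto simp: inp_header esq_def\<close>)
  qed
  then show ?thesis by (rule wp_mono) simp_all
qed

end

section \<open>The size of the input and of the numbers stored\<close>

lemma card_kcnf:
  assumes "kcnf k n F" shows "card F \<le> (2 * n + 1) ^ k"
proof -
  \<comment> \<open>\<open>None\<close> pads clauses with fewer than \<open>k\<close> literals, so
    that lists of the single length \<open>k\<close> represent all clauses.\<close>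
  define A :: "literal option set" where "A = insert None (Some ` ({..<n} \<times> UNIV))"
  have finA: "finite A" by (simp add: A_def)
  have cA: "card A = 2 * n + 1"
    unfolding A_def by (subst card_insert_disjoint) (auto simp: card_image card_cartesian_product)
  define Ls where "Ls = {xs. set xs \<subseteq> A \<and> length xs = k}"
  have "F \<subseteq> (\<lambda>xs. {l. Some l \<in> set xs}) ` Ls"
  proof
    fix C assume C: "C \<in> F"
    then have "finite C" "card C \<le> k" and Cn: "\<And>v b. (v, b) \<in> C \<Longrightarrow> v < n" using assms by (auto simp: kcnf_def)
    obtain xs where xs: "set xs = C" "distinct xs" using finite_distinct_list[OF \<open>finite C\<close>] by auto
    then have len: "length xs \<le> k" using \<open>card C \<le> k\<close> by (metis distinct_card)
    let ?ys = "map Some xs @ replicate (k - length xs) None"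
    have "?ys \<in> Ls" using xs len Cn by (auto simp: Ls_def A_def)
    moreover have "C = {l. Some l \<in> set ?ys}" using xs by auto
    ultimately show "C \<in> (\<lambda>xs. {l. Some l \<in> set xs}) ` Ls" by blast
  qed
  moreover have "finite Ls" unfolding Ls_def by (rule finite_lists_length_eq[OF finA])
  ultimately have "card F \<le> card Ls" by (meson card_image_le card_mono finite_imageI le_trans)
  also have "\<dots> = (2 * n + 1) ^ k" unfolding Ls_def card_lists_length_eq[OF finA] cA ..
  finally show ?thesis .
qed

text \<open>Clauses do not repeat, so for fixed \<open>k\<close> their number is polynomial in
  \<open>n\<close>, and the running time can be bounded by \<open>n\<close> and \<open>N\<close>
  alone.\<close>

lemma length_Cs:
  assumes "kcnf k n F" "lists_formula Cs F" shows "length Cs \<le> (2 * n + 1) ^ k"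
proof -
  have "card (set (map set Cs)) = length (map set Cs)"
    using assms(2) by (intro distinct_card) (simp add: lists_formula_def)
  then show ?thesis using card_kcnf[OF assms(1)] assms(2) by (simp add: lists_formula_def)
qed

lemma clause_in_list:
  assumes "kcnf k n F" "lists_formula Cs F" "C \<in> set Cs"
  shows "length C \<le> k" "(v, b) \<in> set C \<Longrightarrow> v < n"
proof -
  have C: "set C \<in> F" "distinct C" using assms by (auto simp: lists_formula_def)
  then show "length C \<le> k" using assms(1) distinct_card[of C] by (auto simp: kcnf_def)
  show "(v, b) \<in> set C \<Longrightarrow> v < n" using assms(1) C by (auto simp: kcnf_def)
qed

lemma length_input:
  assumes "kcnf k n F" "lists_formula Cs F"
  shows "length (encode_input n Cs N) \<le> 3 + (2 * n + 1) ^ k * (k + 1)"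
proof -
  have "sum_list (map (\<lambda>C. Suc (length C)) Ds) \<le> length Ds * (k + 1)" if "set Ds \<subseteq> set Cs" for Ds
    using that
  proof (induction Ds)
    case (Cons D Ds)
    have "length D \<le> k" using clause_in_list(1)[OF assms] Cons.prems by auto
    then show ?case using Cons by simp
  qed simp
  from this[of Cs] have "sum_list (map (\<lambda>C. Suc (length C)) Cs) \<le> length Cs * (k + 1)" by simp
  also have "\<dots> \<le> (2 * n + 1) ^ k * (k + 1)" by (intro mult_right_mono length_Cs[OF assms]) simp
  finally show ?thesis by (simp add: encode_input_def length_concat o_def)
qed

definition Epar :: "nat \<Rightarrow> nat \<Rightarrow> nat \<Rightarrow> nat" where
  "Epar k n0 n = (n + k + n0 + 20) * (n + k + n0 + 20)"

text \<open>\<open>N\<close> is not bounded in terms of \<open>n\<close> and therefore enters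
  separately. All other numbers stored stay below a power of \<open>2\<close> with quadratic
  exponent, since the search branch requires \<open>N < 2 ^ n\<close>.\<close>

definition Vpar :: "nat \<Rightarrow> nat \<Rightarrow> nat \<Rightarrow> nat \<Rightarrow> nat" where
  "Vpar k n0 n N = N + 2 ^ Epar k n0 n"

lemma Epar_ge: "n * n + 20 * n + 20 \<le> Epar k n0 n" "2 + k + (n + 1) * k \<le> Epar k n0 n"
  "n \<le> Epar k n0 n" "k + 1 \<le> Epar k n0 n" "n0 \<le> Epar k n0 n" "10 \<le> Epar k n0 n" "n + n \<le> Epar k n0 n" "2 * n + 1 \<le> Epar k n0 n"
  by (auto simp: Epar_def algebra_simps)

lemma Vpar_ge: "x \<le> 2 ^ a \<Longrightarrow> a \<le> Epar k n0 n \<Longrightarrow> x \<le> Vpar k n0 n N"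
proof -
  assume x: "x \<le> 2 ^ a" "a \<le> Epar k n0 n"
  have "(2::nat) ^ a \<le> 2 ^ Epar k n0 n" using x(2) by (intro power_increasing) auto
  then show ?thesis using x(1) unfolding Vpar_def by linarith
qed

lemma Vpar_ge_self: "x \<le> Epar k n0 n \<Longrightarrow> x \<le> Vpar k n0 n N"
  by (rule Vpar_ge[of _ x]) (use n_lt[of x] in auto)

lemma clauses_le: "3 + (2 * n + 1) ^ k * (k + 1) \<le> 2 ^ (2 + k + (n + 1) * k)"
proof -
  have "2 * n + 1 \<le> 2 * 2 ^ n" using n_lt[of n] by linarith
  then have "2 * n + 1 \<le> 2 ^ (n + 1)" by simp
  then have "(2 * n + 1) ^ k \<le> (2 ^ (n + 1)) ^ k" by (intro power_mono) auto
  also have "\<dots> = 2 ^ ((n + 1) * k)" by (simp only: power_mult)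
  finally have "(2 * n + 1) ^ k * (k + 1) \<le> 2 ^ ((n + 1) * k) * 2 ^ k"
    using n_lt[of k] by (intro mult_le_mono) linarith+
  moreover have "(1::nat) \<le> 2 ^ ((n + 1) * k) * 2 ^ k" by simp
  ultimately have "3 + (2 * n + 1) ^ k * (k + 1) \<le> 4 * (2 ^ ((n + 1) * k) * 2 ^ k)" by linarith
  also have "\<dots> = 2 ^ (2 + k + (n + 1) * k)" by (simp only: power_add) simp
  finally show ?thesis .
qed

lemma bnd_init:
  assumes "kcnf k n F" "lists_formula Cs F"
  shows "bnd (Vpar k n0 n N) (init_state (encode_input n Cs N))"
proof -
  let ?V = "Vpar k n0 n N"
  have m: "length Cs \<le> ?V"
  proof (rule Vpar_ge[OF _ Epar_ge(2)])
    have "length Cs * 1 \<le> (2 * n + 1) ^ k * (k + 1)" by (intro mult_le_mono length_Cs[OF assms]) simp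
    then show "length Cs \<le> 2 ^ (2 + k + (n + 1) * k)" using clauses_le[of n k] by linarith
  qed
  have "x \<le> ?V" if x: "x \<in> set (encode_input n Cs N)" for x
  proof -
    consider "x = n" | "x = N" | "x = length Cs" | C where "C \<in> set Cs" "x = length C"
      | C v b where "C \<in> set Cs" "(v, b) \<in> set C" "x = 2 * v + of_bool b"
      using x by (fastforce simp: encode_input_def encode_literal_def)
    then show ?thesis
    proof cases
      case 1 then show ?thesis using Vpar_ge_self[OF Epar_ge(3)] by simp
    next
      case 2 then show ?thesis by (simp add: Vpar_def)
    next
      case 3 then show ?thesis using m by simp
    next
      case 4
      then have "x \<le> k + 1" using clause_in_list(1)[OF assms 4(1)] by linarith
      then show ?thesis using Vpar_ge_self[OF Epar_ge(4)] le_trans by blast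
    next
      case 5
      then have "v < n" using clause_in_list(2)[OF assms] by blast
      then have "x \<le> 2 * n + 1" using 5 by auto
      then show ?thesis using Vpar_ge_self[OF Epar_ge(8)] le_trans by blast
    qed
  qed
  then show ?thesis by (auto simp: bnd_def init_state_def)
qed

section \<open>The numerical condition on the rate\<close>

definition Spar :: "nat \<Rightarrow> nat \<Rightarrow> real" where
  "Spar k n = 1 - gam (k - 1) (Jpar k n) + 2 / real (Jpar k n)"

text \<open>What the analysis of the search branch asks of \<open>n\<close>; it holds for all large
  \<open>n\<close>, and brute force takes the others.\<close>

definition okpar :: "nat \<Rightarrow> nat \<Rightarrow> bool" where
  "okpar k n \<longleftrightarrow> 0 < n \<and> 0 < Jpar k n \<and> 2 * (n * n) \<le> 2 ^ n \<and>
     real n + 4 \<le> 2 powr (- (Spar k n * real (n - ipar k n))) / 2 * 2 ^ epar k n"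

lemma gam_mono: "2 \<le> m \<Longrightarrow> gam m t \<le> gam 2 t"
  unfolding gam_def by (intro sum_mono divide_left_mono mult_left_mono add_mono mult_right_mono mult_pos_pos add_nonneg_pos) auto

text \<open>Each further term is at most \<open>1 / (2 * t * (t + 1))\<close>, which telescopes. The
  constant is \<open>1 / 3 + 1 / 10 + 1 / 4\<close>, the first two terms plus the bound on the tail,
  with equality at \<open>t = 2\<close>.\<close>

lemma gam2_le: "2 \<le> t \<Longrightarrow> gam 2 t \<le> 41 / 60 - 1 / (2 * real t)"
proof (induction t rule: nat_induct_at_least)
  case base
  show ?case by (simp add: gam_def numeral_2_eq_2)
next
  case (Suc t)
  have t: "2 \<le> real t" using Suc by simp
  have "1 / ((real t + 1) * (2 * (real t + 1) + 1)) \<le> 1 / (2 * real t * (real t + 1))"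
    using t by (intro divide_left_mono mult_pos_pos add_pos_pos) (auto simp: algebra_simps)
  also have "\<dots> = 1 / (2 * real t) - 1 / (2 * (real t + 1))" using t by (simp add: field_simps)
  finally show ?case using Suc by (simp add: gam_def add.commute)
qed

lemma gam_nonneg: "0 \<le> gam m t"
  unfolding gam_def by (intro sum_nonneg) auto

lemma gam_le:
  assumes "2 \<le> m" shows "gam m t \<le> 41 / 60"
proof -
  have "gam 2 t \<le> 41 / 60"
  proof (cases "2 \<le> t")
    case True
    have "0 \<le> 1 / (2 * real t)" by simp
    then show ?thesis using gam2_le[OF True] by linarith
  next
    case False
    then have "t = 0 \<or> t = 1" by auto
    then show ?thesis by (auto simp: gam_def)
  qed
  then show ?thesis using gam_mono[OF assms, of t] by linarith
qed

text \<open>This is where \<open>k \<ge> 3\<close> is decisive: \<open>2 * 41 / 60 = 41 / 30\<close>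
  is below \<open>36 / 25 \<le> 1 / ln 2\<close>. For \<open>k = 2\<close> the series sums to
  \<open>1\<close>, and twice that exceeds \<open>1 / ln 2\<close>.\<close>

lemma Spar_props:
  assumes "3 \<le> k" shows "0 \<le> Spar k n" "2 * (1 - Spar k n) \<le> 1 / ln 2"
proof -
  have g: "gam (k - 1) (Jpar k n) \<le> 41 / 60" using assms by (intro gam_le) auto
  have J: "0 \<le> 2 / real (Jpar k n)" by simp
  show "0 \<le> Spar k n" using g J unfolding Spar_def by linarith
  have "1 - Spar k n \<le> 41 / 60" using g J unfolding Spar_def by linarith
  moreover have "41 / 30 \<le> 1 / ln (2::real)"
  proof -
    have "ln (2::real) \<le> 25 / 36" by (rule ln2_le_25_over_36)
    then have "1 / (25 / 36) \<le> 1 / ln (2::real)" by (intro divide_left_mono) auto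
    moreover have "41 / 30 \<le> 1 / (25 / 36 :: real)" by simp
    ultimately show ?thesis by (rule order_trans[rotated])
  qed
  ultimately have "2 * (1 - Spar k n) \<le> 41 / 30" "41 / 30 \<le> 1 / ln (2::real)" by (simp_all add: field_simps)
  then show "2 * (1 - Spar k n) \<le> 1 / ln 2" by (rule order_trans)
qed

context prog begin

text \<open>The output can be wrong if a live node is missed, with probability at most
  \<open>1 / 8\<close>, or if the estimate is off, with probability at most \<open>1 / 4\<close>.
  Both events concern the same words, so the probabilities are added; \<open>5 / 8\<close>
  remains.\<close>

lemma search_correct:
  assumes b: "bnd V s" and s: "s 0 = inp" and n: "n0 \<le> n" and k: "3 \<le> k" and g\<kappa>: "esq (guardJ k) \<le> \<kappa>"
    and kV: "k + 1 \<le> V" "n0 \<le> V" and N: "N < 2 ^ n" "0 < N" and big: "2 ^ (n * n + 20 * n + 20) \<le> V"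
    and w: "w = wpar k n" and ok: "okpar k n"
  shows "lossless_spmf (exec (main k n0) (s, 0))"
    "(s', t) \<in> set_spmf (exec (main k n0) (s, 0)) \<Longrightarrow> t \<le> Tmain (2 ^ epar k n) * (\<kappa> * bits V)"
    "5 / 8 \<le> measure (measure_spmf (exec (main k n0) (s, 0)))
       {(s', t). approximates (exp (1 / real N)) (real (num_sat n F)) (output_value s')}"
proof -
  have k2: "2 \<le> k" using k by simp
  have n0: "0 < n" and J: "0 < Jpar k n" and n2: "2 * (n * n) \<le> 2 ^ n"
    and Rc: "real n + 4 \<le> 2 powr (- (Spar k n * real (n - ipar k n))) / 2 * 2 ^ epar k n"
    using ok by (auto simp: okpar_def)
  let ?R = "2 ^ epar k n" and ?M = "Mpar k n N" and ?i = "ipar k n"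
  let ?D = "words_pmf (n * (n + 1)) (?M + ?R)"
  let ?P = "\<lambda>s' :: state. approximates (exp (1 / real N)) (real (num_sat n F)) (output_value s')"
  let ?Q = "\<lambda>\<omega> (s' :: state). good (2 ^ n) ?i ?R \<omega> \<longrightarrow>
      (s' 1 0 = num_sat n F \<and> s' 1 1 = 1) \<or>
      (2 ^ ?i < num_sat n F \<and> s' 1 0 = hits ?M \<omega> * 2 ^ n \<and> s' 1 1 = ?M)"
  have W: "wpp (main k n0) (Tmain ?R) ?D ?Q s"
    by (rule main_search_wpp[OF b s n0 n k2 g\<kappa> kV N(1) J big w])
  show "lossless_spmf (exec (main k n0) (s, 0))"
    "(s', t) \<in> set_spmf (exec (main k n0) (s, 0)) \<Longrightarrow> t \<le> Tmain ?R * (\<kappa> * bits V)"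
    by (rule wpp_run[OF W], rule wpp_run(2)[OF W])
  have Jd: "Jpar k n ^ (2 * (k - 1)) \<le> dpar k n"
    using Jpar_props(3)[OF k2, of "Jpar k n - 1" n] J by simp
  have Sb: "gw \<alpha> \<sigma> x \<le> Spar k n" if "\<sigma> \<in> sols \<alpha>" "x \<in> frozen \<alpha>" for \<alpha> \<sigma> x
    unfolding Spar_def by (rule gw_le[OF k2 _ J Jd that]) (simp add: w wpar_def)
  have g8: "measure_pmf.prob ?D {\<omega>. \<not> good (2 ^ n) ?i ?R \<omega>} \<le> 1 / 8"
    by (rule good_prob[OF Spar_props[OF k] Sb n2]) (use Rc in auto)
  \<comment> \<open>The sampling bound is available only for more than \<open>2 ^ ipar k n\<close>
    solutions, so the event is made empty otherwise; in that case \<open>good\<close> rules out that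
    the sampling output occurs.\<close>
  define B where "B = {\<omega>. 2 ^ ?i < num_sat n F \<and>
     \<not> approximates (exp (1 / real N)) (real (num_sat n F)) (real (hits ?M \<omega> * 2 ^ n) / real ?M)}"
  have B4: "measure_pmf.prob ?D B \<le> 1 / 4"
  proof (cases "2 ^ ?i < num_sat n F")
    case True
    have "B = {\<omega>. \<not> approximates (exp (1 / real N)) (real (num_sat n F)) (real (hits ?M \<omega> * 2 ^ n) / real ?M)}"
      unfolding B_def using True by blast
    then show ?thesis by (simp only:) (rule hits_prob[OF ipar_le True N(2) Mpar_def]; simp)
  next
    case False
    then show ?thesis by (simp add: B_def)
  qed
  have ex: "approximates (exp (1 / real N)) x x" if "0 \<le> x" for x
    using approximates_exp[OF N(2) that, of x] that by simp
  have sub: "- ({\<omega>. \<not> good (2 ^ n) ?i ?R \<omega>} \<union> B) \<subseteq> {\<omega>. \<forall>s'. ?Q \<omega> s' \<longrightarrow> ?P s'}"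
  proof (intro subsetI CollectI allI impI)
    fix \<omega> and s' :: state assume \<omega>: "\<omega> \<in> - ({\<omega>. \<not> good (2 ^ n) ?i ?R \<omega>} \<union> B)" and Q: "?Q \<omega> s'"
    then have "(s' 1 0 = num_sat n F \<and> s' 1 1 = 1) \<or>
      (2 ^ ?i < num_sat n F \<and> s' 1 0 = hits ?M \<omega> * 2 ^ n \<and> s' 1 1 = ?M)" by auto
    then show "?P s'"
    proof
      assume "s' 1 0 = num_sat n F \<and> s' 1 1 = 1"
      then show ?thesis using ex by (simp add: output_value_def)
    next
      assume A: "2 ^ ?i < num_sat n F \<and> s' 1 0 = hits ?M \<omega> * 2 ^ n \<and> s' 1 1 = ?M"
      then have "output_value s' = real (hits ?M \<omega> * 2 ^ n) / real ?M" by (simp only: output_value_def)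
      then show ?thesis using \<omega> A unfolding B_def by auto
    qed
  qed
  have "1 - measure_pmf.prob ?D ({\<omega>. \<not> good (2 ^ n) ?i ?R \<omega>} \<union> B) = measure_pmf.prob ?D (- ({\<omega>. \<not> good (2 ^ n) ?i ?R \<omega>} \<union> B))"
    using measure_pmf.prob_compl[of "{\<omega>. \<not> good (2 ^ n) ?i ?R \<omega>} \<union> B" ?D] by (simp add: Compl_eq_Diff_UNIV)
  moreover have "measure_pmf.prob ?D ({\<omega>. \<not> good (2 ^ n) ?i ?R \<omega>} \<union> B) \<le> 1 / 8 + 1 / 4"
    using measure_Un_le[of "{\<omega>. \<not> good (2 ^ n) ?i ?R \<omega>}" "measure_pmf ?D" B] g8 B4 by simp
  ultimately have "5 / 8 \<le> measure_pmf.prob ?D (- ({\<omega>. \<not> good (2 ^ n) ?i ?R \<omega>} \<union> B))" by linarith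
  also have "\<dots> \<le> measure_pmf.prob ?D {\<omega>. \<forall>s'. ?Q \<omega> s' \<longrightarrow> ?P s'}"
    by (rule measure_pmf.finite_measure_mono[OF sub]) simp
  also have "\<dots> \<le> measure (measure_spmf (exec (main k n0) (s, 0))) {(s', t). ?P s'}"
    by (rule wpp_run(3)[OF W])
  finally show "5 / 8 \<le> measure (measure_spmf (exec (main k n0) (s, 0))) {(s', t). ?P s'}" .
qed

lemma brute_correct:
  assumes b: "bnd V s" and s: "s 0 = inp" and br: "2 ^ n \<le> N \<or> n < n0" and kV: "n0 \<le> V"
    and V: "2 ^ n * 2 ^ n \<le> V" and N: "0 < N"
  shows "lossless_spmf (exec (main k n0) (s, 0))"
    "(s', t) \<in> set_spmf (exec (main k n0) (s, 0)) \<Longrightarrow> t \<le> (n * 3 + 6 + (2 ^ n * 3 + Tsample (2 ^ n))) * (\<kappa> * bits V)"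
    "5 / 8 \<le> measure (measure_spmf (exec (main k n0) (s, 0)))
       {(s', t). approximates (exp (1 / real N)) (real (num_sat n F)) (output_value s')}"
proof -
  let ?P = "\<lambda>s' :: state. approximates (exp (1 / real N)) (real (num_sat n F)) (output_value s')"
  let ?Q = "\<lambda>s' :: state. s' 1 0 = num_sat n F * 2 ^ n \<and> s' 1 1 = 2 ^ n"
  note W = wp_wpp[OF main_brute_wp[OF b s br kV V], of "()"]
  show "lossless_spmf (exec (main k n0) (s, 0))"
    "(s', t) \<in> set_spmf (exec (main k n0) (s, 0)) \<Longrightarrow> t \<le> (n * 3 + 6 + (2 ^ n * 3 + Tsample (2 ^ n))) * (\<kappa> * bits V)"
    by (rule wpp_run[OF W], rule wpp_run(2)[OF W])
  have "?P s'" if "?Q s'" for s'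
    using that approximates_exp[OF N, of "real (num_sat n F)" "real (num_sat n F)"] by (simp add: output_value_def)
  then have "measure_pmf.prob (return_pmf ()) {x. \<forall>s'. ?Q s' \<longrightarrow> ?P s'} = 1" by simp
  then have "1 \<le> measure (measure_spmf (exec (main k n0) (s, 0))) {(s', t). ?P s'}"
    using wpp_run(3)[OF W, of ?P] by simp
  then show "5 / 8 \<le> measure (measure_spmf (exec (main k n0) (s, 0))) {(s', t). ?P s'}" by linarith
qed

end

section \<open>Running time\<close>

text \<open>For fixed \<open>k\<close> and \<open>n0\<close> a polynomial in \<open>n\<close> that
  dominates the time to evaluate the formula, the exponent of the stored numbers and all linear
  terms at once; its powers then absorb every subexponential factor.\<close>

definition Zpar :: "nat \<Rightarrow> nat \<Rightarrow> nat \<Rightarrow> nat" where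
  "Zpar k n0 n = ((k + n0 + 100) * (2 * n + 1)) ^ (k + 2)"

text \<open>The common exponent of both tasks: \<open>2 ^ i\<close> nodes with
  \<open>2 ^ epar k n\<close> trials each, and \<open>2 ^ (n - i)\<close> samples up to the factor
  \<open>N^2\<close>.\<close>

definition Xpar :: "nat \<Rightarrow> nat \<Rightarrow> nat" where
  "Xpar k n = n - ipar k n + 16 * (n div Jpar k n)"

lemma Zpar_ge:
  "(2 * n + 1) ^ k * (k * 6 + 9) + 4 \<le> Zpar k n0 n" "Epar k n0 n + 2 \<le> Zpar k n0 n" "2 * n \<le> Zpar k n0 n" "100 \<le> Zpar k n0 n"
proof -
  define K where "K = k + n0 + 100"
  define u where "u = K * (2 * n + 1)"
  have uu: "u \<le> u * u" by simp
  have uK: "K * 1 \<le> u" "100 * (2 * n + 1) \<le> u" unfolding u_def by (intro mult_le_mono; simp add: K_def)+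
  have Z: "Zpar k n0 n = u ^ k * (u * u)" by (simp add: Zpar_def u_def K_def)
  have "1 \<le> u" using uK(2) by simp
  then have "1 \<le> u ^ k" by simp
  then have "1 * (u * u) \<le> u ^ k * (u * u)" by (intro mult_le_mono) auto
  then have u2: "u * u \<le> Zpar k n0 n" using Z by simp
  have "2 * n + 1 \<le> u" using uK(2) by simp
  then have "(2 * n + 1) ^ k \<le> u ^ k" by (rule power_mono) simp
  moreover have "k * 6 + 9 + 4 \<le> u * u"
  proof -
    have "100 * u \<le> u * u" using uK(2) by (intro mult_le_mono) auto
    moreover have "k \<le> u" using uK(1) by (simp add: K_def)
    moreover have "100 \<le> u" using uK(2) by simp
    ultimately show ?thesis by linarith
  qed
  ultimately have "(2 * n + 1) ^ k * (k * 6 + 9 + 4) \<le> Zpar k n0 n" unfolding Z by (rule mult_le_mono)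
  moreover have "(2 * n + 1) ^ k * (k * 6 + 9 + 4) = (2 * n + 1) ^ k * (k * 6 + 9) + 4 * (2 * n + 1) ^ k"
    by (simp add: add_mult_distrib2)
  moreover have "1 \<le> (2 * n + 1) ^ k" by simp
  ultimately show "(2 * n + 1) ^ k * (k * 6 + 9) + 4 \<le> Zpar k n0 n" by linarith
  have "(n + k + n0 + 20) + 2 \<le> u"
  proof -
    have "K * (2 * n + 1) = 2 * (K * n) + K" by simp
    moreover have "1 * n \<le> K * n" by (rule mult_le_mono) (simp_all add: K_def)
    moreover have "k + n0 + 100 = K" by (simp add: K_def)
    ultimately show ?thesis unfolding u_def by linarith
  qed
  then have "((n + k + n0 + 20) + 2) * ((n + k + n0 + 20) + 2) \<le> u * u" by (intro mult_le_mono)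
  moreover have "x * x + 2 \<le> (x + 2) * (x + 2)" for x :: nat by simp
  ultimately show "Epar k n0 n + 2 \<le> Zpar k n0 n" using u2 unfolding Epar_def by (meson le_trans)
  show "2 * n \<le> Zpar k n0 n" "100 \<le> Zpar k n0 n" using le_trans[OF _ le_trans[OF uu u2]] uK(2) by simp_all
qed

text \<open>The second bound uses \<open>N\<close> itself in place of its length. It serves the
  brute-force branch, where the time bound provides two factors \<open>N\<close>.\<close>

lemma bits_Vpar: "N < 2 ^ n \<Longrightarrow> bits (Vpar k n0 n N) \<le> Zpar k n0 n" "bits (Vpar k n0 n N) \<le> N + Zpar k n0 n"
proof -
  let ?E = "Epar k n0 n"
  assume N: "N < 2 ^ n"
  have "(2::nat) ^ n \<le> 2 ^ ?E" by (rule power_increasing) (simp_all add: Epar_ge)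
  then have "N + 2 ^ ?E < 2 * 2 ^ ?E" using N by linarith
  then have "Vpar k n0 n N < 2 ^ (?E + 1)" by (simp add: Vpar_def)
  then have "bits (Vpar k n0 n N) \<le> ?E + 1" by (rule bits_le) simp
  then show "bits (Vpar k n0 n N) \<le> Zpar k n0 n" using Zpar_ge(2)[of k n0 n] by linarith
next
  let ?E = "Epar k n0 n"
  have "(2::nat) ^ ?E \<le> 2 ^ (N + ?E)" by (rule power_increasing) simp_all
  moreover have "N < 2 ^ (N + ?E)" by (rule less_le_trans[OF n_lt[of N] power_increasing]) simp_all
  ultimately have "N + 2 ^ ?E < 2 * 2 ^ (N + ?E)" by linarith
  then have "Vpar k n0 n N < 2 ^ (N + ?E + 1)" by (simp add: Vpar_def)
  then have "bits (Vpar k n0 n N) \<le> N + ?E + 1" by (rule bits_le) simp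
  then show "bits (Vpar k n0 n N) \<le> N + Zpar k n0 n" using Zpar_ge(2)[of k n0 n] by linarith
qed

context prog begin

text \<open>The search dominates. A refutation tries \<open>n ^ w * 2 ^ w \<le> Z ^ w\<close>
  extensions; the three further factors \<open>Z\<close> stand for the evaluation of the formula,
  the steps of a trial, and the factor \<open>2 * n + 3\<close> of the budget.\<close>

lemma Tmain_le:
  assumes Z: "Tcheck \<le> Z" "2 * n \<le> Z" "w \<le> Z" "100 \<le> Z" and n: "0 < n" and N: "0 < N" and i: "2 * ipar k n \<le> n"
  shows "Tmain (2 ^ epar k n) \<le> N * N * 2 ^ Xpar k n * (30 * Z ^ (w + 3))"
proof -
  define W Y M R I where "W = Z ^ w" and "Y = N * N * 2 ^ Xpar k n" and "M = Mpar k n N"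
    and "R = (2::nat) ^ epar k n" and "I = (2::nat) ^ ipar k n"
  have N1: "1 \<le> N * N" using N by simp
  have pow: "2 ^ a \<le> Y" if "a \<le> Xpar k n" for a
  proof -
    have "1 * 2 ^ a \<le> N * N * 2 ^ Xpar k n" by (rule mult_le_mono[OF N1 power_increasing[OF that]]) simp
    then show ?thesis by (simp add: Y_def)
  qed
  have IR: "I * R \<le> Y"
  proof -
    have "I * R = 2 ^ (ipar k n + epar k n)" by (simp add: I_def R_def power_add)
    also have "\<dots> \<le> Y" by (rule pow) (use i in \<open>simp add: Xpar_def epar_def\<close>)
    finally show ?thesis .
  qed
  have I: "I \<le> Y" unfolding I_def by (rule pow) (use i in \<open>simp add: Xpar_def\<close>)
  have R: "R \<le> Y" unfolding R_def by (rule pow) (simp add: Xpar_def epar_def)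
  have Y1: "1 \<le> Y" using pow[of 0] by simp
  have M: "M \<le> 16 * Y" unfolding M_def Mpar_def Y_def
    by (intro mult_le_mono2 power_increasing) (simp_all add: Xpar_def)
  have W1: "1 \<le> W" using Z(4) by (simp add: W_def)
  have nw: "n ^ w * 2 ^ w \<le> W"
    using power_mono[of "n * 2" Z w] Z(2) by (simp add: W_def power_mult_distrib mult.commute)
  have "n ^ w * 1 \<le> n ^ w * 2 ^ w" by (rule mult_le_mono2) simp
  then have nw1: "n ^ w \<le> W" using nw by linarith
  have ZW: "Z \<le> Z * W" using W1 by simp
  have ZZW: "100 * (Z * W) \<le> Z * Z * W" using Z(4) by simp
  have ZZZW: "100 * (Z * Z * W) \<le> Z * Z * Z * W" using Z(4) by simp
  have "Text + 4 \<le> 11 * Z" using Z by (simp add: Text_def)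
  then have "n ^ w * 2 ^ w * (Text + 4) \<le> W * (11 * Z)" by (rule mult_le_mono[OF nw])
  moreover have "Tref = n ^ w * 2 ^ w * (Text + 4) + 7 * n ^ w + 3" by (simp add: Tref_def algebra_simps)
  moreover have "100 * W \<le> Z * W" using Z(4) by simp
  moreover have "W * (11 * Z) = 11 * (Z * W)" by simp
  ultimately have "Tref \<le> 12 * (Z * W)" using nw1 W1 by linarith
  then have "n * (Tref + 11) \<le> Z * (12 * (Z * W) + 11)" using Z(2) by (intro mult_le_mono) auto
  then have "n * (Tstep + 1) \<le> 12 * (Z * Z * W) + 11 * Z" by (simp add: Tstep_def algebra_simps)
  then have tr: "Tdecode + Ttrial + 23 \<le> 14 * (Z * Z * W)"
    using Z ZW ZZW unfolding Ttrial_def Tdecode_def by linarith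
  have "I * (Ttest R + 15) = I * R * (Tdecode + Ttrial + 5) + 18 * I" by (simp add: Ttest_def algebra_simps)
  also have "\<dots> \<le> Y * (Tdecode + Ttrial + 5) + 18 * Y" using IR I by (intro add_mono mult_le_mono) auto
  also have "\<dots> = Y * (Tdecode + Ttrial + 23)" by (simp add: algebra_simps)
  also have "\<dots> \<le> Y * (14 * (Z * Z * W))" using tr by (rule mult_le_mono2)
  finally have "I * (Ttest R + 15) \<le> Y * (14 * (Z * Z * W))" .
  then have "(2 * n + 3) * (I * (Ttest R + 15)) \<le> (2 * Z) * (Y * (14 * (Z * Z * W)))"
    by (rule mult_le_mono[rotated]) (use Z in linarith)
  then have t5: "(2 * n + 3) * I * (Ttest R + 15) \<le> Y * (28 * (Z * Z * Z * W))" by (simp add: algebra_simps)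
  have "n * (n + 1) \<le> Z * Z" using Z n by (intro mult_le_mono) auto
  then have "(M + R) * (n * (n + 1) * 4 + 6) \<le> (17 * Y) * (Z * Z * 4 + 6)" using M R by (intro mult_le_mono) auto
  also have "\<dots> \<le> Y * (68 * (Z * Z * W) + 102 * (Z * W))"
  proof -
    have "17 * (Z * Z * 4 + 6) \<le> 68 * (Z * Z * W) + 102 * (Z * W)"
    proof -
      have "17 * (Z * Z * 4 + 6) = 68 * (Z * Z) + 102" by simp
      moreover have "Z * Z \<le> Z * Z * W" using W1 by simp
      ultimately show ?thesis using ZW Z(4) by linarith
    qed
    then have "Y * (17 * (Z * Z * 4 + 6)) \<le> Y * (68 * (Z * Z * W) + 102 * (Z * W))" by (rule mult_le_mono2)
    then show ?thesis by (simp add: algebra_simps)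
  qed
  finally have t3: "(M + R) * (n * (n + 1) * 4 + 6) \<le> Y * (68 * (Z * Z * W) + 102 * (Z * W))" .
  have "n * 4 + Tcheck + 8 \<le> 4 * (Z * W)" using Z ZW by linarith
  then have "M * (n * 4 + Tcheck + 8) \<le> (16 * Y) * (4 * (Z * W))" by (rule mult_le_mono[OF M])
  then have t6: "Tsample M \<le> Y * (64 * (Z * W)) + 6 * Y" using Y1 unfolding Tsample_def by simp
  have t1: "n * 83 + 50 \<le> Y * (84 * (Z * W))"
  proof -
    have "1 * (n * 83 + 50) \<le> Y * (84 * (Z * W))" using Z ZW by (intro mult_le_mono[OF Y1]) linarith
    then show ?thesis by simp
  qed
  have "Tmain R \<le> Y * (84 * (Z * W)) + Y * (68 * (Z * Z * W) + 102 * (Z * W)) + 4 * Y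
     + Y * (28 * (Z * Z * Z * W)) + (Y * (64 * (Z * W)) + 6 * Y)"
    using t1 t3 I t5 t6 unfolding Tmain_def M_def[symmetric] I_def[symmetric] by linarith
  also have "\<dots> = Y * (84 * (Z * W) + (68 * (Z * Z * W) + 102 * (Z * W)) + 4 + 28 * (Z * Z * Z * W) + 64 * (Z * W) + 6)"
    by (simp add: algebra_simps)
  also have "\<dots> \<le> Y * (30 * (Z * Z * Z * W))"
    by (rule mult_le_mono2) (use ZW ZZW ZZZW Z(4) in linarith)
  also have "Z * Z * Z * W = Z ^ (w + 3)" by (simp add: W_def power_add power3_eq_cube mult.commute)
  finally show ?thesis unfolding Y_def R_def .
qed

text \<open>For \<open>2 ^ n \<le> N\<close> the number of assignments accounts for one factor
  \<open>N\<close>, and the length of the stored numbers, at most \<open>N + Z\<close>, for the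
  other. For \<open>n < n0\<close> the factor \<open>2 ^ n\<close> is granted explicitly; being
  bounded, it is harmless asymptotically.\<close>

lemma brute_time_le:
  assumes Z: "Tcheck \<le> Z" "2 * n \<le> Z" "100 \<le> Z" and b: "b \<le> N + Z" and N: "0 < N" "2 ^ n \<le> N \<or> n < n0"
  shows "(n * 3 + 6 + (2 ^ n * 3 + Tsample (2 ^ n))) * (\<kappa> * b)
    \<le> N * N * (30 * \<kappa> * Z ^ (w + 4)) * 2 ^ (if n < n0 then n else 0)"
proof -
  define G where "G = (2::nat) ^ n"
  have G1: "1 \<le> G" by (simp add: G_def)
  have "n * 3 + 6 \<le> G * (n * 3 + 6)" using G1 by simp
  then have "n * 3 + 6 + (G * 3 + Tsample G) \<le> G * (n * 3 + 6) + (G * 3 + Tsample G)" by simp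
  also have "\<dots> \<le> G * (n * 3 + 6) + (G * 3 + (G * (n * 4 + Tcheck + 8) + G * 6))" using G1 by (simp add: Tsample_def)
  also have "\<dots> = G * (7 * n + Tcheck + 23)" by (simp add: algebra_simps)
  also have "\<dots> \<le> G * (6 * Z)" by (rule mult_le_mono2) (use Z in linarith)
  finally have 1: "n * 3 + 6 + (G * 3 + Tsample G) \<le> G * (6 * Z)" .
  have "N \<le> N * Z" "Z \<le> N * Z" using Z N by simp_all
  then have "b \<le> 2 * (N * Z)" using b by linarith
  then have "(n * 3 + 6 + (G * 3 + Tsample G)) * (\<kappa> * b) \<le> G * (6 * Z) * (\<kappa> * (2 * (N * Z)))"
    by (intro mult_le_mono[OF 1]) simp
  also have "\<dots> = (G * N) * (12 * \<kappa> * (Z * Z))" by (simp add: algebra_simps)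
  also have "\<dots> \<le> (N * N * 2 ^ (if n < n0 then n else 0)) * (30 * \<kappa> * Z ^ (w + 4))"
  proof (rule mult_le_mono)
    show "G * N \<le> N * N * 2 ^ (if n < n0 then n else 0)"
    proof (cases "n < n0")
      case True
      have "N * 1 * G \<le> N * N * G" using N by (intro mult_le_mono) auto
      then show ?thesis using True by (simp add: G_def mult.commute)
    next
      case False
      then show ?thesis using N(2) by (simp add: G_def)
    qed
    have "Z ^ 2 \<le> Z ^ (w + 4)" using Z by (intro power_increasing) auto
    then show "12 * \<kappa> * (Z * Z) \<le> 30 * \<kappa> * Z ^ (w + 4)" by (intro mult_le_mono) (auto simp: power2_eq_square)
  qed
  finally show ?thesis by (simp add: G_def algebra_simps)
qed

end

section \<open>Limits of the parameters\<close>

lemma gam_lim: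
  assumes k: "3 \<le> k" shows "(\<lambda>t. gam (k - 1) t) \<longlonglongrightarrow> mu k / (real k - 1)"
proof -
  define m where "m = real k - 1"
  have m: "2 \<le> m" "real (k - 1) = m" using k by (auto simp: m_def)
  define f where "f i = 1 / (real (Suc i) * (real (Suc i) + 1 / m))" for i
  have "summable f"
  proof (rule summable_comparison_test)
    show "summable (\<lambda>i. 1 / (real i + 1) ^ 2)" using inverse_squares_sums by (auto simp: sums_iff add.commute)
    have "norm (f i) \<le> 1 / (real i + 1) ^ 2" for i
    proof -
      have a: "0 < real i + 1" "0 \<le> 1 / m" using m by auto
      then have "(real i + 1) * (real i + 1) \<le> (real i + 1) * (real i + 1 + 1 / m)" by (intro mult_left_mono) auto
      then have "1 / ((real i + 1) * (real i + 1 + 1 / m)) \<le> 1 / ((real i + 1) * (real i + 1))"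
        using a by (intro divide_left_mono mult_pos_pos) linarith+
      then show ?thesis using a unfolding f_def by (simp add: power2_eq_square add.commute)
    qed
    then show "\<exists>N. \<forall>i\<ge>N. norm (f i) \<le> 1 / (real i + 1) ^ 2" by auto
  qed
  then have "(\<lambda>t. \<Sum>i<t. f i) \<longlonglongrightarrow> mu k" unfolding mu_def f_def m_def by (rule summable_LIMSEQ)
  then have "(\<lambda>t. (\<Sum>i<t. f i) / m) \<longlonglongrightarrow> mu k / m" using m by (intro tendsto_divide) auto
  moreover have "(\<Sum>i<t. f i) / m = gam (k - 1) t" for t
    unfolding gam_def sum_divide_distrib f_def m(2)
  proof (intro sum.cong refl)
    fix i
    have "(real (Suc i) + 1 / m) * m = m * real (Suc i) + 1" using m(1) by (simp add: field_simps)
    then have "real (Suc i) * (real (Suc i) + 1 / m) * m = real (Suc i) * (m * real (Suc i) + 1)" by (simp only: mult.assoc)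
    then show "1 / (real (Suc i) * (real (Suc i) + 1 / m)) / m = 1 / (real (Suc i) * (m * real (Suc i) + 1))"
      by (simp only: divide_divide_eq_left)
  qed
  ultimately show ?thesis by (simp add: m_def)
qed

lemma filterlim_dpar: assumes "0 < k" shows "filterlim (dpar k) at_top sequentially"
  unfolding filterlim_at_top
proof
  fix Z
  show "eventually (\<lambda>n. Z \<le> dpar k n) sequentially"
    using eventually_ge_at_top[of "(k + 1) ^ Z * (k + 1) ^ Z"]
  proof eventually_elim
    case (elim n)
    show ?case
    proof (rule ccontr)
      assume "\<not> ?case"
      then have "(k + 1) ^ Suc (dpar k n) \<le> (k + 1) ^ Z" by (intro power_increasing) auto
      then have "(k + 1) ^ Suc (dpar k n) * (k + 1) ^ Suc (dpar k n) \<le> (k + 1) ^ Z * (k + 1) ^ Z" by (intro mult_le_mono)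
      then show False using dpar_props(1)[OF assms, of n] elim by linarith
    qed
  qed
qed

lemma filterlim_Jpar: assumes "2 \<le> k" shows "filterlim (Jpar k) at_top sequentially"
  unfolding filterlim_at_top
proof
  fix Z
  have "eventually (\<lambda>n. Z ^ (2 * (k - 1)) \<le> dpar k n) sequentially"
    using filterlim_dpar[of k] assms by (simp add: filterlim_at_top)
  then show "eventually (\<lambda>n. Z \<le> Jpar k n) sequentially"
  proof eventually_elim
    case (elim n)
    show ?case
    proof (rule ccontr)
      assume "\<not> ?case"
      then have "Suc (Jpar k n) ^ (2 * (k - 1)) \<le> Z ^ (2 * (k - 1))" by (intro power_mono) auto
      then show False using Jpar_props(1)[OF assms, of n] elim by linarith
    qed
  qed
qed

text \<open>\<open>J \<le> d < 2 ^ d \<le> w\<close>, and \<open>w\<close> is at most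
  \<open>sqrt n\<close>. So \<open>n / J\<close> is at least \<open>sqrt n\<close> and outweighs
  logarithms of \<open>n\<close>.\<close>

lemma Jpar_square: assumes "2 \<le> k" "0 < n" shows "Jpar k n * Jpar k n \<le> n"
proof -
  have "dpar k n < 2 ^ dpar k n" by (rule n_lt)
  also have "(2::nat) ^ dpar k n \<le> wpar k n" unfolding wpar_def using assms by (intro power_mono) auto
  finally have "Jpar k n \<le> wpar k n" using Jpar_props(2)[OF assms(1), of n] by linarith
  then have "Jpar k n * Jpar k n \<le> wpar k n * wpar k n" by (intro mult_le_mono)
  then show ?thesis using wpar_square[of k n] assms by linarith
qed

lemma real_div_bounds: "real (a div b) \<le> real a / real b" "0 < b \<Longrightarrow> real a / real b - 1 \<le> real (a div b)"
proof -
  show "real (a div b) \<le> real a / real b" by (rule of_nat_div_le_of_nat)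
  show "0 < b \<Longrightarrow> real a / real b - 1 \<le> real (a div b)" proof -
    assume b: "0 < b"
    have "real (a mod b) \<le> real b" using b by (simp add: less_imp_le)
    then have "real (a mod b) / real b \<le> 1" using b by simp
    then show ?thesis using of_nat_of_nat_div_aux[of a b, where ?'a = real] by linarith
  qed
qed

lemma qpar_bounds:
  assumes "0 < n"
  shows "real (qpar k n) \<le> real n * real n * gam (k - 1) (Jpar k n)"
    "real n * real n * gam (k - 1) (Jpar k n) - real (Jpar k n) \<le> real (qpar k n)"
proof -
  let ?c = "\<lambda>j. Suc j * ((k - 1) * Suc j + 1)"
  have g: "real n * real n * gam (k - 1) (Jpar k n) = (\<Sum>j<Jpar k n. real (n * n) / real (?c j))"
    by (simp only: gam_def sum_distrib_left of_nat_mult of_nat_add of_nat_1 times_divide_eq_right mult_1_right)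
  show "real (qpar k n) \<le> real n * real n * gam (k - 1) (Jpar k n)"
    unfolding g qpar_def of_nat_sum by (intro sum_mono real_div_bounds)
  have "(\<Sum>j<Jpar k n. real (n * n) / real (?c j) - 1) \<le> real (qpar k n)"
    unfolding qpar_def of_nat_sum by (intro sum_mono real_div_bounds) simp
  then show "real n * real n * gam (k - 1) (Jpar k n) - real (Jpar k n) \<le> real (qpar k n)"
    unfolding g by (simp add: sum_subtractf)
qed

text \<open>Both \<open>qpar\<close> and \<open>ipar\<close> are rounded down, so the equation
  \<open>i = \<gamma> * (n - i)\<close> survives as an inequality in the direction in which it
  limits the number of trials.\<close>

lemma ipar_gam:
  assumes "0 < n" shows "real (ipar k n) \<le> gam (k - 1) (Jpar k n) * (real n - real (ipar k n))"
proof -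
  let ?i = "real (ipar k n)" and ?q = "real (qpar k n)" and ?n = "real n" and ?g = "gam (k - 1) (Jpar k n)"
  have n: "0 < ?n" using assms by simp
  have "?i \<le> ?n * ?q / (?n * ?n + ?q)"
    unfolding ipar_def using real_div_bounds(1)[of "n * qpar k n" "n * n + qpar k n"] by simp
  then have "?i * (?n * ?n + ?q) \<le> ?n * ?q" using n by (simp add: pos_le_divide_eq add_pos_nonneg)
  then have "?i * (?n * ?n) \<le> (?n - ?i) * ?q" by (simp add: algebra_simps)
  also have "\<dots> \<le> (?n - ?i) * (?n * ?n * ?g)"
    using qpar_bounds(1)[OF assms] ipar_le[of k n] by (intro mult_left_mono) auto
  finally have "?i * (?n * ?n) \<le> (?g * (?n - ?i)) * (?n * ?n)" by (simp add: algebra_simps)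
  then show ?thesis using n by simp
qed

text \<open>Makes the truncated subtraction in \<open>epar\<close> exact.\<close>

lemma ipar_half: assumes "3 \<le> k" "0 < n" shows "2 * ipar k n \<le> n"
proof -
  have "gam (k - 1) (Jpar k n) \<le> 1" using gam_le[of "k - 1" "Jpar k n"] assms(1) by linarith
  then have "gam (k - 1) (Jpar k n) * (real n - real (ipar k n)) \<le> 1 * (real n - real (ipar k n))"
    using ipar_le[of k n] by (intro mult_right_mono) auto
  then show ?thesis using ipar_gam[OF assms(2), of k] by simp
qed

text \<open>By \<open>ipar_gam\<close> the exponent \<open>Spar k n * (n - i)\<close> is at most
  \<open>n - 2 * i + 2 * n / J\<close>, and \<open>epar\<close> exceeds this by at least
  \<open>14 * n / J - 16\<close>. As \<open>J\<close> is at most \<open>sqrt n\<close>, the surplus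
  eventually beats the logarithm of \<open>n + 4\<close>.\<close>

lemma eventually_okpar: assumes k: "3 \<le> k" shows "eventually (okpar k) sequentially"
proof -
  have e1: "eventually (\<lambda>n. 1 \<le> Jpar k n) sequentially"
    using filterlim_Jpar[of k] k by (simp add: filterlim_at_top)
  have e2: "eventually (\<lambda>n. 2 * (real n * real n) \<le> 2 powr real n) sequentially" by real_asymp
  have e3: "eventually (\<lambda>n. real n + 4 \<le> 2 powr (14 * sqrt (real n) - 16) / 2) sequentially" by real_asymp
  show ?thesis using e1 e2 e3 eventually_gt_at_top[of 0]
  proof eventually_elim
    case (elim n)
    let ?i = "real (ipar k n)" and ?J = "real (Jpar k n)" and ?n = "real n" and ?g = "gam (k - 1) (Jpar k n)"
    have J: "0 < ?J" using elim by simp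
    have "real (Jpar k n * Jpar k n) \<le> ?n" using Jpar_square[of k n] k elim by (simp del: of_nat_mult)
    then have "?J \<le> sqrt ?n" by (intro real_le_rsqrt) (simp add: power2_eq_square)
    then have "?n / sqrt ?n \<le> ?n / ?J" using J elim by (intro divide_left_mono) auto
    then have nJ: "sqrt ?n \<le> ?n / ?J" by (simp add: real_div_sqrt)
    have "?g * (?n - ?i) - 2 / ?J * (?n - ?i) \<ge> ?i - 2 / ?J * ?n"
    proof -
      have "2 / ?J * (?n - ?i) \<le> 2 / ?J * ?n" by (intro mult_left_mono) auto
      then show ?thesis using ipar_gam[of n k] elim by linarith
    qed
    then have S: "- (Spar k n * (?n - ?i)) \<ge> - ?n + 2 * ?i - 2 * (?n / ?J)"
      by (simp add: Spar_def algebra_simps)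
    have "real (epar k n) = ?n - 2 * ?i + 16 * real (n div Jpar k n)"
      unfolding epar_def using ipar_half[OF k, of n] elim by (simp add: of_nat_diff)
    moreover have "?n / ?J - 1 \<le> real (n div Jpar k n)" by (rule real_div_bounds) (use elim in simp)
    ultimately have E: "14 * sqrt ?n - 16 \<le> - (Spar k n * real (n - ipar k n)) + real (epar k n)"
      using S nJ ipar_le[of k n] by (simp add: of_nat_diff)
    have "?n + 4 \<le> 2 powr (14 * sqrt ?n - 16) / 2" using elim by simp
    also have "\<dots> \<le> 2 powr (- (Spar k n * real (n - ipar k n)) + real (epar k n)) / 2"
      using E by (intro divide_right_mono powr_mono) auto
    also have "\<dots> = 2 powr (- (Spar k n * real (n - ipar k n))) / 2 * 2 ^ epar k n"
      unfolding powr_add by (simp add: powr_realpow[symmetric])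
    finally have "?n + 4 \<le> 2 powr (- (Spar k n * real (n - ipar k n))) / 2 * 2 ^ epar k n" .
    moreover have "2 * (n * n) \<le> 2 ^ n"
    proof -
      have "real (2 * (n * n)) \<le> real (2 ^ n)" using elim by (simp add: powr_realpow)
      then show ?thesis by (simp only: of_nat_le_iff)
    qed
    ultimately show ?case using elim by (simp add: okpar_def)
  qed
qed

text \<open>With \<open>x = qpar k n / n^2\<close> the ratio \<open>(n - i) / n\<close> is
  \<open>1 / (1 + x)\<close> up to \<open>1 / n\<close>. In turn \<open>x\<close> is within
  \<open>1 / n\<close> of \<open>gam\<close>, because it contains at most \<open>n\<close>
  roundings, each divided by \<open>n^2\<close>.\<close>

lemma lim_ipar:
  assumes k: "3 \<le> k"
  shows "(\<lambda>n. real (n - ipar k n) / real n) \<longlonglongrightarrow> (real k - 1) / (real k - 1 + mu k)"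
proof -
  define x where "x n = real (qpar k n) / (real n * real n)" for n
  have g: "(\<lambda>n. gam (k - 1) (Jpar k n)) \<longlonglongrightarrow> mu k / (real k - 1)"
    using filterlim_compose[OF gam_lim[OF k] filterlim_Jpar] k by simp
  have x: "x \<longlonglongrightarrow> mu k / (real k - 1)"
  proof (rule tendsto_sandwich)
    have "(\<lambda>n. 1 / real n) \<longlonglongrightarrow> 0" by real_asymp
    from tendsto_diff[OF g this] show "(\<lambda>n. gam (k - 1) (Jpar k n) - 1 / real n) \<longlonglongrightarrow> mu k / (real k - 1)" by simp
    show "eventually (\<lambda>n. gam (k - 1) (Jpar k n) - 1 / real n \<le> x n) sequentially"
      using eventually_gt_at_top[of 0]
    proof eventually_elim
      case (elim n)
      have "Jpar k n \<le> n" using Jpar_props(2)[of k n] dpar_props(2)[of k n] k by linarith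
      then have "real n * real n * gam (k - 1) (Jpar k n) - real n \<le> real (qpar k n)"
        using qpar_bounds(2)[OF elim, of k] by linarith
      then have "(real n * real n * gam (k - 1) (Jpar k n) - real n) / (real n * real n) \<le> x n"
        unfolding x_def by (rule divide_right_mono) simp
      moreover have "(real n * real n * gam (k - 1) (Jpar k n) - real n) / (real n * real n) = gam (k - 1) (Jpar k n) - 1 / real n"
        using elim by (simp add: diff_divide_distrib)
      ultimately show ?case by simp
    qed
    show "eventually (\<lambda>n. x n \<le> gam (k - 1) (Jpar k n)) sequentially"
      using eventually_gt_at_top[of 0]
      by eventually_elim (use qpar_bounds(1)[of _ k] in \<open>simp add: x_def field_simps\<close>)
  qed (rule g)
  have "0 \<le> mu k / (real k - 1)"
    by (rule tendsto_lowerbound[OF gam_lim[OF k]]) (simp_all add: gam_nonneg)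
  then have lim: "(\<lambda>n. 1 / (1 + x n)) \<longlonglongrightarrow> 1 / (1 + mu k / (real k - 1))"
    by (intro tendsto_intros x) simp
  have "(\<lambda>n. real (n - ipar k n) / real n) \<longlonglongrightarrow> 1 / (1 + mu k / (real k - 1))"
  proof (rule tendsto_sandwich)
    show "(\<lambda>n. 1 / (1 + x n)) \<longlonglongrightarrow> 1 / (1 + mu k / (real k - 1))" by (rule lim)
    have "(\<lambda>n. 1 / real n) \<longlonglongrightarrow> 0" by real_asymp
    from tendsto_add[OF lim this] show "(\<lambda>n. 1 / (1 + x n) + 1 / real n) \<longlonglongrightarrow> 1 / (1 + mu k / (real k - 1))" by simp
    have key: "1 / (1 + x n) \<le> real (n - ipar k n) / real n \<and> real (n - ipar k n) / real n \<le> 1 / (1 + x n) + 1 / real n"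
      if n: "0 < n" for n
    proof -
      let ?n = "real n" and ?q = "real (qpar k n)" and ?a = "real (n * qpar k n) / real (n * n + qpar k n)"
      have pos: "0 < ?n" "0 < ?n * ?n + ?q" using n by (auto intro: add_pos_nonneg)
      have "?a / ?n = ?q / (?n * ?n + ?q)" using pos by simp
      moreover have "1 - ?q / (?n * ?n + ?q) = ?n * ?n / (?n * ?n + ?q)" using pos by (simp add: field_simps)
      moreover have "1 + x n = (?n * ?n + ?q) / (?n * ?n)" unfolding x_def using pos by (simp add: add_divide_distrib)
      ultimately have e: "1 - ?a / ?n = 1 / (1 + x n)" by simp
      have d: "real (n - ipar k n) / ?n = 1 - real (ipar k n) / ?n"
        using ipar_le[of k n] n by (simp add: of_nat_diff diff_divide_distrib)
      have "real (ipar k n) \<le> ?a" "?a - 1 \<le> real (ipar k n)"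
        unfolding ipar_def by (rule real_div_bounds, rule real_div_bounds(2)) (use n in simp)
      then have "real (ipar k n) / ?n \<le> ?a / ?n \<and> (?a - 1) / ?n \<le> real (ipar k n) / ?n"
        by (intro conjI divide_right_mono) simp_all
      then show ?thesis unfolding d e[symmetric] by (simp add: diff_divide_distrib)
    qed
    show "eventually (\<lambda>n. 1 / (1 + x n) \<le> real (n - ipar k n) / real n) sequentially"
      using eventually_gt_at_top[of 0] by eventually_elim (use key in blast)
    show "eventually (\<lambda>n. real (n - ipar k n) / real n \<le> 1 / (1 + x n) + 1 / real n) sequentially"
      using eventually_gt_at_top[of 0] by eventually_elim (use key in blast)
  qed
  moreover have "1 / (1 + mu k / (real k - 1)) = (real k - 1) / (real k - 1 + mu k)"
    using k by (simp add: field_simps)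
  ultimately show ?thesis by simp
qed

definition Qpar :: "nat \<Rightarrow> nat \<Rightarrow> nat \<Rightarrow> nat" where
  "Qpar k n0 n = 30 * (5000 + esq (guardJ k)) * Zpar k n0 n ^ (wpar k n + 4)"

text \<open>The only factor that is not polynomial is \<open>Z ^ w\<close> with
  \<open>w \<le> sqrt n\<close>; its logarithm grows like \<open>sqrt n * log n\<close>.\<close>

lemma lim_Qpar: assumes k: "0 < k" shows "(\<lambda>n. log 2 (real (Qpar k n0 n)) / real n) \<longlonglongrightarrow> 0"
proof -
  define c a b where "c = log 2 (real (30 * (5000 + esq (guardJ k))))" and "a = real (k + 2)" and "b = log 2 (real (k + n0 + 100))"
  have eq: "log 2 (real (Qpar k n0 n)) = c + (real (wpar k n) + 4) * (a * (b + log 2 (2 * real n + 1)))" for n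
  proof -
    have "log 2 (real (Zpar k n0 n)) = a * (b + log 2 (2 * real n + 1))"
    proof -
      have "log 2 (real (k + n0 + 100) * real (2 * n + 1)) = b + log 2 (real (2 * n + 1))"
        unfolding b_def by (subst log_mult) auto
      then have "log 2 (real ((k + n0 + 100) * (2 * n + 1))) = b + log 2 (real (2 * n + 1))" by (simp only: of_nat_mult)
      moreover have "real (2 * n + 1) = 2 * real n + 1" by simp
      moreover have "0 < (k + n0 + 100) * (2 * n + 1)" by simp
      ultimately show ?thesis unfolding Zpar_def a_def of_nat_power
        by (subst log_nat_power) (simp_all only: of_nat_0_less_iff)
    qed
    moreover have "0 < Zpar k n0 n" using Zpar_ge(4)[of k n0 n] by linarith
    ultimately show ?thesis unfolding Qpar_def c_def of_nat_mult[of _ "_ ^ _"] of_nat_power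
      by (subst log_mult) (auto simp: log_nat_power)
  qed
  have b: "0 \<le> b" unfolding b_def by simp
  have a: "0 \<le> a" unfolding a_def by simp
  have c: "0 \<le> c" unfolding c_def by (subst zero_le_log_cancel_iff) auto
  show ?thesis
  proof (rule tendsto_sandwich)
    show "(\<lambda>n. 0) \<longlonglongrightarrow> (0::real)" by simp
    show "(\<lambda>n. (c + (sqrt (real n) + 4) * (a * (b + log 2 (2 * real n + 1)))) / real n) \<longlonglongrightarrow> 0"
      by real_asymp
    show "eventually (\<lambda>n. 0 \<le> log 2 (real (Qpar k n0 n)) / real n) sequentially"
      unfolding eq by (intro always_eventually allI divide_nonneg_nonneg add_nonneg_nonneg mult_nonneg_nonneg) (use a b c in auto)
    show "eventually (\<lambda>n. log 2 (real (Qpar k n0 n)) / real n \<le> (c + (sqrt (real n) + 4) * (a * (b + log 2 (2 * real n + 1)))) / real n) sequentially"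
      using eventually_gt_at_top[of 0]
    proof eventually_elim
      case (elim n)
      have "real (wpar k n * wpar k n) \<le> real n" using wpar_square[OF k elim] by (simp only: of_nat_le_iff)
      then have "real (wpar k n) \<le> sqrt (real n)" by (intro real_le_rsqrt) (simp add: power2_eq_square)
      moreover have "0 \<le> log 2 (2 * real n + 1)" by simp
      ultimately show ?case unfolding eq
        by (intro divide_right_mono add_left_mono mult_right_mono mult_nonneg_nonneg add_nonneg_nonneg a b) auto
    qed
  qed
qed

section \<open>Assembly of correctness and running time\<close>

lemma main_correct:
  assumes k: "3 \<le> k" and ok: "\<And>n. n0 \<le> n \<Longrightarrow> okpar k n"
    and F: "kcnf k n F" and Cs: "lists_formula Cs F" and N: "0 < N"
  shows "lossless_spmf (run (main k n0) n Cs N)"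
    "(s', t) \<in> set_spmf (run (main k n0) n Cs N) \<Longrightarrow>
      t \<le> N * N * 2 ^ Xpar k n * Qpar k n0 n * 2 ^ (if n < n0 then n else 0)"
    "5 / 8 \<le> measure (measure_spmf (run (main k n0) n Cs N))
       {(s', t). approximates (exp (1 / real N)) (real (num_sat n F)) (output_value s')}"
proof -
  \<comment> \<open>\<open>\<kappa>\<close> must also cover the guard of the loop that computes
    \<open>J\<close>, whose size grows with \<open>k\<close> but not with \<open>n\<close>.\<close>
  define V \<kappa> w where "V = Vpar k n0 n N" and "\<kappa> = 5000 + esq (guardJ k)" and "w = wpar k n"
  let ?Z = "Zpar k n0 n" and ?s = "init_state (encode_input n Cs N)"
  interpret prog k n w F V \<kappa> Cs N
  proof
    show "kcnf k n F" "lists_formula Cs F" by fact+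
    show "5000 \<le> \<kappa>" by (simp add: \<kappa>_def)
    show "1000 \<le> V" unfolding V_def by (rule Vpar_ge[OF _ Epar_ge(6)]) simp
    show "length (encode_input n Cs N) \<le> V" unfolding V_def
      by (rule Vpar_ge[OF le_trans[OF length_input[OF F Cs] clauses_le] Epar_ge(2)])
  qed
  have b: "bnd V ?s" unfolding V_def by (rule bnd_init[OF F Cs])
  have s: "?s 0 = inp" by (simp add: inp_def)
  have kV: "k + 1 \<le> V" "n0 \<le> V" unfolding V_def by (intro Vpar_ge_self Epar_ge)+
  have big: "2 ^ (n * n + 20 * n + 20) \<le> V" unfolding V_def by (rule Vpar_ge[OF order_refl Epar_ge(1)])
  have V2: "2 ^ n * 2 ^ n \<le> V" unfolding V_def power_add[symmetric] by (rule Vpar_ge[OF order_refl Epar_ge(7)])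
  have tc: "Tcheck \<le> ?Z"
  proof -
    have "Tcheck \<le> (2 * n + 1) ^ k * (k * 6 + 9) + 4"
      unfolding Tcheck_def by (intro add_right_mono mult_le_mono1 length_Cs[OF F Cs])
    then show ?thesis using Zpar_ge(1)[of n k n0] by linarith
  qed
  have Q: "30 * \<kappa> * ?Z ^ (w + 4) = Qpar k n0 n" by (simp add: Qpar_def \<kappa>_def w_def)
  consider "2 ^ n \<le> N \<or> n < n0" | "N < 2 ^ n" "n0 \<le> n" by linarith
  then have "lossless_spmf (exec (main k n0) (?s, 0)) \<and>
    (\<forall>s' t. (s', t) \<in> set_spmf (exec (main k n0) (?s, 0)) \<longrightarrow>
      t \<le> N * N * 2 ^ Xpar k n * Qpar k n0 n * 2 ^ (if n < n0 then n else 0)) \<and>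
    5 / 8 \<le> measure (measure_spmf (exec (main k n0) (?s, 0)))
       {(s', t). approximates (exp (1 / real N)) (real (num_sat n F)) (output_value s')}"
  proof cases
    case 1
    note B = brute_correct[OF b s 1 kV(2) V2 N]
    have "t \<le> N * N * 2 ^ Xpar k n * Qpar k n0 n * 2 ^ (if n < n0 then n else 0)"
      if "(s', t) \<in> set_spmf (exec (main k n0) (?s, 0))" for s' t
    proof -
      have "t \<le> N * N * Qpar k n0 n * 2 ^ (if n < n0 then n else 0)"
        using le_trans[OF B(2)[OF that] brute_time_le[OF tc Zpar_ge(3) Zpar_ge(4) bits_Vpar(2)[of k n0 n N, folded V_def] N 1]]
        unfolding Q .
      also have "\<dots> = N * N * 1 * Qpar k n0 n * 2 ^ (if n < n0 then n else 0)" by simp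
      also have "\<dots> \<le> N * N * 2 ^ Xpar k n * Qpar k n0 n * 2 ^ (if n < n0 then n else 0)"
        by (intro mult_le_mono1 mult_le_mono2) simp
      finally show ?thesis .
    qed
    then show ?thesis using B(1,3) by blast
  next
    case 2
    have g: "esq (guardJ k) \<le> \<kappa>" by (simp add: \<kappa>_def)
    note B = search_correct[OF b s 2(2) k g kV 2(1) N big w_def ok[OF 2(2)]]
    have n: "0 < n" using ok[OF 2(2)] by (simp add: okpar_def)
    have wZ: "w \<le> ?Z" using wpar_le[of k n] n k Zpar_ge(3)[of n k n0] by (simp add: w_def)
    have "t \<le> N * N * 2 ^ Xpar k n * Qpar k n0 n * 2 ^ (if n < n0 then n else 0)"
      if "(s', t) \<in> set_spmf (exec (main k n0) (?s, 0))" for s' t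
    proof -
      have "t \<le> Tmain (2 ^ epar k n) * (\<kappa> * bits V)" by (rule B(2)[OF that])
      also have "\<dots> \<le> N * N * 2 ^ Xpar k n * (30 * ?Z ^ (w + 3)) * (\<kappa> * ?Z)"
        by (intro mult_le_mono mult_le_mono2 Tmain_le[OF tc Zpar_ge(3) wZ Zpar_ge(4) n N ipar_half[OF k n]])
          (unfold V_def, rule bits_Vpar(1)[OF 2(1)])
      also have "\<dots> = N * N * 2 ^ Xpar k n * Qpar k n0 n"
        unfolding Q[symmetric] by (simp add: power_add power3_eq_cube power4_eq_xxxx algebra_simps)
      finally show ?thesis using 2(2) by simp
    qed
    then show ?thesis using B(1,3) by blast
  qed
  then show "lossless_spmf (run (main k n0) n Cs N)"
    "(s', t) \<in> set_spmf (run (main k n0) n Cs N) \<Longrightarrow>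
      t \<le> N * N * 2 ^ Xpar k n * Qpar k n0 n * 2 ^ (if n < n0 then n else 0)"
    "5 / 8 \<le> measure (measure_spmf (run (main k n0) n Cs N))
       {(s', t). approximates (exp (1 / real N)) (real (num_sat n F)) (output_value s')}"
    unfolding run_def by blast+
qed

text \<open>The binary logarithm of the quotient of the proved time bound and the target. Its last
  summand absorbs brute force for \<open>n < n0\<close> and vanishes from \<open>n0\<close>
  on.\<close>

definition slack :: "nat \<Rightarrow> nat \<Rightarrow> nat \<Rightarrow> real" where
  "slack k n0 n = real (Xpar k n) - real n * ((real k - 1) / (real k - 1 + mu k)) + log 2 (real (Qpar k n0 n))
     + real (if n < n0 then n else 0)"

lemma slack_smallo: assumes k: "3 \<le> k" shows "slack k n0 \<in> o(\<lambda>n. real n)"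
proof (rule smalloI_tendsto)
  define e where "e = (real k - 1) / (real k - 1 + mu k)"
  have X: "(\<lambda>n. real (16 * (n div Jpar k n)) / real n) \<longlonglongrightarrow> 0"
  proof (rule tendsto_sandwich)
    show "(\<lambda>n. 0) \<longlonglongrightarrow> (0::real)" by simp
    have "(\<lambda>J. 16 / real J) \<longlonglongrightarrow> 0" by real_asymp
    then show "(\<lambda>n. 16 / real (Jpar k n)) \<longlonglongrightarrow> 0" by (rule filterlim_compose[OF _ filterlim_Jpar]) (use k in simp)
    show "eventually (\<lambda>n. 0 \<le> real (16 * (n div Jpar k n)) / real n) sequentially" by simp
    show "eventually (\<lambda>n. real (16 * (n div Jpar k n)) / real n \<le> 16 / real (Jpar k n)) sequentially"
      using eventually_gt_at_top[of 0]
    proof eventually_elim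
      case (elim n)
      have "16 * real (n div Jpar k n) \<le> 16 * (real n / real (Jpar k n))" by (intro mult_left_mono real_div_bounds) simp
      then have "16 * real (n div Jpar k n) / real n \<le> 16 * (real n / real (Jpar k n)) / real n" by (rule divide_right_mono) simp
      then show ?case using elim by simp
    qed
  qed
  have n0: "(\<lambda>n. real (if n < n0 then n else 0) / real n) \<longlonglongrightarrow> 0"
    by (rule tendsto_eventually) (use eventually_ge_at_top[of n0] in \<open>eventually_elim, simp\<close>)
  have "(\<lambda>n. real (n - ipar k n) / real n + real (16 * (n div Jpar k n)) / real n - e
     + log 2 (real (Qpar k n0 n)) / real n + real (if n < n0 then n else 0) / real n) \<longlonglongrightarrow> e + 0 - e + 0 + 0"
    by (intro tendsto_add tendsto_diff tendsto_const lim_ipar[OF k, folded e_def] X lim_Qpar n0) (use k in simp)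
  then have *: "(\<lambda>n. real (n - ipar k n) / real n + real (16 * (n div Jpar k n)) / real n - e
     + log 2 (real (Qpar k n0 n)) / real n + real (if n < n0 then n else 0) / real n) \<longlonglongrightarrow> 0" by simp
  show "(\<lambda>n. slack k n0 n / real n) \<longlonglongrightarrow> 0"
  proof (rule Lim_transform_eventually[OF *])
    show "eventually (\<lambda>n. real (n - ipar k n) / real n + real (16 * (n div Jpar k n)) / real n - e
       + log 2 (real (Qpar k n0 n)) / real n + real (if n < n0 then n else 0) / real n = slack k n0 n / real n) sequentially"
      using eventually_gt_at_top[of 0]
    proof eventually_elim
      case (elim n)
      then have "real n * e / real n = e" by simp
      then show ?case
        unfolding slack_def e_def[symmetric] unfolding Xpar_def of_nat_add add_divide_distrib diff_divide_distrib by (simp only:)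
    qed
  qed
  show "eventually (\<lambda>n. real n \<noteq> 0) sequentially" using eventually_gt_at_top[of 0] by eventually_elim simp
qed

theorem theorem4:
  fixes k :: nat
  assumes "k \<ge> 3"
  shows "\<exists>P T. randomized_approximation_scheme k P \<and> runs_in_time k P T \<and>
    T \<in> O_star (\<lambda>n N. (real N)\<^sup>2 * 2 powr (real n * ((real k - 1) / (real k - 1 + mu k))))"
proof -
  obtain n0 where ok: "\<And>n. n0 \<le> n \<Longrightarrow> okpar k n"
    using eventually_okpar[OF assms] unfolding eventually_sequentially by blast
  let ?g = "\<lambda>n N. (real N)\<^sup>2 * 2 powr (real n * ((real k - 1) / (real k - 1 + mu k)))"
  \<comment> \<open>By the choice of \<open>slack\<close> this is exactly the bound of
    \<open>main_correct\<close>, written so that membership in \<open>O_star\<close> can be read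
    off.\<close>
  define T where "T n N = 2 powr slack k n0 n * ?g n N" for n N
  note correct = main_correct[OF assms ok]
  have "randomized_approximation_scheme k (main k n0)"
    unfolding randomized_approximation_scheme_def
    by (rule exI[of _ "5 / 8"]) (use correct(3) in auto)
  moreover have "runs_in_time k (main k n0) T"
    unfolding runs_in_time_def
  proof (intro allI impI conjI)
    fix n F Cs and N :: nat assume A: "kcnf k n F \<and> lists_formula Cs F \<and> N > 0"
    then show "lossless_spmf (run (main k n0) n Cs N)" using correct(1) by blast
    have Q: "0 < Qpar k n0 n" using Zpar_ge(4)[of k n0 n] by (simp add: Qpar_def)
    have "T n N = (real N)\<^sup>2 * 2 powr (real (Xpar k n) + log 2 (real (Qpar k n0 n)) + real (if n < n0 then n else 0))"
      by (simp add: T_def slack_def powr_add[symmetric] mult.commute mult.left_commute add.assoc)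
    also have "\<dots> = real (N * N * 2 ^ Xpar k n * Qpar k n0 n * 2 ^ (if n < n0 then n else 0))"
      using Q by (simp add: powr_add powr_realpow power2_eq_square)
    finally have T: "T n N = real (N * N * 2 ^ Xpar k n * Qpar k n0 n * 2 ^ (if n < n0 then n else 0))" .
    have "real t \<le> T n N" if "(s, t) \<in> set_spmf (run (main k n0) n Cs N)" for s t
      unfolding T of_nat_le_iff by (rule correct(2)) (use A that in auto)
    then show "\<forall>(s, t) \<in> set_spmf (run (main k n0) n Cs N). real t \<le> T n N" by auto
  qed
  moreover have "T \<in> O_star ?g"
    unfolding O_star_def T_def by (intro CollectI bexI[OF _ slack_smallo[OF assms, of n0]]) (simp add: abs_mult)
  ultimately show ?thesis by blast
qed

end
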